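(* Consider, for each $N\ge 1$, the perturbed binary ($\pm1$ spins) optimal Bayesian inference model described in the context. Assume: (i) the prior is factorised: conditionally on the (possibly random) hyperparameters $\theta^*$, the law of the signal is a product measure, $P^*(\cdot\mid\theta^* )=\prod_{i\le N}P_i^*(\cdot\mid\theta^* )$; (ii) (symmetry between spins) for every permutation $\rho$ of the spin indices, with $\rho(\sigma)=(\sigma_{\rho(i)})_{i\le N}$, the random measures satisfy $\big(G_N^{\rm pert}(\sigma,\lambda)\big)_{\sigma}\overset{d}{=}\big(G_N^{\rm pert}(\rho(\sigma),\lambda)\big)_{\sigma}$; (iii) $1\ge\varepsilon_N\to0$, $N\varepsilon_N\to+\infty$, $s_N/N\to 0$, $s_N/\sqrt N\to+\infty$; (iv) (standing assumption of free energy concentration) $v_N\le v$ for some constant $v$ independent of $N$; (v) (overlap concentration) $\lim_{N\to+\infty}\mathbb{E}_\lambda\mathbb{E}\big\langle (R_{1,2}-\mathbb{E}\langle R_{1,2}\rangle)^2\big\rangle=0$. Then $$\lim_{N\to+\infty}\mathbb{E}_\lambda\mathbb{E}\big\langle (R_{1,\ldots,n}-\mathbb{E}\langle R_{1,\ldots,n}\rangle)^2\big\rangle=0\qquad\text{for all } n\ge1 .$$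
   Context: Base model (all objects depend on $N$). $\theta=(\theta^*,\theta_{\rm out})$ are (possibly random) hyperparameters, $\theta^*=(\theta^*_i)_{i\le N}$. Given $\theta$, the signal $\sigma^*\in\{-1,1\}^N$ has the product law $P^*(\sigma\mid\theta^* )\propto\exp\sum_{i\le N}\theta_i^*\sigma_i$ (for binary spins every product law can be written in this way). Given $(\sigma^*,\theta)$ the data $Y$ has law (density with respect to a reference measure) $P_{\rm out}(\cdot\mid\sigma^*,\theta_{\rm out})$. Put $\mathcal H_N(\sigma)=\ln P_{\rm out}(Y\mid\sigma,\theta_{\rm out})$. $\mathrm{Exp}(\gamma)$ is the law with density $\gamma e^{-\gamma x}$, $x\ge0$; $\mathcal U$ denotes a uniform law. Perturbation. The parameters are $\lambda=(\lambda_k)_{k\ge0}$ with $\lambda_k\in[2^{-k-1},2^{-k}]$; $(\varepsilon_N)$, $(s_N)$ are positive sequences. With $Z\sim\mathcal N(0,I_N)$, $$\mathcal H_N^{\rm gauss}(\sigma,\lambda_0)=\lambda_0\varepsilon_N\,\sigma^*\cdot\sigma+\sqrt{\lambda_0\varepsilon_N}\,Z\cdot\sigma-\tfrac12\lambda_0\varepsilon_N\|\sigma\|^2 .$$ With independent $\pi_k\sim\mathrm{Poiss}(s_N)$ ($k\ge1$), $i_{jk}\sim\mathcal U\{1,\dots,N\}$, $\xi_{jk}\sim\mathrm{Exp}(1)$ (all independent of each other and of everything else), $$\mathcal H_N^{\rm exp}(\sigma,\lambda)=\sum_{k\ge1}\sum_{j\le\pi_k}\Big(\ln(1+\lambda_k\sigma_{i_{jk}})-\frac{\lambda_k\xi_{jk}\sigma_{i_{jk}}}{1+\lambda_k\sigma^*_{i_{jk}}}\Big).$$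 This is the Hamiltonian of a Bayes-optimal model with extra observations $Y^{\rm gauss}=\sqrt{\lambda_0\varepsilon_N}\sigma^*+Z$ and $Y^{\rm exp}_{jk}=\xi_{jk}/(1+\lambda_k\sigma^*_{i_{jk}})$. Set $\mathcal H_N^{\rm pert}(\sigma,\lambda)=\mathcal H_N(\sigma)+\mathcal H^{\rm gauss}_N(\sigma,\lambda_0)+\mathcal H^{\rm exp}_N(\sigma,\lambda)$ and define the random probability measure (the posterior) $$G_N^{\rm pert}(\sigma,\lambda)=\frac{1}{\mathcal Z_N^{\rm pert}}\exp\Big\{\sum_{i\le N}\theta_i^*\sigma_i+\mathcal H_N^{\rm pert}(\sigma,\lambda)\Big\},\quad \sigma\in\{-1,1\}^N,$$ with $\mathcal Z_N^{\rm pert}$ the normalisation and $F_N^{\rm pert}(\lambda)=\ln\mathcal Z_N^{\rm pert}$. Averages. $\sigma^1,\sigma^2,\dots$ (replicas) are conditionally i.i.d. samples from $G_N^{\rm pert}(\cdot,\lambda)$, and $\langle\cdot\rangle$ is the average over them (with respect to $G_N^{\rm pert}(\cdot,\lambda)^{\otimes\infty}$). $\mathbb E$ is the expectation over $(\sigma^*,Y,Z,\xi,\theta,\pi,(i_{jk}))$ with $\lambda$ fixed; $\mathbb E_\lambda$ is the expectation over independent $\lambda_k\sim\mathcal U[2^{-k-1},2^{-k}]$, $k\ge0$. Multioverlaps: $R_{\ell_1,\dots,\ell_n}=\frac1N\sum_{i\le N}\sigma_i^{\ell_1}\cdots\sigma_i^{\ell_n}$. Free energy fluctuations: $Nv_N=\sup\{\mathbb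 E(F_N^{\rm pert}(\lambda)-\mathbb EF_N^{\rm pert}(\lambda))^2:\ \lambda_k\in[2^{-k-1},2^{-k}],\ k\ge0\}$. *)

theory Defs
  imports "HOL-Probability.Probability"
begin

type_synonym spins = "nat \<Rightarrow> real"

definition configs :: "nat \<Rightarrow> spins set" where
  "configs N = {1..N} \<rightarrow>\<^sub>E {-1, 1}"

text \<open>
  \<open>hyper_law\<close> is the law of \<open>\<theta> = (\<theta>\<^sup>*, \<theta>_out)\<close>, \<open>out_space\<close> the measurable space of the
  hyperparameters \<open>\<theta>_out\<close>, \<open>ref_meas\<close> the reference measure on the space of the data, and
  \<open>P_out y \<sigma> t\<close> the density at \<open>y\<close> of the law of the data given the signal \<open>\<sigma>\<close> and
  \<open>\<theta>_out = t\<close>.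
\<close>

record ('o, 'y) base_model =
  hyper_law :: "((nat \<Rightarrow> real) \<times> 'o) measure"
  out_space :: "'o measure"
  ref_meas :: "'y measure"
  P_out :: "'y \<Rightarrow> spins \<Rightarrow> 'o \<Rightarrow> real"

definition valid_model :: "nat \<Rightarrow> ('o, 'y) base_model \<Rightarrow> bool" where
  "valid_model N m \<longleftrightarrow>
     prob_space (hyper_law m) \<and>
     sets (hyper_law m) = sets (PiM {1..N} (\<lambda>_. borel) \<Otimes>\<^sub>M out_space m) \<and>
     sigma_finite_measure (ref_meas m) \<and>
     (\<forall>\<sigma>\<in>configs N. (\<lambda>(y, t). P_out m y \<sigma> t) \<in> borel_measurable (ref_meas m \<Otimes>\<^sub>M out_space m)) \<and>
     (\<forall>\<sigma>\<in>configs N. \<forall>t\<in>space (out_space m). \<forall>y\<in>space (ref_meas m). 0 \<le> P_out m y \<sigma> t) \<and>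
     (\<forall>\<sigma>\<in>configs N. \<forall>t\<in>space (out_space m).
        (\<integral>\<^sup>+ y. ennreal (P_out m y \<sigma> t) \<partial>ref_meas m) = 1)"

definition spin_prior :: "real \<Rightarrow> real \<Rightarrow> real" where
  "spin_prior h x = exp (h * x) / (exp h + exp (- h))"

text \<open>
  The prior is factorised over the spins by definition; \<open>prior_eq_normalised_exp\<close> below is the
  form \<open>P\<^sup>*(\<sigma> | \<theta>\<^sup>*) \<propto> exp (\<Sum>i. \<theta>\<^sup>*\<^sub>i \<sigma>\<^sub>i)\<close>.
\<close>

definition prior :: "nat \<Rightarrow> (nat \<Rightarrow> real) \<Rightarrow> spins \<Rightarrow> real" where
  "prior N th \<sigma> = (\<Prod>i=1..N. spin_prior (th i) (\<sigma> i))"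

lemma finite_configs [simp]: "finite (configs N)"
  unfolding configs_def by (intro finite_PiE) auto

lemma prior_nonneg: "0 \<le> prior N th \<sigma>"
  unfolding prior_def spin_prior_def by (intro prod_nonneg) (auto intro!: divide_nonneg_nonneg add_nonneg_nonneg)

lemma sum_exp_configs:
  "(\<Sum>\<tau>\<in>configs N. exp (\<Sum>i=1..N. th i * \<tau> i)) = (\<Prod>i=1..N. exp (th i) + exp (- th i :: real))"
proof -
  have "(\<Sum>\<tau>\<in>configs N. exp (\<Sum>i=1..N. th i * \<tau> i))
      = (\<Sum>\<tau>\<in>{1..N} \<rightarrow>\<^sub>E {-1, 1}. \<Prod>i\<in>{1..N}. exp (th i * \<tau> i))"
    by (simp only: configs_def exp_sum finite_atLeastAtMost)
  also have "\<dots> = (\<Prod>i\<in>{1..N}. \<Sum>x\<in>{-1, 1::real}. exp (th i * x))"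
    by (rule prod_sum_PiE [symmetric]) auto
  also have "\<dots> = (\<Prod>i=1..N. exp (th i) + exp (- th i))"
    by (intro prod.cong) auto
  finally show ?thesis .
qed

lemma prior_eq_normalised_exp:
  "prior N th \<sigma> = exp (\<Sum>i=1..N. th i * \<sigma> i) / (\<Sum>\<tau>\<in>configs N. exp (\<Sum>i=1..N. th i * \<tau> i))"
  unfolding sum_exp_configs by (simp add: prior_def spin_prior_def exp_sum prod_dividef)

lemma sum_prior: "(\<Sum>\<sigma>\<in>configs N. prior N th \<sigma>) = 1"
proof -
  have "0 < (\<Prod>i=1..N. exp (th i) + exp (- th i))"
    by (intro prod_pos) (auto intro: add_pos_pos)
  then have "(\<Sum>\<tau>\<in>configs N. exp (\<Sum>i=1..N. th i * \<tau> i)) \<noteq> 0"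
    unfolding sum_exp_configs by (rule less_imp_neq [symmetric])
  then show ?thesis
    by (simp only: prior_eq_normalised_exp flip: sum_divide_distrib) (rule divide_self)
qed

type_synonym ('o, 'y) base_sample = "((nat \<Rightarrow> real) \<times> 'o) \<times> spins \<times> 'y"

definition base_law :: "nat \<Rightarrow> ('o, 'y) base_model \<Rightarrow> ('o, 'y) base_sample measure" where
  "base_law N m =
     density (hyper_law m \<Otimes>\<^sub>M (count_space (configs N) \<Otimes>\<^sub>M ref_meas m))
       (\<lambda>((th, t), sg, y). ennreal (prior N th sg * P_out m y sg t))"

definition param_box :: "(nat \<Rightarrow> real) set" where
  "param_box = {lam. \<forall>k. lam k \<in> {(1/2) ^ (k + 1) .. (1/2) ^ k}}"

definition param_law :: "(nat \<Rightarrow> real) measure" where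
  "param_law = PiM UNIV (\<lambda>k. uniform_measure lborel {(1/2) ^ (k + 1) .. (1/2) ^ k})"

text \<open>
  Samples are tuples \<open>(Z, \<pi>, i, \<xi>)\<close>; the variables \<open>i\<^sub>j\<^sub>k\<close> and \<open>\<xi>\<^sub>j\<^sub>k\<close> are indexed by the pair \<open>(j, k)\<close>.
\<close>

type_synonym pert_sample =
  "(nat \<Rightarrow> real) \<times> (nat \<Rightarrow> nat) \<times> (nat \<times> nat \<Rightarrow> nat) \<times> (nat \<times> nat \<Rightarrow> real)"

definition pert_noise_law :: "nat \<Rightarrow> real \<Rightarrow> pert_sample measure" where
  "pert_noise_law N s =
     PiM {1..N} (\<lambda>_. density lborel std_normal_density)
     \<Otimes>\<^sub>M (PiM {1..} (\<lambda>_. measure_pmf (poisson_pmf s))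
     \<Otimes>\<^sub>M (PiM ({1..} \<times> {1..}) (\<lambda>_. measure_pmf (pmf_of_set {1..N}))
     \<Otimes>\<^sub>M PiM ({1..} \<times> {1..}) (\<lambda>_. density lborel (exponential_density 1))))"

type_synonym ('o, 'y) disorder = "('o, 'y) base_sample \<times> pert_sample"

definition law :: "nat \<Rightarrow> ('o, 'y) base_model \<Rightarrow> real \<Rightarrow> ('o, 'y) disorder measure" where
  "law N m s = base_law N m \<Otimes>\<^sub>M pert_noise_law N s"

definition H_gauss :: "nat \<Rightarrow> real \<Rightarrow> (nat \<Rightarrow> real) \<Rightarrow> ('o, 'y) disorder \<Rightarrow> spins \<Rightarrow> real" where
  "H_gauss N e lam = (\<lambda>((_, sg, _), z, _) \<sigma>.
     lam 0 * e * (\<Sum>i=1..N. sg i * \<sigma> i)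
     + sqrt (lam 0 * e) * (\<Sum>i=1..N. z i * \<sigma> i)
     - 1/2 * (lam 0 * e) * (\<Sum>i=1..N. (\<sigma> i)\<^sup>2))"

text \<open>The series runs over \<open>k \<ge> 1\<close>, hence the shift in the summation index.\<close>

definition H_exp :: "(nat \<Rightarrow> real) \<Rightarrow> ('o, 'y) disorder \<Rightarrow> spins \<Rightarrow> real" where
  "H_exp lam = (\<lambda>((_, sg, _), _, p, idx, xi) \<sigma>.
     (\<Sum>k'. let k = Suc k' in \<Sum>j=1..p k.
        ln (1 + lam k * \<sigma> (idx (j, k)))
        - lam k * xi (j, k) * \<sigma> (idx (j, k)) / (1 + lam k * sg (idx (j, k)))))"

definition H_base :: "('o, 'y) base_model \<Rightarrow> ('o, 'y) disorder \<Rightarrow> spins \<Rightarrow> real" where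
  "H_base m = (\<lambda>(((_, t), _, y), _) \<sigma>. ln (P_out m y \<sigma> t))"

definition H_pert ::
  "nat \<Rightarrow> ('o, 'y) base_model \<Rightarrow> real \<Rightarrow> (nat \<Rightarrow> real) \<Rightarrow> ('o, 'y) disorder \<Rightarrow> spins \<Rightarrow> real" where
  "H_pert N m e lam \<omega> \<sigma> = H_base m \<omega> \<sigma> + H_gauss N e lam \<omega> \<sigma> + H_exp lam \<omega> \<sigma>"

text \<open>
  The likelihood may vanish for some configurations. There the Hamiltonian is \<open>-\<infinity>\<close> and the
  Boltzmann weight is \<open>0\<close>; as \<open>ln 0 = 0\<close> in HOL, this case is treated separately.
\<close>

definition boltzmann ::
  "nat \<Rightarrow> ('o, 'y) base_model \<Rightarrow> real \<Rightarrow> (nat \<Rightarrow> real) \<Rightarrow> ('o, 'y) disorder \<Rightarrow> spins \<Rightarrow> real" where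
  "boltzmann N m e lam \<omega> \<sigma> = (case \<omega> of (((th, t), _, y), _) \<Rightarrow>
     if P_out m y \<sigma> t = 0 then 0
     else exp ((\<Sum>i=1..N. th i * \<sigma> i) + H_pert N m e lam \<omega> \<sigma>))"

definition Z_pert ::
  "nat \<Rightarrow> ('o, 'y) base_model \<Rightarrow> real \<Rightarrow> (nat \<Rightarrow> real) \<Rightarrow> ('o, 'y) disorder \<Rightarrow> real" where
  "Z_pert N m e lam \<omega> = (\<Sum>\<sigma>\<in>configs N. boltzmann N m e lam \<omega> \<sigma>)"

definition F_pert ::
  "nat \<Rightarrow> ('o, 'y) base_model \<Rightarrow> real \<Rightarrow> (nat \<Rightarrow> real) \<Rightarrow> ('o, 'y) disorder \<Rightarrow> real" where
  "F_pert N m e lam \<omega> = ln (Z_pert N m e lam \<omega>)"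

definition G_pert ::
  "nat \<Rightarrow> ('o, 'y) base_model \<Rightarrow> real \<Rightarrow> (nat \<Rightarrow> real) \<Rightarrow> ('o, 'y) disorder \<Rightarrow> spins \<Rightarrow> real" where
  "G_pert N m e lam \<omega> \<sigma> = boltzmann N m e lam \<omega> \<sigma> / Z_pert N m e lam \<omega>"

type_synonym replicas = "nat \<Rightarrow> spins"

definition gibbs_avg ::
  "nat \<Rightarrow> ('o, 'y) base_model \<Rightarrow> real \<Rightarrow> (nat \<Rightarrow> real) \<Rightarrow> ('o, 'y) disorder \<Rightarrow> (replicas \<Rightarrow> real) \<Rightarrow> real" where
  "gibbs_avg N m e lam \<omega> f =
     (\<integral>r. f r \<partial>PiM {1..} (\<lambda>_. point_measure (configs N) (\<lambda>\<sigma>. ennreal (G_pert N m e lam \<omega> \<sigma>))))"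

definition quenched_avg ::
  "nat \<Rightarrow> ('o, 'y) base_model \<Rightarrow> real \<Rightarrow> real \<Rightarrow> (nat \<Rightarrow> real) \<Rightarrow> (replicas \<Rightarrow> real) \<Rightarrow> real" where
  "quenched_avg N m e s lam f = (\<integral>\<omega>. gibbs_avg N m e lam \<omega> f \<partial>law N m s)"

definition multioverlap :: "nat \<Rightarrow> nat list \<Rightarrow> replicas \<Rightarrow> real" where
  "multioverlap N ls r = (\<Sum>i=1..N. \<Prod>l\<leftarrow>ls. r l i) / real N"

definition overlap_fluctuation ::
  "nat \<Rightarrow> ('o, 'y) base_model \<Rightarrow> real \<Rightarrow> real \<Rightarrow> nat list \<Rightarrow> real" where
  "overlap_fluctuation N m e s ls =
     (\<integral>lam. quenched_avg N m e s lam
        (\<lambda>r. (multioverlap N ls r - quenched_avg N m e s lam (multioverlap N ls))\<^sup>2) \<partial>param_law)"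

text \<open>
  The variance is a nonnegative Lebesgue integral, so that it is \<open>\<infinity>\<close> when the free energy is
  not square-integrable (in particular when it is not integrable, where the Bochner integral
  is \<open>0\<close>).
\<close>

definition free_energy_fluctuation ::
  "nat \<Rightarrow> ('o, 'y) base_model \<Rightarrow> real \<Rightarrow> real \<Rightarrow> ennreal" where
  "free_energy_fluctuation N m e s =
     (SUP lam\<in>param_box.
        \<integral>\<^sup>+ \<omega>. ennreal ((F_pert N m e lam \<omega> - (\<integral>\<omega>'. F_pert N m e lam \<omega>' \<partial>law N m s))\<^sup>2) \<partial>law N m s)
     / of_nat N"

text \<open>The law of the random vector \<open>(G(\<rho>(\<sigma>)))\<^sub>\<sigma>\<close>, where \<open>\<rho>(\<sigma>)\<^sub>i = \<sigma>\<^bsub>\<rho>(i)\<^esub>\<close>.\<close>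

definition permuted_gibbs_law ::
  "nat \<Rightarrow> ('o, 'y) base_model \<Rightarrow> real \<Rightarrow> real \<Rightarrow> (nat \<Rightarrow> real) \<Rightarrow> (nat \<Rightarrow> nat) \<Rightarrow> (spins \<Rightarrow> real) measure" where
  "permuted_gibbs_law N m e s lam \<rho> =
     distr (law N m s) (PiM (configs N) (\<lambda>_. borel))
       (\<lambda>\<omega>. \<lambda>\<sigma>\<in>configs N. G_pert N m e lam \<omega> (\<sigma> \<circ> \<rho>))"

definition spin_symmetric ::
  "nat \<Rightarrow> ('o, 'y) base_model \<Rightarrow> real \<Rightarrow> real \<Rightarrow> bool" where
  "spin_symmetric N m e s \<longleftrightarrow>
     (\<forall>lam\<in>param_box. \<forall>\<rho>. \<rho> permutes {1..N} \<longrightarrow>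
        permuted_gibbs_law N m e s lam id = permuted_gibbs_law N m e s lam \<rho>)"

end

theory Submission
  imports Defs "HOL-Computational_Algebra.Polynomial"
begin

text \<open>Write \<open>m_i\<close> and \<open>a_ij\<close> for the posterior means of \<open>\<sigma>_i\<close> and \<open>\<sigma>_i \<sigma>_j\<close> (\<open>mag\<close> and \<open>corr\<close>). As
replicas are independent under the posterior, \<open>R\<^bsub>1..n\<^esub>\<close> has Gibbs mean \<open>(1/N) \<Sum>_i m_i^n\<close>, the
empirical \<open>n\<close>-th moment of the magnetisations, and its square has Gibbs mean
\<open>(1/N^2) \<Sum>_ij a_ij^n\<close>. For \<open>n = 2\<close> the latter minus the square of the former controls the mean square of
\<open>a_ij - m_i m_j\<close> (\<open>decorr_square_le\<close>), so concentration of \<open>R\<^bsub>1,2\<^esub>\<close> forces typical pairs of spins to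
decorrelate under the posterior. Then \<open>(1/N^2) \<Sum>_ij a_ij^n\<close> is close to the square of the empirical
moment (\<open>corr_moment_near\<close>), and what is left of the fluctuation of \<open>R\<^bsub>1..n\<^esub>\<close> is the variance of
\<open>(1/N) \<Sum>_i m_i^n\<close> over the disorder. The theorem thus says that empirical averages of polynomials
of the magnetisations are self-averaging.

The exponential observations make them so. The derivative of the free energy in \<open>\<lambda>_k\<close> is the
posterior mean of a sum over the observations of strength \<open>\<lambda>_k\<close>, called the energy below. The free
energy is convex in \<open>\<lambda>_k\<close> up to a quadratic error of order \<open>s_N\<close> and fluctuates by
\<open>\<surd>(v N)\<close>, which is much smaller than \<open>s_N\<close>; comparing it at \<open>\<lambda>_k\<close> and \<open>\<lambda>_k \<plusminus> \<delta>\<close> and averaging over \<open>\<lambda>_k\<close> shows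
that the energy fluctuates by \<open>o(s_N)\<close> (\<open>energy_concentration\<close>). Its covariance with any bounded
quantity \<open>f\<close> is therefore \<open>o(s_N)\<close>. On the other hand, by the Mecke formula for Poisson processes
(\<open>mecke_real\<close>) the expectation of \<open>f\<close> times the energy is \<open>s_N\<close> times the expectation of \<open>f\<close> times a single
summand, both evaluated after adding one observation at a random site \<open>i\<close>. That
observation changes \<open>m_j\<close> by a multiple of \<open>a_ij - m_i m_j\<close>, hence \<open>f\<close> hardly changes if it is an empirical
average. The summand depends on the magnetisation and on the true spin at \<open>i\<close>; the Nishimori
identity (\<open>nishimori\<close>) replaces the true spin by a spin drawn from the posterior and leaves a function
\<open>response (\<lambda>_k)\<close> of \<open>m_i\<close> alone. Altogether the covariance of every empirical average with the
empirical average of \<open>response (\<lambda>_k)\<close> vanishes in the limit (\<open>covariance_bound\<close>).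

Finally \<open>response l x = \<Sum>_J l^J P_J(x)\<close> asymptotically as \<open>l \<rightarrow> 0\<close>, with polynomials \<open>P_J\<close>
(\<open>response_expansion\<close>). Testing against \<open>P_J\<close> itself, discarding the lower orders by induction and
letting \<open>k \<rightarrow> \<infinity>\<close>, that is \<open>\<lambda>_k \<rightarrow> 0\<close>, one finds that the empirical average of \<open>P_J\<close>
is self-averaging. For \<open>J \<ge> 1\<close> the polynomial \<open>P_J\<close> has degree \<open>J + 1\<close>; it has the parity of \<open>J + 1\<close>, and
\<open>P_J'(1) = 0\<close> for even \<open>J\<close>. So the \<open>P_J\<close> and the constants span all \<open>x^n\<close> with \<open>n\<close> even and all \<open>x^n - n x\<close> with \<open>n\<close> odd
(\<open>span_response_poly\<close>). Since \<open>\<bar>x^n\<bar> \<le> 1\<close>, dividing by \<open>n\<close> and letting \<open>n\<close> grow yields \<open>x\<close>, and then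
every power (\<open>fluctuations_vanish\<close>).\<close>

section \<open>Integration over product measures\<close>

lemma nn_integral_PiM_split:
  assumes M: "\<And>i. i \<in> I \<Longrightarrow> prob_space (M i)" and q: "q \<in> I"
    and g [measurable]: "g \<in> borel_measurable (PiM I M)"
  shows "(\<integral>\<^sup>+X. g X \<partial>PiM I M) = (\<integral>\<^sup>+X. \<integral>\<^sup>+x. g (X(q := x)) \<partial>M q \<partial>PiM (I - {q}) M)"
proof -
  interpret Q: prob_space "M q" using M q by auto
  interpret J: prob_space "PiM (I - {q}) M" using M by (intro prob_space_PiM) auto
  interpret pair_sigma_finite "M q" "PiM (I - {q}) M" ..
  have I: "insert q (I - {q}) = I" using q by auto
  have [measurable]: "(\<lambda>(x, X). X(q := x)) \<in> M q \<Otimes>\<^sub>M PiM (I - {q}) M \<rightarrow>\<^sub>M PiM I M"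
    using measurable_add_dim [of q "I - {q}" M] unfolding I
    by (subst (asm) measurable_pair_swap_iff) (simp add: split_beta')
  have "(\<integral>\<^sup>+X. g X \<partial>PiM I M) = (\<integral>\<^sup>+X. g X \<partial>distr (M q \<Otimes>\<^sub>M PiM (I - {q}) M) (PiM I M) (\<lambda>(x, X). X(q := x)))"
    using distr_pair_PiM_eq_PiM [of "I - {q}" M q] M q unfolding I by auto
  also have "\<dots> = (\<integral>\<^sup>+z. g ((\<lambda>(x, X). X(q := x)) z) \<partial>(M q \<Otimes>\<^sub>M PiM (I - {q}) M))"
    by (rule nn_integral_distr) measurable
  also have "\<dots> = (\<integral>\<^sup>+X. \<integral>\<^sup>+x. g (X(q := x)) \<partial>M q \<partial>PiM (I - {q}) M)"
    by (subst nn_integral_snd [symmetric]) (auto simp: split_beta')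
  finally show ?thesis .
qed

lemma measurable_PiM_upd [measurable]:
  assumes q: "q \<in> I"
  shows "(\<lambda>(X, x). X(q := x)) \<in> PiM I M \<Otimes>\<^sub>M M q \<rightarrow>\<^sub>M PiM I M"
proof -
  have "insert q I = I" using q by auto
  then show ?thesis using measurable_add_dim [of q I M] by simp
qed

text \<open>Replacing one coordinate by an independent copy does not change the law.\<close>

lemma nn_integral_PiM_resample:
  assumes M: "\<And>i. i \<in> I \<Longrightarrow> prob_space (M i)" and q: "q \<in> I"
    and g [measurable]: "g \<in> borel_measurable (PiM I M)"
  shows "(\<integral>\<^sup>+X. g X \<partial>PiM I M) = (\<integral>\<^sup>+X. \<integral>\<^sup>+x. g (X(q := x)) \<partial>M q \<partial>PiM I M)"
proof -
  interpret Q: prob_space "M q" using M q by auto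
  have [measurable]: "(\<lambda>X. \<integral>\<^sup>+x. g (X(q := x)) \<partial>M q) \<in> borel_measurable (PiM I M)"
    using measurable_PiM_upd [OF q, of M]
    by (intro Q.borel_measurable_nn_integral) (simp add: split_beta' measurable_compose [OF _ g])
  show ?thesis
    using Q.emeasure_space_1
    by (subst (1 2) nn_integral_PiM_split [OF M q]) (auto)
qed

text \<open>The substitution rule for a map that acts on finitely many coordinates separately: the factors
\<open>d i\<close> are one-dimensional densities, one for each coordinate that is moved. It turns the extra observations, which are
functions of the signal and of the noise, back into noise variables.\<close>

lemma nn_integral_PiM_change_of_variables:
  fixes \<tau> :: "'i \<Rightarrow> 'a \<Rightarrow> 'a" and d :: "'i \<Rightarrow> 'a \<Rightarrow> ennreal"
  assumes M: "\<And>i. i \<in> I \<Longrightarrow> prob_space (M i)" and Q: "finite Q" "Q \<subseteq> I"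
    and \<tau>: "\<And>q. q \<in> Q \<Longrightarrow> \<tau> q \<in> M q \<rightarrow>\<^sub>M M q"
    and d: "\<And>q. q \<in> Q \<Longrightarrow> d q \<in> borel_measurable (M q)"
    and eq: "\<And>q f. q \<in> Q \<Longrightarrow> f \<in> borel_measurable (M q) \<Longrightarrow>
      (\<integral>\<^sup>+x. f (\<tau> q x) \<partial>M q) = (\<integral>\<^sup>+x. d q x * f x \<partial>M q)"
    and g: "g \<in> borel_measurable (PiM I M)"
  shows "(\<integral>\<^sup>+X. g (\<lambda>i. if i \<in> Q then \<tau> i (X i) else X i) \<partial>PiM I M)
    = (\<integral>\<^sup>+X. (\<Prod>i\<in>Q. d i (X i)) * g X \<partial>PiM I M)"
  using Q \<tau> d eq g
proof (induction Q arbitrary: g rule: finite_induct)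
  case empty
  then show ?case by simp
next
  case (insert q Q)
  have q: "q \<in> I" "Q \<subseteq> I" using insert by auto
  note [measurable] = insert.prems(5)
  have [measurable]: "\<tau> q \<in> M q \<rightarrow>\<^sub>M M q" "d q \<in> borel_measurable (M q)"
    using insert by auto
  note upd [measurable] = measurable_PiM_upd [OF q(1), of M]
  have upd' [measurable]: "(\<lambda>x. X(q := x)) \<in> M q \<rightarrow>\<^sub>M PiM I M" if "X \<in> space (PiM I M)" for X
    using measurable_compose [OF measurable_Pair1' [OF that] upd] by simp
  have g' [measurable]: "(\<lambda>X. g (X(q := \<tau> q (X q)))) \<in> borel_measurable (PiM I M)"
  proof -
    have "(\<lambda>X. (X, \<tau> q (X q))) \<in> PiM I M \<rightarrow>\<^sub>M PiM I M \<Otimes>\<^sub>M M q"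
      using q by measurable
    from measurable_compose [OF this upd] show ?thesis
      by (simp add: measurable_compose [OF _ insert.prems(5)])
  qed
  have dQ [measurable]: "(\<lambda>X. \<Prod>i\<in>Q. d i (X i)) \<in> borel_measurable (PiM I M)"
    using insert.prems(3) q by (intro borel_measurable_prod_ennreal) (auto intro!: measurable_compose [OF measurable_component_singleton])
  have dQ': "(\<lambda>X. \<Prod>i\<in>insert q Q. d i (X i)) \<in> borel_measurable (PiM I M)"
    using insert.prems(3) q by (intro borel_measurable_prod_ennreal) (auto intro!: measurable_compose [OF measurable_component_singleton])
  have prodQ: "(\<Prod>i\<in>Q. d i ((X(q := x)) i)) = (\<Prod>i\<in>Q. d i (X i))" for X x
    using insert.hyps by (intro prod.cong) auto
  have "(\<integral>\<^sup>+X. g (\<lambda>i. if i \<in> insert q Q then \<tau> i (X i) else X i) \<partial>PiM I M)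
      = (\<integral>\<^sup>+X. (\<lambda>X. g (X(q := \<tau> q (X q)))) (\<lambda>i. if i \<in> Q then \<tau> i (X i) else X i) \<partial>PiM I M)"
    using insert.hyps by (intro nn_integral_cong arg_cong [where f = g]) auto
  also have "\<dots> = (\<integral>\<^sup>+X. (\<Prod>i\<in>Q. d i (X i)) * g (X(q := \<tau> q (X q))) \<partial>PiM I M)"
    using insert.prems g' by (intro insert.IH) (auto simp only: insert_iff simp_thms)
  also have "\<dots> = (\<integral>\<^sup>+X. \<integral>\<^sup>+x. (\<Prod>i\<in>Q. d i (X i)) * g (X(q := \<tau> q x)) \<partial>M q \<partial>PiM I M)"
    by (subst nn_integral_PiM_resample [OF M q(1)])
      (simp_all only: prodQ fun_upd_same fun_upd_upd borel_measurable_times_ennreal dQ g')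
  also have "\<dots> = (\<integral>\<^sup>+X. (\<Prod>i\<in>Q. d i (X i)) * (\<integral>\<^sup>+x. d q x * g (X(q := x)) \<partial>M q) \<partial>PiM I M)"
  proof (intro nn_integral_cong)
    fix X assume X: "X \<in> space (PiM I M)"
    have "(\<lambda>x. g (X(q := x))) \<in> borel_measurable (M q)"
      using upd' [OF X] insert.prems(5) by (rule measurable_compose)
    moreover have "(\<lambda>x. g (X(q := \<tau> q x))) \<in> borel_measurable (M q)"
      using measurable_compose [OF \<open>\<tau> q \<in> M q \<rightarrow>\<^sub>M M q\<close> upd' [OF X]] insert.prems(5) by (rule measurable_compose)
    ultimately show "(\<integral>\<^sup>+x. (\<Prod>i\<in>Q. d i (X i)) * g (X(q := \<tau> q x)) \<partial>M q)
        = (\<Prod>i\<in>Q. d i (X i)) * (\<integral>\<^sup>+x. d q x * g (X(q := x)) \<partial>M q)"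
      using insert.prems(4) [of q "\<lambda>x. g (X(q := x))"] by (simp add: nn_integral_cmult)
  qed
  also have "\<dots> = (\<integral>\<^sup>+X. \<integral>\<^sup>+x. (\<Prod>i\<in>insert q Q. d i ((X(q := x)) i)) * g (X(q := x)) \<partial>M q \<partial>PiM I M)"
    using insert.hyps
    by (intro nn_integral_cong) (simp add: prodQ [simplified] nn_integral_cmult [symmetric] ac_simps del: nn_integral_cmult)
  also have "\<dots> = (\<integral>\<^sup>+X. (\<Prod>i\<in>insert q Q. d i (X i)) * g X \<partial>PiM I M)"
    by (subst nn_integral_PiM_resample [OF M q(1), symmetric]) (use dQ' in auto)
  finally show ?case .
qed

text \<open>Weighting a Poisson variable by its value is the same as adding one to it, because
\<open>(n + 1) p_\<^bsub>n+1\<^esub> = s p_n\<close>. This is the one-dimensional core of the Mecke formula.\<close>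

lemma nn_integral_poisson_size_bias:
  assumes "0 < s"
  shows "(\<integral>\<^sup>+n. of_nat n * g n \<partial>measure_pmf (poisson_pmf s))
    = ennreal s * (\<integral>\<^sup>+n. g (Suc n) \<partial>measure_pmf (poisson_pmf s))"
proof -
  have p: "ennreal (pmf (poisson_pmf s) (Suc n)) * of_nat (Suc n) = ennreal s * ennreal (pmf (poisson_pmf s) n)" for n
  proof -
    have "pmf (poisson_pmf s) (Suc n) * real (Suc n) = s * pmf (poisson_pmf s) n"
      using assms by (simp add: divide_simps del: of_nat_Suc)
    then show ?thesis
      using assms by (metis ennreal_mult'' ennreal_of_nat_eq_real_of_nat of_nat_0_le_iff pmf_nonneg)
  qed
  have "(\<integral>\<^sup>+n. of_nat n * g n \<partial>measure_pmf (poisson_pmf s))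
      = (\<Sum>n. ennreal (pmf (poisson_pmf s) n) * (of_nat n * g n))"
    by (simp add: nn_integral_measure_pmf nn_integral_count_space_nat)
  also have "\<dots> = (\<Sum>n. ennreal (pmf (poisson_pmf s) (Suc n)) * (of_nat (Suc n) * g (Suc n)))"
    by (subst suminf_offset [where i = 1]) (auto)
  also have "\<dots> = (\<Sum>n. ennreal s * (ennreal (pmf (poisson_pmf s) n) * g (Suc n)))"
    by (intro suminf_cong) (simp only: p [symmetric] mult.assoc [symmetric])
  also have "\<dots> = ennreal s * (\<integral>\<^sup>+n. g (Suc n) \<partial>measure_pmf (poisson_pmf s))"
    by (simp add: nn_integral_measure_pmf nn_integral_count_space_nat)
  finally show ?thesis .
qed

text \<open>The density of \<open>a + Z\<close> relative to \<open>Z\<close> is \<open>exp (a z - a^2 / 2)\<close>; for \<open>a = \<surd>(\<lambda>\<^sub>0 \<epsilon>) \<sigma>\<close> this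
is the likelihood of the Gaussian observation.\<close>

lemma nn_integral_std_normal_shift:
  fixes g :: "real \<Rightarrow> ennreal"
  assumes g [measurable]: "g \<in> borel_measurable borel"
  shows "(\<integral>\<^sup>+z. g (a + z) \<partial>density lborel std_normal_density)
    = (\<integral>\<^sup>+z. ennreal (exp (a * z - a\<^sup>2 / 2)) * g z \<partial>density lborel std_normal_density)"
proof -
  have *: "std_normal_density (z - a) = exp (a * z - a\<^sup>2 / 2) * std_normal_density z" for z
    by (simp add: std_normal_density_def exp_add [symmetric] power2_eq_square field_simps)
  have "(\<integral>\<^sup>+z. g (a + z) \<partial>density lborel std_normal_density)
      = (\<integral>\<^sup>+z. ennreal (std_normal_density z) * g (a + z) \<partial>lborel)"
    by (subst nn_integral_density) auto
  also have "\<dots> = (\<integral>\<^sup>+z. ennreal (std_normal_density (z - a)) * g z \<partial>lborel)"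
    by (subst (2) nn_integral_real_affine [where c = 1 and t = a]) (auto)
  also have "\<dots> = (\<integral>\<^sup>+z. ennreal (std_normal_density z) * (ennreal (exp (a * z - a\<^sup>2 / 2)) * g z) \<partial>lborel)"
    unfolding * by (simp add: ennreal_mult' ac_simps)
  also have "\<dots> = (\<integral>\<^sup>+z. ennreal (exp (a * z - a\<^sup>2 / 2)) * g z \<partial>density lborel std_normal_density)"
    by (subst nn_integral_density) auto
  finally show ?thesis .
qed

text \<open>The density of \<open>\<xi> / c\<close> relative to \<open>\<xi>\<close>; for \<open>c = 1 + \<lambda> \<sigma>\<close> this is the likelihood of an exponential
observation.\<close>

lemma nn_integral_exponential_scale:
  fixes g :: "real \<Rightarrow> ennreal"
  assumes g [measurable]: "g \<in> borel_measurable borel" and c: "0 < c"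
  shows "(\<integral>\<^sup>+x. g (x / c) \<partial>density lborel (exponential_density 1))
    = (\<integral>\<^sup>+x. ennreal (c * exp (- (c - 1) * x)) * g x \<partial>density lborel (exponential_density 1))"
proof -
  have *: "c * exponential_density 1 (c * x) = c * exp (- (c - 1) * x) * exponential_density 1 x" for x
    using c by (auto simp: exponential_density_def exp_add [symmetric] mult_less_0_iff field_simps)
  have "(\<integral>\<^sup>+x. g (x / c) \<partial>density lborel (exponential_density 1))
      = (\<integral>\<^sup>+x. ennreal (exponential_density 1 x) * g (x / c) \<partial>lborel)"
    by (subst nn_integral_density) (auto intro!: AE_I2 exponential_density_nonneg)
  also have "\<dots> = ennreal c * (\<integral>\<^sup>+x. ennreal (exponential_density 1 (c * x)) * g x \<partial>lborel)"
    by (subst nn_integral_real_affine [where c = c and t = 0]) (use c in auto)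
  also have "\<dots> = (\<integral>\<^sup>+x. ennreal c * (ennreal (exponential_density 1 (c * x)) * g x) \<partial>lborel)"
    by (rule nn_integral_cmult [symmetric]) auto
  also have "\<dots> = (\<integral>\<^sup>+x. ennreal (c * exponential_density 1 (c * x)) * g x \<partial>lborel)"
    using c by (auto simp: ennreal_mult' mult.assoc)
  also have "\<dots> = (\<integral>\<^sup>+x. ennreal (exponential_density 1 x) * (ennreal (c * exp (- (c - 1) * x)) * g x) \<partial>lborel)"
    unfolding * using c by (simp add: ennreal_mult' ac_simps)
  also have "\<dots> = (\<integral>\<^sup>+x. ennreal (c * exp (- (c - 1) * x)) * g x \<partial>density lborel (exponential_density 1))"
    by (subst nn_integral_density) (auto intro!: AE_I2 exponential_density_nonneg)
  finally show ?thesis .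
qed

section \<open>The disorder as a probability space\<close>

text \<open>Accessors for the components of a sample: hyperparameters, signal, data, Gaussian noise, counts, sites and exponential marks.\<close>

definition "hyp \<omega> = fst (fst \<omega>)"
definition "sig \<omega> = fst (snd (fst \<omega>))"
definition "obs \<omega> = snd (snd (fst \<omega>))"
definition "gau \<omega> = fst (snd \<omega>)"
definition "cnt \<omega> = fst (snd (snd \<omega>))"
definition "loc \<omega> = fst (snd (snd (snd \<omega>)))"
definition "xi \<omega> = snd (snd (snd (snd \<omega>)))"

lemmas sample_defs = hyp_def sig_def obs_def gau_def cnt_def loc_def xi_def

definition exp_term :: "(nat \<Rightarrow> real) \<Rightarrow> ('o, 'y) disorder \<Rightarrow> spins \<Rightarrow> nat \<Rightarrow> nat \<Rightarrow> real" where
  "exp_term lam \<omega> \<sigma> k j = ln (1 + lam k * \<sigma> (loc \<omega> (j, k)))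
     - lam k * xi \<omega> (j, k) * \<sigma> (loc \<omega> (j, k)) / (1 + lam k * sig \<omega> (loc \<omega> (j, k)))"

lemma H_exp_eq: "H_exp lam \<omega> \<sigma> = (\<Sum>k. \<Sum>j=1..cnt \<omega> (Suc k). exp_term lam \<omega> \<sigma> (Suc k) j)"
  by (simp only: H_exp_def exp_term_def case_prod_beta Let_def sample_defs)

lemma H_gauss_eq: "H_gauss N e lam \<omega> \<sigma> = lam 0 * e * (\<Sum>i=1..N. sig \<omega> i * \<sigma> i)
     + sqrt (lam 0 * e) * (\<Sum>i=1..N. gau \<omega> i * \<sigma> i)
     - 1/2 * (lam 0 * e) * (\<Sum>i=1..N. (\<sigma> i)\<^sup>2)"
  by (simp only: H_gauss_def case_prod_beta sample_defs)

lemma configs_cases: "\<sigma> \<in> configs N \<Longrightarrow> i \<in> {1..N} \<Longrightarrow> \<sigma> i = 1 \<or> \<sigma> i = -1"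
  using PiE_mem [of \<sigma> "{1..N}" "\<lambda>_. {-1, 1}" i] by (auto simp: configs_def)

locale perturbed_model =
  fixes N :: nat and m :: "('o, 'y) base_model" and e s :: real
  assumes N: "1 \<le> N" and valid: "valid_model N m" and e: "0 < e" and s: "0 < s"
begin

abbreviation "gaussM \<equiv> PiM {1..N} (\<lambda>_. density lborel std_normal_density)"
abbreviation "poisM \<equiv> PiM {1..} (\<lambda>_::nat. measure_pmf (poisson_pmf s))"
abbreviation "locM \<equiv> PiM ({1..} \<times> {1..}) (\<lambda>_::nat\<times>nat. measure_pmf (pmf_of_set {1..N}))"
abbreviation "expM \<equiv> PiM ({1..} \<times> {1..}) (\<lambda>_::nat\<times>nat. density lborel (exponential_density 1))"
abbreviation "marksM \<equiv> poisM \<Otimes>\<^sub>M (locM \<Otimes>\<^sub>M expM)"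
abbreviation "noiseM \<equiv> pert_noise_law N s"
abbreviation "baseM \<equiv> base_law N m"
abbreviation "lawM \<equiv> law N m s"

lemma noise_eq: "noiseM = gaussM \<Otimes>\<^sub>M marksM"
  by (simp only: pert_noise_law_def)

lemma prob_gauss: "prob_space gaussM"
  by (rule prob_space_PiM, rule prob_space_normal_density) simp

lemma prob_pois: "prob_space poisM"
  by (rule prob_space_PiM, rule prob_space_measure_pmf)

lemma prob_loc: "prob_space locM"
  by (rule prob_space_PiM, rule prob_space_measure_pmf)

lemma prob_exp1: "prob_space (density lborel (exponential_density 1))"
  by (rule prob_space_exponential_density) simp

lemma prob_exp: "prob_space expM"
  by (rule prob_space_PiM, rule prob_exp1)

lemma prob_pairM: "prob_space A \<Longrightarrow> prob_space B \<Longrightarrow> prob_space (A \<Otimes>\<^sub>M B)"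
  by (rule prob_space_pair)

lemma prob_noise: "prob_space noiseM"
  unfolding noise_eq by (intro prob_pairM prob_gauss prob_pois prob_loc prob_exp)

lemma sets_hyper [measurable_cong]:
  "sets (hyper_law m) = sets (PiM {1..N} (\<lambda>_. borel) \<Otimes>\<^sub>M out_space m)"
  using valid by (simp add: valid_model_def)

lemma space_hyper: "space (hyper_law m) = space (PiM {1..N} (\<lambda>_. borel) \<Otimes>\<^sub>M out_space m)"
  using sets_hyper by (rule sets_eq_imp_space_eq)

lemma prob_hyper: "prob_space (hyper_law m)" and sf_ref: "sigma_finite_measure (ref_meas m)"
  and P_out_meas: "\<sigma> \<in> configs N \<Longrightarrow> (\<lambda>(y, t). P_out m y \<sigma> t) \<in> borel_measurable (ref_meas m \<Otimes>\<^sub>M out_space m)"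
  and P_out_nonneg: "\<sigma> \<in> configs N \<Longrightarrow> t \<in> space (out_space m) \<Longrightarrow> y \<in> space (ref_meas m) \<Longrightarrow> 0 \<le> P_out m y \<sigma> t"
  and P_out_norm: "\<sigma> \<in> configs N \<Longrightarrow> t \<in> space (out_space m) \<Longrightarrow> (\<integral>\<^sup>+ y. ennreal (P_out m y \<sigma> t) \<partial>ref_meas m) = 1"
  using valid by (auto simp: valid_model_def)

lemma sf_count: "sigma_finite_measure (count_space (configs N))"
  by (intro sigma_finite_measure_count_space_countable countable_finite) simp

abbreviation "priorM \<equiv> hyper_law m \<Otimes>\<^sub>M (count_space (configs N) \<Otimes>\<^sub>M ref_meas m)"

lemma sets_base [measurable_cong]: "sets baseM = sets priorM"
  unfolding base_law_def by simp

lemma space_base: "space baseM = space (hyper_law m) \<times> (configs N \<times> space (ref_meas m))"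
  using sets_eq_imp_space_eq [OF sets_base] by (simp add: space_pair_measure)

lemma space_lawM: "space lawM = space baseM \<times> space noiseM"
  unfolding law_def by (simp add: space_pair_measure)

lemma space_law_cases:
  assumes "\<omega> \<in> space lawM"
  shows "sig \<omega> \<in> configs N" "snd (hyp \<omega>) \<in> space (out_space m)" "obs \<omega> \<in> space (ref_meas m)"
  using assms by (auto simp: space_lawM space_base space_hyper space_pair_measure sample_defs)

lemma sets_law [measurable_cong]: "sets lawM = sets (priorM \<Otimes>\<^sub>M noiseM)"
  unfolding law_def by (intro sets_pair_measure_cong sets_base refl)

lemma meas_fst_law [measurable]: "fst \<in> lawM \<rightarrow>\<^sub>M priorM" "snd \<in> lawM \<rightarrow>\<^sub>M noiseM"
  "fst \<in> priorM \<Otimes>\<^sub>M noiseM \<rightarrow>\<^sub>M priorM"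
  by measurable

lemma meas_hyp [measurable]: "hyp \<in> lawM \<rightarrow>\<^sub>M PiM {1..N} (\<lambda>_. borel) \<Otimes>\<^sub>M out_space m"
  unfolding hyp_def by measurable

lemma meas_obs [measurable]: "obs \<in> lawM \<rightarrow>\<^sub>M ref_meas m"
  unfolding obs_def by measurable

lemma meas_th [measurable]: "i \<in> {1..N} \<Longrightarrow> (\<lambda>\<omega>. fst (hyp \<omega>) i) \<in> borel_measurable lawM"
  by measurable

lemma meas_sig [measurable]: "sig \<in> lawM \<rightarrow>\<^sub>M count_space (configs N)"
  unfolding sig_def by measurable

lemma meas_sig_at [measurable]: "(\<lambda>\<omega>. sig \<omega> i) \<in> borel_measurable lawM"
  by (rule measurable_compose [OF meas_sig]) simp

lemma meas_P_out [measurable]: "\<sigma> \<in> configs N \<Longrightarrow> (\<lambda>\<omega>. P_out m (obs \<omega>) \<sigma> (snd (hyp \<omega>))) \<in> borel_measurable lawM"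
  using measurable_compose [OF measurable_Pair [of obs lawM "ref_meas m" "\<lambda>\<omega>. snd (hyp \<omega>)" "out_space m"] P_out_meas]
  by simp

lemma meas_gau [measurable]: "i \<in> {1..N} \<Longrightarrow> (\<lambda>\<omega>. gau \<omega> i) \<in> borel_measurable lawM"
proof -
  assume i: "i \<in> {1..N}"
  have "gau \<in> lawM \<rightarrow>\<^sub>M gaussM" unfolding gau_def by (rule measurable_compose [OF meas_fst_law(2)]) (simp add: noise_eq)
  from measurable_compose [OF this measurable_component_singleton [OF i]] show ?thesis by simp
qed

lemma meas_cnt [measurable]: "1 \<le> k \<Longrightarrow> (\<lambda>\<omega>. cnt \<omega> k) \<in> lawM \<rightarrow>\<^sub>M count_space UNIV"
proof -
  assume k: "1 \<le> k"
  have "cnt \<in> lawM \<rightarrow>\<^sub>M poisM" unfolding cnt_def by (rule measurable_compose [OF meas_fst_law(2)]) (simp add: noise_eq)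
  from measurable_compose [OF this measurable_component_singleton] k show ?thesis by simp
qed

lemma meas_loc [measurable]: "1 \<le> j \<Longrightarrow> 1 \<le> k \<Longrightarrow> (\<lambda>\<omega>. loc \<omega> (j, k)) \<in> lawM \<rightarrow>\<^sub>M count_space UNIV"
proof -
  assume k: "1 \<le> j" "1 \<le> k"
  have "loc \<in> lawM \<rightarrow>\<^sub>M locM" unfolding loc_def by (rule measurable_compose [OF meas_fst_law(2)]) (simp add: noise_eq)
  from measurable_compose [OF this measurable_component_singleton] k show ?thesis by simp
qed

lemma meas_xi [measurable]: "1 \<le> j \<Longrightarrow> 1 \<le> k \<Longrightarrow> (\<lambda>\<omega>. xi \<omega> (j, k)) \<in> borel_measurable lawM"
proof -
  assume k: "1 \<le> j" "1 \<le> k"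
  have "xi \<in> lawM \<rightarrow>\<^sub>M expM" unfolding xi_def by (rule measurable_compose [OF meas_fst_law(2)]) (simp add: noise_eq)
  from measurable_compose [OF this measurable_component_singleton] k show ?thesis by simp
qed

lemma prior_meas: "\<sigma> \<in> configs N \<Longrightarrow> (\<lambda>th. prior N th \<sigma>) \<in> borel_measurable (PiM {1..N} (\<lambda>_. borel))"
  unfolding prior_def spin_prior_def by measurable

lemma base_density_meas [measurable]:
  "(\<lambda>((th, t), sg, y). ennreal (prior N th sg * P_out m y sg t)) \<in> borel_measurable priorM"
proof -
  have "(\<lambda>x. ennreal (prior N (fst (fst x)) \<sigma> * P_out m (snd (snd x)) \<sigma> (snd (fst x)))) \<in> borel_measurable priorM"
    if "\<sigma> \<in> configs N" for \<sigma>
  proof -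
    have "(\<lambda>x. prior N (fst (fst x)) \<sigma>) \<in> borel_measurable priorM"
      by (rule measurable_compose [OF _ prior_meas [OF that]]) measurable
    moreover have "(\<lambda>x. (snd (snd x), snd (fst x))) \<in> priorM \<rightarrow>\<^sub>M ref_meas m \<Otimes>\<^sub>M out_space m"
      by measurable
    from measurable_compose [OF this P_out_meas [OF that]]
    have "(\<lambda>x. P_out m (snd (snd x)) \<sigma> (snd (fst x))) \<in> borel_measurable priorM" by simp
    ultimately show ?thesis by measurable
  qed
  then have "(\<lambda>x. (\<lambda>\<sigma> x. ennreal (prior N (fst (fst x)) \<sigma> * P_out m (snd (snd x)) \<sigma> (snd (fst x)))) (fst (snd x)) x) \<in> borel_measurable priorM"
    by (rule measurable_compose_countable' [where I = "configs N"])
      (simp_all add: countable_finite)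
  then show ?thesis by (simp add: split_beta')
qed

text \<open>The counting measure turns the integral over the signal into a finite sum, which is what Bayes' rule acts on.\<close>

lemma nn_integral_base:
  assumes g [measurable]: "g \<in> borel_measurable priorM"
  shows "(\<integral>\<^sup>+x. g x \<partial>baseM) = (\<integral>\<^sup>+h. \<integral>\<^sup>+y. (\<Sum>\<sigma>\<in>configs N.
      ennreal (prior N (fst h) \<sigma> * P_out m y \<sigma> (snd h)) * g (h, \<sigma>, y)) \<partial>ref_meas m \<partial>hyper_law m)"
proof -
  interpret R: sigma_finite_measure "ref_meas m" by (rule sf_ref)
  interpret C: sigma_finite_measure "count_space (configs N)" by (rule sf_count)
  interpret CR: pair_sigma_finite "count_space (configs N)" "ref_meas m" ..
  have [measurable]: "(\<lambda>x. ennreal (prior N (fst (fst x)) (fst (snd x)) * P_out m (snd (snd x)) (fst (snd x)) (snd (fst x)))) \<in> borel_measurable priorM"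
    using base_density_meas by (simp add: split_beta')
  have "(\<integral>\<^sup>+x. g x \<partial>baseM) = (\<integral>\<^sup>+x. ennreal (prior N (fst (fst x)) (fst (snd x)) * P_out m (snd (snd x)) (fst (snd x)) (snd (fst x))) * g x \<partial>priorM)"
    unfolding base_law_def split_beta' by (rule nn_integral_density) measurable
  also have "\<dots> = (\<integral>\<^sup>+h. \<integral>\<^sup>+x. ennreal (prior N (fst h) (fst x) * P_out m (snd x) (fst x) (snd h)) * g (h, x)
      \<partial>(count_space (configs N) \<Otimes>\<^sub>M ref_meas m) \<partial>hyper_law m)"
    by (subst CR.P.nn_integral_fst [symmetric]) simp_all
  also have "\<dots> = (\<integral>\<^sup>+h. \<integral>\<^sup>+y. (\<integral>\<^sup>+\<sigma>. ennreal (prior N (fst h) \<sigma> * P_out m y \<sigma> (snd h)) * g (h, \<sigma>, y) \<partial>count_space (configs N)) \<partial>ref_meas m \<partial>hyper_law m)"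
  proof (intro nn_integral_cong)
    fix h assume h: "h \<in> space (hyper_law m)"
    have "(\<lambda>x. ennreal (prior N (fst h) (fst x) * P_out m (snd x) (fst x) (snd h)) * g (h, x))
        \<in> borel_measurable (count_space (configs N) \<Otimes>\<^sub>M ref_meas m)"
      using measurable_compose [OF measurable_Pair1' [OF h] base_density_meas]
        measurable_compose [OF measurable_Pair1' [OF h] g]
      by (intro borel_measurable_times_ennreal) (simp_all add: split_beta')
    from CR.nn_integral_snd [OF this]
    show "(\<integral>\<^sup>+x. ennreal (prior N (fst h) (fst x) * P_out m (snd x) (fst x) (snd h)) * g (h, x)
        \<partial>(count_space (configs N) \<Otimes>\<^sub>M ref_meas m))
      = (\<integral>\<^sup>+y. (\<integral>\<^sup>+\<sigma>. ennreal (prior N (fst h) \<sigma> * P_out m y \<sigma> (snd h)) * g (h, \<sigma>, y)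
        \<partial>count_space (configs N)) \<partial>ref_meas m)"
      by simp
  qed
  also have "\<dots> = (\<integral>\<^sup>+h. \<integral>\<^sup>+y. (\<Sum>\<sigma>\<in>configs N.
      ennreal (prior N (fst h) \<sigma> * P_out m y \<sigma> (snd h)) * g (h, \<sigma>, y)) \<partial>ref_meas m \<partial>hyper_law m)"
    by (simp add: nn_integral_count_space_finite)
  finally show ?thesis .
qed

lemma prob_base: "prob_space baseM"
proof (rule prob_spaceI)
  interpret H: prob_space "hyper_law m" by (rule prob_hyper)
  have "emeasure baseM (space baseM) = (\<integral>\<^sup>+x. 1 \<partial>baseM)" by simp
  also have "\<dots> = (\<integral>\<^sup>+h. \<integral>\<^sup>+y. (\<Sum>\<sigma>\<in>configs N. ennreal (prior N (fst h) \<sigma> * P_out m y \<sigma> (snd h))) \<partial>ref_meas m \<partial>hyper_law m)"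
    by (subst nn_integral_base) auto
  also have "\<dots> = (\<integral>\<^sup>+h. 1 \<partial>hyper_law m)"
  proof (intro nn_integral_cong)
    fix h assume h: "h \<in> space (hyper_law m)"
    then have t: "snd h \<in> space (out_space m)" by (auto simp: space_hyper space_pair_measure)
    have P [measurable]: "(\<lambda>y. P_out m y \<sigma> (snd h)) \<in> borel_measurable (ref_meas m)" if "\<sigma> \<in> configs N" for \<sigma>
      using measurable_compose [OF measurable_Pair2' [OF t] P_out_meas [OF that]] by simp
    have "(\<integral>\<^sup>+y. (\<Sum>\<sigma>\<in>configs N. ennreal (prior N (fst h) \<sigma> * P_out m y \<sigma> (snd h))) \<partial>ref_meas m)
        = (\<Sum>\<sigma>\<in>configs N. \<integral>\<^sup>+y. ennreal (prior N (fst h) \<sigma> * P_out m y \<sigma> (snd h)) \<partial>ref_meas m)"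
      by (rule nn_integral_sum) (use P in measurable)
    also have "\<dots> = (\<Sum>\<sigma>\<in>configs N. ennreal (prior N (fst h) \<sigma>))"
    proof (intro sum.cong refl)
      fix \<sigma> assume \<sigma>: "\<sigma> \<in> configs N"
      note [measurable] = P [OF \<sigma>]
      have "(\<integral>\<^sup>+y. ennreal (prior N (fst h) \<sigma> * P_out m y \<sigma> (snd h)) \<partial>ref_meas m)
          = ennreal (prior N (fst h) \<sigma>) * (\<integral>\<^sup>+y. ennreal (P_out m y \<sigma> (snd h)) \<partial>ref_meas m)"
        by (subst nn_integral_cmult [symmetric]) (simp_all add: ennreal_mult' prior_nonneg)
      then show "(\<integral>\<^sup>+y. ennreal (prior N (fst h) \<sigma> * P_out m y \<sigma> (snd h)) \<partial>ref_meas m) = ennreal (prior N (fst h) \<sigma>)"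
        by (simp add: P_out_norm [OF \<sigma> t])
    qed
    also have "\<dots> = 1" by (simp add: prior_nonneg sum_ennreal sum_prior)
    finally show "(\<integral>\<^sup>+y. (\<Sum>\<sigma>\<in>configs N. ennreal (prior N (fst h) \<sigma> * P_out m y \<sigma> (snd h))) \<partial>ref_meas m) = 1" .
  qed
  also have "\<dots> = 1" by (simp add: H.emeasure_space_1)
  finally show "emeasure baseM (space baseM) = 1" .
qed

lemma prob_law: "prob_space lawM"
  unfolding law_def by (intro prob_pairM prob_base prob_noise)

sublocale law: prob_space lawM by (rule prob_law)
sublocale noise: prob_space noiseM by (rule prob_noise)
sublocale base: prob_space baseM by (rule prob_base)

end

section \<open>Magnetisations, correlations and multioverlaps\<close>

lemma prob_uniform_Icc: "a < b \<Longrightarrow> prob_space (uniform_measure lborel {a .. b :: real})"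
  by (rule prob_space_uniform_measure) auto

lemma prob_param_component: "prob_space (uniform_measure lborel {(1/2::real) ^ (k + 1) .. (1/2) ^ k})"
  by (rule prob_uniform_Icc) simp

lemma prob_param: "prob_space param_law"
  unfolding param_law_def by (rule prob_space_PiM, rule prob_param_component)

lemma sets_param [measurable_cong]: "sets param_law = sets (PiM UNIV (\<lambda>_. borel))"
  unfolding param_law_def by (intro sets_PiM_cong) simp_all

lemma space_param: "space param_law = UNIV"
  unfolding param_law_def by (simp add: space_PiM)

lemma meas_param: "(\<lambda>lam. lam k) \<in> borel_measurable param_law"
  by measurable

lemma AE_param_box: "AE lam in param_law. lam \<in> param_box"
proof -
  have "AE lam in param_law. lam k \<in> {(1/2) ^ (k + 1) .. (1/2) ^ k}" for k
    unfolding param_law_def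
  proof (rule AE_PiM_component)
    show "AE x in uniform_measure lborel {(1/2::real) ^ (k + 1)..(1/2) ^ k}. x \<in> {(1/2) ^ (k + 1)..(1/2) ^ k}"
      by (rule AE_uniform_measureI) auto
  qed (rule prob_param_component, simp)
  then show ?thesis
    by (simp only: param_box_def mem_Collect_eq AE_all_countable) simp
qed

context perturbed_model
begin

abbreviation "jointM \<equiv> param_law \<Otimes>\<^sub>M lawM"

sublocale param: prob_space param_law by (rule prob_param)
sublocale joint: pair_prob_space param_law lawM ..

lemma meas_lam: "(\<lambda>x. fst x k) \<in> borel_measurable jointM"
  by (rule measurable_compose [OF measurable_fst meas_param])

lemma joint_sndI: "f \<in> lawM \<rightarrow>\<^sub>M A \<Longrightarrow> (\<lambda>x. f (snd x)) \<in> jointM \<rightarrow>\<^sub>M A"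
  by (rule measurable_compose [OF measurable_snd])

lemma joint_section: "(\<lambda>x. f (fst x) (snd x)) \<in> borel_measurable jointM \<Longrightarrow> f lam \<in> borel_measurable lawM"
  using measurable_compose [OF measurable_Pair1' [of lam param_law lawM], of "\<lambda>x. f (fst x) (snd x)"]
  by (simp add: space_param)

lemma meas_at_loc: "1 \<le> j \<Longrightarrow> 1 \<le> k \<Longrightarrow> (\<lambda>\<omega>. \<sigma> (loc \<omega> (j, k))) \<in> borel_measurable lawM"
  by (rule measurable_compose [OF meas_loc]) auto

lemma meas_sig_loc: "1 \<le> j \<Longrightarrow> 1 \<le> k \<Longrightarrow> (\<lambda>\<omega>. sig \<omega> (loc \<omega> (j, k))) \<in> borel_measurable lawM"
  by (rule measurable_compose_countable [OF meas_sig_at meas_loc])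

lemma meas_exp_term:
  assumes "1 \<le> j" "1 \<le> k"
  shows "(\<lambda>x. exp_term (fst x) (snd x) \<sigma> k j) \<in> borel_measurable jointM"
proof -
  note m = meas_lam [of k] joint_sndI [OF meas_at_loc [OF assms, of \<sigma>]]
    joint_sndI [OF meas_sig_loc [OF assms]] joint_sndI [OF meas_xi [OF assms]]
  show ?thesis unfolding exp_term_def
    by (intro borel_measurable_diff borel_measurable_ln borel_measurable_add borel_measurable_divide
        borel_measurable_times m borel_measurable_const)
qed

lemma meas_sum_cnt:
  fixes f :: "nat \<Rightarrow> _ \<Rightarrow> real"
  assumes "1 \<le> k" "\<And>j. 1 \<le> j \<Longrightarrow> f j \<in> borel_measurable jointM"
  shows "(\<lambda>x. \<Sum>j=1..cnt (snd x) k. f j x) \<in> borel_measurable jointM"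
  by (rule measurable_compose_countable [OF _ joint_sndI [OF meas_cnt [OF assms(1)]]])
    (use assms(2) in auto)

lemma meas_H_exp: "(\<lambda>x. H_exp (fst x) (snd x) \<sigma>) \<in> borel_measurable jointM"
  unfolding H_exp_eq
  by (intro borel_measurable_suminf meas_sum_cnt meas_exp_term) auto

lemma meas_H_gauss: "(\<lambda>x. H_gauss N e (fst x) (snd x) \<sigma>) \<in> borel_measurable jointM"
proof -
  have "(\<lambda>x. \<Sum>i=1..N. gau (snd x) i * \<sigma> i) \<in> borel_measurable jointM"
    by (intro borel_measurable_sum borel_measurable_times joint_sndI [OF meas_gau] borel_measurable_const)
  then show ?thesis unfolding H_gauss_eq
    by (intro borel_measurable_diff borel_measurable_add borel_measurable_times borel_measurable_sum
        measurable_compose [OF _ borel_measurable_sqrt] meas_lam joint_sndI [OF meas_sig_at] joint_sndI [OF meas_gau] borel_measurable_const)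
qed

lemma boltzmann_eq: "boltzmann N m e lam \<omega> \<sigma> =
   (if P_out m (obs \<omega>) \<sigma> (snd (hyp \<omega>)) = 0 then 0
    else exp ((\<Sum>i=1..N. fst (hyp \<omega>) i * \<sigma> i) + (ln (P_out m (obs \<omega>) \<sigma> (snd (hyp \<omega>)))
      + H_gauss N e lam \<omega> \<sigma> + H_exp lam \<omega> \<sigma>)))"
  by (simp only: boltzmann_def H_pert_def H_base_def case_prod_beta sample_defs)

lemma meas_boltzmann:
  assumes "\<sigma> \<in> configs N"
  shows "(\<lambda>x. boltzmann N m e (fst x) (snd x) \<sigma>) \<in> borel_measurable jointM"
proof -
  define P where "P x = P_out m (obs (snd x)) \<sigma> (snd (hyp (snd x)))" for x :: "(nat \<Rightarrow> real) \<times> ('o, 'y) disorder"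
  have [measurable]: "P \<in> borel_measurable jointM"
    unfolding P_def by (rule joint_sndI [OF meas_P_out [OF assms]])
  have "(\<lambda>x. \<Sum>i=1..N. fst (hyp (snd x)) i * \<sigma> i) \<in> borel_measurable jointM"
    by (intro borel_measurable_sum borel_measurable_times joint_sndI [OF meas_th] borel_measurable_const)
  then have "(\<lambda>x. exp ((\<Sum>i=1..N. fst (hyp (snd x)) i * \<sigma> i) + (ln (P x)
      + H_gauss N e (fst x) (snd x) \<sigma> + H_exp (fst x) (snd x) \<sigma>))) \<in> borel_measurable jointM"
    by (intro measurable_compose [OF _ borel_measurable_exp] borel_measurable_add borel_measurable_ln meas_H_exp meas_H_gauss)
      measurable
  then show ?thesis unfolding boltzmann_eq P_def [symmetric] by measurable
qed

abbreviation "Z \<equiv> Z_pert N m e"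
abbreviation "G \<equiv> G_pert N m e"

lemma meas_Z: "(\<lambda>x. Z (fst x) (snd x)) \<in> borel_measurable jointM"
  unfolding Z_pert_def by (intro borel_measurable_sum meas_boltzmann)

lemma meas_F: "(\<lambda>x. F_pert N m e (fst x) (snd x)) \<in> borel_measurable jointM"
  unfolding F_pert_def by (intro borel_measurable_ln meas_Z)

lemma meas_G: "\<sigma> \<in> configs N \<Longrightarrow> (\<lambda>x. G (fst x) (snd x) \<sigma>) \<in> borel_measurable jointM"
  unfolding G_pert_def by (intro borel_measurable_divide meas_boltzmann meas_Z)

definition avg :: "(nat \<Rightarrow> real) \<Rightarrow> ('o, 'y) disorder \<Rightarrow> (spins \<Rightarrow> real) \<Rightarrow> real" where
  "avg lam \<omega> f = (\<Sum>\<sigma>\<in>configs N. G lam \<omega> \<sigma> * f \<sigma>)"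

definition mag :: "(nat \<Rightarrow> real) \<Rightarrow> ('o, 'y) disorder \<Rightarrow> nat \<Rightarrow> real" where
  "mag lam \<omega> i = avg lam \<omega> (\<lambda>\<sigma>. \<sigma> i)"

definition corr :: "(nat \<Rightarrow> real) \<Rightarrow> ('o, 'y) disorder \<Rightarrow> nat \<Rightarrow> nat \<Rightarrow> real" where
  "corr lam \<omega> i j = avg lam \<omega> (\<lambda>\<sigma>. \<sigma> i * \<sigma> j)"

definition emp :: "(real \<Rightarrow> real) \<Rightarrow> (nat \<Rightarrow> real) \<Rightarrow> ('o, 'y) disorder \<Rightarrow> real" where
  "emp h lam \<omega> = (\<Sum>i=1..N. h (mag lam \<omega> i)) / real N"

definition corr_moment :: "nat \<Rightarrow> (nat \<Rightarrow> real) \<Rightarrow> ('o, 'y) disorder \<Rightarrow> real" where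
  "corr_moment n lam \<omega> = (\<Sum>i=1..N. \<Sum>j=1..N. corr lam \<omega> i j ^ n) / (real N)\<^sup>2"

lemma boltzmann_nonneg: "0 \<le> boltzmann N m e lam \<omega> \<sigma>"
  by (simp add: boltzmann_eq)

lemma Z_nonneg: "0 \<le> Z lam \<omega>"
  unfolding Z_pert_def by (intro sum_nonneg boltzmann_nonneg)

lemma G_nonneg: "0 \<le> G lam \<omega> \<sigma>"
  unfolding G_pert_def by (intro divide_nonneg_nonneg boltzmann_nonneg Z_nonneg)

lemma sum_G: "Z lam \<omega> \<noteq> 0 \<Longrightarrow> (\<Sum>\<sigma>\<in>configs N. G lam \<omega> \<sigma>) = 1"
  by (simp add: G_pert_def sum_divide_distrib [symmetric] Z_pert_def [symmetric])

lemma sum_G_le: "(\<Sum>\<sigma>\<in>configs N. G lam \<omega> \<sigma>) \<le> 1"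
  by (cases "Z lam \<omega> = 0") (auto simp: sum_G, simp add: G_pert_def)

lemma abs_avg_le:
  assumes "\<And>\<sigma>. \<sigma> \<in> configs N \<Longrightarrow> \<bar>f \<sigma>\<bar> \<le> c" "0 \<le> c"
  shows "\<bar>avg lam \<omega> f\<bar> \<le> c"
proof -
  have "\<bar>avg lam \<omega> f\<bar> \<le> (\<Sum>\<sigma>\<in>configs N. G lam \<omega> \<sigma> * c)"
    unfolding avg_def
    by (rule order_trans [OF sum_abs]) (intro sum_mono, simp add: abs_mult G_nonneg assms mult_left_mono)
  also have "\<dots> = (\<Sum>\<sigma>\<in>configs N. G lam \<omega> \<sigma>) * c" by (simp add: sum_distrib_right)
  also have "\<dots> \<le> 1 * c" by (intro mult_right_mono sum_G_le assms)
  finally show ?thesis by simp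
qed

lemma config_abs: "\<sigma> \<in> configs N \<Longrightarrow> i \<in> {1..N} \<Longrightarrow> \<bar>\<sigma> i\<bar> = 1"
  using configs_cases by fastforce

lemma mag_bound: "i \<in> {1..N} \<Longrightarrow> \<bar>mag lam \<omega> i\<bar> \<le> 1"
  unfolding mag_def by (intro abs_avg_le) (auto simp: config_abs)

lemma corr_bound: "i \<in> {1..N} \<Longrightarrow> j \<in> {1..N} \<Longrightarrow> \<bar>corr lam \<omega> i j\<bar> \<le> 1"
  unfolding corr_def by (intro abs_avg_le) (auto simp: config_abs abs_mult)

lemma meas_avg: "(\<lambda>x. avg (fst x) (snd x) f) \<in> borel_measurable jointM"
  unfolding avg_def by (intro borel_measurable_sum borel_measurable_times meas_G) auto

lemma meas_mag: "(\<lambda>x. mag (fst x) (snd x) i) \<in> borel_measurable jointM"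
  unfolding mag_def by (rule meas_avg)

lemma meas_corr: "(\<lambda>x. corr (fst x) (snd x) i j) \<in> borel_measurable jointM"
  unfolding corr_def by (rule meas_avg)

lemma meas_emp:
  assumes "h \<in> borel_measurable borel"
  shows "(\<lambda>x. emp h (fst x) (snd x)) \<in> borel_measurable jointM"
  unfolding emp_def
  by (intro borel_measurable_divide borel_measurable_sum measurable_compose [OF meas_mag assms]) auto

lemma meas_corr_moment: "(\<lambda>x. corr_moment n (fst x) (snd x)) \<in> borel_measurable jointM"
  unfolding corr_moment_def
  by (intro borel_measurable_divide borel_measurable_sum borel_measurable_power meas_corr) auto

lemma emp_bound:
  assumes "\<And>x. \<bar>x\<bar> \<le> 1 \<Longrightarrow> \<bar>h x\<bar> \<le> c"
  shows "\<bar>emp h lam \<omega>\<bar> \<le> c"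
proof -
  have "\<bar>\<Sum>i=1..N. h (mag lam \<omega> i)\<bar> \<le> (\<Sum>i=1..N. c)"
    by (rule order_trans [OF sum_abs]) (intro sum_mono assms mag_bound)
  then show ?thesis using N by (simp add: emp_def abs_divide divide_le_eq mult.commute)
qed

lemma double_avg_bound:
  assumes "\<And>i j. i \<in> {1..N} \<Longrightarrow> j \<in> {1..N} \<Longrightarrow> \<bar>f i j\<bar> \<le> c"
  shows "\<bar>(\<Sum>i=1..N. \<Sum>j=1..N. f i j) / (real N)\<^sup>2\<bar> \<le> c"
proof -
  have "\<bar>\<Sum>i=1..N. \<Sum>j=1..N. f i j\<bar> \<le> (\<Sum>i=1..N. \<Sum>j=1..N. c)"
    by (rule order_trans [OF sum_abs], rule sum_mono, rule order_trans [OF sum_abs], intro sum_mono assms) auto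
  then show ?thesis using N by (simp add: abs_divide divide_le_eq power2_eq_square ac_simps)
qed

lemma corr_moment_bound: "\<bar>corr_moment n lam \<omega>\<bar> \<le> 1"
  unfolding corr_moment_def
  by (intro double_avg_bound) (use corr_bound in \<open>auto simp: power_abs power_le_one\<close>)

text \<open>Replicas are independent and identically distributed given the disorder, so a product over \<open>card J\<close> replicas integrates to a power.\<close>

lemma integral_replica_prod:
  assumes Z: "Z lam \<omega> \<noteq> 0" and J: "finite J" "J \<subseteq> {1..}"
  shows "integrable (PiM {1::nat..} (\<lambda>_. point_measure (configs N) (\<lambda>\<sigma>. ennreal (G lam \<omega> \<sigma>)))) (\<lambda>r. \<Prod>l\<in>J. g (r l) :: real)"
    and "(\<integral>r. (\<Prod>l\<in>J. g (r l)) \<partial>PiM {1::nat..} (\<lambda>_. point_measure (configs N) (\<lambda>\<sigma>. ennreal (G lam \<omega> \<sigma>))))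
      = avg lam \<omega> g ^ card J"
proof -
  let ?P = "point_measure (configs N) (\<lambda>\<sigma>. ennreal (G lam \<omega> \<sigma>))"
  interpret P: prob_space ?P
    by (intro prob_space_point_measure) (auto simp: G_nonneg sum_G [OF Z])
  interpret PP: product_prob_space "\<lambda>_. ?P" "{1::nat..}" ..
  interpret PJ: finite_product_prob_space "\<lambda>_. ?P" J by unfold_locales (rule J)
  have gi: "integrable ?P g"
    by (simp add: integrable_point_measure_finite)
  have gm [measurable]: "g \<in> borel_measurable ?P" using gi by auto
  have i: "integrable (PiM J (\<lambda>_. ?P)) (\<lambda>r. \<Prod>l\<in>J. g (r l))"
    by (rule PP.product_integrable_prod [OF J(1)]) (rule gi)
  have v: "(\<integral>r. (\<Prod>l\<in>J. g (r l)) \<partial>PiM J (\<lambda>_. ?P)) = (\<Prod>l\<in>J. integral\<^sup>L ?P g)"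
    by (rule PP.product_integral_prod [OF J(1)]) (rule gi)
  have ga: "integral\<^sup>L ?P g = avg lam \<omega> g"
    unfolding avg_def by (subst lebesgue_integral_point_measure_finite) (auto simp: G_nonneg)
  have rm [measurable]: "(\<lambda>r. restrict r J) \<in> PiM {1..} (\<lambda>_. ?P) \<rightarrow>\<^sub>M PiM J (\<lambda>_. ?P)"
    by (rule measurable_restrict_subset [OF J(2)])
  have pm [measurable]: "(\<lambda>r. \<Prod>l\<in>J. g (r l)) \<in> borel_measurable (PiM J (\<lambda>_. ?P))"
    using i by auto
  have d: "distr (PiM {1..} (\<lambda>_. ?P)) (PiM J (\<lambda>_. ?P)) (\<lambda>x. restrict x J) = PiM J (\<lambda>_. ?P)"
    by (rule PP.distr_PiM_restrict_finite [OF J])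
  show "integrable (PiM {1..} (\<lambda>_. ?P)) (\<lambda>r. \<Prod>l\<in>J. g (r l))"
    using i integrable_distr [OF rm, of "\<lambda>r. \<Prod>l\<in>J. g (r l)"] unfolding d by simp
  show "(\<integral>r. (\<Prod>l\<in>J. g (r l)) \<partial>PiM {1..} (\<lambda>_. ?P)) = avg lam \<omega> g ^ card J"
    using v integral_distr [OF rm pm] unfolding d by (simp add: ga)
qed

text \<open>Exchanging the product over replicas with the sum over sites: a site contributes \<open>m_i^n\<close>, and a pair of sites,
which comes from squaring the multioverlap, contributes \<open>a_ij^n\<close>.\<close>

lemma gibbs_avg_replica_prod:
  assumes "Z lam \<omega> \<noteq> 0"
  shows "gibbs_avg N m e lam \<omega> (multioverlap N [1..<Suc n]) = emp (\<lambda>x. x ^ n) lam \<omega>"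
    and "gibbs_avg N m e lam \<omega> (\<lambda>r. (multioverlap N [1..<Suc n] r - c)\<^sup>2)
      = corr_moment n lam \<omega> - 2 * c * emp (\<lambda>x. x ^ n) lam \<omega> + c\<^sup>2"
proof -
  let ?PP = "PiM {1::nat..} (\<lambda>_. point_measure (configs N) (\<lambda>\<sigma>. ennreal (G lam \<omega> \<sigma>)))"
  interpret P: prob_space "point_measure (configs N) (\<lambda>\<sigma>. ennreal (G lam \<omega> \<sigma>))"
    by (intro prob_space_point_measure) (auto simp: G_nonneg sum_G [OF assms])
  interpret PP: prob_space ?PP by (rule prob_space_PiM) (rule P.prob_space_axioms)
  have R: "multioverlap N [1..<Suc n] r = (\<Sum>i=1..N. \<Prod>l\<in>{1..n}. r l i) / real N" for r
  proof -
    have "(\<Prod>l\<leftarrow>[1..<Suc n]. r l i) = (\<Prod>l\<in>{1..n}. r l i)" for i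
      by (subst prod.distinct_set_conv_list [symmetric]) (simp_all only: distinct_upt set_upt atLeastLessThanSuc_atLeastAtMost)
    then show ?thesis by (simp only: multioverlap_def)
  qed
  define X where "X r = (\<Sum>i=1..N. \<Sum>j=1..N. \<Prod>l\<in>{1..n}. r l i * r l j) / (real N)\<^sup>2" for r :: replicas
  define Y where "Y r = (\<Sum>i=1..N. \<Prod>l\<in>{1..n}. r l i) / real N" for r :: replicas
  have RY: "multioverlap N [1..<Suc n] = Y"
    by (rule ext) (simp only: R Y_def)
  have X: "(Y r)\<^sup>2 = X r" for r
    by (simp only: X_def Y_def power_divide power2_eq_square [of "sum _ _"] sum_product prod.distrib)
  have R2: "(Y r - c)\<^sup>2 = X r - 2 * c * Y r + c\<^sup>2" for r
    by (simp add: power2_diff X)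
  have J: "finite {1..n}" "{1..n} \<subseteq> {1..}" by auto
  have i1 [simp]: "integrable ?PP (\<lambda>r. \<Prod>l\<in>{1..n}. r l i)"
      "(\<integral>r. (\<Prod>l\<in>{1..n}. r l i) \<partial>?PP) = avg lam \<omega> (\<lambda>\<sigma>. \<sigma> i) ^ n" for i
    using integral_replica_prod [OF assms J, of "\<lambda>\<sigma>. \<sigma> i"] by (simp_all del: One_nat_def)
  have i2 [simp]: "integrable ?PP (\<lambda>r. \<Prod>l\<in>{1..n}. r l i * r l j)"
      "(\<integral>r. (\<Prod>l\<in>{1..n}. r l i * r l j) \<partial>?PP) = avg lam \<omega> (\<lambda>\<sigma>. \<sigma> i * \<sigma> j) ^ n" for i j
    using integral_replica_prod [OF assms J, of "\<lambda>\<sigma>. \<sigma> i * \<sigma> j"] by (simp_all del: One_nat_def prod.distrib)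
  have a: "(\<integral>r. Y r \<partial>?PP) = emp (\<lambda>x. x ^ n) lam \<omega>"
    by (simp add: Y_def emp_def mag_def del: One_nat_def)
  have b: "(\<integral>r. X r \<partial>?PP) = corr_moment n lam \<omega>"
    by (simp add: X_def corr_moment_def corr_def del: prod.distrib One_nat_def)
  have ia: "integrable ?PP Y"
    unfolding Y_def by (intro integrable_divide_zero Bochner_Integration.integrable_sum i1)
  have ib: "integrable ?PP X"
    unfolding X_def by (intro integrable_divide_zero Bochner_Integration.integrable_sum i2)
  show "gibbs_avg N m e lam \<omega> (multioverlap N [1..<Suc n]) = emp (\<lambda>x. x ^ n) lam \<omega>"
    unfolding gibbs_avg_def RY a ..
  show "gibbs_avg N m e lam \<omega> (\<lambda>r. (multioverlap N [1..<Suc n] r - c)\<^sup>2)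
      = corr_moment n lam \<omega> - 2 * c * emp (\<lambda>x. x ^ n) lam \<omega> + c\<^sup>2"
    unfolding gibbs_avg_def RY R2 using ia ib a b by (simp add: PP.prob_space del: One_nat_def)
qed

text \<open>The signal is drawn with a probability proportional to its own likelihood, so that likelihood is almost surely positive.
Hence the partition function does not vanish (\<open>AE_Z_pos\<close>).\<close>

lemma AE_likelihood_pos: "AE \<omega> in lawM. P_out m (obs \<omega>) (sig \<omega>) (snd (hyp \<omega>)) \<noteq> 0"
proof -
  have "AE x in baseM. P_out m (snd (snd x)) (fst (snd x)) (snd (fst x)) \<noteq> 0"
    unfolding base_law_def using base_density_meas
    by (subst AE_density) (auto simp: case_prod_beta)
  then have "AE x in distr lawM baseM fst. P_out m (snd (snd x)) (fst (snd x)) (snd (fst x)) \<noteq> 0"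
    unfolding law_def noise.distr_pair_fst .
  from AE_distrD [OF _ this] show ?thesis
    by (simp add: sample_defs law_def)
qed

lemma Z_pos:
  assumes "P_out m (obs \<omega>) \<sigma> (snd (hyp \<omega>)) \<noteq> 0" "\<sigma> \<in> configs N"
  shows "0 < Z lam \<omega>"
  unfolding Z_pert_def
  by (rule sum_pos2 [OF finite_configs assms(2)]) (use assms(1) boltzmann_nonneg in \<open>auto simp: boltzmann_eq\<close>)

lemma AE_Z_pos: "AE \<omega> in lawM. Z lam \<omega> \<noteq> 0"
  using AE_likelihood_pos AE_space
proof eventually_elim
  case (elim \<omega>)
  from Z_pos [OF elim(1) space_law_cases(1) [OF elim(2)]] show ?case by (simp add: less_imp_neq [symmetric])
qed

lemma quenched_avg_eq:
  assumes "\<And>\<omega>. Z lam \<omega> \<noteq> 0 \<Longrightarrow> gibbs_avg N m e lam \<omega> f = Q \<omega>" and Q [measurable]: "Q \<in> borel_measurable lawM"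
  shows "quenched_avg N m e s lam f = (\<integral>\<omega>. Q \<omega> \<partial>lawM)"
proof -
  define K where "K = (\<integral>r. f r \<partial>PiM {1::nat..} (\<lambda>_. point_measure (configs N) (\<lambda>\<sigma>. 0)))"
  have *: "gibbs_avg N m e lam \<omega> f = (if Z lam \<omega> = 0 then K else Q \<omega>)" for \<omega>
    using assms(1) by (auto simp: gibbs_avg_def K_def G_pert_def)
  have [measurable]: "Z lam \<in> borel_measurable lawM" using joint_section [OF meas_Z] .
  show ?thesis
    unfolding quenched_avg_def *
    by (rule integral_cong_AE) (use AE_Z_pos [of lam] in \<open>auto elim: eventually_mono\<close>)
qed

lemma law_bounded_integrable:
  assumes "f \<in> borel_measurable lawM" "\<And>\<omega>. \<bar>f \<omega>\<bar> \<le> c"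
  shows "integrable lawM (f :: _ \<Rightarrow> real)"
  by (rule law.integrable_const_bound [where B = c]) (use assms in auto)

lemma integrable_emp:
  assumes "h \<in> borel_measurable borel" "\<And>x. \<bar>x\<bar> \<le> 1 \<Longrightarrow> \<bar>h x\<bar> \<le> c"
  shows "integrable lawM (emp h lam)"
  by (rule law_bounded_integrable [OF joint_section [OF meas_emp [OF assms(1)]] emp_bound [OF assms(2)]])

lemma integrable_corr_moment: "integrable lawM (corr_moment n lam)"
  by (rule law_bounded_integrable [OF joint_section [OF meas_corr_moment] corr_moment_bound])

lemma overlap_fluctuation_eq:
  "overlap_fluctuation N m e s [1..<Suc n] =
    (\<integral>lam. (\<integral>\<omega>. corr_moment n lam \<omega> \<partial>lawM) - (\<integral>\<omega>. emp (\<lambda>x. x ^ n) lam \<omega> \<partial>lawM)\<^sup>2 \<partial>param_law)"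
proof -
  have ie: "integrable lawM (emp (\<lambda>x. x ^ n) lam)" for lam
    by (rule integrable_emp [where c = 1]) (auto simp: power_abs power_le_one)
  note [measurable] = borel_measurable_integrable [OF ie] borel_measurable_integrable [OF integrable_corr_moment]
  have q1: "quenched_avg N m e s lam (multioverlap N [1..<Suc n]) = (\<integral>\<omega>. emp (\<lambda>x. x ^ n) lam \<omega> \<partial>lawM)" for lam
    by (rule quenched_avg_eq [OF gibbs_avg_replica_prod(1)]) auto
  have q2: "quenched_avg N m e s lam (\<lambda>r. (multioverlap N [1..<Suc n] r - c)\<^sup>2)
     = (\<integral>\<omega>. corr_moment n lam \<omega> - 2 * c * emp (\<lambda>x. x ^ n) lam \<omega> + c\<^sup>2 \<partial>lawM)" for lam c
    by (rule quenched_avg_eq [OF gibbs_avg_replica_prod(2)]) auto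
  have q3: "(\<integral>\<omega>. corr_moment n lam \<omega> - 2 * c * emp (\<lambda>x. x ^ n) lam \<omega> + c\<^sup>2 \<partial>lawM)
     = (\<integral>\<omega>. corr_moment n lam \<omega> \<partial>lawM) - 2 * c * (\<integral>\<omega>. emp (\<lambda>x. x ^ n) lam \<omega> \<partial>lawM) + c\<^sup>2" for lam c
    using ie [of lam] integrable_corr_moment [of n lam] by (simp add: law.prob_space)
  show ?thesis
    unfolding overlap_fluctuation_def q1 q2 q3
    by (intro Bochner_Integration.integral_cong refl) (simp add: power2_eq_square)
qed

lemma avg_const: "Z lam \<omega> \<noteq> 0 \<Longrightarrow> avg lam \<omega> (\<lambda>_. c) = c"
  by (simp add: avg_def sum_distrib_right [symmetric] sum_G)

lemma avg_add: "avg lam \<omega> (\<lambda>\<sigma>. f \<sigma> + g \<sigma>) = avg lam \<omega> f + avg lam \<omega> g"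
  by (simp add: avg_def algebra_simps sum.distrib)

lemma avg_diff: "avg lam \<omega> (\<lambda>\<sigma>. f \<sigma> - g \<sigma>) = avg lam \<omega> f - avg lam \<omega> g"
  by (simp add: avg_def algebra_simps sum_subtractf)

lemma avg_cmult: "avg lam \<omega> (\<lambda>\<sigma>. c * f \<sigma>) = c * avg lam \<omega> f"
  by (simp add: avg_def sum_distrib_left mult.left_commute)

lemma avg_sum: "avg lam \<omega> (\<lambda>\<sigma>. \<Sum>i\<in>I. f i \<sigma>) = (\<Sum>i\<in>I. avg lam \<omega> (f i))"
  unfolding avg_def by (simp add: sum_distrib_left sum.swap [of _ I])

lemma avg_mono: "(\<And>\<sigma>. \<sigma> \<in> configs N \<Longrightarrow> f \<sigma> \<le> g \<sigma>) \<Longrightarrow> avg lam \<omega> f \<le> avg lam \<omega> g"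
  unfolding avg_def by (intro sum_mono mult_left_mono G_nonneg)

lemma avg_jensen_square:
  assumes "Z lam \<omega> \<noteq> 0"
  shows "(avg lam \<omega> f)\<^sup>2 \<le> avg lam \<omega> (\<lambda>\<sigma>. (f \<sigma>)\<^sup>2)"
proof -
  let ?a = "avg lam \<omega> f"
  have "0 \<le> avg lam \<omega> (\<lambda>\<sigma>. (f \<sigma> - ?a)\<^sup>2)"
    unfolding avg_def by (intro sum_nonneg mult_nonneg_nonneg G_nonneg) auto
  also have "\<dots> = avg lam \<omega> (\<lambda>\<sigma>. (f \<sigma>)\<^sup>2 + (?a\<^sup>2 - 2 * ?a * f \<sigma>))"
    by (simp add: power2_diff algebra_simps)
  also have "\<dots> = avg lam \<omega> (\<lambda>\<sigma>. (f \<sigma>)\<^sup>2) + (?a\<^sup>2 - 2 * ?a * ?a)"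
    by (simp only: avg_add avg_diff avg_cmult avg_const [OF assms])
  finally show ?thesis by (simp add: power2_eq_square)
qed

definition decorr :: "(nat \<Rightarrow> real) \<Rightarrow> ('o, 'y) disorder \<Rightarrow> real" where
  "decorr lam \<omega> = (\<Sum>i=1..N. \<Sum>j=1..N. \<bar>corr lam \<omega> i j - mag lam \<omega> i * mag lam \<omega> j\<bar>) / (real N)\<^sup>2"

abbreviation "expected_decorr lam \<equiv> \<integral>\<omega>. decorr lam \<omega> \<partial>lawM"

text \<open>By the Cauchy-Schwarz inequality the left side is at most the average over \<open>i\<close> and \<open>j\<close> of
\<open>(a_ij - m_i m_j)^2 = a_ij^2 - 2 a_ij m_i m_j + (m_i m_j)^2\<close>. The average of \<open>a_ij m_i m_j\<close> is the posterior
mean of \<open>((1/N) \<Sum>_i m_i \<sigma>_i)^2\<close>, which is at least the square of the posterior mean \<open>(1/N) \<Sum>_i m_i^2\<close> of the bracket; the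
average of \<open>(m_i m_j)^2\<close> is equal to that square.\<close>

lemma decorr_square_le:
  assumes Z: "Z lam \<omega> \<noteq> 0"
  shows "(decorr lam \<omega>)\<^sup>2 \<le> corr_moment 2 lam \<omega> - (emp (\<lambda>x. x\<^sup>2) lam \<omega>)\<^sup>2"
proof -
  let ?m = "mag lam \<omega>" and ?a = "corr lam \<omega>"
  have N0: "real N > 0" using N by simp
  have "(decorr lam \<omega>)\<^sup>2 \<le> (\<Sum>i=1..N. \<Sum>j=1..N. (?a i j - ?m i * ?m j)\<^sup>2) / (real N)\<^sup>2"
  proof -
    let ?x = "\<lambda>p. \<bar>?a (fst p) (snd p) - ?m (fst p) * ?m (snd p)\<bar>"
    have "(\<Sum>p\<in>{1..N}\<times>{1..N}. ?x p * 1)\<^sup>2 \<le> (\<Sum>p\<in>{1..N}\<times>{1..N}. (?x p)\<^sup>2) * (\<Sum>p\<in>{1..N}\<times>{1..N}. 1\<^sup>2)"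
      by (rule Cauchy_Schwarz_ineq_sum)
    then have "(\<Sum>p\<in>{1..N}\<times>{1..N}. ?x p)\<^sup>2 \<le> (\<Sum>p\<in>{1..N}\<times>{1..N}. (?x p)\<^sup>2) * (real N)\<^sup>2"
      by (simp add: power2_eq_square)
    then have "(\<Sum>i=1..N. \<Sum>j=1..N. \<bar>?a i j - ?m i * ?m j\<bar>)\<^sup>2 \<le> (\<Sum>i=1..N. \<Sum>j=1..N. (?a i j - ?m i * ?m j)\<^sup>2) * (real N)\<^sup>2"
      by (simp add: sum.cartesian_product case_prod_beta)
    then show ?thesis using N0
      by (simp add: decorr_def power_divide divide_le_eq field_simps power2_eq_square)
  qed
  also have "\<dots> = corr_moment 2 lam \<omega> - 2 * ((\<Sum>i=1..N. \<Sum>j=1..N. ?a i j * (?m i * ?m j)) / (real N)\<^sup>2)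
      + (\<Sum>i=1..N. \<Sum>j=1..N. (?m i * ?m j)\<^sup>2) / (real N)\<^sup>2"
    by (simp add: corr_moment_def power2_diff sum.distrib sum_subtractf add_divide_distrib diff_divide_distrib sum_distrib_left mult.assoc)
  also have "(\<Sum>i=1..N. \<Sum>j=1..N. (?m i * ?m j)\<^sup>2) = (\<Sum>i=1..N. (?m i)\<^sup>2)\<^sup>2"
    by (simp add: power2_eq_square [of "sum _ _"] sum_product power_mult_distrib)
  finally have 1: "(decorr lam \<omega>)\<^sup>2 \<le> corr_moment 2 lam \<omega> - 2 * ((\<Sum>i=1..N. \<Sum>j=1..N. ?a i j * (?m i * ?m j)) / (real N)\<^sup>2)
      + (\<Sum>i=1..N. (?m i)\<^sup>2)\<^sup>2 / (real N)\<^sup>2" .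
  have "(\<Sum>i=1..N. (?m i)\<^sup>2)\<^sup>2 \<le> (\<Sum>i=1..N. \<Sum>j=1..N. ?a i j * (?m i * ?m j))"
  proof -
    let ?U = "\<lambda>\<sigma>. \<Sum>i=1..N. ?m i * \<sigma> i"
    have "avg lam \<omega> ?U = (\<Sum>i=1..N. (?m i)\<^sup>2)"
      by (simp add: avg_sum avg_cmult mag_def [symmetric] power2_eq_square)
    moreover have "avg lam \<omega> (\<lambda>\<sigma>. (?U \<sigma>)\<^sup>2) = (\<Sum>i=1..N. \<Sum>j=1..N. ?a i j * (?m i * ?m j))"
    proof -
      have "(?U \<sigma>)\<^sup>2 = (\<Sum>i=1..N. \<Sum>j=1..N. (?m i * ?m j) * (\<sigma> i * \<sigma> j))" for \<sigma>
        by (simp add: power2_eq_square sum_product mult_ac)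
      then show ?thesis by (simp only: avg_sum avg_cmult corr_def [symmetric]) (simp only: mult.commute)
    qed
    ultimately show ?thesis using avg_jensen_square [OF Z, of ?U] by simp
  qed
  then have "(\<Sum>i=1..N. (?m i)\<^sup>2)\<^sup>2 / (real N)\<^sup>2 \<le> (\<Sum>i=1..N. \<Sum>j=1..N. ?a i j * (?m i * ?m j)) / (real N)\<^sup>2"
    by (rule divide_right_mono) simp
  moreover have "(emp (\<lambda>x. x\<^sup>2) lam \<omega>)\<^sup>2 = (\<Sum>i=1..N. (?m i)\<^sup>2)\<^sup>2 / (real N)\<^sup>2"
    by (simp add: emp_def power_divide)
  ultimately show ?thesis using 1 by linarith
qed

lemma meas_decorr: "(\<lambda>x. decorr (fst x) (snd x)) \<in> borel_measurable jointM"
  unfolding decorr_def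
  by (intro borel_measurable_divide borel_measurable_sum borel_measurable_abs borel_measurable_diff
      borel_measurable_times meas_corr meas_mag) auto

lemma decorr_bound: "0 \<le> decorr lam \<omega>" "decorr lam \<omega> \<le> 2"
proof -
  show "0 \<le> decorr lam \<omega>" unfolding decorr_def by (intro divide_nonneg_nonneg sum_nonneg) auto
  have "\<bar>decorr lam \<omega>\<bar> \<le> 2"
    unfolding decorr_def
  proof (intro double_avg_bound)
    fix i j assume "i \<in> {1..N}" "j \<in> {1..N}"
    then have "\<bar>corr lam \<omega> i j\<bar> \<le> 1" "\<bar>mag lam \<omega> i * mag lam \<omega> j\<bar> \<le> 1 * 1"
      using corr_bound [of i j] mag_bound [of i lam \<omega>] mag_bound [of j lam \<omega>]
      by (simp_all only: abs_mult) (intro mult_mono, auto)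
    then show "\<bar>\<bar>corr lam \<omega> i j - mag lam \<omega> i * mag lam \<omega> j\<bar>\<bar> \<le> 2" by linarith
  qed
  then show "decorr lam \<omega> \<le> 2" by simp
qed

text \<open>The map \<open>x \<mapsto> x^n\<close> has Lipschitz constant \<open>n\<close> on \<open>[-1, 1]\<close>, and the squared empirical moment is the double average of \<open>(m_i m_j)^n\<close>.\<close>

lemma corr_moment_near: "\<bar>corr_moment n lam \<omega> - (emp (\<lambda>x. x ^ n) lam \<omega>)\<^sup>2\<bar> \<le> real n * decorr lam \<omega>"
proof -
  let ?m = "mag lam \<omega>" and ?a = "corr lam \<omega>"
  have pw: "\<bar>a ^ n - b ^ n\<bar> \<le> real n * \<bar>a - b\<bar>" if "\<bar>a\<bar> \<le> 1" "\<bar>b\<bar> \<le> 1" for a b :: real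
    using norm_power_diff [of a b n] that by simp
  have 1: "corr_moment n lam \<omega> - (emp (\<lambda>x. x ^ n) lam \<omega>)\<^sup>2 = (\<Sum>i=1..N. \<Sum>j=1..N. ?a i j ^ n - (?m i * ?m j) ^ n) / (real N)\<^sup>2"
    by (simp add: corr_moment_def emp_def power_divide power2_eq_square [of "sum _ _"] sum_product
        sum_subtractf diff_divide_distrib power_mult_distrib)
  have 2: "\<bar>?a i j ^ n - (?m i * ?m j) ^ n\<bar> \<le> real n * \<bar>?a i j - ?m i * ?m j\<bar>" if "i \<in> {1..N}" "j \<in> {1..N}" for i j
    using corr_bound [OF that, of lam \<omega>] mag_bound [OF that(1), of lam \<omega>] mag_bound [OF that(2), of lam \<omega>]
    by (intro pw) (auto simp: abs_mult intro!: mult_le_one)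
  have 3: "\<bar>\<Sum>i=1..N. \<Sum>j=1..N. ?a i j ^ n - (?m i * ?m j) ^ n\<bar> \<le> (\<Sum>i=1..N. \<Sum>j=1..N. real n * \<bar>?a i j - ?m i * ?m j\<bar>)"
    by (rule order_trans [OF sum_abs], rule sum_mono, rule order_trans [OF sum_abs], rule sum_mono, rule 2)
  then show ?thesis
    unfolding 1 decorr_def abs_divide times_divide_eq_right sum_distrib_left
    by (simp add: divide_right_mono)
qed

end

(* keeps 1 from being rewritten to Suc 0 in index ranges such as {1..N} *)
declare One_nat_def [simp del]

section \<open>The Mecke formula for the exponential observations\<close>

lemma measurable_PiM_fun_upd:
  assumes "f \<in> N \<rightarrow>\<^sub>M PiM I M" "h \<in> N \<rightarrow>\<^sub>M M q" "q \<in> I"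
  shows "(\<lambda>x. (f x)(q := h x)) \<in> N \<rightarrow>\<^sub>M PiM I M"
  using measurable_compose [OF measurable_Pair [OF assms(1,2)] measurable_PiM_upd [OF assms(3)]] by simp

text \<open>Independent identically distributed coordinates are exchangeable.\<close>

lemma nn_integral_PiM_transpose:
  assumes M: "prob_space M" and q: "a \<in> I" "b \<in> I"
    and g [measurable]: "g \<in> borel_measurable (PiM I (\<lambda>_. M))"
  shows "(\<integral>\<^sup>+X. g (X \<circ> Transposition.transpose a b) \<partial>PiM I (\<lambda>_. M)) = (\<integral>\<^sup>+X. g X \<partial>PiM I (\<lambda>_. M))"
proof -
  let ?P = "PiM I (\<lambda>_. M)" and ?t = "\<lambda>\<omega>. \<lambda>n\<in>I. \<omega> (Transposition.transpose a b n)"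
  have tI: "Transposition.transpose a b n \<in> I \<longleftrightarrow> n \<in> I" for n
    using q by (auto simp: Transposition.transpose_def)
  have d: "distr ?P ?P ?t = ?P"
    by (rule distr_PiM_reindex [where M = "\<lambda>_. M" and K = I]) (use M tI in \<open>auto intro: inj_on_subset [OF inj_swap]\<close>)
  have m: "?t \<in> ?P \<rightarrow>\<^sub>M ?P"
    by (rule measurable_restrict) (use tI in auto)
  have "(\<integral>\<^sup>+X. g (X \<circ> Transposition.transpose a b) \<partial>?P) = (\<integral>\<^sup>+X. g (?t X) \<partial>?P)"
  proof (intro nn_integral_cong arg_cong [where f = g])
    fix X assume "X \<in> space ?P"
    then show "X \<circ> Transposition.transpose a b = ?t X"
      using tI by (auto simp: space_PiM PiE_def extensional_def restrict_def fun_eq_iff)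
  qed
  also have "\<dots> = (\<integral>\<^sup>+X. g X \<partial>distr ?P ?P ?t)"
    by (rule nn_integral_distr [symmetric, OF m]) simp
  finally show ?thesis unfolding d .
qed

definition set_cnt :: "nat \<Rightarrow> nat \<Rightarrow> ('o, 'y) disorder \<Rightarrow> ('o, 'y) disorder" where
  "set_cnt k n \<omega> = (fst \<omega>, gau \<omega>, (cnt \<omega>)(k := n), loc \<omega>, xi \<omega>)"

definition set_pt :: "nat \<times> nat \<Rightarrow> nat \<Rightarrow> real \<Rightarrow> ('o, 'y) disorder \<Rightarrow> ('o, 'y) disorder" where
  "set_pt q i x \<omega> = (fst \<omega>, gau \<omega>, cnt \<omega>, (loc \<omega>)(q := i), (xi \<omega>)(q := x))"

definition swap_pts :: "nat \<times> nat \<Rightarrow> nat \<times> nat \<Rightarrow> ('o, 'y) disorder \<Rightarrow> ('o, 'y) disorder" where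
  "swap_pts a b \<omega> = (fst \<omega>, gau \<omega>, cnt \<omega>, loc \<omega> \<circ> Transposition.transpose a b, xi \<omega> \<circ> Transposition.transpose a b)"

text \<open>A new observation of strength \<open>\<lambda>_k\<close> at site \<open>i\<close> with mark \<open>x\<close> takes the first unused index.\<close>

definition add_pt :: "nat \<Rightarrow> nat \<Rightarrow> real \<Rightarrow> ('o, 'y) disorder \<Rightarrow> ('o, 'y) disorder" where
  "add_pt k i x \<omega> = set_cnt k (Suc (cnt \<omega> k)) (set_pt (Suc (cnt \<omega> k), k) i x \<omega>)"

lemma sample_of_tuple [simp]:
  "gau (b, z, p, l, y) = z" "cnt (b, z, p, l, y) = p" "loc (b, z, p, l, y) = l" "xi (b, z, p, l, y) = y"
  "sig (b, w) = fst (snd b)" "hyp (b, w) = fst b" "obs (b, w) = snd (snd b)"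
  by (simp_all add: sample_defs)

lemma upd_simps [simp]:
  "fst (set_cnt k n \<omega>) = fst \<omega>" "gau (set_cnt k n \<omega>) = gau \<omega>" "cnt (set_cnt k n \<omega>) = (cnt \<omega>)(k := n)"
  "loc (set_cnt k n \<omega>) = loc \<omega>" "xi (set_cnt k n \<omega>) = xi \<omega>"
  "fst (set_pt q i x \<omega>) = fst \<omega>" "gau (set_pt q i x \<omega>) = gau \<omega>" "cnt (set_pt q i x \<omega>) = cnt \<omega>"
  "loc (set_pt q i x \<omega>) = (loc \<omega>)(q := i)" "xi (set_pt q i x \<omega>) = (xi \<omega>)(q := x)"
  "fst (swap_pts a b \<omega>) = fst \<omega>" "gau (swap_pts a b \<omega>) = gau \<omega>" "cnt (swap_pts a b \<omega>) = cnt \<omega>"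
  "loc (swap_pts a b \<omega>) = loc \<omega> \<circ> Transposition.transpose a b" "xi (swap_pts a b \<omega>) = xi \<omega> \<circ> Transposition.transpose a b"
  by (simp_all add: set_cnt_def set_pt_def swap_pts_def)

lemma add_pt_simps [simp]:
  "fst (add_pt k i x \<omega>) = fst \<omega>" "gau (add_pt k i x \<omega>) = gau \<omega>"
  "cnt (add_pt k i x \<omega>) = (cnt \<omega>)(k := Suc (cnt \<omega> k))"
  "loc (add_pt k i x \<omega>) = (loc \<omega>)((Suc (cnt \<omega> k), k) := i)"
  "xi (add_pt k i x \<omega>) = (xi \<omega>)((Suc (cnt \<omega> k), k) := x)"
  by (simp_all add: add_pt_def)

lemma upd_base_simps [simp]:
  "sig (set_cnt k n \<omega>) = sig \<omega>" "hyp (set_cnt k n \<omega>) = hyp \<omega>" "obs (set_cnt k n \<omega>) = obs \<omega>"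
  "sig (set_pt q i x \<omega>) = sig \<omega>" "hyp (set_pt q i x \<omega>) = hyp \<omega>" "obs (set_pt q i x \<omega>) = obs \<omega>"
  "sig (swap_pts a b \<omega>) = sig \<omega>" "hyp (swap_pts a b \<omega>) = hyp \<omega>" "obs (swap_pts a b \<omega>) = obs \<omega>"
  "sig (add_pt k i x \<omega>) = sig \<omega>" "hyp (add_pt k i x \<omega>) = hyp \<omega>" "obs (add_pt k i x \<omega>) = obs \<omega>"
  by (simp_all add: sig_def hyp_def obs_def)

context perturbed_model
begin

abbreviation "siteM \<equiv> measure_pmf (pmf_of_set {1..N})"
abbreviation "expo \<equiv> density lborel (exponential_density 1)"
abbreviation "ptM \<equiv> siteM \<Otimes>\<^sub>M expo"
abbreviation "lawptM \<equiv> lawM \<Otimes>\<^sub>M ptM"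
abbreviation "plus_pt k w \<equiv> add_pt k (fst (snd w)) (snd (snd w)) (fst w)"
abbreviation "idxs \<equiv> {1::nat..} \<times> {1::nat..}"

sublocale expo: prob_space expo by (rule prob_exp1)
sublocale site: prob_space siteM by (rule prob_space_measure_pmf)
sublocale pt: pair_prob_space siteM expo ..
sublocale lawpt: pair_prob_space lawM ptM ..
sublocale gaussM: prob_space gaussM by (rule prob_gauss)
sublocale poisM: prob_space poisM by (rule prob_pois)
sublocale locM: prob_space locM by (rule prob_loc)
sublocale expM: prob_space expM by (rule prob_exp)
sublocale le: pair_prob_space locM expM ..
sublocale ple: pair_prob_space poisM "locM \<Otimes>\<^sub>M expM" ..
sublocale gple: pair_prob_space gaussM "marksM" ..

lemma law_eq: "lawM = baseM \<Otimes>\<^sub>M (gaussM \<Otimes>\<^sub>M marksM)"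
  by (simp only: law_def noise_eq)

lemma meas_parts:
  "fst \<in> lawM \<rightarrow>\<^sub>M baseM" "gau \<in> lawM \<rightarrow>\<^sub>M gaussM" "cnt \<in> lawM \<rightarrow>\<^sub>M poisM" "loc \<in> lawM \<rightarrow>\<^sub>M locM" "xi \<in> lawM \<rightarrow>\<^sub>M expM"
  unfolding law_eq gau_def cnt_def loc_def xi_def by measurable

lemma nn_integral_law:
  assumes g: "g \<in> borel_measurable lawM"
  shows "(\<integral>\<^sup>+\<omega>. g \<omega> \<partial>lawM) = (\<integral>\<^sup>+b. \<integral>\<^sup>+z. \<integral>\<^sup>+p. \<integral>\<^sup>+l. \<integral>\<^sup>+x. g (b, z, p, l, x) \<partial>expM \<partial>locM \<partial>poisM \<partial>gaussM \<partial>baseM)"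
proof -
  have [measurable]: "g \<in> borel_measurable (baseM \<Otimes>\<^sub>M (gaussM \<Otimes>\<^sub>M marksM))"
    using g by (simp only: law_eq)
  have 1: "(\<integral>\<^sup>+\<omega>. g \<omega> \<partial>lawM) = (\<integral>\<^sup>+b. \<integral>\<^sup>+w. g (b, w) \<partial>(gaussM \<Otimes>\<^sub>M marksM) \<partial>baseM)"
    unfolding law_eq by (rule gple.P.nn_integral_fst [symmetric]) simp
  have 2: "(\<integral>\<^sup>+w. g (b, w) \<partial>(gaussM \<Otimes>\<^sub>M marksM))
      = (\<integral>\<^sup>+z. \<integral>\<^sup>+w. g (b, z, w) \<partial>marksM \<partial>gaussM)"
    if [measurable]: "b \<in> space baseM" for b
    by (rule ple.P.nn_integral_fst [symmetric]) measurable
  have 3: "(\<integral>\<^sup>+w. g (b, z, w) \<partial>marksM)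
      = (\<integral>\<^sup>+p. \<integral>\<^sup>+w. g (b, z, p, w) \<partial>(locM \<Otimes>\<^sub>M expM) \<partial>poisM)"
    if [measurable]: "b \<in> space baseM" "z \<in> space gaussM" for b z
    by (rule le.P.nn_integral_fst [symmetric]) measurable
  have 4: "(\<integral>\<^sup>+w. g (b, z, p, w) \<partial>(locM \<Otimes>\<^sub>M expM))
      = (\<integral>\<^sup>+l. \<integral>\<^sup>+x. g (b, z, p, l, x) \<partial>expM \<partial>locM)"
    if [measurable]: "b \<in> space baseM" "z \<in> space gaussM" "p \<in> space poisM" for b z p
    by (rule expM.nn_integral_fst [symmetric]) measurable
  show ?thesis
    unfolding 1
    by (rule nn_integral_cong, subst 2, assumption, rule nn_integral_cong, subst 3, assumption, assumption,
        rule nn_integral_cong, rule 4, assumption, assumption, assumption)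
qed

lemma meas_law_intro:
  assumes "a \<in> A \<rightarrow>\<^sub>M baseM" "z \<in> A \<rightarrow>\<^sub>M gaussM" "p \<in> A \<rightarrow>\<^sub>M poisM" "l \<in> A \<rightarrow>\<^sub>M locM" "y \<in> A \<rightarrow>\<^sub>M expM"
  shows "(\<lambda>w. (a w, z w, p w, l w, y w)) \<in> A \<rightarrow>\<^sub>M lawM"
  unfolding law_eq by (intro measurable_Pair assms)

lemma meas_swap:
  assumes "a \<in> idxs" "b \<in> idxs"
  shows "swap_pts a b \<in> lawM \<rightarrow>\<^sub>M lawM"
proof -
  have t: "(\<lambda>X. X \<circ> Transposition.transpose a b) \<in> PiM idxs (\<lambda>_. M) \<rightarrow>\<^sub>M PiM idxs (\<lambda>_. M)" for M :: "'c measure"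
  proof (rule measurable_PiM_single')
    fix i assume "i \<in> idxs"
    then have "Transposition.transpose a b i \<in> idxs" using assms by (auto simp: Transposition.transpose_def)
    then show "(\<lambda>\<omega>. (\<omega> \<circ> Transposition.transpose a b) i) \<in> PiM idxs (\<lambda>_. M) \<rightarrow>\<^sub>M M" by simp
  next
    have "Transposition.transpose a b n \<in> idxs \<longleftrightarrow> n \<in> idxs" for n
      using assms by (auto simp: Transposition.transpose_def)
    then show "(\<lambda>\<omega> i. (\<omega> \<circ> Transposition.transpose a b) i) \<in> space (PiM idxs (\<lambda>_. M)) \<rightarrow> (\<Pi>\<^sub>E i\<in>idxs. space M)"
      by (auto simp: space_PiM PiE_iff extensional_def)
  qed
  show ?thesis
    unfolding swap_pts_def
    by (intro meas_law_intro meas_parts measurable_compose [OF meas_parts(4) t] measurable_compose [OF meas_parts(5) t])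
qed

lemma nn_integral_swap:
  assumes q: "a \<in> idxs" "b \<in> idxs" and g: "g \<in> borel_measurable lawM"
  shows "(\<integral>\<^sup>+\<omega>. g (swap_pts a b \<omega>) \<partial>lawM) = (\<integral>\<^sup>+\<omega>. g \<omega> \<partial>lawM)"
proof -
  have m: "(\<lambda>\<omega>. g (swap_pts a b \<omega>)) \<in> borel_measurable lawM"
    by (rule measurable_compose [OF meas_swap [OF q] g])
  have [measurable]: "g \<in> borel_measurable (baseM \<Otimes>\<^sub>M (gaussM \<Otimes>\<^sub>M marksM))"
    using g by (simp only: law_eq)
  show ?thesis
    unfolding nn_integral_law [OF m] nn_integral_law [OF g]
  proof (rule nn_integral_cong, rule nn_integral_cong, rule nn_integral_cong)
    fix b' z p assume bzp [measurable]: "b' \<in> space baseM" "z \<in> space gaussM" "p \<in> space poisM"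
    have "(\<integral>\<^sup>+l. \<integral>\<^sup>+x. g (b', z, p, l \<circ> Transposition.transpose a b, x \<circ> Transposition.transpose a b) \<partial>expM \<partial>locM)
        = (\<integral>\<^sup>+l. \<integral>\<^sup>+x. g (b', z, p, l, x \<circ> Transposition.transpose a b) \<partial>expM \<partial>locM)"
    proof (rule nn_integral_PiM_transpose [OF prob_space_measure_pmf q])
      have "swap_pts a b \<in> lawM \<rightarrow>\<^sub>M lawM" by (rule meas_swap [OF q])
      have t: "(\<lambda>X. X \<circ> Transposition.transpose a b) \<in> expM \<rightarrow>\<^sub>M expM"
      proof (rule measurable_PiM_single')
        fix i assume "i \<in> idxs"
        then have "Transposition.transpose a b i \<in> idxs" using q by (auto simp: Transposition.transpose_def)
        then show "(\<lambda>\<omega>. (\<omega> \<circ> Transposition.transpose a b) i) \<in> expM \<rightarrow>\<^sub>M expo" by simp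
      next
        have "Transposition.transpose a b n \<in> idxs \<longleftrightarrow> n \<in> idxs" for n
          using q by (auto simp: Transposition.transpose_def)
        then show "(\<lambda>\<omega> i. (\<omega> \<circ> Transposition.transpose a b) i) \<in> space expM \<rightarrow> (\<Pi>\<^sub>E i\<in>idxs. space expo)"
          by (auto simp: space_PiM PiE_iff extensional_def)
      qed
      show "(\<lambda>l. \<integral>\<^sup>+x. g (b', z, p, l, x \<circ> Transposition.transpose a b) \<partial>expM) \<in> borel_measurable locM"
        using t [measurable] by (intro expM.borel_measurable_nn_integral) (simp add: split_beta')
    qed
    also have "\<dots> = (\<integral>\<^sup>+l. \<integral>\<^sup>+x. g (b', z, p, l, x) \<partial>expM \<partial>locM)"
    proof (rule nn_integral_cong)
      fix l assume [measurable]: "l \<in> space locM"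
      show "(\<integral>\<^sup>+x. g (b', z, p, l, x \<circ> Transposition.transpose a b) \<partial>expM) = (\<integral>\<^sup>+x. g (b', z, p, l, x) \<partial>expM)"
        by (rule nn_integral_PiM_transpose [OF prob_exp1 q]) measurable
    qed
    finally show "(\<integral>\<^sup>+l. \<integral>\<^sup>+x. g (swap_pts a b (b', z, p, l, x)) \<partial>expM \<partial>locM)
        = (\<integral>\<^sup>+l. \<integral>\<^sup>+x. g (b', z, p, l, x) \<partial>expM \<partial>locM)"
      by (simp add: swap_pts_def)
  qed
qed

lemma nn_integral_pois_size_bias:
  assumes k: "1 \<le> k" and h [measurable]: "h \<in> borel_measurable poisM"
  shows "(\<integral>\<^sup>+p. of_nat (p k) * h p \<partial>poisM) = ennreal s * (\<integral>\<^sup>+p. h (p(k := Suc (p k))) \<partial>poisM)"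
proof -
  let ?S = "\<lambda>b z. SSS"
  have kI: "k \<in> {1..}" using k by simp
  have pk: "(\<lambda>p. p k) \<in> poisM \<rightarrow>\<^sub>M count_space UNIV"
    using measurable_component_singleton [OF kI, of "\<lambda>_. measure_pmf (poisson_pmf s)"] by simp
  have u: "(\<lambda>p. p(k := Suc (p k))) \<in> poisM \<rightarrow>\<^sub>M poisM"
    by (rule measurable_PiM_fun_upd [OF _ _ kI]) (use measurable_compose [OF pk, of Suc] in auto)
  have m1: "(\<lambda>p. of_nat (p k) * h p) \<in> borel_measurable poisM"
    by (intro borel_measurable_times_ennreal h measurable_compose [OF pk]) auto
  have m2: "(\<lambda>p. h (p(k := Suc (p k)))) \<in> borel_measurable poisM"
    by (rule measurable_compose [OF u h])
  have "(\<integral>\<^sup>+p. of_nat (p k) * h p \<partial>poisM) = (\<integral>\<^sup>+p. \<integral>\<^sup>+n. of_nat n * h (p(k := n)) \<partial>poisson_pmf s \<partial>poisM)"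
    by (subst nn_integral_PiM_resample [OF prob_space_measure_pmf kI m1]) simp
  also have "\<dots> = (\<integral>\<^sup>+p. ennreal s * (\<integral>\<^sup>+n. h (p(k := Suc n)) \<partial>poisson_pmf s) \<partial>poisM)"
    by (intro nn_integral_cong nn_integral_poisson_size_bias s)
  also have "\<dots> = ennreal s * (\<integral>\<^sup>+p. \<integral>\<^sup>+n. h (p(k := Suc n)) \<partial>poisson_pmf s \<partial>poisM)"
  proof (rule nn_integral_cmult)
    have "(\<lambda>w. (fst w)(k := Suc (snd w))) \<in> poisM \<Otimes>\<^sub>M measure_pmf (poisson_pmf s) \<rightarrow>\<^sub>M poisM"
      by (rule measurable_PiM_fun_upd [OF measurable_fst _ kI])
        (use measurable_compose [OF measurable_snd, of Suc] in simp)
    then show "(\<lambda>p. \<integral>\<^sup>+n. h (p(k := Suc n)) \<partial>poisson_pmf s) \<in> borel_measurable poisM"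
      by (intro measure_pmf.borel_measurable_nn_integral)
        (simp add: split_beta' measurable_compose [OF _ h])
  qed
  also have "(\<integral>\<^sup>+p. \<integral>\<^sup>+n. h (p(k := Suc n)) \<partial>poisson_pmf s \<partial>poisM) = (\<integral>\<^sup>+p. h (p(k := Suc (p k))) \<partial>poisM)"
    by (subst nn_integral_PiM_resample [OF prob_space_measure_pmf kI m2]) simp
  finally show ?thesis .
qed

lemma meas_incr_cnt:
  assumes k: "1 \<le> k"
  shows "(\<lambda>\<omega>. set_cnt k (Suc (cnt \<omega> k)) \<omega>) \<in> lawM \<rightarrow>\<^sub>M lawM"
proof -
  have kI: "k \<in> {1..}" using k by simp
  have "(\<lambda>p. p k) \<in> poisM \<rightarrow>\<^sub>M count_space UNIV"
    using measurable_component_singleton [OF kI, of "\<lambda>_. measure_pmf (poisson_pmf s)"] by simp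
  from measurable_compose [OF this, of Suc] have "(\<lambda>p. p(k := Suc (p k))) \<in> poisM \<rightarrow>\<^sub>M poisM"
    by (intro measurable_PiM_fun_upd [OF _ _ kI]) auto
  then show ?thesis
    unfolding set_cnt_def by (intro meas_law_intro meas_parts measurable_compose [OF meas_parts(3)])
qed

lemma meas_set_new_pt:
  assumes k: "1 \<le> k"
  shows "(\<lambda>w. set_pt (Suc (cnt (fst w) k), k) (fst (snd w)) (snd (snd w)) (fst w)) \<in> lawptM \<rightarrow>\<^sub>M lawM"
proof -
  have ul: "(\<lambda>w. (f w)((Suc (n w), k) := h w)) \<in> A \<rightarrow>\<^sub>M PiM idxs (\<lambda>_. M)"
    if "f \<in> A \<rightarrow>\<^sub>M PiM idxs (\<lambda>_. M)" "h \<in> A \<rightarrow>\<^sub>M M" "n \<in> A \<rightarrow>\<^sub>M count_space UNIV" for f h n A M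
    by (rule measurable_compose_countable [OF _ that(3), of "\<lambda>n w. (f w)((Suc n, k) := h w)"],
        rule measurable_PiM_fun_upd [where M = "\<lambda>_. M"]) (use that k in auto)
  show ?thesis
    unfolding set_pt_def
    by (intro meas_law_intro ul measurable_compose [OF measurable_fst] meas_parts meas_cnt [OF k])
      (measurable)
qed

lemma nn_integral_cnt_size_bias:
  assumes k: "1 \<le> k" and g: "g \<in> borel_measurable lawM"
  shows "(\<integral>\<^sup>+\<omega>. of_nat (cnt \<omega> k) * g \<omega> \<partial>lawM) = ennreal s * (\<integral>\<^sup>+\<omega>. g (set_cnt k (Suc (cnt \<omega> k)) \<omega>) \<partial>lawM)"
proof -
  let ?S = "\<lambda>b z. \<integral>\<^sup>+p. \<integral>\<^sup>+l. \<integral>\<^sup>+x. g (b, z, p(k := Suc (p k)), l, x) \<partial>expM \<partial>locM \<partial>poisM"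
  have kI: "k \<in> {1..}" using k by simp
  have pk: "(\<lambda>p. p k) \<in> poisM \<rightarrow>\<^sub>M count_space UNIV"
    using measurable_component_singleton [OF kI, of "\<lambda>_. measure_pmf (poisson_pmf s)"] by simp
  have u: "(\<lambda>p. p(k := Suc (p k))) \<in> poisM \<rightarrow>\<^sub>M poisM"
    by (rule measurable_PiM_fun_upd [OF _ _ kI]) (use measurable_compose [OF pk, of Suc] in auto)
  have m1: "(\<lambda>\<omega>. of_nat (cnt \<omega> k) * g \<omega>) \<in> borel_measurable lawM"
    by (intro borel_measurable_times_ennreal g measurable_compose [OF meas_cnt [OF k]]) auto
  have m2: "(\<lambda>\<omega>. g (set_cnt k (Suc (cnt \<omega> k)) \<omega>)) \<in> borel_measurable lawM"
    by (rule measurable_compose [OF meas_incr_cnt [OF k] g])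
  have gm [measurable]: "g \<in> borel_measurable (baseM \<Otimes>\<^sub>M (gaussM \<Otimes>\<^sub>M marksM))"
    using g by (simp only: law_eq)
  have um [measurable]: "(\<lambda>p. p(k := Suc (p k))) \<in> poisM \<rightarrow>\<^sub>M poisM" by (rule u)
  have "(\<integral>\<^sup>+\<omega>. of_nat (cnt \<omega> k) * g \<omega> \<partial>lawM)
      = (\<integral>\<^sup>+b. \<integral>\<^sup>+z. ennreal s * ?S b z \<partial>gaussM \<partial>baseM)"
    unfolding nn_integral_law [OF m1]
  proof (rule nn_integral_cong, rule nn_integral_cong)
    fix b z assume [measurable]: "b \<in> space baseM" "z \<in> space gaussM"
    have "(\<integral>\<^sup>+p. \<integral>\<^sup>+l. \<integral>\<^sup>+x. of_nat (cnt (b, z, p, l, x) k) * g (b, z, p, l, x) \<partial>expM \<partial>locM \<partial>poisM)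
        = (\<integral>\<^sup>+p. of_nat (p k) * (\<integral>\<^sup>+l. \<integral>\<^sup>+x. g (b, z, p, l, x) \<partial>expM \<partial>locM) \<partial>poisM)"
    proof (rule nn_integral_cong)
      fix p assume [measurable]: "p \<in> space poisM"
      have "(\<integral>\<^sup>+l. \<integral>\<^sup>+x. of_nat (cnt (b, z, p, l, x) k) * g (b, z, p, l, x) \<partial>expM \<partial>locM)
          = (\<integral>\<^sup>+l. of_nat (p k) * (\<integral>\<^sup>+x. g (b, z, p, l, x) \<partial>expM) \<partial>locM)"
      proof (rule nn_integral_cong)
        fix l assume [measurable]: "l \<in> space locM"
        show "(\<integral>\<^sup>+x. of_nat (cnt (b, z, p, l, x) k) * g (b, z, p, l, x) \<partial>expM)
            = of_nat (p k) * (\<integral>\<^sup>+x. g (b, z, p, l, x) \<partial>expM)"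
          unfolding sample_of_tuple by (rule nn_integral_cmult) measurable
      qed
      also have "\<dots> = of_nat (p k) * (\<integral>\<^sup>+l. \<integral>\<^sup>+x. g (b, z, p, l, x) \<partial>expM \<partial>locM)"
        by (rule nn_integral_cmult) measurable
      finally show "(\<integral>\<^sup>+l. \<integral>\<^sup>+x. of_nat (cnt (b, z, p, l, x) k) * g (b, z, p, l, x) \<partial>expM \<partial>locM)
          = of_nat (p k) * (\<integral>\<^sup>+l. \<integral>\<^sup>+x. g (b, z, p, l, x) \<partial>expM \<partial>locM)" .
    qed
    also have "\<dots> = ennreal s * ?S b z"
      by (rule nn_integral_pois_size_bias [OF k]) measurable
    finally show "(\<integral>\<^sup>+p. \<integral>\<^sup>+l. \<integral>\<^sup>+x. of_nat (cnt (b, z, p, l, x) k) * g (b, z, p, l, x) \<partial>expM \<partial>locM \<partial>poisM)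
       = ennreal s * ?S b z" .
  qed
  also have "\<dots> = ennreal s * (\<integral>\<^sup>+b. \<integral>\<^sup>+z. ?S b z \<partial>gaussM \<partial>baseM)"
  proof -
    have "(\<integral>\<^sup>+b. \<integral>\<^sup>+z. ennreal s * ?S b z \<partial>gaussM \<partial>baseM)
       = (\<integral>\<^sup>+b. ennreal s * (\<integral>\<^sup>+z. ?S b z \<partial>gaussM) \<partial>baseM)"
    proof (rule nn_integral_cong)
      fix b assume [measurable]: "b \<in> space baseM"
      show "(\<integral>\<^sup>+z. ennreal s * ?S b z \<partial>gaussM)
        = ennreal s * (\<integral>\<^sup>+z. ?S b z \<partial>gaussM)"
        by (rule nn_integral_cmult) measurable
    qed
    also have "\<dots> = ennreal s * (\<integral>\<^sup>+b. \<integral>\<^sup>+z. ?S b z \<partial>gaussM \<partial>baseM)"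
      by (rule nn_integral_cmult) measurable
    finally show ?thesis .
  qed
  finally show ?thesis
    unfolding nn_integral_law [OF m2] by (simp add: set_cnt_def)
qed

text \<open>The mark with index \<open>cnt \<omega> k + 1\<close> is the first one that the Hamiltonian does not read. Given the counts it is independent
of the others, so it may be drawn afresh.\<close>

lemma nn_integral_resample_pt:
  assumes k: "1 \<le> k" and g: "g \<in> borel_measurable lawM"
  shows "(\<integral>\<^sup>+\<omega>. g \<omega> \<partial>lawM) = (\<integral>\<^sup>+\<omega>. \<integral>\<^sup>+i. \<integral>\<^sup>+x. g (set_pt (Suc (cnt \<omega> k), k) i x \<omega>) \<partial>expo \<partial>siteM \<partial>lawM)"
proof -
  have gm [measurable]: "g \<in> borel_measurable (baseM \<Otimes>\<^sub>M (gaussM \<Otimes>\<^sub>M marksM))"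
    using g by (simp only: law_eq)
  have m2: "(\<lambda>w. g (set_pt (Suc (cnt (fst w) k), k) (fst (snd w)) (snd (snd w)) (fst w))) \<in> borel_measurable lawptM"
    by (rule measurable_compose [OF meas_set_new_pt [OF k] g])
  have m3: "(\<lambda>\<omega>. \<integral>\<^sup>+i. \<integral>\<^sup>+x. g (set_pt (Suc (cnt \<omega> k), k) i x \<omega>) \<partial>expo \<partial>siteM) \<in> borel_measurable lawM"
  proof -
    have [measurable]: "(\<lambda>w. g (set_pt (Suc (cnt (fst w) k), k) (fst (snd w)) (snd (snd w)) (fst w))) \<in> borel_measurable lawptM"
      by (rule m2)
    have "(\<lambda>w. \<integral>\<^sup>+x. g (set_pt (Suc (cnt (fst w) k), k) (snd w) x (fst w)) \<partial>expo) \<in> borel_measurable (lawM \<Otimes>\<^sub>M siteM)"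
    proof (rule expo.borel_measurable_nn_integral)
      have "(\<lambda>v. (fst (fst v), (snd (fst v), snd v))) \<in> (lawM \<Otimes>\<^sub>M siteM) \<Otimes>\<^sub>M expo \<rightarrow>\<^sub>M lawptM"
        by (intro measurable_Pair measurable_compose [OF measurable_fst] measurable_fst measurable_snd)
      from measurable_compose [OF this m2]
      show "(\<lambda>(w, x). g (set_pt (Suc (cnt (fst w) k), k) (snd w) x (fst w))) \<in> borel_measurable ((lawM \<Otimes>\<^sub>M siteM) \<Otimes>\<^sub>M expo)"
        by (simp add: split_beta')
    qed
    then show ?thesis
      by (intro measure_pmf.borel_measurable_nn_integral) (simp add: split_beta')
  qed
  show ?thesis
    unfolding nn_integral_law [OF m3] nn_integral_law [OF g]
  proof (rule nn_integral_cong, rule nn_integral_cong, rule nn_integral_cong)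
    fix b z p assume [measurable]: "b \<in> space baseM" "z \<in> space gaussM" "p \<in> space poisM"
    define q where "q = (Suc (p k), k)"
    have q: "q \<in> idxs" using k by (auto simp: q_def)
    have [measurable]: "(\<lambda>w. (f w)(q := h w)) \<in> A \<rightarrow>\<^sub>M PiM idxs (\<lambda>_. M)"
      if "f \<in> A \<rightarrow>\<^sub>M PiM idxs (\<lambda>_. M)" "h \<in> A \<rightarrow>\<^sub>M M" for f h A M
      by (rule measurable_PiM_fun_upd [where M = "\<lambda>_. M"]) (use that q in auto)
    have "(\<integral>\<^sup>+l. \<integral>\<^sup>+x. g (b, z, p, l, x) \<partial>expM \<partial>locM)
        = (\<integral>\<^sup>+l. \<integral>\<^sup>+i. \<integral>\<^sup>+x. g (b, z, p, l(q := i), x) \<partial>expM \<partial>siteM \<partial>locM)"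
      by (rule nn_integral_PiM_resample [OF prob_space_measure_pmf q]) measurable
    also have "\<dots> = (\<integral>\<^sup>+l. \<integral>\<^sup>+i. \<integral>\<^sup>+x. \<integral>\<^sup>+x'. g (b, z, p, l(q := i), x(q := x')) \<partial>expo \<partial>expM \<partial>siteM \<partial>locM)"
    proof (rule nn_integral_cong, rule nn_integral_cong)
      fix l i assume l [measurable]: "l \<in> space locM"
      have [measurable]: "l(q := i) \<in> space locM"
        using l PiE_fun_upd [of i "\<lambda>_. UNIV" q l idxs] insert_absorb [OF q] by (simp add: space_PiM)
      show "(\<integral>\<^sup>+x. g (b, z, p, l(q := i), x) \<partial>expM) = (\<integral>\<^sup>+x. \<integral>\<^sup>+x'. g (b, z, p, l(q := i), x(q := x')) \<partial>expo \<partial>expM)"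
        by (rule nn_integral_PiM_resample [OF prob_exp1 q]) measurable
    qed
    also have "\<dots> = (\<integral>\<^sup>+l. \<integral>\<^sup>+x. \<integral>\<^sup>+i. \<integral>\<^sup>+x'. g (b, z, p, l(q := i), x(q := x')) \<partial>expo \<partial>siteM \<partial>expM \<partial>locM)"
    proof (rule nn_integral_cong)
      fix l assume l [measurable]: "l \<in> space locM"
      interpret se: pair_sigma_finite siteM expM ..
      show "(\<integral>\<^sup>+i. \<integral>\<^sup>+x. \<integral>\<^sup>+x'. g (b, z, p, l(q := i), x(q := x')) \<partial>expo \<partial>expM \<partial>siteM)
         = (\<integral>\<^sup>+x. \<integral>\<^sup>+i. \<integral>\<^sup>+x'. g (b, z, p, l(q := i), x(q := x')) \<partial>expo \<partial>siteM \<partial>expM)"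
        by (rule se.Fubini' [symmetric]) measurable
    qed
    finally show "(\<integral>\<^sup>+l. \<integral>\<^sup>+x. g (b, z, p, l, x) \<partial>expM \<partial>locM) =
       (\<integral>\<^sup>+l. \<integral>\<^sup>+x. \<integral>\<^sup>+i. \<integral>\<^sup>+x'. g (set_pt (Suc (cnt (b, z, p, l, x) k), k) i x' (b, z, p, l, x)) \<partial>expo \<partial>siteM \<partial>expM \<partial>locM)"
      by (simp add: set_pt_def q_def)
  qed
qed

lemma meas_add_pt:
  assumes k: "1 \<le> k"
  shows "(\<lambda>w. plus_pt k w) \<in> lawptM \<rightarrow>\<^sub>M lawM"
  using measurable_compose [OF meas_set_new_pt [OF k] meas_incr_cnt [OF k]]
  by (simp add: add_pt_def)

lemma meas_at_pt:
  assumes A: "(\<lambda>w. A (fst w) (fst (snd w)) (snd (snd w))) \<in> borel_measurable lawptM"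
    and j: "1 \<le> j" "1 \<le> k"
  shows "(\<lambda>\<omega>. A \<omega> (loc \<omega> (j, k)) (xi \<omega> (j, k))) \<in> borel_measurable lawM"
proof -
  have "(\<lambda>\<omega>. (\<omega>, loc \<omega> (j, k), xi \<omega> (j, k))) \<in> lawM \<rightarrow>\<^sub>M lawptM"
    using meas_loc [OF j] meas_xi [OF j] by (intro measurable_Pair measurable_ident) auto
  from measurable_compose [OF this A] show ?thesis by simp
qed

text \<open>The marks of strength \<open>\<lambda>_k\<close> are exchangeable, so on \<open>cnt \<omega> k = n\<close> each of the \<open>n\<close> summands may be exchanged for the
last one. The factor \<open>n\<close> is absorbed by the Poisson law, which raises the count by one, and the last mark becomes an independent fresh one.\<close>

lemma mecke_nn:
  fixes A :: "('o, 'y) disorder \<Rightarrow> nat \<Rightarrow> real \<Rightarrow> ennreal"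
  assumes k: "1 \<le> k"
    and A: "(\<lambda>w. A (fst w) (fst (snd w)) (snd (snd w))) \<in> borel_measurable lawptM"
    and sym: "\<And>\<omega> j j' i x. j \<in> {1..cnt \<omega> k} \<Longrightarrow> j' \<in> {1..cnt \<omega> k} \<Longrightarrow> A (swap_pts (j, k) (j', k) \<omega>) i x = A \<omega> i x"
  shows "(\<integral>\<^sup>+\<omega>. (\<Sum>j=1..cnt \<omega> k. A \<omega> (loc \<omega> (j, k)) (xi \<omega> (j, k))) \<partial>lawM)
    = ennreal s * (\<integral>\<^sup>+w. A (plus_pt k w) (fst (snd w)) (snd (snd w)) \<partial>lawptM)"
proof -
  define B where "B j \<omega> = A \<omega> (loc \<omega> (j, k)) (xi \<omega> (j, k))" for j \<omega>
  define I where "I n \<omega> = (if cnt \<omega> k = n then 1 else 0 :: ennreal)" for n and \<omega> :: "('o, 'y) disorder"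
  have B: "B j \<in> borel_measurable lawM" if "1 \<le> j" for j
    unfolding B_def by (rule meas_at_pt [OF A that k])
  have I: "I n \<in> borel_measurable lawM" for n
    unfolding I_def by (rule measurable_compose [OF meas_cnt [OF k]]) simp
  have IB: "(\<lambda>\<omega>. I n \<omega> * B j \<omega>) \<in> borel_measurable lawM" if "1 \<le> j" for j n
    by (intro borel_measurable_times_ennreal I B that)
  \<comment> \<open>exchangeability moves the mark \<open>j\<close> to the last position \<open>n\<close>\<close>
  have swap: "(\<integral>\<^sup>+\<omega>. I n \<omega> * B j \<omega> \<partial>lawM) = (\<integral>\<^sup>+\<omega>. I n \<omega> * B n \<omega> \<partial>lawM)" if j: "j \<in> {1..n}" for j n
  proof -
    have i: "(j, k) \<in> idxs" "(n, k) \<in> idxs" "1 \<le> j" using j k by auto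
    have "(\<integral>\<^sup>+\<omega>. I n \<omega> * B j \<omega> \<partial>lawM) = (\<integral>\<^sup>+\<omega>. I n (swap_pts (j, k) (n, k) \<omega>) * B j (swap_pts (j, k) (n, k) \<omega>) \<partial>lawM)"
      by (rule nn_integral_swap [OF i(1,2) IB [OF i(3)], symmetric])
    also have "\<dots> = (\<integral>\<^sup>+\<omega>. I n \<omega> * B n \<omega> \<partial>lawM)"
      using j sym by (intro nn_integral_cong) (auto simp: I_def B_def)
    finally show ?thesis .
  qed
  have point: "f (cnt \<omega> k) = (\<Sum>n. I n \<omega> * f n)" for f :: "nat \<Rightarrow> ennreal" and \<omega>
  proof -
    have "(\<lambda>n. I n \<omega> * f n) = (\<lambda>n. if n = cnt \<omega> k then f n else 0)"
      by (auto simp: I_def)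
    with sums_unique [OF sums_single [of "cnt \<omega> k" f]] show ?thesis by simp
  qed
  \<comment> \<open>for \<open>n = 0\<close> both sides vanish; the maximum only keeps the index in the range where \<open>B\<close> is measurable\<close>
  have termwise: "(\<integral>\<^sup>+\<omega>. I n \<omega> * (\<Sum>j=1..n. B j \<omega>) \<partial>lawM) = (\<integral>\<^sup>+\<omega>. I n \<omega> * (of_nat n * B (max 1 n) \<omega>) \<partial>lawM)" for n
  proof (cases "n = 0")
    case False
    have "(\<integral>\<^sup>+\<omega>. I n \<omega> * (\<Sum>j=1..n. B j \<omega>) \<partial>lawM) = (\<Sum>j=1..n. \<integral>\<^sup>+\<omega>. I n \<omega> * B j \<omega> \<partial>lawM)"
      unfolding sum_distrib_left by (rule nn_integral_sum) (use IB in auto)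
    also have "\<dots> = of_nat n * (\<integral>\<^sup>+\<omega>. I n \<omega> * B n \<omega> \<partial>lawM)"
    proof -
      have "(\<Sum>j=1..n. \<integral>\<^sup>+\<omega>. I n \<omega> * B j \<omega> \<partial>lawM) = (\<Sum>j=1..n. \<integral>\<^sup>+\<omega>. I n \<omega> * B n \<omega> \<partial>lawM)"
        by (rule sum.cong [OF refl swap])
      then show ?thesis by simp
    qed
    also have "\<dots> = (\<integral>\<^sup>+\<omega>. of_nat n * (I n \<omega> * B n \<omega>) \<partial>lawM)"
      by (rule nn_integral_cmult [symmetric]) (use IB False in auto)
    finally show ?thesis using False by (simp add: max_def ac_simps)
  qed simp
  \<comment> \<open>the summand of the last mark; raising the count by one makes the fresh mark the last one\<close>
  define g where "g \<omega> = B (max 1 (cnt \<omega> k)) \<omega>" for \<omega>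
  have g: "g \<in> borel_measurable lawM"
    unfolding g_def by (rule measurable_compose_countable [OF B meas_cnt [OF k], of "\<lambda>n. max 1 n"]) auto
  have "(\<integral>\<^sup>+\<omega>. (\<Sum>j=1..cnt \<omega> k. A \<omega> (loc \<omega> (j, k)) (xi \<omega> (j, k))) \<partial>lawM)
      = (\<integral>\<^sup>+\<omega>. (\<Sum>n. I n \<omega> * (\<Sum>j=1..n. B j \<omega>)) \<partial>lawM)"
  proof (rule nn_integral_cong)
    fix \<omega>
    show "(\<Sum>j=1..cnt \<omega> k. A \<omega> (loc \<omega> (j, k)) (xi \<omega> (j, k))) = (\<Sum>n. I n \<omega> * (\<Sum>j=1..n. B j \<omega>))"
      using point [of "\<lambda>n. \<Sum>j=1..n. B j \<omega>" \<omega>] by (simp only: B_def)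
  qed
  also have "\<dots> = (\<Sum>n. \<integral>\<^sup>+\<omega>. I n \<omega> * (\<Sum>j=1..n. B j \<omega>) \<partial>lawM)"
    by (rule nn_integral_suminf) (intro borel_measurable_times_ennreal I borel_measurable_sum B, auto)
  also have "\<dots> = (\<Sum>n. \<integral>\<^sup>+\<omega>. I n \<omega> * (of_nat n * B (max 1 n) \<omega>) \<partial>lawM)"
    by (simp only: termwise)
  also have "\<dots> = (\<integral>\<^sup>+\<omega>. (\<Sum>n. I n \<omega> * (of_nat n * B (max 1 n) \<omega>)) \<partial>lawM)"
    by (rule nn_integral_suminf [symmetric]) (intro borel_measurable_times_ennreal I B, auto)
  also have "\<dots> = (\<integral>\<^sup>+\<omega>. of_nat (cnt \<omega> k) * g \<omega> \<partial>lawM)"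
  proof (rule nn_integral_cong)
    fix \<omega>
    show "(\<Sum>n. I n \<omega> * (of_nat n * B (max 1 n) \<omega>)) = of_nat (cnt \<omega> k) * g \<omega>"
      using point [of "\<lambda>n. of_nat n * B (max 1 n) \<omega>" \<omega>] by (simp only: g_def)
  qed
  also have "\<dots> = ennreal s * (\<integral>\<^sup>+\<omega>. g (set_cnt k (Suc (cnt \<omega> k)) \<omega>) \<partial>lawM)"
    by (rule nn_integral_cnt_size_bias [OF k g])
  also have "(\<integral>\<^sup>+\<omega>. g (set_cnt k (Suc (cnt \<omega> k)) \<omega>) \<partial>lawM)
      = (\<integral>\<^sup>+\<omega>. \<integral>\<^sup>+i. \<integral>\<^sup>+x. g (add_pt k i x \<omega>) \<partial>expo \<partial>siteM \<partial>lawM)"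
    by (subst nn_integral_resample_pt [OF k]) (simp_all add: measurable_compose [OF meas_incr_cnt [OF k] g] add_pt_def)
  also have "\<dots> = (\<integral>\<^sup>+\<omega>. \<integral>\<^sup>+i. \<integral>\<^sup>+x. A (add_pt k i x \<omega>) i x \<partial>expo \<partial>siteM \<partial>lawM)"
    by (simp add: g_def B_def max_def)
  also have "\<dots> = (\<integral>\<^sup>+w. A (plus_pt k w) (fst (snd w)) (snd (snd w)) \<partial>lawptM)"
  proof -
    have "(\<lambda>w. (plus_pt k w, snd w)) \<in> lawptM \<rightarrow>\<^sub>M lawptM"
      by (intro measurable_Pair meas_add_pt k measurable_snd)
    from measurable_compose [OF this A]
    have m [measurable]: "(\<lambda>w. A (plus_pt k w) (fst (snd w)) (snd (snd w))) \<in> borel_measurable lawptM"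
      by simp
    have "(\<integral>\<^sup>+w. A (plus_pt k w) (fst (snd w)) (snd (snd w)) \<partial>lawptM)
        = (\<integral>\<^sup>+\<omega>. \<integral>\<^sup>+v. A (add_pt k (fst v) (snd v) \<omega>) (fst v) (snd v) \<partial>ptM \<partial>lawM)"
      using pt.P.nn_integral_fst [OF m] by simp
    also have "\<dots> = (\<integral>\<^sup>+\<omega>. \<integral>\<^sup>+i. \<integral>\<^sup>+x. A (add_pt k i x \<omega>) i x \<partial>expo \<partial>siteM \<partial>lawM)"
    proof (rule nn_integral_cong)
      fix \<omega> assume "\<omega> \<in> space lawM"
      from measurable_compose [OF measurable_Pair1' [OF this] m]
      have "(\<lambda>v. A (add_pt k (fst v) (snd v) \<omega>) (fst v) (snd v)) \<in> borel_measurable ptM" by simp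
      from expo.nn_integral_fst [OF this]
      show "(\<integral>\<^sup>+v. A (add_pt k (fst v) (snd v) \<omega>) (fst v) (snd v) \<partial>ptM) = (\<integral>\<^sup>+i. \<integral>\<^sup>+x. A (add_pt k i x \<omega>) i x \<partial>expo \<partial>siteM)"
        by simp
    qed
    finally show ?thesis ..
  qed
  finally show ?thesis .
qed

lemma meas_sum_at_pts:
  fixes A :: "('o, 'y) disorder \<Rightarrow> nat \<Rightarrow> real \<Rightarrow> real"
  assumes k: "1 \<le> k"
    and A: "(\<lambda>w. A (fst w) (fst (snd w)) (snd (snd w))) \<in> borel_measurable lawptM"
  shows "(\<lambda>\<omega>. \<Sum>j=1..cnt \<omega> k. A \<omega> (loc \<omega> (j, k)) (xi \<omega> (j, k))) \<in> borel_measurable lawM"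
  by (rule measurable_compose_countable [OF _ meas_cnt [OF k]], intro borel_measurable_sum meas_at_pt A k) auto

text \<open>The formula for nonnegative functions, applied to the positive and the negative part.\<close>

lemma mecke_real:
  fixes A :: "('o, 'y) disorder \<Rightarrow> nat \<Rightarrow> real \<Rightarrow> real"
  assumes k: "1 \<le> k"
    and A: "(\<lambda>w. A (fst w) (fst (snd w)) (snd (snd w))) \<in> borel_measurable lawptM"
    and sym: "\<And>\<omega> j j' i x. j \<in> {1..cnt \<omega> k} \<Longrightarrow> j' \<in> {1..cnt \<omega> k} \<Longrightarrow> A (swap_pts (j, k) (j', k) \<omega>) i x = A \<omega> i x"
    and int: "integrable lawptM (\<lambda>w. A (plus_pt k w) (fst (snd w)) (snd (snd w)))"
  shows "integrable lawM (\<lambda>\<omega>. \<Sum>j=1..cnt \<omega> k. A \<omega> (loc \<omega> (j, k)) (xi \<omega> (j, k)))" (is ?int)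
    and "(\<integral>\<omega>. (\<Sum>j=1..cnt \<omega> k. A \<omega> (loc \<omega> (j, k)) (xi \<omega> (j, k))) \<partial>lawM)
      = s * (\<integral>w. A (plus_pt k w) (fst (snd w)) (snd (snd w)) \<partial>lawptM)" (is ?eq)
proof -
  have *: "integrable lawM (\<lambda>\<omega>. \<Sum>j=1..cnt \<omega> k. P \<omega> (loc \<omega> (j, k)) (xi \<omega> (j, k))) \<and>
      (\<integral>\<omega>. (\<Sum>j=1..cnt \<omega> k. P \<omega> (loc \<omega> (j, k)) (xi \<omega> (j, k))) \<partial>lawM)
      = s * (\<integral>w. P (plus_pt k w) (fst (snd w)) (snd (snd w)) \<partial>lawptM)"
    if P: "(\<lambda>w. P (fst w) (fst (snd w)) (snd (snd w))) \<in> borel_measurable lawptM"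
      and Psym: "\<And>\<omega> j j' i x. j \<in> {1..cnt \<omega> k} \<Longrightarrow> j' \<in> {1..cnt \<omega> k} \<Longrightarrow> P (swap_pts (j, k) (j', k) \<omega>) i x = P \<omega> i x"
      and Pint: "integrable lawptM (\<lambda>w. P (plus_pt k w) (fst (snd w)) (snd (snd w)))"
      and P0: "\<And>\<omega> i x. 0 \<le> P \<omega> i x" for P :: "('o, 'y) disorder \<Rightarrow> nat \<Rightarrow> real \<Rightarrow> real"
  proof -
    let ?v = "\<integral>w. P (plus_pt k w) (fst (snd w)) (snd (snd w)) \<partial>lawptM"
    have v0: "0 \<le> ?v" by (intro integral_nonneg_AE AE_I2 P0)
    have "(\<integral>\<^sup>+\<omega>. ennreal (\<Sum>j=1..cnt \<omega> k. P \<omega> (loc \<omega> (j, k)) (xi \<omega> (j, k))) \<partial>lawM)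
       = (\<integral>\<^sup>+\<omega>. (\<Sum>j=1..cnt \<omega> k. ennreal (P \<omega> (loc \<omega> (j, k)) (xi \<omega> (j, k)))) \<partial>lawM)"
      by (simp add: sum_ennreal P0)
    also have "\<dots> = ennreal s * (\<integral>\<^sup>+w. ennreal (P (plus_pt k w) (fst (snd w)) (snd (snd w))) \<partial>lawptM)"
      by (rule mecke_nn [OF k, of "\<lambda>\<omega> i x. ennreal (P \<omega> i x)"]) (use P Psym in auto)
    also have "\<dots> = ennreal s * ennreal ?v"
      by (subst nn_integral_eq_integral [OF Pint]) (auto simp: P0)
    also have "\<dots> = ennreal (s * ?v)" using s by (simp add: ennreal_mult' v0)
    finally show ?thesis
      using s v0 by (subst (asm) nn_integral_eq_integrable) (auto intro!: meas_sum_at_pts k P sum_nonneg P0)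
  qed
  let ?p = "\<lambda>\<omega> i x. max 0 (A \<omega> i x)" and ?n = "\<lambda>\<omega> i x. max 0 (- A \<omega> i x)"
  have p: "integrable lawM (\<lambda>\<omega>. \<Sum>j=1..cnt \<omega> k. ?p \<omega> (loc \<omega> (j, k)) (xi \<omega> (j, k))) \<and>
      (\<integral>\<omega>. (\<Sum>j=1..cnt \<omega> k. ?p \<omega> (loc \<omega> (j, k)) (xi \<omega> (j, k))) \<partial>lawM)
      = s * (\<integral>w. ?p (plus_pt k w) (fst (snd w)) (snd (snd w)) \<partial>lawptM)"
    by (rule *) (use A sym int in auto)
  have n: "integrable lawM (\<lambda>\<omega>. \<Sum>j=1..cnt \<omega> k. ?n \<omega> (loc \<omega> (j, k)) (xi \<omega> (j, k))) \<and>
      (\<integral>\<omega>. (\<Sum>j=1..cnt \<omega> k. ?n \<omega> (loc \<omega> (j, k)) (xi \<omega> (j, k))) \<partial>lawM)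
      = s * (\<integral>w. ?n (plus_pt k w) (fst (snd w)) (snd (snd w)) \<partial>lawptM)"
    by (rule *) (use A sym int in auto)
  have d: "A \<omega> i x = ?p \<omega> i x - ?n \<omega> i x" for \<omega> i x by simp
  show ?int using p n by (subst d) (simp add: sum_subtractf)
  show ?eq
  proof -
    have "(\<integral>w. A (plus_pt k w) (fst (snd w)) (snd (snd w)) \<partial>lawptM)
      = (\<integral>w. ?p (plus_pt k w) (fst (snd w)) (snd (snd w)) \<partial>lawptM)
      - (\<integral>w. ?n (plus_pt k w) (fst (snd w)) (snd (snd w)) \<partial>lawptM)"
      by (subst d, rule Bochner_Integration.integral_diff) (use int in auto)
    moreover have "(\<integral>\<omega>. (\<Sum>j=1..cnt \<omega> k. A \<omega> (loc \<omega> (j, k)) (xi \<omega> (j, k))) \<partial>lawM)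
      = (\<integral>\<omega>. (\<Sum>j=1..cnt \<omega> k. ?p \<omega> (loc \<omega> (j, k)) (xi \<omega> (j, k))) \<partial>lawM)
      - (\<integral>\<omega>. (\<Sum>j=1..cnt \<omega> k. ?n \<omega> (loc \<omega> (j, k)) (xi \<omega> (j, k))) \<partial>lawM)"
      by (subst d, unfold sum_subtractf, rule Bochner_Integration.integral_diff) (use p n in auto)
    ultimately show ?thesis using p n by (simp add: right_diff_distrib)
  qed
qed

end

section \<open>Adding an observation and moving a parameter\<close>

abbreviation "exponential_one \<equiv> density lborel (exponential_density 1)"

lemma AE_exponential_nonneg: "AE x in exponential_one. 0 \<le> x"
  by (subst AE_density) (auto simp: exponential_density_def)

lemma integrable_exponential_exp:
  assumes "a < 1"
  shows "integrable exponential_one (\<lambda>x. exp (a * x))"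
proof -
  have e: "exponential_density 1 x * exp (a * x) = 1 / (1 - a) * exponential_density (1 - a) x" for x
  proof -
    have "exp (- x) * exp (a * x) = exp (- x * (1 - a))" by (simp add: exp_add [symmetric] algebra_simps)
    then show ?thesis using assms by (simp add: exponential_density_def)
  qed
  interpret P: prob_space "density lborel (exponential_density (1 - a))"
    by (rule prob_space_exponential_density) (use assms in simp)
  have "integrable (density lborel (exponential_density (1 - a))) (\<lambda>_. 1 :: real)" by simp
  then have "integrable lborel (exponential_density (1 - a))"
    by (subst (asm) integrable_density) (auto simp: exponential_density_nonneg assms)
  then show ?thesis
    by (subst integrable_density) (auto simp: exponential_density_nonneg e)
qed

lemma one_plus_le_exp: "0 \<le> x \<Longrightarrow> 1 + x \<le> 4 * exp (x / 4)" for x :: real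
  using exp_ge_add_one_self [of "x / 4"] by linarith

lemma integrable_exponential_linear_exp:
  assumes "a \<le> 1/2"
  shows "integrable exponential_one (\<lambda>x. (1 + x) * exp (a * x))"
proof (rule Bochner_Integration.integrable_bound)
  show "integrable exponential_one (\<lambda>x. 4 * exp (3/4 * x))"
    by (intro integrable_mult_right integrable_exponential_exp) simp
  show "AE x in exponential_one. norm ((1 + x) * exp (a * x)) \<le> norm (4 * exp (3/4 * x))"
    using AE_exponential_nonneg
  proof eventually_elim
    case (elim x)
    have "a * x \<le> 1/2 * x" using elim assms by (intro mult_right_mono)
    then have "(1 + x) * exp (a * x) \<le> (4 * exp (x / 4)) * exp (1/2 * x)"
      using elim by (intro mult_mono one_plus_le_exp) auto
    also have "\<dots> = 4 * exp (3/4 * x)" by (simp add: exp_add [symmetric])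
    finally show ?case using elim by simp
  qed
qed simp

definition exp_moment :: real where
  "exp_moment = (\<integral>x. (1 + x) * exp (1/2 * x) \<partial>exponential_one)"

lemma integrable_exponential_linear: "integrable exponential_one (\<lambda>x. 1 + x)"
  using integrable_exponential_linear_exp [of 0] by simp

lemma distr_pair_snd:
  assumes "prob_space A" "prob_space B"
  shows "distr (A \<Otimes>\<^sub>M B) B snd = B"
proof (rule measure_eqI)
  interpret A: prob_space A by fact
  interpret B: prob_space B by fact
  fix X assume X: "X \<in> sets (distr (A \<Otimes>\<^sub>M B) B snd)"
  then have "snd -` X \<inter> space (A \<Otimes>\<^sub>M B) = space A \<times> X"
    using sets.sets_into_space [of X B] by (auto simp: space_pair_measure)
  then show "emeasure (distr (A \<Otimes>\<^sub>M B) B snd) X = emeasure B X"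
    using X by (simp add: emeasure_distr B.emeasure_pair_measure_Times A.emeasure_space_1)
qed simp

lemma AE_pair_fst:
  assumes "prob_space B" "AE x in A. Q x"
  shows "AE z in A \<Otimes>\<^sub>M B. Q (fst z)"
proof -
  have "AE x in distr (A \<Otimes>\<^sub>M B) A fst. Q x"
    unfolding prob_space.distr_pair_fst [OF assms(1)] by (rule assms(2))
  from AE_distrD [OF measurable_fst this] show ?thesis .
qed

lemma AE_pair_snd:
  assumes "prob_space A" "prob_space B" "AE x in B. Q x"
  shows "AE z in A \<Otimes>\<^sub>M B. Q (snd z)"
proof -
  have "AE x in distr (A \<Otimes>\<^sub>M B) B snd. Q x"
    unfolding distr_pair_snd [OF assms(1,2)] by (rule assms(3))
  from AE_distrD [OF measurable_snd this] show ?thesis .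
qed

lemma
  fixes f :: "'b \<Rightarrow> real"
  assumes "prob_space A" "prob_space B" "integrable B f"
  shows integrable_pair_snd: "integrable (A \<Otimes>\<^sub>M B) (\<lambda>w. f (snd w))"
    and integral_pair_snd: "(\<integral>w. f (snd w) \<partial>(A \<Otimes>\<^sub>M B)) = (\<integral>x. f x \<partial>B)"
proof -
  have f: "f \<in> borel_measurable B" using assms(3) by simp
  show "integrable (A \<Otimes>\<^sub>M B) (\<lambda>w. f (snd w))"
    using assms(3) integrable_distr [OF measurable_snd, of A B f] unfolding distr_pair_snd [OF assms(1,2)] by simp
  show "(\<integral>w. f (snd w) \<partial>(A \<Otimes>\<^sub>M B)) = (\<integral>x. f x \<partial>B)"
    using integral_distr [OF measurable_snd f, of A] unfolding distr_pair_snd [OF assms(1,2)] by simp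
qed

definition load :: "nat \<Rightarrow> ('o, 'y) disorder \<Rightarrow> real" where
  "load k \<omega> = (\<Sum>j=1..cnt \<omega> k. 1 + xi \<omega> (j, k))"

text \<open>The contribution of one exponential observation to the Hamiltonian, for strength \<open>l\<close>, spin \<open>a\<close>, true spin \<open>c\<close> and mark \<open>x\<close>.\<close>

definition pt_term :: "real \<Rightarrow> real \<Rightarrow> real \<Rightarrow> real \<Rightarrow> real" where
  "pt_term l a c x = ln (1 + l * a) - l * x * a / (1 + l * c)"

lemma exp_term_pt: "exp_term lam \<omega> \<sigma> k j = pt_term (lam k) (\<sigma> (loc \<omega> (j, k))) (sig \<omega> (loc \<omega> (j, k))) (xi \<omega> (j, k))"
  by (simp only: exp_term_def pt_term_def)

lemma param_box_bounds:
  assumes "lam \<in> param_box"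
  shows "0 < lam k" "lam k \<le> (1/2) ^ k" "(1/2) ^ Suc k \<le> lam k"
proof -
  have "lam k \<in> {(1/2) ^ (k + 1) .. (1/2) ^ k}" using assms unfolding param_box_def by blast
  then show "lam k \<le> (1/2) ^ k" "(1/2) ^ Suc k \<le> lam k" by (simp_all only: atLeastAtMost_iff Suc_eq_plus1)
  moreover have "(0::real) < (1/2) ^ Suc k" by simp
  ultimately show "0 < lam k" by linarith
qed

lemma param_box_half:
  assumes "lam \<in> param_box" "1 \<le> k"
  shows "lam k \<le> 1/2"
proof -
  have "(1/2::real) ^ k \<le> (1/2) ^ 1" using assms(2) by (intro power_decreasing) auto
  then show ?thesis using param_box_bounds(2) [OF assms(1), of k] by simp
qed

lemma pt_term_bound:
  assumes l: "0 < l" "l \<le> 1/2" and a: "\<bar>a\<bar> = 1" and c: "\<bar>c\<bar> = 1" and x: "0 \<le> x"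
  shows "\<bar>pt_term l a c x\<bar> \<le> 2 * l * (1 + x)"
proof -
  have lc: "1/2 \<le> 1 + l * c" using l c by (auto simp: abs_if split: if_splits)
  have la: "\<bar>l * a\<bar> = l" using l a by (simp add: abs_mult)
  have "\<bar>ln (1 + l * a) - l * a\<bar> \<le> 2 * (l * a)\<^sup>2"
    by (rule abs_ln_one_plus_x_minus_x_bound) (use la l in simp)
  also have "(l * a)\<^sup>2 = l * l" using la by (metis power2_abs power2_eq_square)
  also have "2 * (l * l) \<le> l" using l by (simp add: mult_left_le mult.assoc [symmetric])
  finally have 1: "\<bar>ln (1 + l * a)\<bar> \<le> 2 * l" using la by linarith
  have "\<bar>l * x * a / (1 + l * c)\<bar> = l * x / (1 + l * c)"
    using l a x lc by (simp add: abs_mult abs_divide)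
  also have "\<dots> \<le> l * x / (1/2)" using lc l x by (intro divide_left_mono) auto
  finally have "\<bar>l * x * a / (1 + l * c)\<bar> \<le> 2 * l * x" by simp
  with 1 show ?thesis unfolding pt_term_def distrib_left mult_1_right by linarith
qed

context perturbed_model
begin

text \<open>Almost every sample is good. For a good sample the partition function is positive and the series in the Hamiltonian converges
absolutely for all parameters at once.\<close>

definition good :: "('o, 'y) disorder \<Rightarrow> bool" where
  "good \<omega> \<longleftrightarrow> \<omega> \<in> space lawM \<and> P_out m (obs \<omega>) (sig \<omega>) (snd (hyp \<omega>)) \<noteq> 0 \<and>
     (\<forall>j\<ge>1. \<forall>k\<ge>1. loc \<omega> (j, k) \<in> {1..N} \<and> 0 \<le> xi \<omega> (j, k)) \<and>
     summable (\<lambda>k. (1/2) ^ Suc k * load (Suc k) \<omega>)"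

lemma goodD:
  assumes "good \<omega>"
  shows "\<omega> \<in> space lawM" "sig \<omega> \<in> configs N" "P_out m (obs \<omega>) (sig \<omega>) (snd (hyp \<omega>)) \<noteq> 0"
    "1 \<le> j \<Longrightarrow> 1 \<le> k \<Longrightarrow> loc \<omega> (j, k) \<in> {1..N}" "1 \<le> j \<Longrightarrow> 1 \<le> k \<Longrightarrow> 0 \<le> xi \<omega> (j, k)"
    "summable (\<lambda>k. (1/2) ^ Suc k * load (Suc k) \<omega>)"
  using assms space_law_cases(1) unfolding good_def by blast+

lemma AE_marks: "AE \<omega> in lawM. \<forall>j\<ge>1. \<forall>k\<ge>1. loc \<omega> (j, k) \<in> {1..N} \<and> 0 \<le> xi \<omega> (j, k)"
proof -
  have "AE \<omega> in lawM. loc \<omega> (j, k) \<in> {1..N} \<and> 0 \<le> xi \<omega> (j, k)" if jk: "1 \<le> j" "1 \<le> k" for j k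
  proof -
    have q: "(j, k) \<in> idxs" using jk by auto
    have l: "AE l in locM. l (j, k) \<in> {1..N}"
      by (rule AE_PiM_component [OF prob_space_measure_pmf q]) (use N in \<open>auto simp: AE_measure_pmf_iff\<close>)
    have x: "AE x in expM. 0 \<le> x (j, k)"
      by (rule AE_PiM_component [OF prob_exp1 q AE_exponential_nonneg])
    note f = AE_pair_fst and g = AE_pair_snd
    have "AE \<omega> in lawM. loc \<omega> (j, k) \<in> {1..N}"
      unfolding law_eq loc_def
      by (intro g [where Q = "\<lambda>z. fst (snd (snd z)) (j, k) \<in> {1..N}"] g [where Q = "\<lambda>z. fst (snd z) (j, k) \<in> {1..N}"]
          g [where Q = "\<lambda>z. fst z (j, k) \<in> {1..N}"] f [where Q = "\<lambda>l. l (j, k) \<in> {1..N}"] l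
          base.prob_space_axioms gaussM.prob_space_axioms poisM.prob_space_axioms locM.prob_space_axioms expM.prob_space_axioms
          le.P.prob_space_axioms ple.P.prob_space_axioms gple.P.prob_space_axioms)
    moreover have "AE \<omega> in lawM. 0 \<le> xi \<omega> (j, k)"
      unfolding law_eq xi_def
      by (intro g [where Q = "\<lambda>z. 0 \<le> snd (snd (snd z)) (j, k)"] g [where Q = "\<lambda>z. 0 \<le> snd (snd z) (j, k)"]
          g [where Q = "\<lambda>z. 0 \<le> snd z (j, k)"] g [where Q = "\<lambda>x. 0 \<le> x (j, k)"] x
          base.prob_space_axioms gaussM.prob_space_axioms poisM.prob_space_axioms locM.prob_space_axioms expM.prob_space_axioms
          le.P.prob_space_axioms ple.P.prob_space_axioms gple.P.prob_space_axioms)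
    ultimately show ?thesis by eventually_elim simp
  qed
  then show ?thesis by (simp add: AE_all_countable)
qed

lemma integrable_pt_linear: "integrable lawptM (\<lambda>w. 1 + snd (snd w))"
  and integral_pt_linear: "(\<integral>w. 1 + snd (snd w) \<partial>lawptM) = (\<integral>x. 1 + x \<partial>exponential_one)"
proof -
  show "integrable lawptM (\<lambda>w. 1 + snd (snd w))"
    "(\<integral>w. 1 + snd (snd w) \<partial>lawptM) = (\<integral>x. 1 + x \<partial>exponential_one)"
    using integrable_pair_snd [OF site.prob_space_axioms expo.prob_space_axioms integrable_exponential_linear]
      integral_pair_snd [OF site.prob_space_axioms expo.prob_space_axioms integrable_exponential_linear]
      integrable_pair_snd [OF law.prob_space_axioms pt.P.prob_space_axioms, of "\<lambda>w. 1 + snd w"]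
      integral_pair_snd [OF law.prob_space_axioms pt.P.prob_space_axioms, of "\<lambda>w. 1 + snd w"] by simp_all
qed

lemma integrable_load: "1 \<le> k \<Longrightarrow> integrable lawM (load k)"
  and integral_load: "1 \<le> k \<Longrightarrow> (\<integral>\<omega>. load k \<omega> \<partial>lawM) = s * (\<integral>x. 1 + x \<partial>exponential_one)"
  using mecke_real [of k "\<lambda>\<omega> i x. 1 + x"] integrable_pt_linear integral_pt_linear
  unfolding load_def [abs_def] by auto

text \<open>The expected loads do not depend on \<open>k\<close>, so the weights \<open>2^-k\<close> make the series of loads integrable.\<close>

lemma AE_good: "AE \<omega> in lawM. good \<omega>"
proof -
  let ?c = "\<integral>x. 1 + x \<partial>exponential_one"
  have c: "0 \<le> ?c" by (intro integral_nonneg_AE) (use AE_exponential_nonneg in eventually_elim, simp)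
  have pos: "AE \<omega> in lawM. \<forall>k. 0 \<le> load (Suc k) \<omega>"
    using AE_marks by eventually_elim (auto simp: load_def intro!: sum_nonneg add_nonneg_nonneg)
  have "(\<integral>\<^sup>+\<omega>. (\<Sum>k. ennreal ((1/2) ^ Suc k * load (Suc k) \<omega>)) \<partial>lawM)
      = (\<Sum>k. \<integral>\<^sup>+\<omega>. ennreal ((1/2) ^ Suc k * load (Suc k) \<omega>) \<partial>lawM)"
    by (rule nn_integral_suminf) (use integrable_load [of "Suc _"] in \<open>auto intro!: borel_measurable_times\<close>)
  also have "\<dots> = (\<Sum>k. ennreal ((1/2) ^ Suc k * (s * ?c)))"
  proof (intro suminf_cong)
    fix k
    have "(\<integral>\<^sup>+\<omega>. ennreal ((1/2) ^ Suc k * load (Suc k) \<omega>) \<partial>lawM) = ennreal (\<integral>\<omega>. (1/2) ^ Suc k * load (Suc k) \<omega> \<partial>lawM)"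
      by (rule nn_integral_eq_integral) (use integrable_load [of "Suc k"] pos in \<open>auto elim!: eventually_mono\<close>)
    then show "(\<integral>\<^sup>+\<omega>. ennreal ((1/2) ^ Suc k * load (Suc k) \<omega>) \<partial>lawM) = ennreal ((1/2) ^ Suc k * (s * ?c))"
      by (simp add: integral_load)
  qed
  also have "\<dots> = ennreal (\<Sum>k. (1/2) ^ Suc k * (s * ?c))"
  proof (rule suminf_ennreal2)
    show "summable (\<lambda>k. (1/2) ^ Suc k * (s * ?c))"
      unfolding power_Suc by (intro summable_mult2 summable_mult summable_geometric) simp
    show "0 \<le> (1/2) ^ Suc k * (s * ?c)" for k
      using s c by (intro mult_nonneg_nonneg) auto
  qed
  finally have "(\<integral>\<^sup>+\<omega>. (\<Sum>k. ennreal ((1/2) ^ Suc k * load (Suc k) \<omega>)) \<partial>lawM) \<noteq> \<infinity>" by simp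
  then have "AE \<omega> in lawM. (\<Sum>k. ennreal ((1/2) ^ Suc k * load (Suc k) \<omega>)) \<noteq> \<infinity>"
    by (intro nn_integral_PInf_AE borel_measurable_suminf)
      (use integrable_load [of "Suc _"] in \<open>auto intro!: borel_measurable_times\<close>)
  then show ?thesis
    using AE_marks AE_likelihood_pos AE_space pos
  proof eventually_elim
    case (elim \<omega>)
    have "summable (\<lambda>k. (1/2) ^ Suc k * load (Suc k) \<omega>)"
    proof (rule summable_suminf_not_top)
      show "0 \<le> (1/2) ^ Suc k * load (Suc k) \<omega>" for k
        using elim(5) by (intro mult_nonneg_nonneg zero_le_power) auto
      show "(\<Sum>k. ennreal ((1/2) ^ Suc k * load (Suc k) \<omega>)) \<noteq> top"
        using elim(1) by (simp only: infinity_ennreal_def not_False_eq_True)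
    qed
    then show ?case using elim unfolding good_def by blast
  qed
qed

lemma good_Z: "good \<omega> \<Longrightarrow> Z lam \<omega> \<noteq> 0"
  using Z_pos [OF goodD(3,2), of \<omega> lam] by simp

lemma exp_term_bound:
  assumes g: "good \<omega>" and lam: "lam \<in> param_box" and \<sigma>: "\<sigma> \<in> configs N" and jk: "1 \<le> j" "1 \<le> k"
  shows "\<bar>exp_term lam \<omega> \<sigma> k j\<bar> \<le> 2 * (1/2) ^ k * (1 + xi \<omega> (j, k))"
proof -
  have l: "loc \<omega> (j, k) \<in> {1..N}" "0 \<le> xi \<omega> (j, k)" using goodD(4,5) [OF g jk] by auto
  have sg: "sig \<omega> \<in> configs N" by (rule goodD(2) [OF g])
  have "\<bar>exp_term lam \<omega> \<sigma> k j\<bar> \<le> 2 * lam k * (1 + xi \<omega> (j, k))"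
    unfolding exp_term_pt
    by (rule pt_term_bound [OF param_box_bounds(1) [OF lam] param_box_half [OF lam jk(2)]
          config_abs [OF \<sigma> l(1)] config_abs [OF sg l(1)] l(2)])
  also have "\<dots> \<le> 2 * (1/2) ^ k * (1 + xi \<omega> (j, k))"
    using param_box_bounds(2) [OF lam, of k] l by (intro mult_right_mono) auto
  finally show ?thesis .
qed

lemma summable_exp_term:
  assumes g: "good \<omega>" and lam: "lam \<in> param_box" and \<sigma>: "\<sigma> \<in> configs N"
  shows "summable (\<lambda>k. \<Sum>j=1..cnt \<omega> (Suc k). exp_term lam \<omega> \<sigma> (Suc k) j)"
proof (rule summable_comparison_test)
  show "summable (\<lambda>k. 2 * ((1/2) ^ Suc k * load (Suc k) \<omega>))"
    by (intro summable_mult goodD(6) g)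
  have "\<bar>\<Sum>j=1..cnt \<omega> (Suc k). exp_term lam \<omega> \<sigma> (Suc k) j\<bar> \<le> 2 * ((1/2) ^ Suc k * load (Suc k) \<omega>)" for k
  proof -
    have "\<bar>\<Sum>j=1..cnt \<omega> (Suc k). exp_term lam \<omega> \<sigma> (Suc k) j\<bar> \<le> (\<Sum>j=1..cnt \<omega> (Suc k). 2 * (1/2) ^ Suc k * (1 + xi \<omega> (j, Suc k)))"
      by (rule order_trans [OF sum_abs], rule sum_mono, rule exp_term_bound [OF g lam \<sigma>]) auto
    also have "\<dots> = 2 * ((1/2) ^ Suc k * load (Suc k) \<omega>)"
      by (simp only: load_def sum_distrib_left mult.assoc)
    finally show ?thesis .
  qed
  then show "\<exists>K. \<forall>k\<ge>K. norm (\<Sum>j=1..cnt \<omega> (Suc k). exp_term lam \<omega> \<sigma> (Suc k) j) \<le> 2 * ((1/2) ^ Suc k * load (Suc k) \<omega>)"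
    by auto
qed

lemma suminf_add_single:
  fixes f :: "nat \<Rightarrow> real"
  assumes "summable f"
  shows "(\<Sum>n. f n + (if n = k then c else 0)) = suminf f + c"
  using sums_unique [OF sums_add [OF summable_sums [OF assms] sums_single [of k "\<lambda>_. c"]]] by simp

text \<open>On a good sample the series in the Hamiltonian converges, so changing one of its terms changes the sum by the same amount.\<close>

lemma H_exp_add_pt:
  assumes g: "good \<omega>" and lam: "lam \<in> param_box" and \<sigma>: "\<sigma> \<in> configs N" and k: "1 \<le> k"
  shows "H_exp lam (add_pt k i x \<omega>) \<sigma> = H_exp lam \<omega> \<sigma> + pt_term (lam k) (\<sigma> i) (sig \<omega> i) x"
proof -
  have "(\<Sum>j=1..cnt (add_pt k i x \<omega>) (Suc k'). exp_term lam (add_pt k i x \<omega>) \<sigma> (Suc k') j)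
     = (\<Sum>j=1..cnt \<omega> (Suc k'). exp_term lam \<omega> \<sigma> (Suc k') j) + (if k' = k - 1 then pt_term (lam k) (\<sigma> i) (sig \<omega> i) x else 0)" for k'
    using k by (auto simp: exp_term_pt intro!: sum.cong)
  then show ?thesis
    unfolding H_exp_eq using suminf_add_single [OF summable_exp_term [OF g lam \<sigma>]] by simp
qed

lemma H_exp_upd:
  assumes g: "good \<omega>" and lam: "lam \<in> param_box" and \<sigma>: "\<sigma> \<in> configs N" and k: "1 \<le> k"
  shows "H_exp (lam(k := u)) \<omega> \<sigma> = H_exp lam \<omega> \<sigma>
    + (\<Sum>j=1..cnt \<omega> k. pt_term u (\<sigma> (loc \<omega> (j, k))) (sig \<omega> (loc \<omega> (j, k))) (xi \<omega> (j, k))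
        - pt_term (lam k) (\<sigma> (loc \<omega> (j, k))) (sig \<omega> (loc \<omega> (j, k))) (xi \<omega> (j, k)))"
    (is "_ = _ + ?D")
proof -
  have "(\<Sum>j=1..cnt \<omega> (Suc k'). exp_term (lam(k := u)) \<omega> \<sigma> (Suc k') j)
     = (\<Sum>j=1..cnt \<omega> (Suc k'). exp_term lam \<omega> \<sigma> (Suc k') j) + (if k' = k - 1 then ?D else 0)" for k'
    using k by (auto simp: exp_term_pt sum_subtractf)
  then show ?thesis
    unfolding H_exp_eq using suminf_add_single [OF summable_exp_term [OF g lam \<sigma>]] by simp
qed

lemma H_gauss_cong: "sig \<omega>' = sig \<omega> \<Longrightarrow> gau \<omega>' = gau \<omega> \<Longrightarrow> lam' 0 = lam 0 \<Longrightarrow> H_gauss N e lam' \<omega>' \<sigma> = H_gauss N e lam \<omega> \<sigma>"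
  by (simp add: H_gauss_eq)

lemma boltzmann_add_pt:
  assumes "good \<omega>" "lam \<in> param_box" "\<sigma> \<in> configs N" "1 \<le> k"
  shows "boltzmann N m e lam (add_pt k i x \<omega>) \<sigma> = boltzmann N m e lam \<omega> \<sigma> * exp (pt_term (lam k) (\<sigma> i) (sig \<omega> i) x)"
proof -
  have "H_gauss N e lam (add_pt k i x \<omega>) \<sigma> = H_gauss N e lam \<omega> \<sigma>"
    by (rule H_gauss_cong) auto
  then show ?thesis
    unfolding boltzmann_eq H_exp_add_pt [OF assms] by (simp add: exp_add [symmetric] add.assoc)
qed

lemma boltzmann_upd:
  assumes "good \<omega>" "lam \<in> param_box" "\<sigma> \<in> configs N" "1 \<le> k"
  shows "boltzmann N m e (lam(k := u)) \<omega> \<sigma> = boltzmann N m e lam \<omega> \<sigma> *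
    exp (\<Sum>j=1..cnt \<omega> k. pt_term u (\<sigma> (loc \<omega> (j, k))) (sig \<omega> (loc \<omega> (j, k))) (xi \<omega> (j, k))
        - pt_term (lam k) (\<sigma> (loc \<omega> (j, k))) (sig \<omega> (loc \<omega> (j, k))) (xi \<omega> (j, k)))"
proof -
  have "H_gauss N e (lam(k := u)) \<omega> \<sigma> = H_gauss N e lam \<omega> \<sigma>"
    by (rule H_gauss_cong) (use assms(4) in auto)
  then show ?thesis
    unfolding boltzmann_eq H_exp_upd [OF assms] by (simp add: exp_add [symmetric] add.assoc)
qed

lemma boltzmann_swap:
  assumes j: "j \<in> {1..cnt \<omega> k}" "j' \<in> {1..cnt \<omega> k}"
  shows "boltzmann N m e lam (swap_pts (j, k) (j', k) \<omega>) \<sigma> = boltzmann N m e lam \<omega> \<sigma>"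
proof -
  have 1: "H_gauss N e lam (swap_pts (j, k) (j', k) \<omega>) \<sigma> = H_gauss N e lam \<omega> \<sigma>"
    by (rule H_gauss_cong) auto
  have "(\<Sum>i=1..cnt \<omega> k'. exp_term lam (swap_pts (j, k) (j', k) \<omega>) \<sigma> k' i) = (\<Sum>i=1..cnt \<omega> k'. exp_term lam \<omega> \<sigma> k' i)" for k'
  proof (cases "k' = k")
    case True
    have "(\<Sum>i=1..cnt \<omega> k. exp_term lam (swap_pts (j, k) (j', k) \<omega>) \<sigma> k i)
      = (\<Sum>i=1..cnt \<omega> k. (exp_term lam \<omega> \<sigma> k \<circ> Transposition.transpose j j') i)"
      by (intro sum.cong) (auto simp: exp_term_pt Transposition.transpose_def)
    also have "\<dots> = (\<Sum>i=1..cnt \<omega> k. exp_term lam \<omega> \<sigma> k i)"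
      by (rule sum.permute [symmetric]) (rule permutes_swap_id [OF j])
    finally show ?thesis using True by simp
  next
    case False
    then show ?thesis by (intro sum.cong) (auto simp: exp_term_pt Transposition.transpose_def)
  qed
  then show ?thesis unfolding boltzmann_eq H_exp_eq 1 by simp
qed

lemma avg_swap:
  assumes "j \<in> {1..cnt \<omega> k}" "j' \<in> {1..cnt \<omega> k}"
  shows "avg lam (swap_pts (j, k) (j', k) \<omega>) f = avg lam \<omega> f"
  by (simp add: avg_def G_pert_def Z_pert_def boltzmann_swap [OF assms])

lemma avg_eq: "avg lam \<omega> f = (\<Sum>\<sigma>\<in>configs N. boltzmann N m e lam \<omega> \<sigma> * f \<sigma>) / Z lam \<omega>"
  by (simp only: avg_def G_pert_def sum_divide_distrib times_divide_eq_left)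

lemma avg_tilt:
  assumes tilt: "\<And>\<sigma>. \<sigma> \<in> configs N \<Longrightarrow> boltzmann N m e lam' \<omega>' \<sigma> = boltzmann N m e lam \<omega> \<sigma> * E \<sigma>" and Z: "Z lam \<omega> \<noteq> 0"
  shows "Z lam' \<omega>' = Z lam \<omega> * avg lam \<omega> E"
    and "avg lam' \<omega>' f = avg lam \<omega> (\<lambda>\<sigma>. f \<sigma> * E \<sigma>) / avg lam \<omega> E"
proof -
  have "Z lam' \<omega>' = (\<Sum>\<sigma>\<in>configs N. boltzmann N m e lam \<omega> \<sigma> * E \<sigma>)"
    unfolding Z_pert_def [of N m e lam' \<omega>'] by (rule sum.cong [OF refl tilt])
  then show 1: "Z lam' \<omega>' = Z lam \<omega> * avg lam \<omega> E"
    using Z by (simp add: avg_eq)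
  have "(\<Sum>\<sigma>\<in>configs N. boltzmann N m e lam' \<omega>' \<sigma> * f \<sigma>) = (\<Sum>\<sigma>\<in>configs N. boltzmann N m e lam \<omega> \<sigma> * (f \<sigma> * E \<sigma>))"
    by (rule sum.cong [OF refl]) (simp add: tilt)
  then show "avg lam' \<omega>' f = avg lam \<omega> (\<lambda>\<sigma>. f \<sigma> * E \<sigma>) / avg lam \<omega> E"
    using Z by (simp add: avg_eq [of lam' \<omega>'] 1) (simp add: avg_eq)
qed

end

section \<open>Concentration of the energy\<close>

text \<open>The derivative of \<open>pt_term\<close> with respect to the strength \<open>l\<close>.\<close>

definition slope :: "real \<Rightarrow> real \<Rightarrow> real \<Rightarrow> real \<Rightarrow> real" where
  "slope l a c x = a / (1 + l * a) - x * a / (1 + l * c)\<^sup>2"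

lemma unit_cases: "\<bar>a\<bar> = 1 \<Longrightarrow> a = 1 \<or> a = - (1::real)"
  by linarith

lemma slope_bound:
  assumes l: "0 < l" "l \<le> 1/2" and a: "\<bar>a\<bar> = 1" and c: "\<bar>c\<bar> = 1" and x: "0 \<le> x"
  shows "\<bar>slope l a c x\<bar> \<le> 4 * (1 + x)"
proof -
  have la: "1/2 \<le> 1 + l * a" and lc: "1/2 \<le> 1 + l * c"
    using l unit_cases [OF a] unit_cases [OF c] by auto
  have "\<bar>a / (1 + l * a)\<bar> = 1 / (1 + l * a)" using a la by (simp add: abs_divide)
  also have "\<dots> \<le> 1 / (1/2)" using la by (intro divide_left_mono) auto
  finally have 1: "\<bar>a / (1 + l * a)\<bar> \<le> 2" by simp
  have q: "(1/2)\<^sup>2 \<le> (1 + l * c)\<^sup>2" using lc by (intro power_mono) auto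
  have "\<bar>x * a / (1 + l * c)\<^sup>2\<bar> = x / (1 + l * c)\<^sup>2" using a x by (simp add: abs_divide abs_mult)
  also have "\<dots> \<le> x / (1/2)\<^sup>2"
    using q x by (intro divide_left_mono) (auto simp: power2_eq_square intro!: mult_pos_pos)
  finally have 2: "\<bar>x * a / (1 + l * c)\<^sup>2\<bar> \<le> 4 * x" by (simp add: power2_eq_square)
  have "\<bar>a / (1 + l * a) - x * a / (1 + l * c)\<^sup>2\<bar> \<le> \<bar>a / (1 + l * a)\<bar> + \<bar>x * a / (1 + l * c)\<^sup>2\<bar>"
    by (rule abs_triangle_ineq4)
  also have "\<dots> \<le> 2 + 4 * x" using 1 2 by (rule add_mono)
  also have "\<dots> \<le> 4 * (1 + x)" by simp
  finally show ?thesis unfolding slope_def .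
qed

text \<open>For strengths up to \<open>1/2\<close> all denominators are at least \<open>1/2\<close>, so the second derivative of \<open>pt_term\<close> in the strength is of order
\<open>1 + x\<close>, and the function lies above its tangents up to a quadratic error.\<close>

lemma pt_term_tangent:
  assumes l: "0 < l" "l \<le> 1/2" and u: "0 < u" "u \<le> 1/2" and a: "\<bar>a\<bar> = 1" and c: "\<bar>c\<bar> = 1" and x: "0 \<le> x"
  shows "(u - l) * slope l a c x - (u - l)\<^sup>2 * (8 * (1 + x)) \<le> pt_term u a c x - pt_term l a c x"
proof -
  have la: "1/2 \<le> 1 + l * a" and lc: "1/2 \<le> 1 + l * c" and ua: "1/2 \<le> 1 + u * a" and uc: "1/2 \<le> 1 + u * c"
    using l u unit_cases [OF a] unit_cases [OF c] by auto
  have a2: "a * a = 1" and c2: "\<bar>c\<bar> \<le> 1" using unit_cases [OF a] c by auto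
  have prod: "1/4 \<le> (1 + u * a) * (1 + l * a)"
  proof -
    have "1/2 * (1/2) \<le> (1 + u * a) * (1 + l * a)"
      by (rule mult_mono [OF ua la]) (use ua in linarith, simp)
    then show ?thesis by simp
  qed
  have prodc: "1/8 \<le> (1 + l * c)\<^sup>2 * (1 + u * c)"
  proof -
    have "(1/2)\<^sup>2 * (1/2) \<le> (1 + l * c)\<^sup>2 * (1 + u * c)"
      using lc uc by (intro mult_mono power_mono) auto
    then show ?thesis by (simp add: power2_eq_square)
  qed
  have "ln ((1 + l * a) / (1 + u * a)) \<le> (1 + l * a) / (1 + u * a) - 1"
    by (rule ln_le_minus_one) (use la ua in auto)
  then have "(u - l) * a / (1 + u * a) \<le> ln (1 + u * a) - ln (1 + l * a)"
    using la ua by (simp add: ln_div field_simps)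
  moreover have "(u - l) * a / (1 + u * a) = (u - l) * (a / (1 + l * a)) - (u - l)\<^sup>2 / ((1 + u * a) * (1 + l * a))"
  proof -
    have nz: "1 + l * a \<noteq> 0" "1 + u * a \<noteq> 0" using la ua by auto
    have e1: "(u - l) * (a / (1 + l * a)) = (u - l) * a * (1 + u * a) / ((1 + u * a) * (1 + l * a))"
      using nz by simp
    have "(u - l) * (a / (1 + l * a)) - (u - l)\<^sup>2 / ((1 + u * a) * (1 + l * a))
        = ((u - l) * a * (1 + u * a) - (u - l)\<^sup>2 * (a * a)) / ((1 + u * a) * (1 + l * a))"
      unfolding e1 a2 diff_divide_distrib by simp
    also have "(u - l) * a * (1 + u * a) - (u - l)\<^sup>2 * (a * a) = (u - l) * a * (1 + l * a)"
      by (simp add: power2_eq_square algebra_simps)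
    also have "\<dots> / ((1 + u * a) * (1 + l * a)) = (u - l) * a / (1 + u * a)"
      using la by simp
    finally show ?thesis ..
  qed
  moreover have "(u - l)\<^sup>2 / ((1 + u * a) * (1 + l * a)) \<le> (u - l)\<^sup>2 / (1/4)"
    using prod by (intro divide_left_mono) (auto intro!: mult_pos_pos)
  ultimately have 1: "(u - l) * (a / (1 + l * a)) - 4 * (u - l)\<^sup>2 \<le> ln (1 + u * a) - ln (1 + l * a)"
    by simp
  have "u / (1 + u * c) - l / (1 + l * c) - (u - l) / (1 + l * c)\<^sup>2 = - ((u - l)\<^sup>2 * c) / ((1 + l * c)\<^sup>2 * (1 + u * c))"
  proof -
    have nz: "1 + l * c \<noteq> 0" "1 + u * c \<noteq> 0" using lc uc by auto
    have "u / (1 + u * c) - l / (1 + l * c) = (u - l) / ((1 + u * c) * (1 + l * c))"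
      using nz by (simp add: field_simps)
    then have "u / (1 + u * c) - l / (1 + l * c) - (u - l) / (1 + l * c)\<^sup>2
        = (u - l) * (1 + l * c) / ((1 + l * c)\<^sup>2 * (1 + u * c)) - (u - l) * (1 + u * c) / ((1 + l * c)\<^sup>2 * (1 + u * c))"
      using nz by (simp add: power2_eq_square ac_simps)
    also have "\<dots> = - ((u - l)\<^sup>2 * c) / ((1 + l * c)\<^sup>2 * (1 + u * c))"
      unfolding diff_divide_distrib [symmetric] by (simp add: power2_eq_square algebra_simps)
    finally show ?thesis .
  qed
  moreover have "\<bar>- ((u - l)\<^sup>2 * c) / ((1 + l * c)\<^sup>2 * (1 + u * c))\<bar> \<le> (u - l)\<^sup>2 / (1/8)"
  proof -
    have "\<bar>- ((u - l)\<^sup>2 * c) / ((1 + l * c)\<^sup>2 * (1 + u * c))\<bar> = (u - l)\<^sup>2 / ((1 + l * c)\<^sup>2 * (1 + u * c))"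
      using prodc uc c by (simp add: abs_mult abs_divide)
    also have "\<dots> \<le> (u - l)\<^sup>2 / (1/8)"
      using prodc by (intro divide_left_mono) (auto intro!: mult_pos_pos)
    finally show ?thesis .
  qed
  ultimately have q: "\<bar>u / (1 + u * c) - l / (1 + l * c) - (u - l) / (1 + l * c)\<^sup>2\<bar> \<le> 8 * (u - l)\<^sup>2"
    by simp
  let ?Q = "u / (1 + u * c) - l / (1 + l * c) - (u - l) / (1 + l * c)\<^sup>2"
  have "\<bar>x * a * ?Q\<bar> \<le> x * (8 * (u - l)\<^sup>2)"
    using q x a by (simp add: abs_mult mult_left_mono)
  moreover have "pt_term u a c x - pt_term l a c x - (u - l) * slope l a c x
     = (ln (1 + u * a) - ln (1 + l * a) - (u - l) * (a / (1 + l * a))) - x * a * ?Q"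
    unfolding pt_term_def slope_def by (simp add: algebra_simps add_divide_distrib diff_divide_distrib)
  moreover have "(u - l)\<^sup>2 * (8 * (1 + x)) = 8 * (u - l)\<^sup>2 + x * (8 * (u - l)\<^sup>2)"
    by (simp add: algebra_simps)
  moreover have "0 \<le> (u - l)\<^sup>2" by simp
  ultimately show ?thesis using 1 by linarith
qed

text \<open>Second differences of a function telescope under integration, up to boundary terms that are small for a Lipschitz function. Integrated over
the parameter, the second differences of the mean free energy therefore cost only \<open>4 L \<delta>\<close>.\<close>

lemma second_difference_integral:
  fixes \<phi> :: "real \<Rightarrow> real"
  assumes ab: "a < b" and \<delta>: "0 < \<delta>" "a + 2 * \<delta> \<le> b - 2 * \<delta>"
    and lip: "\<And>x y. x \<in> {a..b} \<Longrightarrow> y \<in> {a..b} \<Longrightarrow> \<bar>\<phi> x - \<phi> y\<bar> \<le> L * \<bar>x - y\<bar>"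
    and A0: "\<And>u. u \<in> {a + \<delta>..b - \<delta>} \<Longrightarrow> 0 \<le> A + (\<phi> (u + \<delta>) - 2 * \<phi> u + \<phi> (u - \<delta>)) / \<delta>"
  shows "(\<integral>\<^sup>+u. ennreal (A + (\<phi> (u + \<delta>) - 2 * \<phi> u + \<phi> (u - \<delta>)) / \<delta>) * indicator {a + \<delta>..b - \<delta>} u \<partial>lborel)
    \<le> ennreal (A * (b - a - 2 * \<delta>) + 4 * L * \<delta>)"
proof -
  define cl where "cl u = max a (min b u)" for u
  define \<psi> where "\<psi> u = \<phi> (cl u)" for u
  have cl: "cl u \<in> {a..b}" for u using ab by (auto simp: cl_def)
  have cl_id: "cl u = u" if "u \<in> {a..b}" for u using that by (auto simp: cl_def)
  have cl1: "\<bar>cl x - cl y\<bar> \<le> \<bar>x - y\<bar>" for x y by (auto simp: cl_def max_def min_def abs_if)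
  have L0: "0 \<le> L" using lip [of a b] ab by (smt (verit) atLeastAtMost_iff zero_le_mult_iff)
  have lip': "\<bar>\<psi> x - \<psi> y\<bar> \<le> L * \<bar>x - y\<bar>" for x y
    unfolding \<psi>_def by (rule order_trans [OF lip [OF cl cl] mult_left_mono [OF cl1 L0]])
  have cont: "continuous_on S \<psi>" for S
  proof (rule continuous_onI)
    fix x e' :: real assume e': "0 < e'"
    show "\<exists>d>0. \<forall>x'\<in>S. dist x' x < d \<longrightarrow> dist (\<psi> x') (\<psi> x) \<le> e'"
    proof (intro exI [of _ "e' / (L + 1)"] conjI ballI impI)
      show "0 < e' / (L + 1)" using e' L0 by simp
      fix x' assume "dist x' x < e' / (L + 1)"
      then have "\<bar>x' - x\<bar> * (L + 1) < e'" using L0 by (simp add: dist_real_def pos_less_divide_eq)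
      moreover have "L * \<bar>x' - x\<bar> \<le> \<bar>x' - x\<bar> * (L + 1)" by (simp add: algebra_simps)
      ultimately show "dist (\<psi> x') (\<psi> x) \<le> e'" using lip' [of x' x] by (simp add: dist_real_def)
    qed
  qed
  have [measurable]: "\<psi> \<in> borel_measurable borel"
    by (intro borel_measurable_continuous_onI cont)
  define \<Phi> where "\<Phi> x = integral {a - 1..x} \<psi>" for x
  have d\<Phi>: "(\<Phi> has_real_derivative \<psi> x) (at x)" if "x \<in> {a..b}" for x
  proof -
    have "(\<Phi> has_real_derivative \<psi> x) (at x within {a - 1..b + 1})"
      unfolding \<Phi>_def by (rule integral_has_real_derivative [OF cont]) (use that in auto)
    moreover have "at x within {a - 1..b + 1} = at x"
      by (rule at_within_interior) (use that in auto)
    ultimately show ?thesis by simp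
  qed
  define K where "K u = \<Phi> (u + \<delta>) - 2 * \<Phi> u + \<Phi> (u - \<delta>)" for u
  have dK: "(K has_real_derivative (\<psi> (u + \<delta>) - 2 * \<psi> u + \<psi> (u - \<delta>))) (at u)" if "u \<in> {a + \<delta>..b - \<delta>}" for u
  proof -
    have "((\<lambda>u. \<Phi> (u + \<delta>)) has_real_derivative \<psi> (u + \<delta>)) (at u)"
      using d\<Phi> [of "u + \<delta>"] that \<delta> by (simp add: DERIV_shift)
    moreover have "((\<lambda>u. \<Phi> (u - \<delta>)) has_real_derivative \<psi> (u - \<delta>)) (at u)"
      using d\<Phi> [of "u - \<delta>"] that \<delta> DERIV_shift [of \<Phi> "\<psi> (u - \<delta>)" u "- \<delta>"] by simp
    moreover have "(\<Phi> has_real_derivative \<psi> u) (at u)" using d\<Phi> [of u] that \<delta> by simp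
    ultimately show ?thesis unfolding K_def by (auto intro!: derivative_eq_intros)
  qed
  have mvt: "\<exists>\<xi>\<in>{x..x + \<delta>}. \<Phi> (x + \<delta>) - \<Phi> x = \<delta> * \<psi> \<xi>" if "x \<in> {a..b - \<delta>}" for x
    using MVT2 [of x "x + \<delta>" \<Phi> \<psi>] d\<Phi> that \<delta> by fastforce
  have Kb: "\<bar>K u\<bar> \<le> 2 * L * \<delta>\<^sup>2" if "u \<in> {a + \<delta>..b - \<delta>}" for u
  proof -
    have "u \<in> {a..b - \<delta>}" "u - \<delta> \<in> {a..b - \<delta>}" using that \<delta> by auto
    from mvt [OF this(1)] mvt [OF this(2)]
    obtain p q where p: "p \<in> {u..u + \<delta>}" "\<Phi> (u + \<delta>) - \<Phi> u = \<delta> * \<psi> p"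
      and q: "q \<in> {u - \<delta>..u}" "\<Phi> u - \<Phi> (u - \<delta>) = \<delta> * \<psi> q"
      by auto
    have "K u = \<delta> * (\<psi> p - \<psi> q)" using p(2) q(2) by (simp add: K_def algebra_simps)
    then have "\<bar>K u\<bar> \<le> \<delta> * (L * \<bar>p - q\<bar>)" using lip' [of p q] \<delta> by (simp add: abs_mult)
    also have "\<dots> \<le> \<delta> * (L * (2 * \<delta>))" using p(1) q(1) \<delta> L0 by (intro mult_left_mono) auto
    finally show ?thesis by (simp add: power2_eq_square mult_ac)
  qed
  let ?f = "\<lambda>u. A + (\<psi> (u + \<delta>) - 2 * \<psi> u + \<psi> (u - \<delta>)) / \<delta>"
  have eq: "\<phi> (u + \<delta>) - 2 * \<phi> u + \<phi> (u - \<delta>) = \<psi> (u + \<delta>) - 2 * \<psi> u + \<psi> (u - \<delta>)" if "u \<in> {a + \<delta>..b - \<delta>}" for u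
    using that \<delta> by (simp add: \<psi>_def cl_id)
  have "(\<integral>\<^sup>+u. ennreal (A + (\<phi> (u + \<delta>) - 2 * \<phi> u + \<phi> (u - \<delta>)) / \<delta>) * indicator {a + \<delta>..b - \<delta>} u \<partial>lborel)
      = (\<integral>\<^sup>+u. ennreal (?f u) * indicator {a + \<delta>..b - \<delta>} u \<partial>lborel)"
    by (intro nn_integral_cong) (auto simp: eq split: split_indicator)
  also have "\<dots> = ennreal ((A * (b - \<delta>) + K (b - \<delta>) / \<delta>) - (A * (a + \<delta>) + K (a + \<delta>) / \<delta>))"
  proof (rule nn_integral_FTC_Icc [where F = "\<lambda>u. A * u + K u / \<delta>" and f = ?f])
    fix u assume "u \<in> {a + \<delta>..b - \<delta>}"
    then have u: "a + \<delta> \<le> u" "u \<le> b - \<delta>" by auto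
    show "((\<lambda>u. A * u + K u / \<delta>) has_real_derivative ?f u) (at u)"
      using dK [of u] u \<delta> by (auto intro!: derivative_eq_intros)
    show "0 \<le> ?f u" using A0 [of u] eq [of u] u by simp
  qed (use \<delta> in auto)
  also have "\<dots> \<le> ennreal (A * (b - a - 2 * \<delta>) + 4 * L * \<delta>)"
  proof (rule ennreal_leI)
    have "K (b - \<delta>) - K (a + \<delta>) \<le> 4 * L * \<delta>\<^sup>2"
      using Kb [of "b - \<delta>"] Kb [of "a + \<delta>"] \<delta> by auto
    then have "(K (b - \<delta>) - K (a + \<delta>)) / \<delta> \<le> 4 * L * \<delta>\<^sup>2 / \<delta>" using \<delta> by (intro divide_right_mono) auto
    then have "(K (b - \<delta>) - K (a + \<delta>)) / \<delta> \<le> 4 * L * \<delta>" using \<delta> by (simp add: power2_eq_square)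
    then show "(A * (b - \<delta>) + K (b - \<delta>) / \<delta>) - (A * (a + \<delta>) + K (a + \<delta>) / \<delta>) \<le> A * (b - a - 2 * \<delta>) + 4 * L * \<delta>"
      by (simp add: algebra_simps diff_divide_distrib)
  qed
  finally show ?thesis .
qed

lemma (in prob_space) expectation_abs_le_sqrt:
  fixes Y :: "'a \<Rightarrow> real"
  assumes "Y \<in> borel_measurable M" "integrable M (\<lambda>x. (Y x)\<^sup>2)" "expectation (\<lambda>x. (Y x)\<^sup>2) \<le> c"
  shows "integrable M Y" "expectation (\<lambda>x. \<bar>Y x\<bar>) \<le> sqrt c"
proof -
  show i: "integrable M Y" using square_integrable_imp_integrable [OF assms(1,2)] .
  have "0 \<le> variance (\<lambda>x. \<bar>Y x\<bar>)" by (rule variance_positive)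
  also have "\<dots> = expectation (\<lambda>x. (Y x)\<^sup>2) - (expectation (\<lambda>x. \<bar>Y x\<bar>))\<^sup>2"
    using variance_eq [of "\<lambda>x. \<bar>Y x\<bar>"] i assms(2) by simp
  finally have "(expectation (\<lambda>x. \<bar>Y x\<bar>))\<^sup>2 \<le> c" using assms(3) by simp
  then show "expectation (\<lambda>x. \<bar>Y x\<bar>) \<le> sqrt c" by (rule real_le_rsqrt)
qed

definition mark_mass :: real where
  "mark_mass = (\<integral>x. 1 + x \<partial>exponential_one)"

context perturbed_model
begin

lemmas integral_load_mu = integral_load [folded mark_mass_def]

abbreviation "F \<equiv> F_pert N m e"

definition mean_slope :: "nat \<Rightarrow> (nat \<Rightarrow> real) \<Rightarrow> ('o, 'y) disorder \<Rightarrow> nat \<Rightarrow> real \<Rightarrow> real" where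
  "mean_slope k lam \<omega> i x = avg lam \<omega> (\<lambda>\<sigma>. slope (lam k) (\<sigma> i) (sig \<omega> i) x)"

text \<open>The posterior mean of the derivative of the Hamiltonian with respect to \<open>\<lambda>_k\<close>.\<close>

definition energy :: "nat \<Rightarrow> (nat \<Rightarrow> real) \<Rightarrow> ('o, 'y) disorder \<Rightarrow> real" where
  "energy k lam \<omega> = (\<Sum>j=1..cnt \<omega> k. mean_slope k lam \<omega> (loc \<omega> (j, k)) (xi \<omega> (j, k)))"

lemma mark_mass_pos: "0 \<le> mark_mass"
  unfolding mark_mass_def by (intro integral_nonneg_AE) (use AE_exponential_nonneg in eventually_elim, simp)

lemma mean_slope_bound:
  assumes lam: "lam \<in> param_box" and k: "1 \<le> k" and sg: "sig \<omega> \<in> configs N" and i: "i \<in> {1..N}" and x: "0 \<le> x"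
  shows "\<bar>mean_slope k lam \<omega> i x\<bar> \<le> 4 * (1 + x)"
  unfolding mean_slope_def
proof (rule abs_avg_le)
  fix \<sigma> assume \<sigma>: "\<sigma> \<in> configs N"
  show "\<bar>slope (lam k) (\<sigma> i) (sig \<omega> i) x\<bar> \<le> 4 * (1 + x)"
    by (rule slope_bound [OF param_box_bounds(1) [OF lam] param_box_half [OF lam k] config_abs [OF \<sigma> i] config_abs [OF sg i] x])
qed (use x in simp)

lemma energy_bound:
  assumes g: "good \<omega>" and lam: "lam \<in> param_box" and k: "1 \<le> k"
  shows "\<bar>energy k lam \<omega>\<bar> \<le> 4 * load k \<omega>"
proof -
  have "\<bar>energy k lam \<omega>\<bar> \<le> (\<Sum>j=1..cnt \<omega> k. 4 * (1 + xi \<omega> (j, k)))"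
    unfolding energy_def
    by (rule order_trans [OF sum_abs], rule sum_mono, rule mean_slope_bound [OF lam k goodD(2) [OF g] goodD(4) [OF g _ k] goodD(5) [OF g _ k]]) auto
  then show ?thesis by (simp only: load_def sum_distrib_left)
qed

lemma ln_avg_exp_ge:
  assumes Z: "Z lam \<omega> \<noteq> 0"
  shows "0 < avg lam \<omega> (\<lambda>\<sigma>. exp (D \<sigma>))" "avg lam \<omega> D \<le> ln (avg lam \<omega> (\<lambda>\<sigma>. exp (D \<sigma>)))"
proof -
  let ?c = "avg lam \<omega> D"
  have "exp ?c = avg lam \<omega> (\<lambda>\<sigma>. exp ?c * (1 - ?c) + exp ?c * D \<sigma>)"
    unfolding avg_add avg_cmult avg_const [OF Z] by (simp add: algebra_simps)
  also have "\<dots> \<le> avg lam \<omega> (\<lambda>\<sigma>. exp (D \<sigma>))"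
  proof (rule avg_mono)
    fix \<sigma>
    have "exp ?c * (1 + (D \<sigma> - ?c)) \<le> exp ?c * exp (D \<sigma> - ?c)"
      by (intro mult_left_mono exp_ge_add_one_self) simp
    then show "exp ?c * (1 - ?c) + exp ?c * D \<sigma> \<le> exp (D \<sigma>)"
      by (simp add: exp_diff algebra_simps)
  qed
  finally have *: "exp ?c \<le> avg lam \<omega> (\<lambda>\<sigma>. exp (D \<sigma>))" .
  then show p: "0 < avg lam \<omega> (\<lambda>\<sigma>. exp (D \<sigma>))" by (rule less_le_trans [OF exp_gt_zero])
  show "?c \<le> ln (avg lam \<omega> (\<lambda>\<sigma>. exp (D \<sigma>)))" using * p by (simp add: ln_ge_iff)
qed

text \<open>The difference of the free energies is the logarithm of a Gibbs average of an exponential. Jensen's inequality bounds it from below by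
the Gibbs average of the exponent, and the exponent lies above its tangent.\<close>

lemma free_energy_tangent:
  assumes g: "good \<omega>" and lam: "lam \<in> param_box" and u: "lam(k := u) \<in> param_box" and k: "1 \<le> k"
  shows "(u - lam k) * energy k lam \<omega> - (u - lam k)\<^sup>2 * (8 * load k \<omega>) \<le> F (lam(k := u)) \<omega> - F lam \<omega>"
proof -
  define D where "D \<sigma> = (\<Sum>j=1..cnt \<omega> k. pt_term u (\<sigma> (loc \<omega> (j, k))) (sig \<omega> (loc \<omega> (j, k))) (xi \<omega> (j, k))
        - pt_term (lam k) (\<sigma> (loc \<omega> (j, k))) (sig \<omega> (loc \<omega> (j, k))) (xi \<omega> (j, k)))" for \<sigma>
  have Z: "Z lam \<omega> \<noteq> 0" by (rule good_Z [OF g])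
  have ub: "0 < u" "u \<le> 1/2" using param_box_bounds(1) [OF u, of k] param_box_half [OF u k] by auto
  have "Z (lam(k := u)) \<omega> = Z lam \<omega> * avg lam \<omega> (\<lambda>\<sigma>. exp (D \<sigma>))"
    unfolding D_def by (rule avg_tilt(1) [OF boltzmann_upd [OF g lam _ k] Z])
  then have "F (lam(k := u)) \<omega> - F lam \<omega> = ln (avg lam \<omega> (\<lambda>\<sigma>. exp (D \<sigma>)))"
    using ln_avg_exp_ge(1) [OF Z, of D] Z Z_nonneg [of lam \<omega>] by (simp add: F_pert_def ln_mult)
  also have "avg lam \<omega> D \<le> ln (avg lam \<omega> (\<lambda>\<sigma>. exp (D \<sigma>)))" by (rule ln_avg_exp_ge(2) [OF Z])
  finally have 1: "avg lam \<omega> D \<le> F (lam(k := u)) \<omega> - F lam \<omega>" .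
  have "avg lam \<omega> (\<lambda>\<sigma>. \<Sum>j=1..cnt \<omega> k. (u - lam k) * slope (lam k) (\<sigma> (loc \<omega> (j, k))) (sig \<omega> (loc \<omega> (j, k))) (xi \<omega> (j, k))
      - (u - lam k)\<^sup>2 * (8 * (1 + xi \<omega> (j, k)))) \<le> avg lam \<omega> D"
    unfolding D_def
  proof (intro avg_mono sum_mono)
    fix \<sigma> j assume \<sigma>: "\<sigma> \<in> configs N" and j: "j \<in> {1..cnt \<omega> k}"
    then have j1: "1 \<le> j" by simp
    note i = goodD(4) [OF g j1 k]
    show "(u - lam k) * slope (lam k) (\<sigma> (loc \<omega> (j, k))) (sig \<omega> (loc \<omega> (j, k))) (xi \<omega> (j, k)) - (u - lam k)\<^sup>2 * (8 * (1 + xi \<omega> (j, k)))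
      \<le> pt_term u (\<sigma> (loc \<omega> (j, k))) (sig \<omega> (loc \<omega> (j, k))) (xi \<omega> (j, k))
        - pt_term (lam k) (\<sigma> (loc \<omega> (j, k))) (sig \<omega> (loc \<omega> (j, k))) (xi \<omega> (j, k))"
      by (rule pt_term_tangent [OF param_box_bounds(1) [OF lam] param_box_half [OF lam k] ub
            config_abs [OF \<sigma> i] config_abs [OF goodD(2) [OF g] i] goodD(5) [OF g j1 k]])
  qed
  also have "avg lam \<omega> (\<lambda>\<sigma>. \<Sum>j=1..cnt \<omega> k. (u - lam k) * slope (lam k) (\<sigma> (loc \<omega> (j, k))) (sig \<omega> (loc \<omega> (j, k))) (xi \<omega> (j, k))
      - (u - lam k)\<^sup>2 * (8 * (1 + xi \<omega> (j, k))))
    = (u - lam k) * energy k lam \<omega> - (u - lam k)\<^sup>2 * (8 * load k \<omega>)"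
    unfolding avg_sum avg_diff avg_cmult avg_const [OF Z] sum_subtractf
    by (simp only: energy_def mean_slope_def load_def sum_distrib_left)
  finally have 2: "(u - lam k) * energy k lam \<omega> - (u - lam k)\<^sup>2 * (8 * load k \<omega>) \<le> avg lam \<omega> D" .
  from order_trans [OF 2 1] show ?thesis .
qed

lemma meas_energy_joint:
  assumes k: "1 \<le> k"
  shows "(\<lambda>x. energy k (fst x) (snd x)) \<in> borel_measurable jointM"
proof -
  have "(\<lambda>x. mean_slope k (fst x) (snd x) (loc (snd x) (j, k)) (xi (snd x) (j, k))) \<in> borel_measurable jointM" if j: "1 \<le> j" for j
    unfolding mean_slope_def avg_def slope_def
    by (intro borel_measurable_sum borel_measurable_times borel_measurable_diff borel_measurable_divide borel_measurable_add
        borel_measurable_power meas_G meas_lam joint_sndI [OF meas_at_loc [OF j k]] joint_sndI [OF meas_sig_loc [OF j k]]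
        joint_sndI [OF meas_xi [OF j k]] borel_measurable_const)
  then show ?thesis unfolding energy_def by (intro meas_sum_cnt k)
qed

lemma integrable_energy:
  assumes lam: "lam \<in> param_box" and k: "1 \<le> k"
  shows "integrable lawM (energy k lam)" "\<bar>\<integral>\<omega>. energy k lam \<omega> \<partial>lawM\<bar> \<le> 4 * s * mark_mass"
    "(\<integral>\<omega>. \<bar>energy k lam \<omega> - (\<integral>\<omega>. energy k lam \<omega> \<partial>lawM)\<bar> \<partial>lawM) \<le> 8 * s * mark_mass"
proof -
  have b: "AE \<omega> in lawM. \<bar>energy k lam \<omega>\<bar> \<le> 4 * load k \<omega>"
    using AE_good
  proof eventually_elim
    case (elim \<omega>)
    show ?case by (rule energy_bound [OF elim lam k])
  qed
  have il: "integrable lawM (\<lambda>\<omega>. 4 * load k \<omega>)" using integrable_load [OF k] by simp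
  show i: "integrable lawM (energy k lam)"
    by (rule Bochner_Integration.integrable_bound [OF il joint_section [OF meas_energy_joint [OF k]]])
      (use b in eventually_elim, simp)
  have a: "(\<integral>\<omega>. \<bar>energy k lam \<omega>\<bar> \<partial>lawM) \<le> 4 * s * mark_mass"
  proof -
    have "(\<integral>\<omega>. \<bar>energy k lam \<omega>\<bar> \<partial>lawM) \<le> (\<integral>\<omega>. 4 * load k \<omega> \<partial>lawM)"
      by (rule integral_mono_AE [OF _ il b]) (use i in simp)
    then show ?thesis using integral_load_mu [OF k] by simp
  qed
  show 2: "\<bar>\<integral>\<omega>. energy k lam \<omega> \<partial>lawM\<bar> \<le> 4 * s * mark_mass"
    using integral_abs_bound [of lawM "energy k lam"] a by linarith
  let ?c = "\<integral>\<omega>. energy k lam \<omega> \<partial>lawM"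
  have "(\<integral>\<omega>. \<bar>energy k lam \<omega> - ?c\<bar> \<partial>lawM) \<le> (\<integral>\<omega>. \<bar>energy k lam \<omega>\<bar> + \<bar>?c\<bar> \<partial>lawM)"
    by (rule integral_mono) (use i in auto)
  also have "\<dots> = (\<integral>\<omega>. \<bar>energy k lam \<omega>\<bar> \<partial>lawM) + \<bar>?c\<bar>"
    using i by (simp add: law.prob_space)
  finally show "(\<integral>\<omega>. \<bar>energy k lam \<omega> - ?c\<bar> \<partial>lawM) \<le> 8 * s * mark_mass" using a 2 by linarith
qed

text \<open>The fluctuation is a second moment of \<open>F\<close> about the value of its Bochner integral, which is \<open>0\<close> if \<open>F\<close> is not integrable. A finite second moment about any
constant makes \<open>F\<close> integrable, so this value is the mean.\<close>

lemma free_energy_integrable: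
  assumes fe: "free_energy_fluctuation N m e s \<le> ennreal v" and v: "0 \<le> v" and lam: "lam \<in> param_box"
  shows "integrable lawM (F lam)" "(\<integral>\<omega>. \<bar>F lam \<omega> - (\<integral>\<omega>. F lam \<omega> \<partial>lawM)\<bar> \<partial>lawM) \<le> sqrt (v * N)"
proof -
  let ?c = "\<integral>\<omega>. F lam \<omega> \<partial>lawM"
  have Fm [measurable]: "F lam \<in> borel_measurable lawM" by (rule joint_section [OF meas_F])
  let ?I = "\<integral>\<^sup>+\<omega>. ennreal ((F lam \<omega> - ?c)\<^sup>2) \<partial>lawM"
  have "?I / of_nat N \<le> free_energy_fluctuation N m e s"
    unfolding free_energy_fluctuation_def by (intro divide_right_mono_ennreal SUP_upper lam)
  with fe have "?I / of_nat N \<le> ennreal v" by (rule order_trans [rotated])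
  then have "?I / of_nat N * of_nat N \<le> ennreal v * of_nat N" by (rule mult_right_mono) simp
  moreover have "?I / of_nat N * of_nat N = ?I"
  proof -
    have "of_nat N / of_nat N = (1 :: ennreal)"
      using N by (intro ennreal_divide_self) (auto simp: ennreal_of_nat_eq_real_of_nat)
    then show ?thesis by (simp add: divide_ennreal_def mult.assoc mult.commute [of "inverse _"])
  qed
  moreover have "ennreal v * of_nat N = ennreal (v * N)" using v by (simp add: ennreal_mult' ennreal_of_nat_eq_real_of_nat)
  ultimately have I: "?I \<le> ennreal (v * N)" by simp
  have i2: "integrable lawM (\<lambda>\<omega>. (F lam \<omega> - ?c)\<^sup>2)"
    by (rule integrableI_bounded) (use le_less_trans [OF I ennreal_less_top] in simp_all)
  have "ennreal (\<integral>\<omega>. (F lam \<omega> - ?c)\<^sup>2 \<partial>lawM) \<le> ennreal (v * N)"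
    using I nn_integral_eq_integral [OF i2] by simp
  then have e2: "(\<integral>\<omega>. (F lam \<omega> - ?c)\<^sup>2 \<partial>lawM) \<le> v * N" using v by (simp add: ennreal_le_iff)
  note r = law.expectation_abs_le_sqrt [OF _ i2 e2]
  have "integrable lawM (\<lambda>\<omega>. (F lam \<omega> - ?c) + ?c)" by (intro Bochner_Integration.integrable_add r(1)) auto
  then show "integrable lawM (F lam)" by simp
  show "(\<integral>\<omega>. \<bar>F lam \<omega> - ?c\<bar> \<partial>lawM) \<le> sqrt (v * N)" by (rule r(2)) simp
qed

lemma param_box_upd: "lam \<in> param_box \<Longrightarrow> u \<in> {(1/2) ^ (k + 1)..(1/2) ^ k} \<Longrightarrow> lam(k := u) \<in> param_box"
  unfolding param_box_def by (simp del: power_Suc add: Suc_eq_plus1)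

text \<open>The energy is squeezed between the difference quotients of the free energy to the left and to the right. Each quotient deviates
from its mean by the fluctuations of \<open>F\<close> divided by \<open>\<delta>\<close>, and the means of the two quotients differ by the second difference of the mean free energy.\<close>

lemma energy_dev_pointwise:
  assumes fe: "free_energy_fluctuation N m e s \<le> ennreal v" and v: "0 \<le> v" and k: "1 \<le> k"
    and lam: "lam \<in> param_box" and up: "lam(k := lam k + \<delta>) \<in> param_box" and dn: "lam(k := lam k - \<delta>) \<in> param_box" and \<delta>: "0 < \<delta>"
  shows "(\<integral>\<omega>. \<bar>energy k lam \<omega> - (\<integral>\<omega>. energy k lam \<omega> \<partial>lawM)\<bar> \<partial>lawM) \<le> 4 * sqrt (v * N) / \<delta> + 16 * \<delta> * s * mark_mass
    + ((\<integral>\<omega>. F (lam(k := lam k + \<delta>)) \<omega> \<partial>lawM) - 2 * (\<integral>\<omega>. F lam \<omega> \<partial>lawM) + (\<integral>\<omega>. F (lam(k := lam k - \<delta>)) \<omega> \<partial>lawM)) / \<delta>"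
proof -
  let ?E = "\<lambda>f. \<integral>\<omega>. f \<omega> \<partial>lawM"
  let ?X = "energy k lam" and ?p = "F (lam(k := lam k + \<delta>))" and ?z = "F lam" and ?q = "F (lam(k := lam k - \<delta>))"
  note ip = free_energy_integrable [OF fe v up] and iz = free_energy_integrable [OF fe v lam] and iq = free_energy_integrable [OF fe v dn]
  note iX = integrable_energy(1) [OF lam k] and iL = integrable_load [OF k] and eL = integral_load_mu [OF k]
  have up1: "AE \<omega> in lawM. ?X \<omega> \<le> (?p \<omega> - ?z \<omega>) / \<delta> + \<delta> * (8 * load k \<omega>)"
    using AE_good
  proof eventually_elim
    case (elim \<omega>)
    have "\<delta> * ?X \<omega> \<le> (?p \<omega> - ?z \<omega>) + \<delta>\<^sup>2 * (8 * load k \<omega>)"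
      using free_energy_tangent [OF elim lam up k] by simp
    then have "\<delta> * ?X \<omega> \<le> \<delta> * ((?p \<omega> - ?z \<omega>) / \<delta> + \<delta> * (8 * load k \<omega>))"
      using \<delta> by (simp add: power2_eq_square distrib_left mult.assoc)
    then show ?case using \<delta> by simp
  qed
  have dn1: "AE \<omega> in lawM. (?z \<omega> - ?q \<omega>) / \<delta> - \<delta> * (8 * load k \<omega>) \<le> ?X \<omega>"
    using AE_good
  proof eventually_elim
    case (elim \<omega>)
    have "(?z \<omega> - ?q \<omega>) - \<delta>\<^sup>2 * (8 * load k \<omega>) \<le> \<delta> * ?X \<omega>"
      using free_energy_tangent [OF elim lam dn k] by simp
    moreover have "\<delta> * ((?z \<omega> - ?q \<omega>) / \<delta>) = ?z \<omega> - ?q \<omega>" using \<delta> by simp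
    ultimately have "\<delta> * ((?z \<omega> - ?q \<omega>) / \<delta> - \<delta> * (8 * load k \<omega>)) \<le> \<delta> * ?X \<omega>"
      by (simp only: power2_eq_square right_diff_distrib [of \<delta> "_ / _"] mult.assoc)
    then show ?case using \<delta> by simp
  qed
  have Eup: "?E ?X \<le> (?E ?p - ?E ?z) / \<delta> + \<delta> * (8 * (s * mark_mass))"
  proof -
    have "?E ?X \<le> ?E (\<lambda>\<omega>. (?p \<omega> - ?z \<omega>) / \<delta> + \<delta> * (8 * load k \<omega>))"
      by (rule integral_mono_AE [OF iX _ up1]) (use ip iz iL in auto)
    also have "\<dots> = (?E ?p - ?E ?z) / \<delta> + \<delta> * (8 * (s * mark_mass))"
      using ip iz iL eL by simp
    finally show ?thesis .
  qed
  have Edn: "(?E ?z - ?E ?q) / \<delta> - \<delta> * (8 * (s * mark_mass)) \<le> ?E ?X"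
  proof -
    have "(?E ?z - ?E ?q) / \<delta> - \<delta> * (8 * (s * mark_mass)) = ?E (\<lambda>\<omega>. (?z \<omega> - ?q \<omega>) / \<delta> - \<delta> * (8 * load k \<omega>))"
      using iq iz iL eL by simp
    also have "\<dots> \<le> ?E ?X"
      by (rule integral_mono_AE [OF _ iX dn1]) (use iq iz iL in auto)
    finally show ?thesis .
  qed
  \<comment> \<open>the difference of the means of the two quotients, and the mean of the quadratic error\<close>
  define R where "R = (?E ?p - 2 * ?E ?z + ?E ?q) / \<delta> + \<delta> * (8 * (s * mark_mass))"
  have Rsplit: "(?E ?p - ?E ?z) / \<delta> - (?E ?z - ?E ?q) / \<delta> = (?E ?p - 2 * ?E ?z + ?E ?q) / \<delta>"
    by (simp add: diff_divide_distrib [symmetric])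
  have pt: "AE \<omega> in lawM. \<bar>?X \<omega> - ?E ?X\<bar> \<le> (\<bar>?p \<omega> - ?E ?p\<bar> + 2 * \<bar>?z \<omega> - ?E ?z\<bar> + \<bar>?q \<omega> - ?E ?q\<bar>) / \<delta> + \<delta> * (8 * load k \<omega>) + R"
    using up1 dn1
  proof eventually_elim
    case (elim \<omega>)
    let ?n = "(\<bar>?p \<omega> - ?E ?p\<bar> + 2 * \<bar>?z \<omega> - ?E ?z\<bar> + \<bar>?q \<omega> - ?E ?q\<bar>) / \<delta>"
    have r1: "x - y - (x' - y') \<le> A + 2 * B + C" if "x - x' \<le> A" "- (y - y') \<le> B" "0 \<le> B" "0 \<le> C"
      for x y x' y' A B C :: real using that by linarith
    have r2: "y' - w' - (y - w) \<le> A + 2 * B + C" if "0 \<le> A" "- (y - y') \<le> B" "0 \<le> B" "w - w' \<le> C"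
      for w y w' y' A B C :: real using that by linarith
    note n1 = r1 [OF abs_ge_self abs_ge_minus_self abs_ge_zero abs_ge_zero]
      and n2 = r2 [OF abs_ge_zero abs_ge_minus_self abs_ge_zero abs_ge_self]
    have d1: "(?p \<omega> - ?z \<omega>) / \<delta> - (?E ?p - ?E ?z) / \<delta> \<le> ?n"
      unfolding diff_divide_distrib [symmetric] using \<delta> by (intro divide_right_mono n1 n2) simp
    have d2: "(?E ?z - ?E ?q) / \<delta> - (?z \<omega> - ?q \<omega>) / \<delta> \<le> ?n"
      unfolding diff_divide_distrib [symmetric] using \<delta> by (intro divide_right_mono n1 n2) simp
    have "?X \<omega> - ?E ?X \<le> ?n + \<delta> * (8 * load k \<omega>) + R"
      using elim(1) Edn d1 Rsplit unfolding R_def by linarith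
    moreover have "?E ?X - ?X \<omega> \<le> ?n + \<delta> * (8 * load k \<omega>) + R"
      using elim(2) Eup d2 Rsplit unfolding R_def by linarith
    ultimately show ?case by linarith
  qed
  have "?E (\<lambda>\<omega>. \<bar>?X \<omega> - ?E ?X\<bar>) \<le> ?E (\<lambda>\<omega>. (\<bar>?p \<omega> - ?E ?p\<bar> + 2 * \<bar>?z \<omega> - ?E ?z\<bar> + \<bar>?q \<omega> - ?E ?q\<bar>) / \<delta> + \<delta> * (8 * load k \<omega>) + R)"
    by (rule integral_mono_AE [OF _ _ pt]) (use ip(1) iq(1) iz(1) iL iX in auto)
  also have "\<dots> = (?E (\<lambda>\<omega>. \<bar>?p \<omega> - ?E ?p\<bar>) + 2 * ?E (\<lambda>\<omega>. \<bar>?z \<omega> - ?E ?z\<bar>) + ?E (\<lambda>\<omega>. \<bar>?q \<omega> - ?E ?q\<bar>)) / \<delta> + \<delta> * (8 * (s * mark_mass)) + R"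
    using ip(1) iq(1) iz(1) iL eL by (simp add: law.prob_space)
  also have "\<dots> \<le> (4 * sqrt (v * N)) / \<delta> + \<delta> * (8 * (s * mark_mass)) + R"
    using ip(2) iq(2) iz(2) \<delta> by (intro add_right_mono divide_right_mono) linarith+
  finally have "?E (\<lambda>\<omega>. \<bar>?X \<omega> - ?E ?X\<bar>) \<le> (4 * sqrt (v * N)) / \<delta> + \<delta> * (8 * (s * mark_mass)) + R" .
  moreover have "\<delta> * (8 * (s * mark_mass)) + \<delta> * (8 * (s * mark_mass)) = 16 * \<delta> * s * mark_mass" by simp
  ultimately show ?thesis unfolding R_def by linarith
qed

definition energy_dev :: "nat \<Rightarrow> (nat \<Rightarrow> real) \<Rightarrow> real" where
  "energy_dev k lam = (\<integral>\<omega>. \<bar>energy k lam \<omega> - (\<integral>\<omega>. energy k lam \<omega> \<partial>lawM)\<bar> \<partial>lawM)"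

lemma energy_dev_nonneg: "0 \<le> energy_dev k lam"
  unfolding energy_dev_def by (intro integral_nonneg_AE) simp

lemma meas_energy_dev [measurable]: "1 \<le> k \<Longrightarrow> energy_dev k \<in> borel_measurable param_law"
proof -
  assume k: "1 \<le> k"
  have e: "(\<lambda>(lam, \<omega>). energy k lam \<omega>) \<in> borel_measurable jointM"
    using meas_energy_joint [OF k] by (simp add: split_beta')
  have "(\<lambda>lam. \<integral>\<omega>. energy k lam \<omega> \<partial>lawM) \<in> borel_measurable param_law"
    by (rule law.borel_measurable_lebesgue_integral [OF e])
  then have "(\<lambda>(lam, \<omega>). \<bar>energy k lam \<omega> - (\<integral>\<omega>. energy k lam \<omega> \<partial>lawM)\<bar>) \<in> borel_measurable jointM"
    using meas_energy_joint [OF k] unfolding split_beta'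
    by (intro borel_measurable_abs borel_measurable_diff measurable_compose [OF measurable_fst])
  from law.borel_measurable_lebesgue_integral [OF this] show ?thesis
    unfolding energy_dev_def [abs_def] .
qed

text \<open>The tangent inequality with the bound \<open>4 * load\<close> on the energy; the interval of \<open>\<lambda>_k\<close> has length at most \<open>1/2\<close>, which turns the quadratic
error into a linear one.\<close>

lemma free_energy_mean_lipschitz:
  assumes fe: "free_energy_fluctuation N m e s \<le> ennreal v" and v: "0 \<le> v" and k: "1 \<le> k"
    and lam: "lam \<in> param_box" and u: "u \<in> {(1/2) ^ (k + 1)..(1/2) ^ k}" and w: "w \<in> {(1/2) ^ (k + 1)..(1/2) ^ k}"
  shows "\<bar>(\<integral>\<omega>. F (lam(k := u)) \<omega> \<partial>lawM) - (\<integral>\<omega>. F (lam(k := w)) \<omega> \<partial>lawM)\<bar> \<le> 8 * s * mark_mass * \<bar>u - w\<bar>"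
proof -
  have *: "(\<integral>\<omega>. F (lam(k := u)) \<omega> \<partial>lawM) - (\<integral>\<omega>. F (lam(k := w)) \<omega> \<partial>lawM) \<le> 8 * s * mark_mass * \<bar>u - w\<bar>"
    if u: "u \<in> {(1/2) ^ (k + 1)..(1/2) ^ k}" and w: "w \<in> {(1/2) ^ (k + 1)..(1/2) ^ k}" for u w
  proof -
    note bu = param_box_upd [OF lam u] and bw = param_box_upd [OF lam w]
    have bw': "(lam(k := u))(k := w) \<in> param_box" using bw by simp
    note iu = free_energy_integrable(1) [OF fe v bu] and iw = free_energy_integrable(1) [OF fe v bw]
    have "AE \<omega> in lawM. F (lam(k := u)) \<omega> - F (lam(k := w)) \<omega> \<le> (4 * \<bar>w - u\<bar> + 8 * (w - u)\<^sup>2) * load k \<omega>"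
      using AE_good
    proof eventually_elim
      case (elim \<omega>)
      have "(w - u) * energy k (lam(k := u)) \<omega> - (w - u)\<^sup>2 * (8 * load k \<omega>) \<le> F (lam(k := w)) \<omega> - F (lam(k := u)) \<omega>"
        using free_energy_tangent [OF elim bu bw' k] by simp
      moreover have "\<bar>(w - u) * energy k (lam(k := u)) \<omega>\<bar> \<le> \<bar>w - u\<bar> * (4 * load k \<omega>)"
        unfolding abs_mult by (intro mult_left_mono energy_bound elim bu k) simp
      ultimately show ?case by (simp add: algebra_simps abs_le_iff)
    qed
    then have "(\<integral>\<omega>. F (lam(k := u)) \<omega> - F (lam(k := w)) \<omega> \<partial>lawM) \<le> (\<integral>\<omega>. (4 * \<bar>w - u\<bar> + 8 * (w - u)\<^sup>2) * load k \<omega> \<partial>lawM)"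
      by (intro integral_mono_AE) (use iu iw integrable_load [OF k] in auto)
    then have 1: "(\<integral>\<omega>. F (lam(k := u)) \<omega> \<partial>lawM) - (\<integral>\<omega>. F (lam(k := w)) \<omega> \<partial>lawM) \<le> (4 * \<bar>w - u\<bar> + 8 * (w - u)\<^sup>2) * (s * mark_mass)"
      using iu iw integral_load_mu [OF k] by simp
    have hk: "(1/2::real) ^ k \<le> (1/2) ^ 1" using k by (intro power_decreasing) auto
    have h0: "(0::real) \<le> (1/2) ^ (k + 1)" by simp
    have "\<bar>w - u\<bar> \<le> 1/2" using u w hk h0 unfolding atLeastAtMost_iff power_one_right by linarith
    then have "\<bar>w - u\<bar> * \<bar>w - u\<bar> \<le> 1/2 * \<bar>w - u\<bar>" by (intro mult_right_mono) auto
    note q1 = this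
    have q2: "(w - u)\<^sup>2 = \<bar>w - u\<bar> * \<bar>w - u\<bar>" by (simp add: power2_eq_square)
    have "4 * \<bar>w - u\<bar> + 8 * (w - u)\<^sup>2 \<le> 8 * \<bar>u - w\<bar>"
    proof -
      have "4 * x + 8 * y \<le> 8 * z" if "x * x \<le> 1/2 * x" "y = x * x" "z = x" for x y z :: real
        using that by linarith
      from this [OF q1 q2 abs_minus_commute] show ?thesis .
    qed
    then have "(4 * \<bar>w - u\<bar> + 8 * (w - u)\<^sup>2) * (s * mark_mass) \<le> 8 * \<bar>u - w\<bar> * (s * mark_mass)"
      using s mark_mass_pos by (intro mult_right_mono mult_nonneg_nonneg) auto
    with 1 show ?thesis by (simp add: mult_ac)
  qed
  from * [OF u w] * [OF w u] show ?thesis by (simp add: abs_le_iff abs_minus_commute)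
qed

text \<open>The parameter \<open>\<lambda>_k\<close> is averaged over its interval. Within distance \<open>\<delta>\<close> of the end points the trivial bound is used, elsewhere the
comparison of difference quotients, whose second differences telescope. Divided by \<open>s\<close>, the bound is small once \<open>\<delta>\<close> is small and \<open>s\<close> is much larger than
\<open>\<surd>(v N) / \<delta>\<close>.\<close>

lemma energy_concentration:
  assumes fe: "free_energy_fluctuation N m e s \<le> ennreal v" and v: "0 \<le> v" and k: "1 \<le> k"
    and \<delta>: "0 < \<delta>" "4 * \<delta> \<le> (1/2) ^ (k + 1)"
  shows "(\<integral>lam. energy_dev k lam \<partial>param_law) \<le> 2 ^ (k + 1) * (4 * sqrt (v * N) / \<delta> + 64 * mark_mass * \<delta> * s)"
proof -
  \<comment> \<open>the interval of \<open>\<lambda>_k\<close> is \<open>[a, b]\<close>, of length \<open>b - a = a\<close>\<close>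
  define a b :: real where "a = (1/2) ^ (k + 1)" and "b = (1/2) ^ k"
  have ba: "b - a = a" unfolding a_def b_def power_add by simp
  have a0: "0 < a" by (simp add: a_def)
  have ab: "a < b" "a + 2 * \<delta> \<le> b - 2 * \<delta>" "b \<le> 1"
  proof -
    show "b \<le> 1" unfolding b_def by (rule power_le_one) auto
  qed (use \<delta> ba a0 in \<open>auto simp: a_def [symmetric]\<close>)
  note dm [measurable] = meas_energy_dev [OF k]
  define A where "A = 4 * sqrt (v * N) / \<delta> + 16 * \<delta> * s * mark_mass"
  have A0: "0 \<le> A" unfolding A_def using \<delta> s mark_mass_pos v by (intro add_nonneg_nonneg divide_nonneg_nonneg mult_nonneg_nonneg) auto
  let ?B = "4 * sqrt (v * N) / \<delta> + 64 * mark_mass * \<delta> * s"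
  have B0: "0 \<le> ?B" using \<delta> s mark_mass_pos v by (intro add_nonneg_nonneg divide_nonneg_nonneg mult_nonneg_nonneg) auto
  have smu: "0 \<le> s * mark_mass" using s mark_mass_pos by simp
  have inner: "(\<integral>\<^sup>+u. ennreal (energy_dev k (lam(k := u))) \<partial>uniform_measure lborel {a..b}) \<le> ennreal (2 ^ (k + 1) * ?B)"
    if lam: "lam \<in> param_box" for lam
  proof -
    define \<phi> where "\<phi> u = (\<integral>\<omega>. F (lam(k := u)) \<omega> \<partial>lawM)" for u
    let ?D = "\<lambda>u. ennreal (A + (\<phi> (u + \<delta>) - 2 * \<phi> u + \<phi> (u - \<delta>)) / \<delta>) * indicator {a + \<delta>..b - \<delta>} u"
    have updm [measurable]: "(\<lambda>u. lam(k := u)) \<in> borel \<rightarrow>\<^sub>M param_law"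
    proof -
      have "(\<lambda>u. lam(k := u)) \<in> borel \<rightarrow>\<^sub>M PiM UNIV (\<lambda>_. borel)"
        by (rule measurable_PiM_fun_upd [where M = "\<lambda>_. borel"]) (auto simp: space_PiM)
      then show ?thesis by (simp cong: measurable_cong_sets add: sets_param)
    qed
    have [measurable]: "(\<lambda>u. energy_dev k (lam(k := u))) \<in> borel_measurable borel"
      by (rule measurable_compose [OF updm dm])
    have bx: "lam(k := u) \<in> param_box" if "u \<in> {a..b}" for u
      using param_box_upd [OF lam, of u k] that by (simp add: a_def b_def)
    \<comment> \<open>trivial bound near the end points, difference quotients in between\<close>
    have le: "ennreal (energy_dev k (lam(k := u))) * indicator {a..b} u
       \<le> ennreal (8 * s * mark_mass) * indicator {a..a + \<delta>} u + ennreal (8 * s * mark_mass) * indicator {b - \<delta>..b} u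
        + ?D u" for u
    proof (cases "u \<in> {a..b}")
      case u: True
      show ?thesis
      proof (cases "u \<in> {a + \<delta>..b - \<delta>}")
        case True
        have "energy_dev k (lam(k := u)) \<le> A + (\<phi> (u + \<delta>) - 2 * \<phi> u + \<phi> (u - \<delta>)) / \<delta>"
          using energy_dev_pointwise [OF fe v k bx [OF u], of \<delta>] bx [of "u + \<delta>"] bx [of "u - \<delta>"] True u \<delta>
          by (simp add: energy_dev_def \<phi>_def A_def)
        then have "ennreal (energy_dev k (lam(k := u))) \<le> ennreal (A + (\<phi> (u + \<delta>) - 2 * \<phi> u + \<phi> (u - \<delta>)) / \<delta>)"
          by (rule ennreal_leI)
        then show ?thesis using True u by (simp add: add_increasing)
      next
        case False
        have "energy_dev k (lam(k := u)) \<le> 8 * s * mark_mass"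
          unfolding energy_dev_def by (rule integrable_energy(3) [OF bx [OF u] k])
        then have "ennreal (energy_dev k (lam(k := u))) \<le> ennreal (8 * s * mark_mass)" by (rule ennreal_leI)
        moreover have "u \<in> {a..a + \<delta>} \<or> u \<in> {b - \<delta>..b}" using u False by auto
        ultimately show ?thesis using u False by (auto split: split_indicator intro: add_increasing add_increasing2)
      qed
    qed simp
    have sd: "(\<integral>\<^sup>+u. ?D u \<partial>lborel)
        \<le> ennreal (A * (b - a - 2 * \<delta>) + 4 * (8 * s * mark_mass) * \<delta>)"
    proof (rule second_difference_integral [OF ab(1) \<delta>(1) ab(2), where \<phi> = \<phi> and A = A and L = "8 * s * mark_mass"])
      show "\<bar>\<phi> x - \<phi> y\<bar> \<le> 8 * s * mark_mass * \<bar>x - y\<bar>" if "x \<in> {a..b}" "y \<in> {a..b}" for x y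
        using free_energy_mean_lipschitz [OF fe v k lam, of x y] that by (simp add: \<phi>_def a_def b_def)
      show "0 \<le> A + (\<phi> (u + \<delta>) - 2 * \<phi> u + \<phi> (u - \<delta>)) / \<delta>" if u: "u \<in> {a + \<delta>..b - \<delta>}" for u
      proof -
        have "energy_dev k (lam(k := u)) \<le> A + (\<phi> (u + \<delta>) - 2 * \<phi> u + \<phi> (u - \<delta>)) / \<delta>"
          using energy_dev_pointwise [OF fe v k bx, of u \<delta>] bx [of "u + \<delta>"] bx [of "u - \<delta>"] u \<delta>
          by (simp add: energy_dev_def \<phi>_def A_def)
        with energy_dev_nonneg show ?thesis by (rule order_trans)
      qed
    qed
    have \<phi>m: "(\<lambda>u. ?D u) \<in> borel_measurable lborel"
    proof -
      have Fj: "(\<lambda>(lam, \<omega>). F lam \<omega>) \<in> borel_measurable jointM" using meas_F by (simp add: split_beta')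
      have "(\<lambda>lam. \<integral>\<omega>. F lam \<omega> \<partial>lawM) \<in> borel_measurable param_law"
        by (rule law.borel_measurable_lebesgue_integral [OF Fj])
      from measurable_compose [OF updm this] have [measurable]: "\<phi> \<in> borel_measurable borel" by (simp add: \<phi>_def [abs_def])
      show ?thesis by measurable
    qed
    have "(\<integral>\<^sup>+u. ennreal (energy_dev k (lam(k := u))) * indicator {a..b} u \<partial>lborel)
      \<le> (\<integral>\<^sup>+u. ennreal (8 * s * mark_mass) * indicator {a..a + \<delta>} u + ennreal (8 * s * mark_mass) * indicator {b - \<delta>..b} u
        + ?D u \<partial>lborel)"
      by (intro nn_integral_mono le)
    also have "\<dots> = ennreal (8 * s * mark_mass) * ennreal \<delta> + ennreal (8 * s * mark_mass) * ennreal \<delta>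
        + (\<integral>\<^sup>+u. ?D u \<partial>lborel)"
      using \<phi>m \<delta> by (subst nn_integral_add, simp, simp, subst nn_integral_add) (auto simp: nn_integral_cmult)
    also have "\<dots> \<le> ennreal (8 * s * mark_mass) * ennreal \<delta> + ennreal (8 * s * mark_mass) * ennreal \<delta> + ennreal (A * (b - a - 2 * \<delta>) + 4 * (8 * s * mark_mass) * \<delta>)"
      by (intro add_left_mono sd)
    also have "\<dots> = ennreal (8 * s * mark_mass * \<delta> + 8 * s * mark_mass * \<delta> + (A * (b - a - 2 * \<delta>) + 4 * (8 * s * mark_mass) * \<delta>))"
    proof -
      have n: "0 \<le> 8 * s * mark_mass * \<delta>" "0 \<le> A * (b - a - 2 * \<delta>) + 4 * (8 * s * mark_mass) * \<delta>"
        using s mark_mass_pos \<delta> A0 ab by (auto intro!: add_nonneg_nonneg mult_nonneg_nonneg simp: mult.assoc)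
      have "ennreal (8 * s * mark_mass) * ennreal \<delta> = ennreal (8 * s * mark_mass * \<delta>)"
        using \<delta> by (simp add: ennreal_mult'')
      with n show ?thesis by (simp only: ennreal_plus add_nonneg_nonneg)
    qed
    also have "\<dots> \<le> ennreal ?B"
    proof (rule ennreal_leI)
      have "A * (b - a - 2 * \<delta>) \<le> A * 1" using A0 ab \<delta> a0 by (intro mult_left_mono) auto
      then show "8 * s * mark_mass * \<delta> + 8 * s * mark_mass * \<delta> + (A * (b - a - 2 * \<delta>) + 4 * (8 * s * mark_mass) * \<delta>) \<le> ?B"
        unfolding A_def by (simp add: algebra_simps)
    qed
    finally have 1: "(\<integral>\<^sup>+u. ennreal (energy_dev k (lam(k := u))) * indicator {a..b} u \<partial>lborel) \<le> ennreal ?B" .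
    have "(\<integral>\<^sup>+u. ennreal (energy_dev k (lam(k := u))) \<partial>uniform_measure lborel {a..b})
      = (\<integral>\<^sup>+u. ennreal (energy_dev k (lam(k := u))) * indicator {a..b} u \<partial>lborel) / emeasure lborel {a..b}"
      by (subst nn_integral_uniform_measure) auto
    also have "\<dots> \<le> ennreal ?B / ennreal a"
      using 1 ab ba by (simp add: divide_right_mono_ennreal)
    also have "\<dots> = ennreal (?B / a)" using B0 a0 by (simp add: divide_ennreal)
    also have "?B / a = 2 ^ (k + 1) * ?B" by (simp add: a_def power_divide field_simps)
    finally show ?thesis .
  qed
  \<comment> \<open>the components of the parameter are independent, so the average over \<open>\<lambda>_k\<close> may be taken first\<close>
  have "(\<integral>\<^sup>+lam. ennreal (energy_dev k lam) \<partial>param_law)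
      = (\<integral>\<^sup>+lam. \<integral>\<^sup>+u. ennreal (energy_dev k (lam(k := u))) \<partial>uniform_measure lborel {a..b} \<partial>param_law)"
    unfolding a_def b_def param_law_def
    by (rule nn_integral_PiM_resample [OF prob_param_component]) (use dm in \<open>auto simp: param_law_def\<close>)
  also have "\<dots> \<le> (\<integral>\<^sup>+lam. ennreal (2 ^ (k + 1) * ?B) \<partial>param_law)"
    by (rule nn_integral_mono_AE) (use AE_param_box in eventually_elim, rule inner)
  also have "\<dots> = ennreal (2 ^ (k + 1) * ?B)"
    by (simp add: param.emeasure_space_1 del: power_Suc)
  finally have n: "(\<integral>\<^sup>+lam. ennreal (energy_dev k lam) \<partial>param_law) \<le> ennreal (2 ^ (k + 1) * ?B)" .
  have "(\<integral>lam. energy_dev k lam \<partial>param_law) = enn2real (\<integral>\<^sup>+lam. ennreal (energy_dev k lam) \<partial>param_law)"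
    by (rule integral_eq_nn_integral) (auto simp: energy_dev_nonneg)
  also have "\<dots> \<le> enn2real (ennreal (2 ^ (k + 1) * ?B))"
    by (rule enn2real_mono [OF n]) simp
  also have "\<dots> = 2 ^ (k + 1) * ?B" using B0 by (intro enn2real_ennreal mult_nonneg_nonneg) auto
  finally show ?thesis .
qed

end

section \<open>The Nishimori identity\<close>

text \<open>The mean of \<open>f\<close> under the law on \<open>{-1, 1}\<close> with mean \<open>m\<close>.\<close>

definition two_point :: "real \<Rightarrow> (real \<Rightarrow> real) \<Rightarrow> real" where
  "two_point m f = (1 + m) / 2 * f 1 + (1 - m) / 2 * f (-1)"

lemma two_point_bound:
  assumes "\<bar>m\<bar> \<le> 1" "\<bar>f 1\<bar> \<le> c" "\<bar>f (-1)\<bar> \<le> c"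
  shows "\<bar>two_point m f\<bar> \<le> c"
proof -
  have "\<bar>two_point m f\<bar> \<le> \<bar>(1 + m) / 2 * f 1\<bar> + \<bar>(1 - m) / 2 * f (-1)\<bar>"
    unfolding two_point_def by (rule abs_triangle_ineq)
  also have "\<dots> = (1 + m) / 2 * \<bar>f 1\<bar> + (1 - m) / 2 * \<bar>f (-1)\<bar>"
    using assms(1) by (simp add: abs_mult)
  also have "\<dots> \<le> (1 + m) / 2 * c + (1 - m) / 2 * c"
    using assms by (intro add_mono mult_left_mono) auto
  also have "\<dots> = c" by (simp add: field_simps)
  finally show ?thesis .
qed

text \<open>The indices of the observations of the first \<open>K\<close> strengths. Truncating at \<open>K\<close> keeps the likelihood a finite product.\<close>

definition revealed :: "nat \<Rightarrow> (nat \<Rightarrow> nat) \<Rightarrow> (nat \<times> nat) set" where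
  "revealed K p = {(j, k). 1 \<le> k \<and> k \<le> K \<and> 1 \<le> j \<and> j \<le> p k}"

lemma revealed_eq: "revealed K p = (\<lambda>(k, j). (j, k)) ` (SIGMA k:{1..K}. {1..p k})"
  by (auto simp: revealed_def)

lemma finite_revealed: "finite (revealed K p)"
  unfolding revealed_eq by (intro finite_imageI finite_SigmaI) auto

lemma prod_revealed:
  fixes f :: "nat \<times> nat \<Rightarrow> 'a :: comm_monoid_mult"
  shows "(\<Prod>q\<in>revealed K p. f q) = (\<Prod>k=1..K. \<Prod>j=1..p k. f (j, k))"
  unfolding revealed_eq
  by (subst prod.reindex) (auto simp: inj_on_def prod.Sigma split_beta)

context perturbed_model
begin

definition magv :: "(spins \<Rightarrow> real) \<Rightarrow> nat \<Rightarrow> real" where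
  "magv g i = (\<Sum>\<sigma>\<in>configs N. g \<sigma> * \<sigma> i)"

definition empv :: "(real \<Rightarrow> real) \<Rightarrow> (spins \<Rightarrow> real) \<Rightarrow> real" where
  "empv h g = (\<Sum>i=1..N. h (magv g i)) / real N"

lemma mag_eq_magv: "mag lam \<omega> i = magv (G lam \<omega>) i"
  by (simp add: mag_def avg_def magv_def)

text \<open>Sends the noise to the observations that it produces from the signal \<open>\<sigma>s\<close>; only the observations in \<open>revealed K p\<close> are
formed, the other coordinates remain pure noise.\<close>

definition shift :: "nat \<Rightarrow> (nat \<Rightarrow> real) \<Rightarrow> spins \<Rightarrow> pert_sample \<Rightarrow> pert_sample" where
  "shift K lam \<sigma>s = (\<lambda>(z, p, l, x).
     (\<lambda>i. if i \<in> {1..N} then sqrt (lam 0 * e) * \<sigma>s i + z i else z i, p, l,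
      \<lambda>q. if q \<in> revealed K p then x q / (1 + lam (snd q) * \<sigma>s (l q)) else x q))"

definition gauss_weight :: "(nat \<Rightarrow> real) \<Rightarrow> (nat \<Rightarrow> real) \<Rightarrow> spins \<Rightarrow> real" where
  "gauss_weight lam z \<sigma> = (\<Prod>i\<in>{1..N}. exp (sqrt (lam 0 * e) * \<sigma> i * z i - (sqrt (lam 0 * e) * \<sigma> i)\<^sup>2 / 2))"

definition exp_weight :: "nat \<Rightarrow> (nat \<Rightarrow> real) \<Rightarrow> (nat \<Rightarrow> nat) \<Rightarrow> (nat \<times> nat \<Rightarrow> nat) \<Rightarrow> (nat \<times> nat \<Rightarrow> real) \<Rightarrow> spins \<Rightarrow> real" where
  "exp_weight K lam p l x \<sigma> = (\<Prod>k=1..K. \<Prod>j=1..p k.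
     (1 + lam k * \<sigma> (l (j, k))) * exp (- (lam k * \<sigma> (l (j, k))) * x (j, k)))"

text \<open>The likelihood ratio of the observations. For parameters in the box and sites in range all factors are positive; the absolute value keeps the weight
nonnegative elsewhere.\<close>

definition obs_weight :: "nat \<Rightarrow> (nat \<Rightarrow> real) \<Rightarrow> pert_sample \<Rightarrow> spins \<Rightarrow> real" where
  "obs_weight K lam n \<sigma> = gauss_weight lam (fst n) \<sigma> * \<bar>exp_weight K lam (fst (snd n)) (fst (snd (snd n))) (snd (snd (snd n))) \<sigma>\<bar>"

lemma obs_weight_nonneg: "0 \<le> obs_weight K lam n \<sigma>"
  unfolding obs_weight_def gauss_weight_def by (intro mult_nonneg_nonneg prod_nonneg) auto

lemma nn_integral_noise:
  assumes g: "g \<in> borel_measurable noiseM"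
  shows "(\<integral>\<^sup>+n. g n \<partial>noiseM) = (\<integral>\<^sup>+z. \<integral>\<^sup>+p. \<integral>\<^sup>+l. \<integral>\<^sup>+x. g (z, p, l, x) \<partial>expM \<partial>locM \<partial>poisM \<partial>gaussM)"
proof -
  have [measurable]: "g \<in> borel_measurable (gaussM \<Otimes>\<^sub>M marksM)"
    using g by (simp only: noise_eq)
  have 2: "(\<integral>\<^sup>+w. g w \<partial>noiseM) = (\<integral>\<^sup>+z. \<integral>\<^sup>+w. g (z, w) \<partial>marksM \<partial>gaussM)"
    unfolding noise_eq by (rule ple.P.nn_integral_fst [symmetric]) measurable
  have 3: "(\<integral>\<^sup>+w. g (z, w) \<partial>marksM)
      = (\<integral>\<^sup>+p. \<integral>\<^sup>+w. g (z, p, w) \<partial>(locM \<Otimes>\<^sub>M expM) \<partial>poisM)"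
    if [measurable]: "z \<in> space gaussM" for z
    by (rule le.P.nn_integral_fst [symmetric]) measurable
  have 4: "(\<integral>\<^sup>+w. g (z, p, w) \<partial>(locM \<Otimes>\<^sub>M expM))
      = (\<integral>\<^sup>+l. \<integral>\<^sup>+x. g (z, p, l, x) \<partial>expM \<partial>locM)"
    if [measurable]: "z \<in> space gaussM" "p \<in> space poisM" for z p
    by (rule expM.nn_integral_fst [symmetric]) measurable
  show ?thesis
    unfolding 2
    by (rule nn_integral_cong, subst 3, assumption, rule nn_integral_cong, rule 4, assumption, assumption)
qed

lemma noise_parts:
  "fst \<in> noiseM \<rightarrow>\<^sub>M gaussM" "(\<lambda>n. fst (snd n)) \<in> noiseM \<rightarrow>\<^sub>M poisM"
  "(\<lambda>n. fst (snd (snd n))) \<in> noiseM \<rightarrow>\<^sub>M locM" "(\<lambda>n. snd (snd (snd n))) \<in> noiseM \<rightarrow>\<^sub>M expM"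
  unfolding noise_eq by measurable

lemma noise_at:
  "i \<in> {1..N} \<Longrightarrow> (\<lambda>n. fst n i) \<in> borel_measurable noiseM"
  "1 \<le> k \<Longrightarrow> (\<lambda>n. fst (snd n) k) \<in> noiseM \<rightarrow>\<^sub>M count_space UNIV"
  "q \<in> idxs \<Longrightarrow> (\<lambda>n. fst (snd (snd n)) q) \<in> noiseM \<rightarrow>\<^sub>M count_space UNIV"
  "q \<in> idxs \<Longrightarrow> (\<lambda>n. snd (snd (snd n)) q) \<in> borel_measurable noiseM"
  using measurable_compose [OF noise_parts(1) measurable_component_singleton [of i "{1..N}"]]
    measurable_compose [OF noise_parts(2) measurable_component_singleton [of k "{1..}"]]
    measurable_compose [OF noise_parts(3) measurable_component_singleton [of q idxs]]
    measurable_compose [OF noise_parts(4) measurable_component_singleton [of q idxs]]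
  by simp_all

lemma noise_spin_at: "q \<in> idxs \<Longrightarrow> (\<lambda>n. \<sigma> (fst (snd (snd n)) q) :: real) \<in> borel_measurable noiseM"
  by (rule measurable_compose [OF noise_at(3)]) auto

lemma meas_gauss_weight: "(\<lambda>n. gauss_weight lam (fst n) \<sigma>) \<in> borel_measurable noiseM"
  unfolding gauss_weight_def
  by (intro borel_measurable_prod measurable_compose [OF _ borel_measurable_exp] borel_measurable_diff borel_measurable_times
      noise_at(1) borel_measurable_const)

lemma meas_exp_weight: "(\<lambda>n. exp_weight K lam (fst (snd n)) (fst (snd (snd n))) (snd (snd (snd n))) \<sigma>) \<in> borel_measurable noiseM"
  unfolding exp_weight_def
proof (intro borel_measurable_prod)
  fix k assume "k \<in> {1..K}"
  then have k: "1 \<le> k" by simp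
  define t where "t j n = (1 + lam k * \<sigma> (fst (snd (snd n)) (j, k))) * exp (- (lam k * \<sigma> (fst (snd (snd n)) (j, k))) * snd (snd (snd n)) (j, k))"
    for j and n :: pert_sample
  have t: "t j \<in> borel_measurable noiseM" if "1 \<le> j" for j
  proof -
    have q: "(j, k) \<in> idxs" using that k by auto
    show ?thesis unfolding t_def
      by (intro borel_measurable_times borel_measurable_add measurable_compose [OF _ borel_measurable_exp] borel_measurable_uminus
          noise_spin_at [OF q] noise_at(4) [OF q] borel_measurable_const)
  qed
  have "(\<lambda>n. (\<lambda>c n. \<Prod>j=1..c. t j n) (fst (snd n) k) n) \<in> borel_measurable noiseM"
    by (rule measurable_compose_countable [OF _ noise_at(2) [OF k]], rule borel_measurable_prod, rule t) simp
  then show "(\<lambda>n. \<Prod>j=1..fst (snd n) k. (1 + lam k * \<sigma> (fst (snd (snd n)) (j, k))) * exp (- (lam k * \<sigma> (fst (snd (snd n)) (j, k))) * snd (snd (snd n)) (j, k))) \<in> borel_measurable noiseM"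
    unfolding t_def .
qed

lemma meas_obs_weight: "(\<lambda>n. obs_weight K lam n \<sigma>) \<in> borel_measurable noiseM"
  unfolding obs_weight_def by (intro borel_measurable_times borel_measurable_abs meas_gauss_weight meas_exp_weight)

lemma meas_shift: "shift K lam \<sigma>s \<in> noiseM \<rightarrow>\<^sub>M noiseM"
proof -
  have z: "(\<lambda>n. (\<lambda>i. if i \<in> {1..N} then sqrt (lam 0 * e) * \<sigma>s i + fst n i else fst n i)) \<in> noiseM \<rightarrow>\<^sub>M gaussM"
  proof (rule measurable_PiM_single')
    fix i assume i: "i \<in> {1..N}"
    have "(\<lambda>n. sqrt (lam 0 * e) * \<sigma>s i + fst n i) \<in> borel_measurable noiseM"
      by (intro borel_measurable_add noise_at(1) i borel_measurable_const)
    then show "(\<lambda>n. if i \<in> {1..N} then sqrt (lam 0 * e) * \<sigma>s i + fst n i else fst n i) \<in> noiseM \<rightarrow>\<^sub>M density lborel std_normal_density"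
      using i by simp
  next
    show "(\<lambda>n i. if i \<in> {1..N} then sqrt (lam 0 * e) * \<sigma>s i + fst n i else fst n i) \<in> space noiseM \<rightarrow> (\<Pi>\<^sub>E i\<in>{1..N}. space (density lborel std_normal_density))"
      using measurable_space [OF noise_parts(1)] by (auto simp: space_PiM PiE_iff extensional_def)
  qed
  have x: "(\<lambda>n. (\<lambda>q. if q \<in> revealed K (fst (snd n)) then snd (snd (snd n)) q / (1 + lam (snd q) * \<sigma>s (fst (snd (snd n)) q)) else snd (snd (snd n)) q)) \<in> noiseM \<rightarrow>\<^sub>M expM"
  proof (rule measurable_PiM_single')
    fix q assume q: "q \<in> idxs"
    then obtain j k where jk: "q = (j, k)" "1 \<le> k" "1 \<le> j" by (cases q) auto
    define A where "A n = snd (snd (snd n)) q / (1 + lam (snd q) * \<sigma>s (fst (snd (snd n)) q))" for n :: pert_sample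
    define B where "B n = snd (snd (snd n)) q" for n :: pert_sample
    have A: "A \<in> borel_measurable noiseM"
      unfolding A_def by (intro borel_measurable_divide borel_measurable_add borel_measurable_times noise_at(4) noise_spin_at q borel_measurable_const)
    have B: "B \<in> borel_measurable noiseM" unfolding B_def by (rule noise_at(4) [OF q])
    have "(\<lambda>n. (\<lambda>c n. if k \<le> K \<and> j \<le> c then A n else B n) (fst (snd n) k) n) \<in> borel_measurable noiseM"
    proof (rule measurable_compose_countable [OF _ noise_at(2) [OF jk(2)]])
      fix c :: nat
      show "(\<lambda>n. if k \<le> K \<and> j \<le> c then A n else B n) \<in> borel_measurable noiseM"
        using A B by (cases "k \<le> K \<and> j \<le> c") auto
    qed
    also have "(\<lambda>n. (\<lambda>c n. if k \<le> K \<and> j \<le> c then A n else B n) (fst (snd n) k) n)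
       = (\<lambda>n. if q \<in> revealed K (fst (snd n)) then snd (snd (snd n)) q / (1 + lam (snd q) * \<sigma>s (fst (snd (snd n)) q)) else snd (snd (snd n)) q)"
      unfolding A_def B_def revealed_def jk(1) using jk(2,3) by simp
    finally show "(\<lambda>n. if q \<in> revealed K (fst (snd n)) then snd (snd (snd n)) q / (1 + lam (snd q) * \<sigma>s (fst (snd (snd n)) q)) else snd (snd (snd n)) q) \<in> noiseM \<rightarrow>\<^sub>M expo"
      by (simp cong: measurable_cong_sets)
  next
    have "n \<in> space noiseM \<Longrightarrow> snd (snd (snd n)) \<in> space expM" for n
      by (rule measurable_space [OF noise_parts(4)])
    then show "(\<lambda>n q. if q \<in> revealed K (fst (snd n)) then snd (snd (snd n)) q / (1 + lam (snd q) * \<sigma>s (fst (snd (snd n)) q)) else snd (snd (snd n)) q) \<in> space noiseM \<rightarrow> (\<Pi>\<^sub>E i\<in>idxs. space expo)"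
      by (auto simp: space_PiM PiE_iff extensional_def revealed_def)
  qed
  have "(\<lambda>n. (\<lambda>i. if i \<in> {1..N} then sqrt (lam 0 * e) * \<sigma>s i + fst n i else fst n i, fst (snd n), fst (snd (snd n)),
      \<lambda>q. if q \<in> revealed K (fst (snd n)) then snd (snd (snd n)) q / (1 + lam (snd q) * \<sigma>s (fst (snd (snd n)) q)) else snd (snd (snd n)) q)) \<in> noiseM \<rightarrow>\<^sub>M gaussM \<Otimes>\<^sub>M marksM"
    by (intro measurable_Pair z x noise_parts)
  then show ?thesis unfolding shift_def split_beta' noise_eq [symmetric] .
qed

lemma spin_factor_pos:
  assumes "lam \<in> param_box" "1 \<le> k" "\<sigma> \<in> configs N" "i \<in> {1..N}"
  shows "0 < 1 + lam k * \<sigma> i"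
  using param_box_half [OF assms(1,2)] param_box_bounds(1) [OF assms(1), of k] unit_cases [OF config_abs [OF assms(3,4)]] by auto

lemma AE_loc_sites: "AE l in locM. \<forall>q\<in>idxs. l q \<in> {1..N}"
proof (subst AE_ball_countable)
  show "countable idxs" by simp
  show "\<forall>q\<in>idxs. AE l in locM. l q \<in> {1..N}"
  proof
    fix q assume "q \<in> idxs"
    then show "AE l in locM. l q \<in> {1..N}"
      by (rule AE_PiM_component [OF prob_space_measure_pmf]) (use N in \<open>auto simp: AE_measure_pmf_iff\<close>)
  qed
qed

text \<open>Given the signal \<open>\<sigma>s\<close>, the observations \<open>shift K lam \<sigma>s n\<close> have density \<open>obs_weight K lam n \<sigma>s\<close> relative to the noise: the sites
and counts are fixed, and then every Gaussian coordinate is shifted and every revealed exponential coordinate is rescaled.\<close>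

lemma noise_change:
  assumes lam: "lam \<in> param_box" and \<sigma>s: "\<sigma>s \<in> configs N" and \<phi>: "\<phi> \<in> borel_measurable noiseM"
  shows "(\<integral>\<^sup>+n. \<phi> (shift K lam \<sigma>s n) \<partial>noiseM) = (\<integral>\<^sup>+n. ennreal (obs_weight K lam n \<sigma>s) * \<phi> n \<partial>noiseM)"
proof -
  have m1: "(\<lambda>n. \<phi> (shift K lam \<sigma>s n)) \<in> borel_measurable noiseM"
    by (rule measurable_compose [OF meas_shift \<phi>])
  have m2: "(\<lambda>n. ennreal (obs_weight K lam n \<sigma>s) * \<phi> n) \<in> borel_measurable noiseM"
    by (intro borel_measurable_times_ennreal measurable_compose [OF meas_obs_weight measurable_ennreal] \<phi>)
  have \<phi>' [measurable]: "\<phi> \<in> borel_measurable (gaussM \<Otimes>\<^sub>M marksM)"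
    using \<phi> by (simp only: noise_eq)
  have em: "(\<lambda>n. exp_weight K lam (fst (snd n)) (fst (snd (snd n))) (snd (snd (snd n))) \<sigma>s) \<in> borel_measurable (gaussM \<Otimes>\<^sub>M marksM)"
    using meas_exp_weight [of K lam \<sigma>s] by (simp only: noise_eq)
  define W where "W n = ennreal \<bar>exp_weight K lam (fst (snd n)) (fst (snd (snd n))) (snd (snd (snd n))) \<sigma>s\<bar> * \<phi> n" for n
  have W [measurable]: "W \<in> borel_measurable (gaussM \<Otimes>\<^sub>M marksM)"
    unfolding W_def by (intro borel_measurable_times_ennreal measurable_compose [OF _ measurable_ennreal] borel_measurable_abs em \<phi>')
  define zs where "zs z = (\<lambda>i. if i \<in> {1..N} then sqrt (lam 0 * e) * \<sigma>s i + z i else z i)" for z :: "nat \<Rightarrow> real"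
  have zs: "z \<in> space gaussM \<Longrightarrow> zs z \<in> space gaussM" for z
    by (auto simp: zs_def space_PiM PiE_iff extensional_def)
  define J where "J z p l = (\<integral>\<^sup>+x. W (z, p, l, x) \<partial>expM)" for z p l
  \<comment> \<open>first the exponential coordinates, with sites and counts fixed\<close>
  have x_change: "(\<integral>\<^sup>+x. \<phi> (shift K lam \<sigma>s (z, p, l, x)) \<partial>expM) = J (zs z) p l"
    if z [measurable]: "z \<in> space gaussM" and p [measurable]: "p \<in> space poisM" and l [measurable]: "l \<in> space locM" and sites: "\<forall>q\<in>idxs. l q \<in> {1..N}" for z p l
  proof -
    have sp: "0 < 1 + lam (snd q) * \<sigma>s (l q)" if "q \<in> revealed K p" for q
    proof -
      have "q \<in> idxs" "1 \<le> snd q" using that by (auto simp: revealed_def)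
      then show ?thesis using spin_factor_pos [OF lam _ \<sigma>s] sites by blast
    qed
    note zsz [measurable] = zs [OF z]
    have "(\<integral>\<^sup>+x. \<phi> (shift K lam \<sigma>s (z, p, l, x)) \<partial>expM)
       = (\<integral>\<^sup>+x. (\<lambda>x. \<phi> (zs z, p, l, x)) (\<lambda>q. if q \<in> revealed K p then x q / (1 + lam (snd q) * \<sigma>s (l q)) else x q) \<partial>expM)"
      by (simp add: shift_def zs_def)
    also have "\<dots> = (\<integral>\<^sup>+x. (\<Prod>q\<in>revealed K p. ennreal ((1 + lam (snd q) * \<sigma>s (l q)) * exp (- ((1 + lam (snd q) * \<sigma>s (l q)) - 1) * x q))) * \<phi> (zs z, p, l, x) \<partial>expM)"
    proof (rule nn_integral_PiM_change_of_variables [OF prob_exp1 finite_revealed])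
      show "revealed K p \<subseteq> idxs" by (auto simp: revealed_def)
      show "(\<lambda>x. \<phi> (zs z, p, l, x)) \<in> borel_measurable expM" by measurable
      fix q and f :: "real \<Rightarrow> ennreal" assume q: "q \<in> revealed K p" and f: "f \<in> borel_measurable expo"
      then show "(\<integral>\<^sup>+x. f (x / (1 + lam (snd q) * \<sigma>s (l q))) \<partial>expo) = (\<integral>\<^sup>+x. ennreal ((1 + lam (snd q) * \<sigma>s (l q)) * exp (- ((1 + lam (snd q) * \<sigma>s (l q)) - 1) * x)) * f x \<partial>expo)"
        by (intro nn_integral_exponential_scale sp) simp
    qed auto
    also have "\<dots> = J (zs z) p l"
      unfolding J_def
    proof (rule nn_integral_cong)
      fix x
      have "(\<Prod>q\<in>revealed K p. ennreal ((1 + lam (snd q) * \<sigma>s (l q)) * exp (- ((1 + lam (snd q) * \<sigma>s (l q)) - 1) * x q)))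
         = ennreal (\<Prod>q\<in>revealed K p. (1 + lam (snd q) * \<sigma>s (l q)) * exp (- (lam (snd q) * \<sigma>s (l q)) * x q))"
        by (subst prod_ennreal) (auto intro!: mult_nonneg_nonneg less_imp_le [OF sp])
      also have "(\<Prod>q\<in>revealed K p. (1 + lam (snd q) * \<sigma>s (l q)) * exp (- (lam (snd q) * \<sigma>s (l q)) * x q)) = \<bar>exp_weight K lam p l x \<sigma>s\<bar>"
      proof -
        have "0 \<le> (\<Prod>q\<in>revealed K p. (1 + lam (snd q) * \<sigma>s (l q)) * exp (- (lam (snd q) * \<sigma>s (l q)) * x q))"
          by (intro prod_nonneg mult_nonneg_nonneg) (auto intro: less_imp_le [OF sp])
        then show ?thesis unfolding exp_weight_def prod_revealed by simp
      qed
      finally show "(\<Prod>q\<in>revealed K p. ennreal ((1 + lam (snd q) * \<sigma>s (l q)) * exp (- ((1 + lam (snd q) * \<sigma>s (l q)) - 1) * x q))) * \<phi> (zs z, p, l, x)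
        = W (zs z, p, l, x)" by (simp add: W_def)
    qed
    finally show ?thesis .
  qed
  have JM [measurable]: "(\<lambda>z. \<integral>\<^sup>+p. \<integral>\<^sup>+l. J z p l \<partial>locM \<partial>poisM) \<in> borel_measurable gaussM"
    unfolding J_def by measurable
  have "(\<integral>\<^sup>+n. \<phi> (shift K lam \<sigma>s n) \<partial>noiseM) = (\<integral>\<^sup>+z. (\<lambda>z. \<integral>\<^sup>+p. \<integral>\<^sup>+l. J z p l \<partial>locM \<partial>poisM) (\<lambda>i. if i \<in> {1..N} then sqrt (lam 0 * e) * \<sigma>s i + z i else z i) \<partial>gaussM)"
    unfolding nn_integral_noise [OF m1]
  proof (rule nn_integral_cong)
    fix z assume z: "z \<in> space gaussM"
    have "(\<integral>\<^sup>+p. \<integral>\<^sup>+l. \<integral>\<^sup>+x. \<phi> (shift K lam \<sigma>s (z, p, l, x)) \<partial>expM \<partial>locM \<partial>poisM) = (\<integral>\<^sup>+p. \<integral>\<^sup>+l. J (zs z) p l \<partial>locM \<partial>poisM)"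
    proof (rule nn_integral_cong)
      fix p assume p: "p \<in> space poisM"
      show "(\<integral>\<^sup>+l. \<integral>\<^sup>+x. \<phi> (shift K lam \<sigma>s (z, p, l, x)) \<partial>expM \<partial>locM) = (\<integral>\<^sup>+l. J (zs z) p l \<partial>locM)"
      proof (rule nn_integral_cong_AE)
        show "AE l in locM. (\<integral>\<^sup>+x. \<phi> (shift K lam \<sigma>s (z, p, l, x)) \<partial>expM) = J (zs z) p l"
          using AE_loc_sites AE_space
        proof eventually_elim
          case (elim l)
          show ?case by (rule x_change [OF z p elim(2,1)])
        qed
      qed
    qed
    then show "(\<integral>\<^sup>+p. \<integral>\<^sup>+l. \<integral>\<^sup>+x. \<phi> (shift K lam \<sigma>s (z, p, l, x)) \<partial>expM \<partial>locM \<partial>poisM)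
       = (\<lambda>z. \<integral>\<^sup>+p. \<integral>\<^sup>+l. J z p l \<partial>locM \<partial>poisM) (\<lambda>i. if i \<in> {1..N} then sqrt (lam 0 * e) * \<sigma>s i + z i else z i)"
      by (simp only: zs_def)
  qed
  \<comment> \<open>then the Gaussian coordinates\<close>
  also have "\<dots> = (\<integral>\<^sup>+z. (\<Prod>i\<in>{1..N}. ennreal (exp (sqrt (lam 0 * e) * \<sigma>s i * z i - (sqrt (lam 0 * e) * \<sigma>s i)\<^sup>2 / 2))) * (\<integral>\<^sup>+p. \<integral>\<^sup>+l. J z p l \<partial>locM \<partial>poisM) \<partial>gaussM)"
    by (rule nn_integral_PiM_change_of_variables [OF prob_space_normal_density _ _ _ _ _ JM])
      (auto intro!: nn_integral_std_normal_shift)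
  also have "\<dots> = (\<integral>\<^sup>+z. \<integral>\<^sup>+p. \<integral>\<^sup>+l. \<integral>\<^sup>+x. ennreal (obs_weight K lam (z, p, l, x) \<sigma>s) * \<phi> (z, p, l, x) \<partial>expM \<partial>locM \<partial>poisM \<partial>gaussM)"
  proof (rule nn_integral_cong)
    fix z assume z [measurable]: "z \<in> space gaussM"
    let ?c = "gauss_weight lam z \<sigma>s"
    have c0: "0 \<le> ?c" unfolding gauss_weight_def by (intro prod_nonneg) auto
    have "(\<Prod>i\<in>{1..N}. ennreal (exp (sqrt (lam 0 * e) * \<sigma>s i * z i - (sqrt (lam 0 * e) * \<sigma>s i)\<^sup>2 / 2))) = ennreal ?c"
      unfolding gauss_weight_def by (rule prod_ennreal) simp
    moreover have "ennreal ?c * (\<integral>\<^sup>+p. \<integral>\<^sup>+l. J z p l \<partial>locM \<partial>poisM) = (\<integral>\<^sup>+p. ennreal ?c * (\<integral>\<^sup>+l. J z p l \<partial>locM) \<partial>poisM)"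
      unfolding J_def by (rule nn_integral_cmult [symmetric]) measurable
    moreover have "(\<integral>\<^sup>+p. ennreal ?c * (\<integral>\<^sup>+l. J z p l \<partial>locM) \<partial>poisM) = (\<integral>\<^sup>+p. \<integral>\<^sup>+l. \<integral>\<^sup>+x. ennreal (obs_weight K lam (z, p, l, x) \<sigma>s) * \<phi> (z, p, l, x) \<partial>expM \<partial>locM \<partial>poisM)"
    proof (rule nn_integral_cong)
      fix p assume p [measurable]: "p \<in> space poisM"
      have "ennreal ?c * (\<integral>\<^sup>+l. J z p l \<partial>locM) = (\<integral>\<^sup>+l. ennreal ?c * J z p l \<partial>locM)"
        unfolding J_def by (rule nn_integral_cmult [symmetric]) measurable
      also have "\<dots> = (\<integral>\<^sup>+l. \<integral>\<^sup>+x. ennreal (obs_weight K lam (z, p, l, x) \<sigma>s) * \<phi> (z, p, l, x) \<partial>expM \<partial>locM)"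
      proof (rule nn_integral_cong)
        fix l assume l [measurable]: "l \<in> space locM"
        have "(\<lambda>x. W (z, p, l, x)) \<in> borel_measurable expM" by measurable
        from nn_integral_cmult [OF this, of "ennreal ?c", symmetric]
        show "ennreal ?c * J z p l = (\<integral>\<^sup>+x. ennreal (obs_weight K lam (z, p, l, x) \<sigma>s) * \<phi> (z, p, l, x) \<partial>expM)"
          unfolding J_def by (simp add: W_def obs_weight_def ennreal_mult' c0 mult.assoc)
      qed
      finally show "ennreal ?c * (\<integral>\<^sup>+l. J z p l \<partial>locM) = (\<integral>\<^sup>+l. \<integral>\<^sup>+x. ennreal (obs_weight K lam (z, p, l, x) \<sigma>s) * \<phi> (z, p, l, x) \<partial>expM \<partial>locM)" .
    qed
    ultimately show "(\<Prod>i\<in>{1..N}. ennreal (exp (sqrt (lam 0 * e) * \<sigma>s i * z i - (sqrt (lam 0 * e) * \<sigma>s i)\<^sup>2 / 2))) * (\<integral>\<^sup>+p. \<integral>\<^sup>+l. J z p l \<partial>locM \<partial>poisM)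
      = (\<integral>\<^sup>+p. \<integral>\<^sup>+l. \<integral>\<^sup>+x. ennreal (obs_weight K lam (z, p, l, x) \<sigma>s) * \<phi> (z, p, l, x) \<partial>expM \<partial>locM \<partial>poisM)"
      by simp
  qed
  also have "\<dots> = (\<integral>\<^sup>+n. ennreal (obs_weight K lam n \<sigma>s) * \<phi> n \<partial>noiseM)"
    by (rule nn_integral_noise [OF m2, symmetric])
  finally show ?thesis .
qed

definition post_weight :: "nat \<Rightarrow> (nat \<Rightarrow> real) \<Rightarrow> (nat \<Rightarrow> real) \<times> 'o \<Rightarrow> 'y \<Rightarrow> pert_sample \<Rightarrow> spins \<Rightarrow> real" where
  "post_weight K lam h y n \<sigma> = exp (\<Sum>i=1..N. fst h i * \<sigma> i) * P_out m y \<sigma> (snd h) * obs_weight K lam n \<sigma>"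

definition post :: "nat \<Rightarrow> (nat \<Rightarrow> real) \<Rightarrow> (nat \<Rightarrow> real) \<times> 'o \<Rightarrow> 'y \<Rightarrow> pert_sample \<Rightarrow> spins \<Rightarrow> real" where
  "post K lam h y n \<sigma> = post_weight K lam h y n \<sigma> / (\<Sum>\<tau>\<in>configs N. post_weight K lam h y n \<tau>)"

definition data :: "nat \<Rightarrow> (nat \<Rightarrow> real) \<Rightarrow> ('o, 'y) disorder \<Rightarrow> pert_sample" where
  "data K lam \<omega> = shift K lam (sig \<omega>) (snd \<omega>)"

abbreviation "dataM \<equiv> hyper_law m \<Otimes>\<^sub>M (ref_meas m \<Otimes>\<^sub>M noiseM)"

lemma meas_post_weight:
  assumes \<sigma>: "\<sigma> \<in> configs N"
  shows "(\<lambda>d. post_weight K lam (fst d) (fst (snd d)) (snd (snd d)) \<sigma>) \<in> borel_measurable dataM"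
proof -
  have h: "fst \<in> dataM \<rightarrow>\<^sub>M PiM {1..N} (\<lambda>_. borel) \<Otimes>\<^sub>M out_space m" by measurable
  have "(\<lambda>d. fst (fst d) i) \<in> borel_measurable dataM" if i: "i \<in> {1..N}" for i
    using measurable_compose [OF measurable_compose [OF h measurable_fst] measurable_component_singleton [OF i]] .
  moreover have "(\<lambda>d. P_out m (fst (snd d)) \<sigma> (snd (fst d))) \<in> borel_measurable dataM"
  proof -
    have "(\<lambda>d. (fst (snd d), snd (fst d))) \<in> dataM \<rightarrow>\<^sub>M ref_meas m \<Otimes>\<^sub>M out_space m" by measurable
    from measurable_compose [OF this P_out_meas [OF \<sigma>]] show ?thesis by simp
  qed
  moreover have "(\<lambda>d. obs_weight K lam (snd (snd d)) \<sigma>) \<in> borel_measurable dataM"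
    by (rule measurable_compose [OF _ meas_obs_weight]) measurable
  ultimately show ?thesis unfolding post_weight_def
    by (intro borel_measurable_times measurable_compose [OF _ borel_measurable_exp] borel_measurable_sum borel_measurable_const)
qed

lemma meas_post:
  "\<sigma> \<in> configs N \<Longrightarrow> (\<lambda>d. post K lam (fst d) (fst (snd d)) (snd (snd d)) \<sigma>) \<in> borel_measurable dataM"
  unfolding post_def by (intro borel_measurable_divide borel_measurable_sum meas_post_weight)

lemma meas_data_law:
  assumes f: "\<And>\<sigma>. \<sigma> \<in> configs N \<Longrightarrow> (\<lambda>d. f \<sigma> (fst d) (fst (snd d)) (snd (snd d))) \<in> dataM \<rightarrow>\<^sub>M A"
  shows "(\<lambda>\<omega>. f (sig \<omega>) (hyp \<omega>) (obs \<omega>) (data K lam \<omega>)) \<in> lawM \<rightarrow>\<^sub>M A"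
proof -
  have "(\<lambda>\<omega>. (\<lambda>\<sigma> \<omega>. f \<sigma> (hyp \<omega>) (obs \<omega>) (shift K lam \<sigma> (snd \<omega>))) (sig \<omega>) \<omega>) \<in> lawM \<rightarrow>\<^sub>M A"
  proof (rule measurable_compose_countable' [OF _ meas_sig])
    fix \<sigma> assume \<sigma>: "\<sigma> \<in> configs N"
    have "hyp \<in> lawM \<rightarrow>\<^sub>M hyper_law m" using meas_hyp by (simp cong: measurable_cong_sets add: sets_hyper)
    then have "(\<lambda>\<omega>. (hyp \<omega>, obs \<omega>, shift K lam \<sigma> (snd \<omega>))) \<in> lawM \<rightarrow>\<^sub>M dataM"
      by (intro measurable_Pair meas_obs measurable_compose [OF meas_fst_law(2) meas_shift])
    from measurable_compose [OF this f [OF \<sigma>]] show "(\<lambda>\<omega>. f \<sigma> (hyp \<omega>) (obs \<omega>) (shift K lam \<sigma> (snd \<omega>))) \<in> lawM \<rightarrow>\<^sub>M A"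
      by simp
  qed (simp add: countable_finite)
  then show ?thesis by (simp add: data_def)
qed

lemma sum_tilted_prior: "0 < (\<Sum>\<tau>\<in>configs N. exp (\<Sum>i=1..N. th i * \<tau> i :: real))"
  unfolding sum_exp_configs by (intro prod_pos) (auto intro: add_pos_pos)

text \<open>Bayes' rule. Conditionally on the hyperparameters and on all observations, the signal has weights proportional to \<open>post_weight\<close>; the
denominator is the normalisation of the prior.\<close>

lemma nn_integral_data:
  assumes lam: "lam \<in> param_box"
    and \<Phi>: "\<And>\<sigma>. \<sigma> \<in> configs N \<Longrightarrow> (\<lambda>d. \<Phi> \<sigma> (fst d) (fst (snd d)) (snd (snd d))) \<in> borel_measurable dataM"
  shows "(\<integral>\<^sup>+\<omega>. \<Phi> (sig \<omega>) (hyp \<omega>) (obs \<omega>) (data K lam \<omega>) \<partial>lawM)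
    = (\<integral>\<^sup>+h. \<integral>\<^sup>+y. \<integral>\<^sup>+n. (\<Sum>\<sigma>\<in>configs N. ennreal (post_weight K lam h y n \<sigma> / (\<Sum>\<tau>\<in>configs N. exp (\<Sum>i=1..N. fst h i * \<tau> i))) * \<Phi> \<sigma> h y n)
      \<partial>noiseM \<partial>ref_meas m \<partial>hyper_law m)"
proof -
  define f0 where "f0 \<omega> = \<Phi> (sig \<omega>) (hyp \<omega>) (obs \<omega>) (data K lam \<omega>)" for \<omega>
  have fm: "f0 \<in> borel_measurable lawM" unfolding f0_def by (rule meas_data_law [where f = \<Phi>, OF \<Phi>])
  then have fm': "f0 \<in> borel_measurable (baseM \<Otimes>\<^sub>M noiseM)" by (simp only: law_def)
  have gm: "(\<lambda>b. \<integral>\<^sup>+n. f0 (b, n) \<partial>noiseM) \<in> borel_measurable priorM"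
  proof -
    have "(\<lambda>b. \<integral>\<^sup>+n. f0 (b, n) \<partial>noiseM) \<in> borel_measurable baseM"
      by (rule noise.borel_measurable_nn_integral) (use fm' in \<open>simp only: case_prod_eta\<close>)
    then show ?thesis by (simp cong: measurable_cong_sets add: sets_base)
  qed
  have "(\<integral>\<^sup>+\<omega>. f0 \<omega> \<partial>lawM) = (\<integral>\<^sup>+b. \<integral>\<^sup>+n. f0 (b, n) \<partial>noiseM \<partial>baseM)"
    unfolding law_def by (rule noise.nn_integral_fst [symmetric, OF fm'])
  also have "\<dots> = (\<integral>\<^sup>+h. \<integral>\<^sup>+y. (\<Sum>\<sigma>\<in>configs N. ennreal (prior N (fst h) \<sigma> * P_out m y \<sigma> (snd h)) * (\<integral>\<^sup>+n. f0 ((h, \<sigma>, y), n) \<partial>noiseM)) \<partial>ref_meas m \<partial>hyper_law m)"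
    by (rule nn_integral_base [OF gm])
  also have "\<dots> = (\<integral>\<^sup>+h. \<integral>\<^sup>+y. \<integral>\<^sup>+n. (\<Sum>\<sigma>\<in>configs N. ennreal (post_weight K lam h y n \<sigma> / (\<Sum>\<tau>\<in>configs N. exp (\<Sum>i=1..N. fst h i * \<tau> i))) * \<Phi> \<sigma> h y n)
      \<partial>noiseM \<partial>ref_meas m \<partial>hyper_law m)"
  proof (rule nn_integral_cong, rule nn_integral_cong)
    fix h y assume h: "h \<in> space (hyper_law m)" and y: "y \<in> space (ref_meas m)"
    have t: "snd h \<in> space (out_space m)" using h by (auto simp: space_hyper space_pair_measure)
    let ?Z = "\<Sum>\<tau>\<in>configs N. exp (\<Sum>i=1..N. fst h i * \<tau> i)"
    have sec: "(\<lambda>n. \<Phi> \<sigma> h y n) \<in> borel_measurable noiseM" if "\<sigma> \<in> configs N" for \<sigma>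
      using measurable_compose [OF measurable_Pair1' [OF y] measurable_compose [OF measurable_Pair1' [OF h] \<Phi> [OF that]]] by simp
    have secw: "(\<lambda>n. post_weight K lam h y n \<sigma>) \<in> borel_measurable noiseM" if "\<sigma> \<in> configs N" for \<sigma>
      using measurable_compose [OF measurable_Pair1' [OF y] measurable_compose [OF measurable_Pair1' [OF h] meas_post_weight [OF that]]] by simp
    have one: "ennreal (prior N (fst h) \<sigma> * P_out m y \<sigma> (snd h)) * (\<integral>\<^sup>+n. f0 ((h, \<sigma>, y), n) \<partial>noiseM)
        = (\<integral>\<^sup>+n. ennreal (post_weight K lam h y n \<sigma> / ?Z) * \<Phi> \<sigma> h y n \<partial>noiseM)" if \<sigma>: "\<sigma> \<in> configs N" for \<sigma>
    proof -
      let ?c = "prior N (fst h) \<sigma> * P_out m y \<sigma> (snd h)"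
      have c0: "0 \<le> ?c" using P_out_nonneg [OF \<sigma> t y] prior_nonneg by simp
      have "(\<integral>\<^sup>+n. f0 ((h, \<sigma>, y), n) \<partial>noiseM) = (\<integral>\<^sup>+n. \<Phi> \<sigma> h y (shift K lam \<sigma> n) \<partial>noiseM)"
        by (simp add: data_def f0_def)
      also have "\<dots> = (\<integral>\<^sup>+n. ennreal (obs_weight K lam n \<sigma>) * \<Phi> \<sigma> h y n \<partial>noiseM)"
        by (rule noise_change [OF lam \<sigma> sec [OF \<sigma>]])
      finally have I: "(\<integral>\<^sup>+n. f0 ((h, \<sigma>, y), n) \<partial>noiseM) = (\<integral>\<^sup>+n. ennreal (obs_weight K lam n \<sigma>) * \<Phi> \<sigma> h y n \<partial>noiseM)" .
      have "ennreal ?c * (\<integral>\<^sup>+n. f0 ((h, \<sigma>, y), n) \<partial>noiseM) = (\<integral>\<^sup>+n. ennreal ?c * (ennreal (obs_weight K lam n \<sigma>) * \<Phi> \<sigma> h y n) \<partial>noiseM)"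
        unfolding I by (rule nn_integral_cmult [symmetric])
          (intro borel_measurable_times_ennreal measurable_compose [OF _ measurable_ennreal] sec [OF \<sigma>] meas_obs_weight)
      also have "\<dots> = (\<integral>\<^sup>+n. ennreal (post_weight K lam h y n \<sigma> / ?Z) * \<Phi> \<sigma> h y n \<partial>noiseM)"
      proof (rule nn_integral_cong)
        fix n
        have "post_weight K lam h y n \<sigma> / ?Z = ?c * obs_weight K lam n \<sigma>"
          unfolding post_weight_def prior_eq_normalised_exp by simp
        moreover have "ennreal (?c * obs_weight K lam n \<sigma>) = ennreal ?c * ennreal (obs_weight K lam n \<sigma>)"
          by (rule ennreal_mult [OF c0 obs_weight_nonneg])
        ultimately show "ennreal ?c * (ennreal (obs_weight K lam n \<sigma>) * \<Phi> \<sigma> h y n) = ennreal (post_weight K lam h y n \<sigma> / ?Z) * \<Phi> \<sigma> h y n"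
          by (simp only: mult.assoc)
      qed
      finally show ?thesis .
    qed
    have "(\<Sum>\<sigma>\<in>configs N. ennreal (prior N (fst h) \<sigma> * P_out m y \<sigma> (snd h)) * (\<integral>\<^sup>+n. f0 ((h, \<sigma>, y), n) \<partial>noiseM))
      = (\<Sum>\<sigma>\<in>configs N. \<integral>\<^sup>+n. ennreal (post_weight K lam h y n \<sigma> / ?Z) * \<Phi> \<sigma> h y n \<partial>noiseM)"
      by (rule sum.cong [OF refl one])
    also have "\<dots> = (\<integral>\<^sup>+n. (\<Sum>\<sigma>\<in>configs N. ennreal (post_weight K lam h y n \<sigma> / ?Z) * \<Phi> \<sigma> h y n) \<partial>noiseM)"
      by (rule nn_integral_sum [symmetric])
        (intro borel_measurable_times_ennreal measurable_compose [OF _ measurable_ennreal] borel_measurable_divide secw sec borel_measurable_const)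
    finally show "(\<Sum>\<sigma>\<in>configs N. ennreal (prior N (fst h) \<sigma> * P_out m y \<sigma> (snd h)) * (\<integral>\<^sup>+n. f0 ((h, \<sigma>, y), n) \<partial>noiseM))
      = (\<integral>\<^sup>+n. (\<Sum>\<sigma>\<in>configs N. ennreal (post_weight K lam h y n \<sigma> / ?Z) * \<Phi> \<sigma> h y n) \<partial>noiseM)" .
  qed
  finally show ?thesis unfolding f0_def .
qed

text \<open>A probability law on \<open>{-1, 1}\<close> is determined by its mean.\<close>

lemma sum_two_point:
  assumes "(\<Sum>\<sigma>\<in>configs N. g \<sigma>) = 1" and i: "i \<in> {1..N}"
  shows "(\<Sum>\<sigma>\<in>configs N. g \<sigma> * f (\<sigma> i)) = two_point (magv g i) f"
proof -
  have "f (\<sigma> i) = (f 1 + f (-1)) / 2 + \<sigma> i * ((f 1 - f (-1)) / 2)" if "\<sigma> \<in> configs N" for \<sigma>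
    using configs_cases [OF that i] by (auto simp: field_simps)
  then have "(\<Sum>\<sigma>\<in>configs N. g \<sigma> * f (\<sigma> i)) = (\<Sum>\<sigma>\<in>configs N. g \<sigma> * ((f 1 + f (-1)) / 2) + g \<sigma> * \<sigma> i * ((f 1 - f (-1)) / 2))"
    by (intro sum.cong refl) (simp add: distrib_left mult.assoc)
  also have "\<dots> = (f 1 + f (-1)) / 2 + magv g i * ((f 1 - f (-1)) / 2)"
  proof -
    have "(\<Sum>\<sigma>\<in>configs N. g \<sigma> * ((f 1 + f (-1)) / 2) + g \<sigma> * \<sigma> i * ((f 1 - f (-1)) / 2))
      = (\<Sum>\<sigma>\<in>configs N. g \<sigma>) * ((f 1 + f (-1)) / 2) + (\<Sum>\<sigma>\<in>configs N. g \<sigma> * \<sigma> i) * ((f 1 - f (-1)) / 2)"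
      by (simp only: sum.distrib sum_distrib_right)
    then show ?thesis by (simp only: assms(1) magv_def mult_1)
  qed
  also have "\<dots> = two_point (magv g i) f" unfolding two_point_def by (simp add: field_simps)
  finally show ?thesis .
qed

lemma magv_bound:
  assumes "\<And>\<sigma>. \<sigma> \<in> configs N \<Longrightarrow> 0 \<le> g \<sigma>" "(\<Sum>\<sigma>\<in>configs N. g \<sigma>) \<le> 1" "i \<in> {1..N}"
  shows "\<bar>magv g i\<bar> \<le> 1"
proof -
  have "\<bar>magv g i\<bar> \<le> (\<Sum>\<sigma>\<in>configs N. g \<sigma>)"
    unfolding magv_def
    by (rule order_trans [OF sum_abs], rule sum_mono) (use assms(1,3) config_abs in \<open>simp add: abs_mult\<close>)
  with assms(2) show ?thesis by simp
qed

lemma post_weight_nonneg: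
  assumes "h \<in> space (hyper_law m)" "y \<in> space (ref_meas m)" "\<sigma> \<in> configs N"
  shows "0 \<le> post_weight K lam h y n \<sigma>"
proof -
  have "snd h \<in> space (out_space m)" using assms(1) by (auto simp: space_hyper space_pair_measure)
  then show ?thesis
    unfolding post_weight_def by (intro mult_nonneg_nonneg P_out_nonneg assms obs_weight_nonneg) auto
qed

lemma empv_bound:
  assumes "\<And>x. \<bar>x\<bar> \<le> 1 \<Longrightarrow> \<bar>h x\<bar> \<le> c" "\<And>i. i \<in> {1..N} \<Longrightarrow> \<bar>magv g i\<bar> \<le> 1"
  shows "\<bar>empv h g\<bar> \<le> c"
proof -
  have "\<bar>\<Sum>i=1..N. h (magv g i)\<bar> \<le> (\<Sum>i=1..N. c)"
    by (rule order_trans [OF sum_abs]) (intro sum_mono assms)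
  then show ?thesis using N by (simp add: empv_def abs_divide divide_le_eq mult.commute)
qed

text \<open>Both sides are integrals of functions of the observations against the joint law of \<open>nn_integral_data\<close>. Summing over the signal with
its posterior weights replaces \<open>\<psi> _ (\<sigma>_i)\<close> by its posterior mean, which depends on the magnetisation only.\<close>

lemma nishimori_truncated:
  fixes h :: "real \<Rightarrow> real" and \<psi> :: "real \<Rightarrow> real \<Rightarrow> real" and K :: nat
  assumes lam: "lam \<in> param_box" and i: "i \<in> {1..N}"
    and h: "h \<in> borel_measurable borel" "\<And>x. \<bar>x\<bar> \<le> 1 \<Longrightarrow> \<bar>h x\<bar> \<le> C"
    and \<psi>: "\<And>c. (\<lambda>x. \<psi> x c) \<in> borel_measurable borel" "\<And>x c. \<bar>x\<bar> \<le> 1 \<Longrightarrow> \<bar>c\<bar> = 1 \<Longrightarrow> \<bar>\<psi> x c\<bar> \<le> D"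
    and C: "0 \<le> C"
  defines "g \<equiv> \<lambda>\<omega>. post K lam (hyp \<omega>) (obs \<omega>) (data K lam \<omega>)"
  shows "(\<integral>\<omega>. empv h (g \<omega>) * \<psi> (magv (g \<omega>) i) (sig \<omega> i) \<partial>lawM)
    = (\<integral>\<omega>. empv h (g \<omega>) * two_point (magv (g \<omega>) i) (\<psi> (magv (g \<omega>) i)) \<partial>lawM)" (is "(\<integral>\<omega>. ?A \<omega> \<partial>lawM) = (\<integral>\<omega>. ?B \<omega> \<partial>lawM)")
    and "(\<lambda>\<omega>. empv h (g \<omega>) * \<psi> (magv (g \<omega>) i) (sig \<omega> i)) \<in> borel_measurable lawM"
    and "(\<lambda>\<omega>. empv h (g \<omega>) * two_point (magv (g \<omega>) i) (\<psi> (magv (g \<omega>) i))) \<in> borel_measurable lawM"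
    and "AE \<omega> in lawM. \<bar>empv h (g \<omega>) * \<psi> (magv (g \<omega>) i) (sig \<omega> i)\<bar> \<le> C * D"
    and "AE \<omega> in lawM. \<bar>empv h (g \<omega>) * two_point (magv (g \<omega>) i) (\<psi> (magv (g \<omega>) i))\<bar> \<le> C * D"
proof -
  have mm: "(\<lambda>d. magv (post K lam (fst d) (fst (snd d)) (snd (snd d))) j) \<in> borel_measurable dataM" for j
    unfolding magv_def by (intro borel_measurable_sum borel_measurable_times meas_post borel_measurable_const)
  have em: "(\<lambda>d. empv h (post K lam (fst d) (fst (snd d)) (snd (snd d)))) \<in> borel_measurable dataM"
    unfolding empv_def by (intro borel_measurable_divide borel_measurable_sum measurable_compose [OF mm h(1)] borel_measurable_const)
  define R1 where "R1 \<sigma> h' y n = empv h (post K lam h' y n) * \<psi> (magv (post K lam h' y n) i) (\<sigma> i)" for \<sigma> :: spins and h' y n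
  define R2 where "R2 \<sigma> h' y n = empv h (post K lam h' y n) * two_point (magv (post K lam h' y n) i) (\<psi> (magv (post K lam h' y n) i))" for \<sigma> :: spins and h' y n
  have R1m: "(\<lambda>d. R1 \<sigma> (fst d) (fst (snd d)) (snd (snd d))) \<in> borel_measurable dataM" for \<sigma>
    unfolding R1_def by (intro borel_measurable_times em measurable_compose [OF mm \<psi>(1)])
  have R2m: "(\<lambda>d. R2 \<sigma> (fst d) (fst (snd d)) (snd (snd d))) \<in> borel_measurable dataM" for \<sigma>
    unfolding R2_def two_point_def
    by (intro borel_measurable_times borel_measurable_add borel_measurable_diff borel_measurable_divide em mm measurable_compose [OF mm \<psi>(1)] borel_measurable_const)
  have A: "?A \<omega> = R1 (sig \<omega>) (hyp \<omega>) (obs \<omega>) (data K lam \<omega>)" for \<omega> by (simp add: R1_def g_def)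
  have B: "?B \<omega> = R2 (sig \<omega>) (hyp \<omega>) (obs \<omega>) (data K lam \<omega>)" for \<omega> by (simp add: R2_def g_def)
  show Am: "?A \<in> borel_measurable lawM" unfolding A by (rule meas_data_law [where f = R1, OF R1m])
  show Bm: "?B \<in> borel_measurable lawM" unfolding B by (rule meas_data_law [where f = R2, OF R2m])
  have gb: "\<bar>magv (post K lam h' y n) j\<bar> \<le> 1" if "h' \<in> space (hyper_law m)" "y \<in> space (ref_meas m)" "j \<in> {1..N}" for h' y n j
  proof (rule magv_bound [OF _ _ that(3)])
    have s0: "0 \<le> (\<Sum>\<tau>\<in>configs N. post_weight K lam h' y n \<tau>)"
      by (intro sum_nonneg post_weight_nonneg that)
    show "0 \<le> post K lam h' y n \<sigma>" if "\<sigma> \<in> configs N" for \<sigma>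
      unfolding post_def by (intro divide_nonneg_nonneg s0 post_weight_nonneg that \<open>h' \<in> _\<close> \<open>y \<in> _\<close>)
    show "(\<Sum>\<sigma>\<in>configs N. post K lam h' y n \<sigma>) \<le> 1"
      unfolding post_def sum_divide_distrib [symmetric] by (simp add: divide_self_if)
  qed
  have D: "0 \<le> D" using \<psi>(2) [of 0 1] by auto
  have R1b: "\<bar>R1 \<sigma> h' y n\<bar> \<le> C * D" if "h' \<in> space (hyper_law m)" "y \<in> space (ref_meas m)" "\<sigma> \<in> configs N" for \<sigma> h' y n
    unfolding R1_def abs_mult
    by (intro mult_mono empv_bound h \<psi>(2) gb that i C config_abs [OF that(3) i]) auto
  have R2b: "\<bar>R2 \<sigma> h' y n\<bar> \<le> C * D" if "h' \<in> space (hyper_law m)" "y \<in> space (ref_meas m)" for \<sigma> h' y n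
    unfolding R2_def abs_mult
    by (intro mult_mono empv_bound h two_point_bound \<psi>(2) gb that i C) auto
  have pointsum: "(\<Sum>\<sigma>\<in>configs N. ennreal (post_weight K lam h' y n \<sigma> / T) * ennreal (C * D + R1 \<sigma> h' y n))
     = (\<Sum>\<sigma>\<in>configs N. ennreal (post_weight K lam h' y n \<sigma> / T) * ennreal (C * D + R2 \<sigma> h' y n))"
    if sp: "h' \<in> space (hyper_law m)" "y \<in> space (ref_meas m)" and T: "0 < T" for h' y n T
  proof -
    let ?w = "\<lambda>\<sigma>. post_weight K lam h' y n \<sigma>" and ?p = "post K lam h' y n"
    let ?S = "\<Sum>\<sigma>\<in>configs N. ?w \<sigma>"
    have w0: "0 \<le> ?w \<sigma>" if "\<sigma> \<in> configs N" for \<sigma> by (rule post_weight_nonneg [OF sp that])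
    have real_eq: "(\<Sum>\<sigma>\<in>configs N. ?w \<sigma> * (C * D + R1 \<sigma> h' y n)) = (\<Sum>\<sigma>\<in>configs N. ?w \<sigma> * (C * D + R2 \<sigma> h' y n))"
    proof (cases "?S = 0")
      case True
      then have "?w \<sigma> = 0" if "\<sigma> \<in> configs N" for \<sigma>
        using that w0 by (simp add: sum_nonneg_eq_0_iff)
      then show ?thesis by simp
    next
      case False
      have w: "?w \<sigma> = ?S * ?p \<sigma>" for \<sigma> using False by (simp add: post_def)
      have p1: "(\<Sum>\<sigma>\<in>configs N. ?p \<sigma>) = 1"
        using False unfolding post_def sum_divide_distrib [symmetric] by simp
      have "(\<Sum>\<sigma>\<in>configs N. ?p \<sigma> * R1 \<sigma> h' y n) = empv h ?p * (\<Sum>\<sigma>\<in>configs N. ?p \<sigma> * \<psi> (magv ?p i) (\<sigma> i))"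
        unfolding R1_def by (simp add: sum_distrib_left mult.left_commute)
      also have "\<dots> = empv h ?p * two_point (magv ?p i) (\<psi> (magv ?p i))"
        by (simp only: sum_two_point [OF p1 i])
      also have "\<dots> = (\<Sum>\<sigma>\<in>configs N. ?p \<sigma> * R2 \<sigma> h' y n)"
        unfolding R2_def sum_distrib_right [symmetric] p1 by simp
      finally have "(\<Sum>\<sigma>\<in>configs N. ?p \<sigma> * (C * D + R1 \<sigma> h' y n)) = (\<Sum>\<sigma>\<in>configs N. ?p \<sigma> * (C * D + R2 \<sigma> h' y n))"
        by (simp add: distrib_left sum.distrib)
      then show ?thesis
        by (subst (1 2) w) (simp only: mult.assoc sum_distrib_left [symmetric])
    qed
    have conv: "(\<Sum>\<sigma>\<in>configs N. ennreal (?w \<sigma> / T) * ennreal (C * D + R \<sigma>)) = ennreal ((\<Sum>\<sigma>\<in>configs N. ?w \<sigma> * (C * D + R \<sigma>)) / T)"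
      if R: "\<And>\<sigma>. \<sigma> \<in> configs N \<Longrightarrow> \<bar>R \<sigma>\<bar> \<le> C * D" for R
    proof -
      have n0: "0 \<le> C * D + R \<sigma>" if "\<sigma> \<in> configs N" for \<sigma> using R [OF that] by linarith
      have "(\<Sum>\<sigma>\<in>configs N. ennreal (?w \<sigma> / T) * ennreal (C * D + R \<sigma>)) = (\<Sum>\<sigma>\<in>configs N. ennreal (?w \<sigma> / T * (C * D + R \<sigma>)))"
        using T w0 n0 by (intro sum.cong refl ennreal_mult [symmetric]) (auto intro: divide_nonneg_pos)
      also have "\<dots> = ennreal (\<Sum>\<sigma>\<in>configs N. ?w \<sigma> / T * (C * D + R \<sigma>))"
        using T w0 n0 by (intro sum_ennreal) (auto intro!: mult_nonneg_nonneg divide_nonneg_nonneg)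
      finally show ?thesis by (simp add: sum_divide_distrib)
    qed
    show ?thesis
      using conv [of "\<lambda>\<sigma>. R1 \<sigma> h' y n"] conv [of "\<lambda>\<sigma>. R2 \<sigma> h' y n"] R1b [OF sp] R2b [OF sp] real_eq by simp
  qed
  have nn: "(\<integral>\<^sup>+\<omega>. ennreal (C * D + ?A \<omega>) \<partial>lawM) = (\<integral>\<^sup>+\<omega>. ennreal (C * D + ?B \<omega>) \<partial>lawM)"
  proof -
    have "(\<integral>\<^sup>+\<omega>. (\<lambda>\<sigma> h' y n. ennreal (C * D + R1 \<sigma> h' y n)) (sig \<omega>) (hyp \<omega>) (obs \<omega>) (data K lam \<omega>) \<partial>lawM)
       = (\<integral>\<^sup>+\<omega>. (\<lambda>\<sigma> h' y n. ennreal (C * D + R2 \<sigma> h' y n)) (sig \<omega>) (hyp \<omega>) (obs \<omega>) (data K lam \<omega>) \<partial>lawM)"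
      by (subst (1 2) nn_integral_data [OF lam])
        ((intro measurable_compose [OF _ measurable_ennreal] borel_measurable_add R1m R2m borel_measurable_const)+,
         (rule nn_integral_cong)+, rule pointsum, assumption, assumption, rule sum_tilted_prior)
    then show ?thesis by (simp only: A B)
  qed
  show bA: "AE \<omega> in lawM. \<bar>?A \<omega>\<bar> \<le> C * D" and bB: "AE \<omega> in lawM. \<bar>?B \<omega>\<bar> \<le> C * D"
  proof -
    have s: "hyp \<omega> \<in> space (hyper_law m) \<and> obs \<omega> \<in> space (ref_meas m) \<and> sig \<omega> \<in> configs N" if "\<omega> \<in> space lawM" for \<omega>
      using that by (auto simp: space_lawM space_base sample_defs)
    show "AE \<omega> in lawM. \<bar>?A \<omega>\<bar> \<le> C * D" unfolding A
    proof (rule AE_I2)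
      fix \<omega> assume "\<omega> \<in> space lawM"
      from s [OF this] show "\<bar>R1 (sig \<omega>) (hyp \<omega>) (obs \<omega>) (data K lam \<omega>)\<bar> \<le> C * D" by (intro R1b) auto
    qed
    show "AE \<omega> in lawM. \<bar>?B \<omega>\<bar> \<le> C * D" unfolding B
    proof (rule AE_I2)
      fix \<omega> assume "\<omega> \<in> space lawM"
      from s [OF this] show "\<bar>R2 (sig \<omega>) (hyp \<omega>) (obs \<omega>) (data K lam \<omega>)\<bar> \<le> C * D" by (intro R2b) auto
    qed
  qed
  have nA: "AE \<omega> in lawM. 0 \<le> C * D + ?A \<omega>"
    using bA
  proof eventually_elim
    case (elim \<omega>)
    from abs_le_D2 [OF elim] show ?case by linarith
  qed
  have nB: "AE \<omega> in lawM. 0 \<le> C * D + ?B \<omega>"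
    using bB
  proof eventually_elim
    case (elim \<omega>)
    from abs_le_D2 [OF elim] show ?case by linarith
  qed
  have iA: "integrable lawM ?A" by (rule law.integrable_const_bound [OF _ Am]) (use bA in simp)
  have iB: "integrable lawM ?B" by (rule law.integrable_const_bound [OF _ Bm]) (use bB in simp)
  have "ennreal (\<integral>\<omega>. C * D + ?A \<omega> \<partial>lawM) = ennreal (\<integral>\<omega>. C * D + ?B \<omega> \<partial>lawM)"
  proof -
    have "(\<integral>\<^sup>+\<omega>. ennreal (C * D + ?A \<omega>) \<partial>lawM) = ennreal (\<integral>\<omega>. C * D + ?A \<omega> \<partial>lawM)"
      by (rule nn_integral_eq_integral) (use iA nA in auto)
    moreover have "(\<integral>\<^sup>+\<omega>. ennreal (C * D + ?B \<omega>) \<partial>lawM) = ennreal (\<integral>\<omega>. C * D + ?B \<omega> \<partial>lawM)"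
      by (rule nn_integral_eq_integral) (use iB nB in auto)
    ultimately show ?thesis using nn by simp
  qed
  moreover have "0 \<le> (\<integral>\<omega>. C * D + ?A \<omega> \<partial>lawM)"
    by (rule integral_nonneg_AE [OF nA])
  moreover have "0 \<le> (\<integral>\<omega>. C * D + ?B \<omega> \<partial>lawM)"
    by (rule integral_nonneg_AE [OF nB])
  ultimately have "(\<integral>\<omega>. C * D + ?A \<omega> \<partial>lawM) = (\<integral>\<omega>. C * D + ?B \<omega> \<partial>lawM)" by simp
  then show "(\<integral>\<omega>. ?A \<omega> \<partial>lawM) = (\<integral>\<omega>. ?B \<omega> \<partial>lawM)"
    using iA iB by (simp add: law.prob_space)
qed

lemma gauss_weight_data:
  assumes "lam \<in> param_box"
  shows "gauss_weight lam (fst (data K lam \<omega>)) \<sigma> = exp (H_gauss N e lam \<omega> \<sigma>)"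
proof -
  have a: "sqrt (lam 0 * e) * sqrt (lam 0 * e) = lam 0 * e"
    using param_box_bounds(1) [OF assms, of 0] e by simp
  have square: "r * x * (r * y + w) - (r * x)\<^sup>2 / 2 = (r * r) * (y * x) + r * (w * x) - 1/2 * (r * r) * x\<^sup>2" for r x y w :: real
    by (simp add: power2_eq_square field_simps)
  have z: "fst (data K lam \<omega>) i = sqrt (lam 0 * e) * sig \<omega> i + gau \<omega> i" if "i \<in> {1..N}" for i
    using that by (simp add: data_def shift_def split_beta gau_def)
  have "(\<Sum>i\<in>{1..N}. sqrt (lam 0 * e) * \<sigma> i * fst (data K lam \<omega>) i - (sqrt (lam 0 * e) * \<sigma> i)\<^sup>2 / 2)
      = (\<Sum>i=1..N. (lam 0 * e) * (sig \<omega> i * \<sigma> i) + sqrt (lam 0 * e) * (gau \<omega> i * \<sigma> i) - 1/2 * (lam 0 * e) * (\<sigma> i)\<^sup>2)"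
  proof (rule sum.cong [OF refl])
    fix i assume i: "i \<in> {1..N}"
    have "sqrt (lam 0 * e) * \<sigma> i * (sqrt (lam 0 * e) * sig \<omega> i + gau \<omega> i) - (sqrt (lam 0 * e) * \<sigma> i)\<^sup>2 / 2
      = (sqrt (lam 0 * e) * sqrt (lam 0 * e)) * (sig \<omega> i * \<sigma> i) + sqrt (lam 0 * e) * (gau \<omega> i * \<sigma> i)
        - 1/2 * (sqrt (lam 0 * e) * sqrt (lam 0 * e)) * (\<sigma> i)\<^sup>2"
      by (rule square)
    then show "sqrt (lam 0 * e) * \<sigma> i * fst (data K lam \<omega>) i - (sqrt (lam 0 * e) * \<sigma> i)\<^sup>2 / 2
      = (lam 0 * e) * (sig \<omega> i * \<sigma> i) + sqrt (lam 0 * e) * (gau \<omega> i * \<sigma> i) - 1/2 * (lam 0 * e) * (\<sigma> i)\<^sup>2"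
      by (simp only: z [OF i] a)
  qed
  then show ?thesis
    unfolding gauss_weight_def exp_sum [symmetric, OF finite_atLeastAtMost] H_gauss_eq
    by (simp only: sum_subtractf sum.distrib sum_distrib_left)
qed

text \<open>At the observation \<open>\<xi> / (1 + \<lambda> \<sigma>\<^sup>*)\<close> the exponent of the weight, \<open>- \<lambda> \<sigma>\<close> times the observation, is the linear term of the
Hamiltonian, and the prefactor \<open>1 + \<lambda> \<sigma>\<close> gives the logarithm.\<close>

lemma exp_weight_data:
  assumes g: "good \<omega>" and lam: "lam \<in> param_box" and \<sigma>: "\<sigma> \<in> configs N"
  shows "\<bar>exp_weight K lam (fst (snd (data K lam \<omega>))) (fst (snd (snd (data K lam \<omega>)))) (snd (snd (snd (data K lam \<omega>)))) \<sigma>\<bar>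
    = exp (\<Sum>k<K. \<Sum>j=1..cnt \<omega> (Suc k). exp_term lam \<omega> \<sigma> (Suc k) j)"
proof -
  have d: "fst (snd (data K lam \<omega>)) = cnt \<omega>" "fst (snd (snd (data K lam \<omega>))) = loc \<omega>"
    by (simp_all add: data_def shift_def split_beta cnt_def loc_def)
  have x: "snd (snd (snd (data K lam \<omega>))) (j, k) = xi \<omega> (j, k) / (1 + lam k * sig \<omega> (loc \<omega> (j, k)))"
    if "1 \<le> k" "k \<le> K" "1 \<le> j" "j \<le> cnt \<omega> k" for j k
    using that by (simp add: data_def shift_def split_beta cnt_def loc_def xi_def revealed_def)
  have "exp_weight K lam (fst (snd (data K lam \<omega>))) (fst (snd (snd (data K lam \<omega>)))) (snd (snd (snd (data K lam \<omega>)))) \<sigma>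
    = (\<Prod>k=1..K. \<Prod>j=1..cnt \<omega> k. exp (exp_term lam \<omega> \<sigma> k j))"
    unfolding exp_weight_def d
  proof (intro prod.cong refl)
    fix k j assume "k \<in> {1..K}" "j \<in> {1..cnt \<omega> k}"
    then have kj: "1 \<le> k" "k \<le> K" "1 \<le> j" "j \<le> cnt \<omega> k" by auto
    have p: "0 < 1 + lam k * \<sigma> (loc \<omega> (j, k))"
      by (rule spin_factor_pos [OF lam kj(1) \<sigma> goodD(4) [OF g kj(3,1)]])
    show "(1 + lam k * \<sigma> (loc \<omega> (j, k))) * exp (- (lam k * \<sigma> (loc \<omega> (j, k))) * snd (snd (snd (data K lam \<omega>))) (j, k)) = exp (exp_term lam \<omega> \<sigma> k j)"
      unfolding x [OF kj] exp_term_def exp_diff exp_ln [OF p] exp_minus divide_inverse [of _ "exp _"]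
      by (simp add: exp_minus [symmetric] mult_ac)
  qed
  also have "\<dots> = exp (\<Sum>k=1..K. \<Sum>j=1..cnt \<omega> k. exp_term lam \<omega> \<sigma> k j)"
    by (simp only: exp_sum finite_atLeastAtMost)
  also have "(\<Sum>k=1..K. \<Sum>j=1..cnt \<omega> k. exp_term lam \<omega> \<sigma> k j) = (\<Sum>k<K. \<Sum>j=1..cnt \<omega> (Suc k). exp_term lam \<omega> \<sigma> (Suc k) j)"
    using sum.atLeast1_atMost_eq [of "\<lambda>k. \<Sum>j=1..cnt \<omega> k. exp_term lam \<omega> \<sigma> k j" K] by (simp only: One_nat_def)
  finally show ?thesis by simp
qed

lemma post_tendsto:
  assumes g: "good \<omega>" and lam: "lam \<in> param_box" and \<sigma>: "\<sigma> \<in> configs N"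
  shows "(\<lambda>K. post K lam (hyp \<omega>) (obs \<omega>) (data K lam \<omega>) \<sigma>) \<longlonglongrightarrow> G lam \<omega> \<sigma>"
proof -
  have w: "(\<lambda>K. post_weight K lam (hyp \<omega>) (obs \<omega>) (data K lam \<omega>) \<tau>) \<longlonglongrightarrow> boltzmann N m e lam \<omega> \<tau>" if \<tau>: "\<tau> \<in> configs N" for \<tau>
  proof -
    let ?P = "P_out m (obs \<omega>) \<tau> (snd (hyp \<omega>))" and ?L = "exp (\<Sum>i=1..N. fst (hyp \<omega>) i * \<tau> i)"
    have P0: "0 \<le> ?P" using space_law_cases(2,3) [OF goodD(1) [OF g]] by (rule P_out_nonneg [OF \<tau>])
    have "(\<lambda>K. ?L * ?P * (exp (H_gauss N e lam \<omega> \<tau>) * exp (\<Sum>k<K. \<Sum>j=1..cnt \<omega> (Suc k). exp_term lam \<omega> \<tau> (Suc k) j)))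
        \<longlonglongrightarrow> ?L * ?P * (exp (H_gauss N e lam \<omega> \<tau>) * exp (H_exp lam \<omega> \<tau>))"
      unfolding H_exp_eq
      by (intro tendsto_mult tendsto_const tendsto_exp summable_LIMSEQ summable_exp_term g lam \<tau>)
    also have "?L * ?P * (exp (H_gauss N e lam \<omega> \<tau>) * exp (H_exp lam \<omega> \<tau>)) = boltzmann N m e lam \<omega> \<tau>"
      using P0 by (simp add: boltzmann_eq exp_add)
    finally show ?thesis
      unfolding post_weight_def obs_weight_def gauss_weight_data [OF lam] exp_weight_data [OF g lam \<tau>] .
  qed
  show ?thesis
    unfolding post_def G_pert_def Z_pert_def
    by (intro tendsto_divide tendsto_sum w \<sigma> good_Z [OF g, of lam, unfolded Z_pert_def])
qed

text \<open>The truncated identity passes to the limit by dominated convergence: the posteriors converge and the functions are continuous and bounded.\<close>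

lemma nishimori:
  fixes h :: "real \<Rightarrow> real" and \<psi> :: "real \<Rightarrow> real \<Rightarrow> real"
  assumes lam: "lam \<in> param_box" and i: "i \<in> {1..N}"
    and h: "continuous_on UNIV h" "\<And>x. \<bar>x\<bar> \<le> 1 \<Longrightarrow> \<bar>h x\<bar> \<le> C" and C: "0 \<le> C"
    and \<psi>: "\<And>c. (\<lambda>x. \<psi> x c) \<in> borel_measurable borel" "\<And>x c. \<bar>x\<bar> \<le> 1 \<Longrightarrow> \<bar>c\<bar> = 1 \<Longrightarrow> \<bar>\<psi> x c\<bar> \<le> D"
      "\<And>c. \<bar>c\<bar> = 1 \<Longrightarrow> continuous_on {-1..1} (\<lambda>x. \<psi> x c)"
  shows "(\<integral>\<omega>. emp h lam \<omega> * \<psi> (mag lam \<omega> i) (sig \<omega> i) \<partial>lawM)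
    = (\<integral>\<omega>. emp h lam \<omega> * two_point (mag lam \<omega> i) (\<psi> (mag lam \<omega> i)) \<partial>lawM)"
proof -
  have hm: "h \<in> borel_measurable borel" by (rule borel_measurable_continuous_onI [OF h(1)])
  let ?g = "\<lambda>K \<omega>. post K lam (hyp \<omega>) (obs \<omega>) (data K lam \<omega>)"
  note tr = nishimori_truncated [OF lam i hm h(2) \<psi>(1,2) C]
  have magm: "mag lam' \<in> UNIV" for lam' by simp
  have mm: "(\<lambda>\<omega>. mag lam \<omega> i) \<in> borel_measurable lawM" by (rule joint_section [OF meas_mag])
  have em: "(\<lambda>\<omega>. emp h lam \<omega>) \<in> borel_measurable lawM" by (rule joint_section [OF meas_emp [OF hm]])
  have m1: "(\<lambda>\<omega>. emp h lam \<omega> * \<psi> (mag lam \<omega> i) (sig \<omega> i)) \<in> borel_measurable lawM"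
  proof (rule borel_measurable_times [OF em])
    have "(\<lambda>\<omega>. (\<lambda>\<sigma> \<omega>. \<psi> (mag lam \<omega> i) (\<sigma> i)) (sig \<omega>) \<omega>) \<in> borel_measurable lawM"
      by (rule measurable_compose_countable' [OF measurable_compose [OF mm \<psi>(1)] meas_sig]) (simp add: countable_finite)
    then show "(\<lambda>\<omega>. \<psi> (mag lam \<omega> i) (sig \<omega> i)) \<in> borel_measurable lawM" .
  qed
  have m2: "(\<lambda>\<omega>. emp h lam \<omega> * two_point (mag lam \<omega> i) (\<psi> (mag lam \<omega> i))) \<in> borel_measurable lawM"
    unfolding two_point_def
    by (intro borel_measurable_times em borel_measurable_add borel_measurable_diff borel_measurable_divide mm measurable_compose [OF mm \<psi>(1)] borel_measurable_const)
  have lim_mag: "(\<lambda>K. magv (?g K \<omega>) j) \<longlonglongrightarrow> mag lam \<omega> j" if "good \<omega>" for \<omega> j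
    unfolding mag_eq_magv magv_def by (intro tendsto_sum tendsto_mult tendsto_const post_tendsto that lam)
  have lim_emp: "(\<lambda>K. empv h (?g K \<omega>)) \<longlonglongrightarrow> emp h lam \<omega>" if "good \<omega>" for \<omega>
    unfolding emp_def empv_def
    by (intro tendsto_divide tendsto_sum tendsto_const continuous_on_tendsto_compose [OF h(1) lim_mag [OF that]]) (use N in auto)
  have bnd: "\<bar>magv (?g K \<omega>) j\<bar> \<le> 1" if g: "good \<omega>" and j: "j \<in> {1..N}" for K \<omega> j
  proof (rule magv_bound [OF _ _ j])
    have sp: "hyp \<omega> \<in> space (hyper_law m)" "obs \<omega> \<in> space (ref_meas m)"
      using goodD(1) [OF g] by (auto simp: space_lawM space_base sample_defs)
    have s0: "0 \<le> (\<Sum>\<tau>\<in>configs N. post_weight K lam (hyp \<omega>) (obs \<omega>) (data K lam \<omega>) \<tau>)"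
      by (intro sum_nonneg post_weight_nonneg sp)
    show "0 \<le> ?g K \<omega> \<sigma>" if "\<sigma> \<in> configs N" for \<sigma>
      unfolding post_def by (intro divide_nonneg_nonneg s0 post_weight_nonneg that sp)
    show "(\<Sum>\<sigma>\<in>configs N. ?g K \<omega> \<sigma>) \<le> 1"
      unfolding post_def sum_divide_distrib [symmetric] by (simp add: divide_self_if)
  qed
  have lim_psi: "(\<lambda>K. \<psi> (magv (?g K \<omega>) i) c) \<longlonglongrightarrow> \<psi> (mag lam \<omega> i) c" if g: "good \<omega>" and c: "\<bar>c\<bar> = 1" for \<omega> c
  proof (rule continuous_on_tendsto_compose [OF \<psi>(3) [OF c] lim_mag [OF g]])
    show "mag lam \<omega> i \<in> {-1..1}" using mag_bound [OF i, of lam \<omega>] by (simp add: abs_le_iff)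
    show "\<forall>\<^sub>F K in sequentially. magv (?g K \<omega>) i \<in> {-1..1}"
    proof (rule always_eventually, rule allI)
      fix K
      show "magv (?g K \<omega>) i \<in> {-1..1}" using bnd [OF g i, of K] by (simp add: abs_le_iff)
    qed
  qed
  have L1: "(\<lambda>K. \<integral>\<omega>. empv h (?g K \<omega>) * \<psi> (magv (?g K \<omega>) i) (sig \<omega> i) \<partial>lawM) \<longlonglongrightarrow> (\<integral>\<omega>. emp h lam \<omega> * \<psi> (mag lam \<omega> i) (sig \<omega> i) \<partial>lawM)"
  proof (rule integral_dominated_convergence [where w = "\<lambda>_. C * D"])
    show "AE \<omega> in lawM. (\<lambda>K. empv h (?g K \<omega>) * \<psi> (magv (?g K \<omega>) i) (sig \<omega> i)) \<longlonglongrightarrow> emp h lam \<omega> * \<psi> (mag lam \<omega> i) (sig \<omega> i)"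
      using AE_good
    proof eventually_elim
      case (elim \<omega>)
      show ?case by (intro tendsto_mult lim_emp lim_psi elim config_abs [OF goodD(2) [OF elim] i])
    qed
  qed (use tr(2,4) m1 in \<open>auto simp del: abs_mult\<close>)
  have L2: "(\<lambda>K. \<integral>\<omega>. empv h (?g K \<omega>) * two_point (magv (?g K \<omega>) i) (\<psi> (magv (?g K \<omega>) i)) \<partial>lawM) \<longlonglongrightarrow> (\<integral>\<omega>. emp h lam \<omega> * two_point (mag lam \<omega> i) (\<psi> (mag lam \<omega> i)) \<partial>lawM)"
  proof (rule integral_dominated_convergence [where w = "\<lambda>_. C * D"])
    show "AE \<omega> in lawM. (\<lambda>K. empv h (?g K \<omega>) * two_point (magv (?g K \<omega>) i) (\<psi> (magv (?g K \<omega>) i))) \<longlonglongrightarrow> emp h lam \<omega> * two_point (mag lam \<omega> i) (\<psi> (mag lam \<omega> i))"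
      using AE_good
    proof eventually_elim
      case (elim \<omega>)
      show ?case unfolding two_point_def
        by (intro tendsto_mult lim_emp tendsto_add tendsto_diff tendsto_divide tendsto_const lim_mag lim_psi elim) auto
    qed
  qed (use tr(3,5) m2 in \<open>auto simp del: abs_mult\<close>)
  show ?thesis
  proof (rule LIMSEQ_unique [OF L1])
    have "(\<lambda>K. \<integral>\<omega>. empv h (?g K \<omega>) * \<psi> (magv (?g K \<omega>) i) (sig \<omega> i) \<partial>lawM)
        = (\<lambda>K. \<integral>\<omega>. empv h (?g K \<omega>) * two_point (magv (?g K \<omega>) i) (\<psi> (magv (?g K \<omega>) i)) \<partial>lawM)"
      by (rule ext) (rule tr(1))
    with L2 show "(\<lambda>K. \<integral>\<omega>. empv h (?g K \<omega>) * \<psi> (magv (?g K \<omega>) i) (sig \<omega> i) \<partial>lawM)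
        \<longlonglongrightarrow> (\<integral>\<omega>. emp h lam \<omega> * two_point (mag lam \<omega> i) (\<psi> (mag lam \<omega> i)) \<partial>lawM)"
      by (simp only:)
  qed
qed

end

section \<open>Covariances of empirical averages\<close>

text \<open>The posterior mean of the slope at a site of magnetisation \<open>m\<close> after an observation with mark \<open>x\<close> and true spin \<open>c\<close> has been made there.\<close>

definition tilted_slope :: "real \<Rightarrow> real \<Rightarrow> real \<Rightarrow> real \<Rightarrow> real" where
  "tilted_slope l m c x = two_point m (\<lambda>a. slope l a c x * exp (pt_term l a c x)) / two_point m (\<lambda>a. exp (pt_term l a c x))"

text \<open>The mean of the slope over the mark and over a true spin drawn from the posterior.\<close>

definition response :: "real \<Rightarrow> real \<Rightarrow> real" where
  "response l m = (\<integral>x. two_point m (\<lambda>c. tilted_slope l m c x) \<partial>exponential_one)"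

lemma two_point_ge:
  assumes "\<bar>m\<bar> \<le> 1" "c \<le> f 1" "c \<le> f (-1)"
  shows "c \<le> two_point m f"
proof -
  have "c = (1 + m) / 2 * c + (1 - m) / 2 * c" by (simp add: field_simps)
  also have "\<dots> \<le> two_point m f"
    unfolding two_point_def using assms by (intro add_mono mult_left_mono) auto
  finally show ?thesis .
qed

lemma two_point_exp_pos:
  assumes "\<bar>m\<bar> \<le> 1"
  shows "0 < two_point m (\<lambda>a. exp (f a))"
proof -
  have "0 < min (exp (f 1)) (exp (f (-1)))" by simp
  also have "\<dots> \<le> two_point m (\<lambda>a. exp (f a))" by (rule two_point_ge [OF assms]) auto
  finally show ?thesis .
qed

lemma tilted_slope_bound:
  assumes l: "0 < l" "l \<le> 1/2" and m: "\<bar>m\<bar> \<le> 1" and c: "\<bar>c\<bar> = 1" and x: "0 \<le> x"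
  shows "\<bar>tilted_slope l m c x\<bar> \<le> 4 * (1 + x)"
proof -
  let ?E = "\<lambda>a. exp (pt_term l a c x)"
  have pos: "0 < two_point m ?E" by (rule two_point_exp_pos [OF m])
  have b1: "\<bar>slope l 1 c x\<bar> \<le> 4 * (1 + x)" "\<bar>slope l (-1) c x\<bar> \<le> 4 * (1 + x)"
    using slope_bound [OF l _ c x] by auto
  have w: "0 \<le> (1 + m) / 2" "0 \<le> (1 - m) / 2" using m by auto
  have "\<bar>two_point m (\<lambda>a. slope l a c x * ?E a)\<bar> \<le> \<bar>(1 + m) / 2 * (slope l 1 c x * ?E 1)\<bar> + \<bar>(1 - m) / 2 * (slope l (-1) c x * ?E (-1))\<bar>"
    unfolding two_point_def by (rule abs_triangle_ineq)
  also have "\<dots> = (1 + m) / 2 * (\<bar>slope l 1 c x\<bar> * ?E 1) + (1 - m) / 2 * (\<bar>slope l (-1) c x\<bar> * ?E (-1))"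
    using w by (simp only: abs_mult abs_of_nonneg abs_exp_cancel)
  also have "\<dots> \<le> (1 + m) / 2 * (4 * (1 + x) * ?E 1) + (1 - m) / 2 * (4 * (1 + x) * ?E (-1))"
    using b1 w by (intro add_mono mult_left_mono mult_right_mono) auto
  also have "\<dots> = 4 * (1 + x) * two_point m ?E"
    unfolding two_point_def by (simp only: distrib_left mult.left_commute)
  finally show ?thesis
    unfolding tilted_slope_def abs_divide using pos by (simp add: pos_divide_le_eq)
qed

lemma tilted_slope_meas:
  assumes [measurable]: "f \<in> borel_measurable M" "g \<in> borel_measurable M" "d \<in> borel_measurable M"
  shows "(\<lambda>w. tilted_slope l (f w) (d w) (g w)) \<in> borel_measurable M"
  unfolding tilted_slope_def two_point_def slope_def pt_term_def by measurable

lemma tilted_slope_continuous: "continuous_on {-1..1} (\<lambda>m. tilted_slope l m c x)"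
proof -
  have "two_point m (\<lambda>a. exp (pt_term l a c x)) \<noteq> 0" if "m \<in> {-1..1}" for m
    using two_point_exp_pos [of m "\<lambda>a. pt_term l a c x"] that by (auto simp: abs_le_iff)
  then show ?thesis
    unfolding tilted_slope_def two_point_def by (intro continuous_intros) auto
qed

lemma response_meas [measurable]: "response l \<in> borel_measurable borel"
proof -
  interpret prob_space exponential_one by (rule prob_space_exponential_density) simp
  have "(\<lambda>(m, x). two_point m (\<lambda>c. tilted_slope l m c x)) \<in> borel_measurable (borel \<Otimes>\<^sub>M exponential_one)"
    unfolding two_point_def split_beta'
    by (intro borel_measurable_add borel_measurable_times borel_measurable_diff borel_measurable_divide tilted_slope_meas) measurable
  from borel_measurable_lebesgue_integral [OF this] show ?thesis
    unfolding response_def [abs_def] .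
qed

lemma response_integrand_bound:
  assumes l: "0 < l" "l \<le> 1/2" and m: "\<bar>m\<bar> \<le> 1" and x: "0 \<le> x"
  shows "\<bar>two_point m (\<lambda>c. tilted_slope l m c x)\<bar> \<le> 4 * (1 + x)"
  by (rule two_point_bound [OF m tilted_slope_bound [OF l m _ x] tilted_slope_bound [OF l m _ x]]) auto

lemma exp_half_le: "exp (1/2 :: real) \<le> 2"
proof -
  have "exp (1/2 :: real) * exp (1/2) = exp 1" by (simp add: exp_add [symmetric])
  also have "\<dots> \<le> 2 * 2" using exp_le by linarith
  finally have "(exp (1/2 :: real))\<^sup>2 \<le> 2\<^sup>2" by (simp add: power2_eq_square)
  then show ?thesis by (rule power2_le_imp_le) simp
qed

text \<open>For \<open>l \<le> 1/8\<close> the likelihoods of the two spin values differ by a factor of at most \<open>exp ((1 + x) / 2)\<close>. The exponent \<open>x / 2\<close> is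
integrable against the law of the mark.\<close>

lemma likelihood_ratio_bound:
  assumes l: "0 < l" "l \<le> 1/8" and m: "\<bar>m\<bar> \<le> 1" and c: "\<bar>c\<bar> = 1" and x: "0 \<le> x"
  defines "E \<equiv> \<lambda>a. exp (pt_term l a c x)"
  shows "\<bar>(E 1 - E (-1)) / 2\<bar> \<le> 2 * exp (x / 2) * two_point m E"
proof -
  let ?d = "(1 + x) / 2"
  have p: "\<bar>pt_term l a c x\<bar> \<le> (1 + x) / 4" if "\<bar>a\<bar> = 1" for a
  proof -
    have "\<bar>pt_term l a c x\<bar> \<le> 2 * l * (1 + x)" using l by (intro pt_term_bound that c x) auto
    also have "\<dots> \<le> 2 * (1/8) * (1 + x)" using l x by (intro mult_right_mono mult_left_mono) auto
    finally show ?thesis by simp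
  qed
  have r: "E a \<le> exp ?d * E b" if "\<bar>a\<bar> = 1" "\<bar>b\<bar> = 1" for a b
  proof -
    have "pt_term l a c x \<le> ?d + pt_term l b c x"
      using p [OF that(1)] p [OF that(2)] by (simp add: abs_le_iff field_simps)
    then show ?thesis unfolding E_def by (simp add: exp_add [symmetric])
  qed
  have tp: "E a \<le> exp ?d * two_point m E" if a: "\<bar>a\<bar> = 1" for a
  proof -
    have "E a / exp ?d \<le> two_point m E"
      using r [OF a] by (intro two_point_ge m) (simp_all add: pos_divide_le_eq mult.commute)
    then show ?thesis by (simp add: pos_divide_le_eq mult.commute)
  qed
  have E0: "0 < E a" for a by (simp add: E_def)
  have "\<bar>(E 1 - E (-1)) / 2\<bar> \<le> (E 1 + E (-1)) / 2"
    using E0 [of 1] E0 [of "-1"] by (simp add: abs_le_iff)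
  also have "\<dots> \<le> exp ?d * two_point m E"
    using tp [of 1] tp [of "-1"] by simp
  also have "\<dots> \<le> 2 * exp (x / 2) * two_point m E"
  proof (rule mult_right_mono)
    have "exp ?d = exp (1/2) * exp (x / 2)" by (simp add: exp_add [symmetric] add_divide_distrib)
    then show "exp ?d \<le> 2 * exp (x / 2)" using exp_half_le by simp
    show "0 \<le> two_point m E" unfolding E_def using two_point_exp_pos [OF m] by (rule less_imp_le)
  qed
  finally show ?thesis .
qed

context perturbed_model
begin

lemma avg_two_point:
  assumes "Z lam \<omega> \<noteq> 0" "i \<in> {1..N}"
  shows "avg lam \<omega> (\<lambda>\<sigma>. f (\<sigma> i)) = two_point (mag lam \<omega> i) f"
  unfolding avg_def mag_eq_magv by (rule sum_two_point [OF sum_G [OF assms(1)] assms(2)])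

lemma mean_slope_add_pt:
  assumes g: "good \<omega>" and lam: "lam \<in> param_box" and k: "1 \<le> k" and i: "i \<in> {1..N}"
  shows "mean_slope k lam (add_pt k i x \<omega>) i x = tilted_slope (lam k) (mag lam \<omega> i) (sig \<omega> i) x"
proof -
  have Z: "Z lam \<omega> \<noteq> 0" by (rule good_Z [OF g])
  have "mean_slope k lam (add_pt k i x \<omega>) i x = avg lam (add_pt k i x \<omega>) (\<lambda>\<sigma>. slope (lam k) (\<sigma> i) (sig \<omega> i) x)"
    by (simp add: mean_slope_def)
  also have "\<dots> = avg lam \<omega> (\<lambda>\<sigma>. slope (lam k) (\<sigma> i) (sig \<omega> i) x * exp (pt_term (lam k) (\<sigma> i) (sig \<omega> i) x))
      / avg lam \<omega> (\<lambda>\<sigma>. exp (pt_term (lam k) (\<sigma> i) (sig \<omega> i) x))"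
    by (rule avg_tilt(2) [OF boltzmann_add_pt [OF g lam _ k] Z])
  also have "\<dots> = tilted_slope (lam k) (mag lam \<omega> i) (sig \<omega> i) x"
    unfolding tilted_slope_def
    using avg_two_point [OF Z i, of "\<lambda>a. slope (lam k) a (sig \<omega> i) x * exp (pt_term (lam k) a (sig \<omega> i) x)"]
      avg_two_point [OF Z i, of "\<lambda>a. exp (pt_term (lam k) a (sig \<omega> i) x)"] by simp
  finally show ?thesis .
qed

lemma param_box_eighth:
  assumes "lam \<in> param_box" "3 \<le> k"
  shows "lam k \<le> 1/8"
proof -
  have "(1/2::real) ^ k \<le> (1/2) ^ 3" using assms(2) by (intro power_decreasing) auto
  then show ?thesis using param_box_bounds(2) [OF assms(1), of k] by (simp add: power3_eq_cube)
qed

text \<open>For spins, \<open>exp (f \<sigma>_i)\<close> is an affine function of \<open>\<sigma>_i\<close>. Tilting the posterior by it changes the mean of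
\<open>\<sigma>_j\<close> by a multiple of the covariance of \<open>\<sigma>_i\<close> and \<open>\<sigma>_j\<close>.\<close>

lemma mag_add_pt:
  assumes g: "good \<omega>" and lam: "lam \<in> param_box" and k: "3 \<le> k" and i: "i \<in> {1..N}" and x: "0 \<le> x"
  shows "\<bar>mag lam (add_pt k i x \<omega>) j - mag lam \<omega> j\<bar> \<le> 2 * exp (x / 2) * \<bar>corr lam \<omega> i j - mag lam \<omega> i * mag lam \<omega> j\<bar>"
proof -
  have k1: "1 \<le> k" using k by simp
  have Z: "Z lam \<omega> \<noteq> 0" by (rule good_Z [OF g])
  let ?mi = "mag lam \<omega> i" and ?mj = "mag lam \<omega> j"
  define E where "E = (\<lambda>a. exp (pt_term (lam k) a (sig \<omega> i) x))"
  \<comment> \<open>the affine form \<open>\<alpha> + \<beta> \<sigma>_i\<close> of the tilting factor\<close>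
  define \<alpha> \<beta> where "\<alpha> = (E 1 + E (-1)) / 2" and "\<beta> = (E 1 - E (-1)) / 2"
  have E: "E (\<sigma> i) = \<alpha> + \<beta> * \<sigma> i" if "\<sigma> \<in> configs N" for \<sigma>
    using configs_cases [OF that i] by (auto simp: \<alpha>_def \<beta>_def field_simps)
  have mi: "\<bar>?mi\<bar> \<le> 1" by (rule mag_bound [OF i])
  have D: "avg lam \<omega> (\<lambda>\<sigma>. E (\<sigma> i)) = two_point ?mi E" by (rule avg_two_point [OF Z i])
  have D2: "two_point ?mi E = \<alpha> + \<beta> * ?mi"
    unfolding two_point_def \<alpha>_def \<beta>_def by (simp add: field_simps)
  have D0: "0 < two_point ?mi E" unfolding E_def by (rule two_point_exp_pos [OF mi])
  have num: "avg lam \<omega> (\<lambda>\<sigma>. \<sigma> j * E (\<sigma> i)) = \<alpha> * ?mj + \<beta> * corr lam \<omega> i j"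
  proof -
    have "avg lam \<omega> (\<lambda>\<sigma>. \<sigma> j * E (\<sigma> i)) = avg lam \<omega> (\<lambda>\<sigma>. \<alpha> * \<sigma> j + \<beta> * (\<sigma> i * \<sigma> j))"
      unfolding avg_def by (rule sum.cong [OF refl]) (simp add: E algebra_simps)
    then show ?thesis by (simp only: avg_add avg_cmult mag_def corr_def)
  qed
  have "mag lam (add_pt k i x \<omega>) j = avg lam \<omega> (\<lambda>\<sigma>. \<sigma> j * E (\<sigma> i)) / avg lam \<omega> (\<lambda>\<sigma>. E (\<sigma> i))"
    unfolding mag_def E_def by (rule avg_tilt(2) [OF boltzmann_add_pt [OF g lam _ k1] Z])
  also have "\<dots> = (\<alpha> * ?mj + \<beta> * corr lam \<omega> i j) / two_point ?mi E" by (simp only: num D)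
  finally have "mag lam (add_pt k i x \<omega>) j - ?mj = \<beta> * (corr lam \<omega> i j - ?mi * ?mj) / two_point ?mi E"
    using D0 by (simp add: D2 field_simps)
  then have "\<bar>mag lam (add_pt k i x \<omega>) j - ?mj\<bar> = \<bar>\<beta>\<bar> / two_point ?mi E * \<bar>corr lam \<omega> i j - ?mi * ?mj\<bar>"
    using D0 by (simp add: abs_mult abs_divide)
  also have "\<dots> \<le> 2 * exp (x / 2) * \<bar>corr lam \<omega> i j - ?mi * ?mj\<bar>"
  proof (rule mult_right_mono)
    have "\<bar>\<beta>\<bar> \<le> 2 * exp (x / 2) * two_point ?mi E"
      unfolding \<beta>_def E_def
      by (rule likelihood_ratio_bound [OF param_box_bounds(1) [OF lam] param_box_eighth [OF lam k] mi config_abs [OF goodD(2) [OF g] i] x])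
    then show "\<bar>\<beta>\<bar> / two_point ?mi E \<le> 2 * exp (x / 2)" using D0 by (simp add: pos_divide_le_eq)
  qed simp
  finally show ?thesis .
qed

definition site_decorr :: "(nat \<Rightarrow> real) \<Rightarrow> ('o, 'y) disorder \<Rightarrow> nat \<Rightarrow> real" where
  "site_decorr lam \<omega> i = (\<Sum>j=1..N. \<bar>corr lam \<omega> i j - mag lam \<omega> i * mag lam \<omega> j\<bar>) / real N"

lemma decorr_eq_site_decorr: "decorr lam \<omega> = (\<Sum>i=1..N. site_decorr lam \<omega> i) / real N"
  by (simp add: decorr_def site_decorr_def sum_divide_distrib power2_eq_square)

lemma site_decorr_nonneg: "0 \<le> site_decorr lam \<omega> i"
  unfolding site_decorr_def by (intro divide_nonneg_nonneg sum_nonneg) auto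

lemma site_decorr_le: "i \<in> {1..N} \<Longrightarrow> site_decorr lam \<omega> i \<le> 2"
proof -
  assume i: "i \<in> {1..N}"
  have "(\<Sum>j=1..N. \<bar>corr lam \<omega> i j - mag lam \<omega> i * mag lam \<omega> j\<bar>) \<le> (\<Sum>j=1..N. 2)"
  proof (rule sum_mono)
    fix j assume j: "j \<in> {1..N}"
    have "\<bar>mag lam \<omega> i * mag lam \<omega> j\<bar> \<le> 1"
      unfolding abs_mult by (intro mult_le_one mag_bound i j) auto
    with corr_bound [OF i j, of lam \<omega>] show "\<bar>corr lam \<omega> i j - mag lam \<omega> i * mag lam \<omega> j\<bar> \<le> 2"
      by (simp add: abs_le_iff)
  qed
  then show ?thesis using N by (simp add: site_decorr_def divide_le_eq)
qed

lemma emp_add_pt: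
  assumes g: "good \<omega>" and lam: "lam \<in> param_box" and k: "3 \<le> k" and i: "i \<in> {1..N}" and x: "0 \<le> x"
    and h: "\<And>x y. \<bar>x\<bar> \<le> 1 \<Longrightarrow> \<bar>y\<bar> \<le> 1 \<Longrightarrow> \<bar>h x - h y\<bar> \<le> L * \<bar>x - y\<bar>" and L: "0 \<le> L"
  shows "\<bar>emp h lam (add_pt k i x \<omega>) - emp h lam \<omega>\<bar> \<le> 2 * L * exp (x / 2) * site_decorr lam \<omega> i"
proof -
  have "\<bar>(\<Sum>j=1..N. h (mag lam (add_pt k i x \<omega>) j)) - (\<Sum>j=1..N. h (mag lam \<omega> j))\<bar>
     \<le> (\<Sum>j=1..N. 2 * L * exp (x / 2) * \<bar>corr lam \<omega> i j - mag lam \<omega> i * mag lam \<omega> j\<bar>)"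
    unfolding sum_subtractf [symmetric]
  proof (rule order_trans [OF sum_abs], rule sum_mono)
    fix j assume j: "j \<in> {1..N}"
    have "\<bar>h (mag lam (add_pt k i x \<omega>) j) - h (mag lam \<omega> j)\<bar> \<le> L * \<bar>mag lam (add_pt k i x \<omega>) j - mag lam \<omega> j\<bar>"
      by (rule h [OF mag_bound [OF j] mag_bound [OF j]])
    also have "\<dots> \<le> L * (2 * exp (x / 2) * \<bar>corr lam \<omega> i j - mag lam \<omega> i * mag lam \<omega> j\<bar>)"
      by (rule mult_left_mono [OF mag_add_pt [OF g lam k i x] L])
    finally show "\<bar>h (mag lam (add_pt k i x \<omega>) j) - h (mag lam \<omega> j)\<bar> \<le> 2 * L * exp (x / 2) * \<bar>corr lam \<omega> i j - mag lam \<omega> i * mag lam \<omega> j\<bar>"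
      by (simp only: mult_ac)
  qed
  then show ?thesis
    unfolding emp_def site_decorr_def diff_divide_distrib [symmetric] abs_divide sum_distrib_left [symmetric]
    by (simp add: divide_right_mono)
qed

lemma meas_mag_pt: "(\<lambda>w. mag lam (fst w) (fst (snd w))) \<in> borel_measurable lawptM"
proof -
  have i: "(\<lambda>w. fst (snd w)) \<in> lawptM \<rightarrow>\<^sub>M count_space UNIV" by measurable
  show ?thesis
    by (rule measurable_compose_countable [OF measurable_compose [OF measurable_fst joint_section [OF meas_mag]] i])
qed

lemma meas_sig_pt: "(\<lambda>w. sig (fst w) (fst (snd w))) \<in> borel_measurable lawptM"
proof -
  have i: "(\<lambda>w. fst (snd w)) \<in> lawptM \<rightarrow>\<^sub>M count_space UNIV" by measurable
  show ?thesis
    by (rule measurable_compose_countable [OF measurable_compose [OF measurable_fst meas_sig_at] i])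
qed

lemma meas_site_decorr_pt: "(\<lambda>w. site_decorr lam (fst w) (fst (snd w))) \<in> borel_measurable lawptM"
proof -
  have i: "(\<lambda>w. fst (snd w)) \<in> lawptM \<rightarrow>\<^sub>M count_space UNIV" by measurable
  have d: "(\<lambda>\<omega>. site_decorr lam \<omega> i) \<in> borel_measurable lawM" for i
    unfolding site_decorr_def
    by (intro borel_measurable_divide borel_measurable_sum borel_measurable_abs borel_measurable_diff borel_measurable_times
        joint_section [OF meas_mag] joint_section [OF meas_corr] borel_measurable_const)
  show ?thesis
    by (rule measurable_compose_countable [OF measurable_compose [OF measurable_fst d] i])
qed

lemma meas_mark_pt: "(\<lambda>w. snd (snd w)) \<in> borel_measurable lawptM"
  by measurable

lemma meas_mean_slope_pt: "(\<lambda>w. mean_slope k lam (fst w) (fst (snd w)) (snd (snd w))) \<in> borel_measurable lawptM"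
proof -
  have i: "(\<lambda>w. fst (snd w)) \<in> lawptM \<rightarrow>\<^sub>M count_space UNIV" by measurable
  have "(\<lambda>w. mean_slope k lam (fst w) i (snd (snd w))) \<in> borel_measurable lawptM" for i
    unfolding mean_slope_def avg_def slope_def
    by (intro borel_measurable_sum borel_measurable_times borel_measurable_diff borel_measurable_divide borel_measurable_add
        borel_measurable_power measurable_compose [OF measurable_fst joint_section [OF meas_G]]
        measurable_compose [OF measurable_fst meas_sig_at] meas_mark_pt borel_measurable_const)
  from measurable_compose_countable [OF this i] show ?thesis .
qed

lemma AE_pt: "AE w in lawptM. good (fst w) \<and> fst (snd w) \<in> {1..N} \<and> 0 \<le> snd (snd w)"
proof -
  have "AE w in lawptM. good (fst w)"
    by (rule AE_pair_fst [OF pt.P.prob_space_axioms AE_good])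
  moreover have "AE i in siteM. i \<in> {1..N}" using N by (auto simp: AE_measure_pmf_iff)
  then have "AE v in ptM. fst v \<in> {1..N}" by (rule AE_pair_fst [OF expo.prob_space_axioms])
  then have "AE w in lawptM. fst (snd w) \<in> {1..N}"
    by (rule AE_pair_snd [OF law.prob_space_axioms pt.P.prob_space_axioms])
  moreover have "AE v in ptM. 0 \<le> snd v"
    by (rule AE_pair_snd [OF prob_space_measure_pmf expo.prob_space_axioms AE_exponential_nonneg])
  then have "AE w in lawptM. 0 \<le> snd (snd w)"
    by (rule AE_pair_snd [OF law.prob_space_axioms pt.P.prob_space_axioms])
  ultimately show ?thesis by eventually_elim simp
qed

lemma integrable_pt_bound:
  assumes "f \<in> borel_measurable lawptM"
    "\<And>\<omega> i x. good \<omega> \<Longrightarrow> i \<in> {1..N} \<Longrightarrow> 0 \<le> x \<Longrightarrow> \<bar>f (\<omega>, i, x)\<bar> \<le> c * (1 + x)"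
  shows "integrable lawptM (f :: _ \<Rightarrow> real)"
proof (rule Bochner_Integration.integrable_bound [OF _ assms(1)])
  show "integrable lawptM (\<lambda>w. c * (1 + snd (snd w)))"
    by (rule integrable_mult_right [OF integrable_pt_linear])
  show "AE w in lawptM. norm (f w) \<le> norm (c * (1 + snd (snd w)))"
    using AE_pt
  proof eventually_elim
    case (elim w)
    then have "\<bar>f (fst w, fst (snd w), snd (snd w))\<bar> \<le> c * (1 + snd (snd w))" by (intro assms(2)) auto
    then show ?case by simp
  qed
qed

lemma integral_ptM:
  assumes "integrable ptM f"
  shows "(\<integral>v. f v \<partial>ptM) = (\<Sum>i=1..N. \<integral>x. f (i, x) \<partial>expo) / real N"
proof -
  have "(\<integral>v. f v \<partial>ptM) = (\<integral>i. (\<integral>x. f (i, x) \<partial>expo) \<partial>siteM)"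
    by (rule pt.integral_fst' [symmetric, OF assms])
  also have "\<dots> = (\<Sum>i=1..N. \<integral>x. f (i, x) \<partial>expo) / real N"
    using N by (subst integral_pmf_of_set) auto
  finally show ?thesis .
qed

lemma decorr_pt_integral:
  "integrable lawptM (\<lambda>w. (1 + snd (snd w)) * exp (1/2 * snd (snd w)) * site_decorr lam (fst w) (fst (snd w)))"
  "(\<integral>w. (1 + snd (snd w)) * exp (1/2 * snd (snd w)) * site_decorr lam (fst w) (fst (snd w)) \<partial>lawptM)
    = exp_moment * expected_decorr lam"
proof -
  let ?p = "\<lambda>x :: real. (1 + x) * exp (1/2 * x)"
  have pint: "integrable expo ?p" by (rule integrable_exponential_linear_exp) simp
  have pm [measurable]: "?p \<in> borel_measurable borel" by measurable
  have m: "(\<lambda>w. ?p (snd (snd w)) * site_decorr lam (fst w) (fst (snd w))) \<in> borel_measurable lawptM"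
    by (rule borel_measurable_times [OF measurable_compose [OF meas_mark_pt pm] meas_site_decorr_pt])
  have ib: "integrable lawptM (\<lambda>w. 2 * ?p (snd (snd w)))"
    by (intro integrable_mult_right integrable_pair_snd [OF law.prob_space_axioms pt.P.prob_space_axioms, of "\<lambda>v. ?p (snd v)"]
        integrable_pair_snd [OF prob_space_measure_pmf expo.prob_space_axioms pint])
  show i: "integrable lawptM (\<lambda>w. ?p (snd (snd w)) * site_decorr lam (fst w) (fst (snd w)))"
  proof (rule Bochner_Integration.integrable_bound [OF ib m])
    show "AE w in lawptM. norm (?p (snd (snd w)) * site_decorr lam (fst w) (fst (snd w))) \<le> norm (2 * ?p (snd (snd w)))"
      using AE_pt
    proof eventually_elim
      case (elim w)
      then have "?p (snd (snd w)) * site_decorr lam (fst w) (fst (snd w)) \<le> ?p (snd (snd w)) * 2"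
        by (intro mult_left_mono site_decorr_le) auto
      then show ?case using elim site_decorr_nonneg [of lam "fst w" "fst (snd w)"] by (simp add: abs_mult)
    qed
  qed
  have "(\<integral>w. ?p (snd (snd w)) * site_decorr lam (fst w) (fst (snd w)) \<partial>lawptM)
     = (\<integral>\<omega>. (\<integral>v. ?p (snd v) * site_decorr lam \<omega> (fst v) \<partial>ptM) \<partial>lawM)"
    using lawpt.integral_fst' [OF i] by simp
  also have "\<dots> = (\<integral>\<omega>. exp_moment * decorr lam \<omega> \<partial>lawM)"
  proof (rule Bochner_Integration.integral_cong [OF refl])
    fix \<omega> assume \<omega>: "\<omega> \<in> space lawM"
    have "(\<lambda>v. (\<omega>, v)) \<in> ptM \<rightarrow>\<^sub>M lawptM" by (rule measurable_Pair1' [OF \<omega>])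
    from measurable_compose [OF this m] have m': "(\<lambda>v. ?p (snd v) * site_decorr lam \<omega> (fst v)) \<in> borel_measurable ptM" by simp
    have "integrable ptM (\<lambda>v. ?p (snd v) * site_decorr lam \<omega> (fst v))"
    proof (rule Bochner_Integration.integrable_bound [OF _ m'])
      show "integrable ptM (\<lambda>v. 2 * ?p (snd v))"
        by (intro integrable_mult_right integrable_pair_snd [OF prob_space_measure_pmf expo.prob_space_axioms pint])
      have "AE i in siteM. i \<in> {1..N}" using N by (auto simp: AE_measure_pmf_iff)
      then have "AE v in ptM. fst v \<in> {1..N}" by (rule AE_pair_fst [OF expo.prob_space_axioms])
      moreover have "AE v in ptM. 0 \<le> snd v"
        by (rule AE_pair_snd [OF prob_space_measure_pmf expo.prob_space_axioms AE_exponential_nonneg])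
      ultimately show "AE v in ptM. norm (?p (snd v) * site_decorr lam \<omega> (fst v)) \<le> norm (2 * ?p (snd v))"
      proof eventually_elim
        case (elim v)
        then have "?p (snd v) * site_decorr lam \<omega> (fst v) \<le> ?p (snd v) * 2"
          by (intro mult_left_mono site_decorr_le) auto
        then show ?case using elim site_decorr_nonneg [of lam \<omega> "fst v"] by (simp add: abs_mult)
      qed
    qed
    from integral_ptM [OF this]
    have "(\<integral>v. ?p (snd v) * site_decorr lam \<omega> (fst v) \<partial>ptM) = (\<Sum>i=1..N. exp_moment * site_decorr lam \<omega> i) / real N"
      unfolding exp_moment_def by simp
    then show "(\<integral>v. ?p (snd v) * site_decorr lam \<omega> (fst v) \<partial>ptM) = exp_moment * decorr lam \<omega>"
      by (simp add: decorr_eq_site_decorr sum_distrib_left)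
  qed
  also have "\<dots> = exp_moment * expected_decorr lam" by simp
  finally show "(\<integral>w. ?p (snd (snd w)) * site_decorr lam (fst w) (fst (snd w)) \<partial>lawptM) = exp_moment * expected_decorr lam" .
qed

text \<open>By the Mecke formula the energy produces one additional observation. Removing it from the empirical average costs the
decorrelation, and what remains is the slope under the tilted posterior, to which the Nishimori identity applies.\<close>

lemma energy_correlation:
  fixes h :: "real \<Rightarrow> real"
  assumes lam: "lam \<in> param_box" and k: "3 \<le> k"
    and hc: "continuous_on UNIV h" and hb: "\<And>x. \<bar>x\<bar> \<le> 1 \<Longrightarrow> \<bar>h x\<bar> \<le> C" and C: "0 \<le> C"
    and hl: "\<And>x y. \<bar>x\<bar> \<le> 1 \<Longrightarrow> \<bar>y\<bar> \<le> 1 \<Longrightarrow> \<bar>h x - h y\<bar> \<le> L * \<bar>x - y\<bar>" and L: "0 \<le> L"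
  shows "integrable lawM (\<lambda>\<omega>. emp h lam \<omega> * energy k lam \<omega>)"
    "\<bar>(\<integral>\<omega>. emp h lam \<omega> * energy k lam \<omega> \<partial>lawM) / s - (\<integral>\<omega>. emp h lam \<omega> * emp (response (lam k)) lam \<omega> \<partial>lawM)\<bar>
      \<le> 8 * L * exp_moment * expected_decorr lam"
proof -
  have k1: "1 \<le> k" using k by simp
  have hm: "h \<in> borel_measurable borel" by (rule borel_measurable_continuous_onI [OF hc])
  let ?l = "lam k"
  have l: "0 < ?l" "?l \<le> 1/2" using param_box_bounds(1) [OF lam] param_box_half [OF lam k1] by auto
  define A where "A \<omega> i x = emp h lam \<omega> * mean_slope k lam \<omega> i x" for \<omega> i x
  have em: "emp h lam \<in> borel_measurable lawM" by (rule joint_section [OF meas_emp [OF hm]])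
  have Am: "(\<lambda>w. A (fst w) (fst (snd w)) (snd (snd w))) \<in> borel_measurable lawptM"
    unfolding A_def by (rule borel_measurable_times [OF measurable_compose [OF measurable_fst em] meas_mean_slope_pt])
  have Asym: "A (swap_pts (j, k) (j', k) \<omega>) i x = A \<omega> i x" if "j \<in> {1..cnt \<omega> k}" "j' \<in> {1..cnt \<omega> k}" for \<omega> j j' i x
    unfolding A_def emp_def mag_def mean_slope_def by (simp add: avg_swap [OF that])
  let ?plus = "\<lambda>w. plus_pt k w"
  have pm: "(\<lambda>w. (?plus w, snd w)) \<in> lawptM \<rightarrow>\<^sub>M lawptM"
    by (intro measurable_Pair meas_add_pt k1 measurable_snd)
  from measurable_compose [OF this Am]
  have Apm: "(\<lambda>w. A (?plus w) (fst (snd w)) (snd (snd w))) \<in> borel_measurable lawptM" by simp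
  have Aint: "integrable lawptM (\<lambda>w. A (?plus w) (fst (snd w)) (snd (snd w)))"
  proof (rule integrable_pt_bound [OF Apm, of "C * 4"])
    fix \<omega> i and x :: real assume g: "good \<omega>" and i: "i \<in> {1..N}" and x: "0 \<le> x"
    have "\<bar>A (add_pt k i x \<omega>) i x\<bar> \<le> C * (4 * (1 + x))"
      unfolding A_def abs_mult
      by (intro mult_mono emp_bound hb mean_slope_bound lam k1 i x C) (use goodD(2) [OF g] in auto)
    then show "\<bar>A (?plus (\<omega>, i, x)) (fst (snd (\<omega>, i, x))) (snd (snd (\<omega>, i, x)))\<bar> \<le> C * 4 * (1 + x)" by (simp only: fst_conv snd_conv mult.assoc)
  qed
  note M = mecke_real [where A = A and k = k, OF k1 Am Asym Aint]
  have fe: "(\<Sum>j=1..cnt \<omega> k. A \<omega> (loc \<omega> (j, k)) (xi \<omega> (j, k))) = emp h lam \<omega> * energy k lam \<omega>" for \<omega>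
    by (simp only: A_def energy_def sum_distrib_left)
  show "integrable lawM (\<lambda>\<omega>. emp h lam \<omega> * energy k lam \<omega>)" using M(1) unfolding fe .
  let ?xb = "\<lambda>w. tilted_slope ?l (mag lam (fst w) (fst (snd w))) (sig (fst w) (fst (snd w))) (snd (snd w))"
  let ?g = "\<lambda>w. two_point (mag lam (fst w) (fst (snd w))) (\<lambda>c. tilted_slope ?l (mag lam (fst w) (fst (snd w))) c (snd (snd w)))"
  have xm: "?xb \<in> borel_measurable lawptM" by (rule tilted_slope_meas [OF meas_mag_pt meas_mark_pt meas_sig_pt])
  have gm: "?g \<in> borel_measurable lawptM"
    unfolding two_point_def
    by (intro borel_measurable_add borel_measurable_times borel_measurable_diff borel_measurable_divide borel_measurable_const
        meas_mag_pt tilted_slope_meas meas_mark_pt)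
  have fm: "(\<lambda>w. emp h lam (fst w)) \<in> borel_measurable lawptM" by (rule measurable_compose [OF measurable_fst em])
  have T2int: "integrable lawptM (\<lambda>w. emp h lam (fst w) * ?xb w)"
  proof (rule integrable_pt_bound [OF borel_measurable_times [OF fm xm], of "C * 4"])
    fix \<omega> i and x :: real assume g: "good \<omega>" and i: "i \<in> {1..N}" and x: "0 \<le> x"
    have "\<bar>emp h lam \<omega> * tilted_slope ?l (mag lam \<omega> i) (sig \<omega> i) x\<bar> \<le> C * (4 * (1 + x))"
      unfolding abs_mult
      by (intro mult_mono emp_bound hb tilted_slope_bound l mag_bound i x C config_abs [OF goodD(2) [OF g] i]) auto
    then show "\<bar>emp h lam (fst (\<omega>, i, x)) * ?xb (\<omega>, i, x)\<bar> \<le> C * 4 * (1 + x)" by (simp only: fst_conv snd_conv mult.assoc)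
  qed
  have T3int: "integrable lawptM (\<lambda>w. emp h lam (fst w) * ?g w)"
  proof (rule integrable_pt_bound [OF borel_measurable_times [OF fm gm], of "C * 4"])
    fix \<omega> i and x :: real assume g: "good \<omega>" and i: "i \<in> {1..N}" and x: "0 \<le> x"
    have "\<bar>emp h lam \<omega> * two_point (mag lam \<omega> i) (\<lambda>c. tilted_slope ?l (mag lam \<omega> i) c x)\<bar> \<le> C * (4 * (1 + x))"
      unfolding abs_mult by (intro mult_mono emp_bound hb response_integrand_bound l mag_bound i x C) auto
    then show "\<bar>emp h lam (fst (\<omega>, i, x)) * ?g (\<omega>, i, x)\<bar> \<le> C * 4 * (1 + x)" by (simp only: fst_conv snd_conv mult.assoc)
  qed
  have E1: "(\<integral>\<omega>. emp h lam \<omega> * energy k lam \<omega> \<partial>lawM) / s = (\<integral>w. A (?plus w) (fst (snd w)) (snd (snd w)) \<partial>lawptM)"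
    using M(2) s unfolding fe by simp
  \<comment> \<open>the empirical average before and after the new observation\<close>
  have err: "AE w in lawptM. \<bar>A (?plus w) (fst (snd w)) (snd (snd w)) - emp h lam (fst w) * ?xb w\<bar>
      \<le> 8 * L * ((1 + snd (snd w)) * exp (1/2 * snd (snd w)) * site_decorr lam (fst w) (fst (snd w)))"
    using AE_pt
  proof eventually_elim
    case (elim w)
    obtain \<omega> i x where w: "w = (\<omega>, i, x)" by (cases w) auto
    have g: "good \<omega>" and i: "i \<in> {1..N}" and x: "0 \<le> x" using elim by (auto simp: w)
    have "A (add_pt k i x \<omega>) i x - emp h lam \<omega> * tilted_slope ?l (mag lam \<omega> i) (sig \<omega> i) x
       = (emp h lam (add_pt k i x \<omega>) - emp h lam \<omega>) * tilted_slope ?l (mag lam \<omega> i) (sig \<omega> i) x"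
      unfolding A_def mean_slope_add_pt [OF g lam k1 i] by (simp add: left_diff_distrib)
    also have "\<bar>\<dots>\<bar> \<le> (2 * L * exp (x / 2) * site_decorr lam \<omega> i) * (4 * (1 + x))"
      unfolding abs_mult
      by (intro mult_mono emp_add_pt g lam k i x hl L tilted_slope_bound l mag_bound config_abs [OF goodD(2) [OF g] i])
        (use L x site_decorr_nonneg [of lam \<omega> i] in auto)
    also have "\<dots> = 8 * L * ((1 + x) * exp (1/2 * x) * site_decorr lam \<omega> i)" by simp
    finally show ?case by (simp add: w)
  qed
  have "\<bar>(\<integral>w. A (?plus w) (fst (snd w)) (snd (snd w)) \<partial>lawptM) - (\<integral>w. emp h lam (fst w) * ?xb w \<partial>lawptM)\<bar>
     = \<bar>\<integral>w. A (?plus w) (fst (snd w)) (snd (snd w)) - emp h lam (fst w) * ?xb w \<partial>lawptM\<bar>"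
    by (simp only: Bochner_Integration.integral_diff [OF Aint T2int])
  also have "\<dots> \<le> (\<integral>w. \<bar>A (?plus w) (fst (snd w)) (snd (snd w)) - emp h lam (fst w) * ?xb w\<bar> \<partial>lawptM)"
    by (rule integral_abs_bound)
  also have "\<dots> \<le> (\<integral>w. 8 * L * ((1 + snd (snd w)) * exp (1/2 * snd (snd w)) * site_decorr lam (fst w) (fst (snd w))) \<partial>lawptM)"
    by (rule integral_mono_AE [OF _ _ err])
      (intro integrable_abs Bochner_Integration.integrable_diff Aint T2int integrable_mult_right decorr_pt_integral(1))+
  also have "\<dots> = 8 * L * (exp_moment * expected_decorr lam)"
    unfolding integral_mult_right_zero decorr_pt_integral(2) ..
  finally have E2: "\<bar>(\<integral>w. A (?plus w) (fst (snd w)) (snd (snd w)) \<partial>lawptM) - (\<integral>w. emp h lam (fst w) * ?xb w \<partial>lawptM)\<bar>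
      \<le> 8 * L * exp_moment * expected_decorr lam" by (simp only: mult.assoc)
  \<comment> \<open>the Nishimori identity, for a fixed site and mark\<close>
  have E3: "(\<integral>w. emp h lam (fst w) * ?xb w \<partial>lawptM) = (\<integral>w. emp h lam (fst w) * ?g w \<partial>lawptM)"
  proof -
    have vm: "AE v in ptM. fst v \<in> {1..N} \<and> 0 \<le> snd v"
    proof -
      have "AE i in siteM. i \<in> {1..N}" using N by (auto simp: AE_measure_pmf_iff)
      then have "AE v in ptM. fst v \<in> {1..N}" by (rule AE_pair_fst [OF expo.prob_space_axioms])
      moreover have "AE v in ptM. 0 \<le> snd v"
        by (rule AE_pair_snd [OF prob_space_measure_pmf expo.prob_space_axioms AE_exponential_nonneg])
      ultimately show ?thesis by eventually_elim simp
    qed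
    have a: "(\<integral>v. (\<integral>\<omega>. emp h lam \<omega> * tilted_slope ?l (mag lam \<omega> (fst v)) (sig \<omega> (fst v)) (snd v) \<partial>lawM) \<partial>ptM)
        = (\<integral>w. emp h lam (fst w) * ?xb w \<partial>lawptM)"
      using lawpt.integral_snd [of "\<lambda>\<omega> v. emp h lam \<omega> * tilted_slope ?l (mag lam \<omega> (fst v)) (sig \<omega> (fst v)) (snd v)"] T2int
      by (simp add: split_beta')
    have b: "(\<integral>v. (\<integral>\<omega>. emp h lam \<omega> * two_point (mag lam \<omega> (fst v)) (\<lambda>c. tilted_slope ?l (mag lam \<omega> (fst v)) c (snd v)) \<partial>lawM) \<partial>ptM)
        = (\<integral>w. emp h lam (fst w) * ?g w \<partial>lawptM)"
      using lawpt.integral_snd [of "\<lambda>\<omega> v. emp h lam \<omega> * two_point (mag lam \<omega> (fst v)) (\<lambda>c. tilted_slope ?l (mag lam \<omega> (fst v)) c (snd v))"] T3int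
      by (simp add: split_beta')
    have ma: "(\<lambda>v. \<integral>\<omega>. emp h lam \<omega> * tilted_slope ?l (mag lam \<omega> (fst v)) (sig \<omega> (fst v)) (snd v) \<partial>lawM) \<in> borel_measurable ptM"
      using lawpt.integrable_snd [of "\<lambda>\<omega> v. emp h lam \<omega> * tilted_slope ?l (mag lam \<omega> (fst v)) (sig \<omega> (fst v)) (snd v)"] T2int
      by (simp add: split_beta')
    have mb: "(\<lambda>v. \<integral>\<omega>. emp h lam \<omega> * two_point (mag lam \<omega> (fst v)) (\<lambda>c. tilted_slope ?l (mag lam \<omega> (fst v)) c (snd v)) \<partial>lawM) \<in> borel_measurable ptM"
      using lawpt.integrable_snd [of "\<lambda>\<omega> v. emp h lam \<omega> * two_point (mag lam \<omega> (fst v)) (\<lambda>c. tilted_slope ?l (mag lam \<omega> (fst v)) c (snd v))"] T3int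
      by (simp add: split_beta')
    show ?thesis
      unfolding a [symmetric] b [symmetric]
    proof (rule integral_cong_AE [OF ma mb])
      show "AE v in ptM. (\<integral>\<omega>. emp h lam \<omega> * tilted_slope ?l (mag lam \<omega> (fst v)) (sig \<omega> (fst v)) (snd v) \<partial>lawM)
          = (\<integral>\<omega>. emp h lam \<omega> * two_point (mag lam \<omega> (fst v)) (\<lambda>c. tilted_slope ?l (mag lam \<omega> (fst v)) c (snd v)) \<partial>lawM)"
        using vm
      proof eventually_elim
        case (elim v)
        show ?case
          by (rule nishimori [where \<psi> = "\<lambda>m c. tilted_slope ?l m c (snd v)" and D = "4 * (1 + snd v)", OF lam _ hc hb C])
            (use elim in \<open>auto simp del: distrib_left_numeral intro!: tilted_slope_meas tilted_slope_bound l tilted_slope_continuous\<close>)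
      qed
    qed
  qed
  have E4: "(\<integral>w. emp h lam (fst w) * ?g w \<partial>lawptM) = (\<integral>\<omega>. emp h lam \<omega> * emp (response ?l) lam \<omega> \<partial>lawM)"
  proof -
    have "(\<integral>w. emp h lam (fst w) * ?g w \<partial>lawptM) = (\<integral>\<omega>. (\<integral>v. emp h lam \<omega> * ?g (\<omega>, v) \<partial>ptM) \<partial>lawM)"
      using lawpt.integral_fst' [OF T3int] by simp
    also have "\<dots> = (\<integral>\<omega>. emp h lam \<omega> * emp (response ?l) lam \<omega> \<partial>lawM)"
    proof (rule Bochner_Integration.integral_cong [OF refl])
      fix \<omega> assume \<omega>: "\<omega> \<in> space lawM"
      have "(\<lambda>v. (\<omega>, v)) \<in> ptM \<rightarrow>\<^sub>M lawptM" by (rule measurable_Pair1' [OF \<omega>])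
      from measurable_compose [OF this gm] have m': "(\<lambda>v. ?g (\<omega>, v)) \<in> borel_measurable ptM" .
      have gi: "integrable ptM (\<lambda>v. ?g (\<omega>, v))"
      proof (rule Bochner_Integration.integrable_bound [OF _ m'])
        show "integrable ptM (\<lambda>v. 4 * (1 + snd v))"
          by (intro integrable_mult_right integrable_pair_snd [OF prob_space_measure_pmf expo.prob_space_axioms integrable_exponential_linear])
        have "AE i in siteM. i \<in> {1..N}" using N by (auto simp: AE_measure_pmf_iff)
        then have "AE v in ptM. fst v \<in> {1..N}" by (rule AE_pair_fst [OF expo.prob_space_axioms])
        moreover have "AE v in ptM. 0 \<le> snd v"
          by (rule AE_pair_snd [OF prob_space_measure_pmf expo.prob_space_axioms AE_exponential_nonneg])
        ultimately show "AE v in ptM. norm (?g (\<omega>, v)) \<le> norm (4 * (1 + snd v))"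
        proof eventually_elim
          case (elim v)
          have "\<bar>?g (\<omega>, v)\<bar> \<le> 4 * (1 + snd v)"
            unfolding fst_conv snd_conv by (rule response_integrand_bound [OF l mag_bound]) (use elim in auto)
          then show ?case using elim by simp
        qed
      qed
      have "(\<integral>v. emp h lam \<omega> * ?g (\<omega>, v) \<partial>ptM) = emp h lam \<omega> * (\<integral>v. ?g (\<omega>, v) \<partial>ptM)" by (rule integral_mult_right_zero)
      also have "(\<integral>v. ?g (\<omega>, v) \<partial>ptM) = emp (response ?l) lam \<omega>"
        unfolding integral_ptM [OF gi] emp_def response_def by simp
      finally show "(\<integral>v. emp h lam \<omega> * ?g (\<omega>, v) \<partial>ptM) = emp h lam \<omega> * emp (response ?l) lam \<omega>" .
    qed
    finally show ?thesis .
  qed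
  show "\<bar>(\<integral>\<omega>. emp h lam \<omega> * energy k lam \<omega> \<partial>lawM) / s - (\<integral>\<omega>. emp h lam \<omega> * emp (response (lam k)) lam \<omega> \<partial>lawM)\<bar>
      \<le> 8 * L * exp_moment * expected_decorr lam"
    using E2 unfolding E1 E3 E4 .
qed

text \<open>The covariance with the energy is small by concentration. Taking the constant function in \<open>energy_correlation\<close>
identifies the mean of the energy, divided by \<open>s\<close>, with the mean of the empirical average of the response.\<close>

lemma covariance_bound:
  fixes h :: "real \<Rightarrow> real"
  assumes lam: "lam \<in> param_box" and k: "3 \<le> k"
    and hc: "continuous_on UNIV h" and hb: "\<And>x. \<bar>x\<bar> \<le> 1 \<Longrightarrow> \<bar>h x\<bar> \<le> C" and C: "0 \<le> C"
    and hl: "\<And>x y. \<bar>x\<bar> \<le> 1 \<Longrightarrow> \<bar>y\<bar> \<le> 1 \<Longrightarrow> \<bar>h x - h y\<bar> \<le> L * \<bar>x - y\<bar>" and L: "0 \<le> L"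
  shows "\<bar>(\<integral>\<omega>. emp h lam \<omega> * emp (response (lam k)) lam \<omega> \<partial>lawM)
      - (\<integral>\<omega>. emp h lam \<omega> \<partial>lawM) * (\<integral>\<omega>. emp (response (lam k)) lam \<omega> \<partial>lawM)\<bar>
    \<le> C * energy_dev k lam / s + 8 * L * exp_moment * expected_decorr lam"
proof -
  have k1: "1 \<le> k" using k by simp
  have hm: "h \<in> borel_measurable borel" by (rule borel_measurable_continuous_onI [OF hc])
  note ec = energy_correlation [OF lam k hc hb C hl L]
  have one: "emp (\<lambda>_. 1) lam \<omega> = 1" for \<omega> using N by (simp add: emp_def)
  have e1: "(\<integral>\<omega>. energy k lam \<omega> \<partial>lawM) / s = (\<integral>\<omega>. emp (response (lam k)) lam \<omega> \<partial>lawM)"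
    using energy_correlation(2) [OF lam k, of "\<lambda>_. 1" 1 0] by (simp add: one)
  let ?X = "energy k lam" and ?f = "emp h lam" and ?EX = "\<integral>\<omega>. energy k lam \<omega> \<partial>lawM"
  have iX: "integrable lawM ?X" by (rule integrable_energy(1) [OF lam k1])
  have iF: "integrable lawM ?f" by (rule integrable_emp [OF hm hb])
  have "(\<integral>\<omega>. ?f \<omega> * ?X \<omega> \<partial>lawM) - (\<integral>\<omega>. ?f \<omega> \<partial>lawM) * ?EX = (\<integral>\<omega>. ?f \<omega> * (?X \<omega> - ?EX) \<partial>lawM)"
    using ec(1) iF by (simp add: right_diff_distrib)
  also have "\<bar>\<dots>\<bar> \<le> (\<integral>\<omega>. \<bar>?f \<omega> * (?X \<omega> - ?EX)\<bar> \<partial>lawM)" by (rule integral_abs_bound)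
  also have "\<dots> \<le> (\<integral>\<omega>. C * \<bar>?X \<omega> - ?EX\<bar> \<partial>lawM)"
  proof (rule integral_mono)
    show "integrable lawM (\<lambda>\<omega>. \<bar>?f \<omega> * (?X \<omega> - ?EX)\<bar>)"
      using ec(1) iF by (simp add: right_diff_distrib)
    show "integrable lawM (\<lambda>\<omega>. C * \<bar>?X \<omega> - ?EX\<bar>)" using iX by simp
    show "\<bar>?f \<omega> * (?X \<omega> - ?EX)\<bar> \<le> C * \<bar>?X \<omega> - ?EX\<bar>" for \<omega>
      unfolding abs_mult by (intro mult_right_mono emp_bound hb) auto
  qed
  also have "\<dots> = C * energy_dev k lam" by (simp add: energy_dev_def)
  finally have d: "\<bar>(\<integral>\<omega>. ?f \<omega> * ?X \<omega> \<partial>lawM) - (\<integral>\<omega>. ?f \<omega> \<partial>lawM) * ?EX\<bar> \<le> C * energy_dev k lam" .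
  have "\<bar>(\<integral>\<omega>. ?f \<omega> * ?X \<omega> \<partial>lawM) / s - (\<integral>\<omega>. ?f \<omega> \<partial>lawM) * (?EX / s)\<bar> \<le> C * energy_dev k lam / s"
    using d s by (simp add: diff_divide_distrib [symmetric] abs_divide divide_right_mono)
  then show ?thesis using ec(2) unfolding e1 by linarith
qed

end

section \<open>The polynomials of the expansion in the signal strength\<close>

text \<open>The operator \<open>q \<mapsto> (x^2 - 1) q' - x q\<close>. It describes the derivative of \<open>ch m t * q (ratio m t)\<close> with respect to \<open>t\<close>
(\<open>DERIV_ch_poly\<close>).\<close>

definition tilt_op :: "real poly \<Rightarrow> real poly" where
  "tilt_op q = pCons 0 (pCons 0 (pderiv q)) - pderiv q - pCons 0 q"

text \<open>The coefficients of the powers of \<open>l\<close> in \<open>(x + l) / (1 + l x)\<close> (\<open>geometric_ratio\<close>).\<close>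

fun ratio_poly :: "nat \<Rightarrow> real poly" where
  "ratio_poly 0 = monom 1 1"
| "ratio_poly (Suc r) = smult ((-1) ^ r) (monom 1 r - monom 1 (r + 2))"

text \<open>In closed form, \<open>orbit_sum J\<close> is the sum of \<open>tilt_op^(J - r) (ratio_poly r)\<close> over \<open>r \<le> J\<close>, and \<open>weighted_orbit_sum J\<close> is the
same sum with weights \<open>J - r + 1\<close>. The recursions give access to coefficients and to values at \<open>1\<close>.\<close>

primrec orbit_sum :: "nat \<Rightarrow> real poly" where
  "orbit_sum 0 = ratio_poly 0"
| "orbit_sum (Suc J) = tilt_op (orbit_sum J) + ratio_poly (Suc J)"

primrec weighted_orbit_sum :: "nat \<Rightarrow> real poly" where
  "weighted_orbit_sum 0 = ratio_poly 0"
| "weighted_orbit_sum (Suc J) = tilt_op (weighted_orbit_sum J) + orbit_sum (Suc J)"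

text \<open>The coefficient of \<open>l^J\<close> in the expansion of \<open>response l\<close>.\<close>

definition response_poly :: "nat \<Rightarrow> real poly" where
  "response_poly J = (tilt_op ^^ J) (ratio_poly 0) - weighted_orbit_sum J"

lemma coeff_tilt_op: "coeff (tilt_op q) 0 = - coeff q 1"
  "coeff (tilt_op q) (Suc n) = (real n - 1) * coeff q n - real (n + 2) * coeff q (n + 2)"
proof -
  show "coeff (tilt_op q) 0 = - coeff q 1" by (simp add: tilt_op_def coeff_pderiv One_nat_def)
  show "coeff (tilt_op q) (Suc n) = (real n - 1) * coeff q n - real (n + 2) * coeff q (n + 2)"
    by (cases n) (simp_all add: tilt_op_def coeff_pderiv algebra_simps numeral_2_eq_2)
qed

lemma tilt_op_add: "tilt_op (p + q) = tilt_op p + tilt_op q"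
  unfolding tilt_op_def by (simp add: pderiv_add algebra_simps)

lemma tilt_op_0: "tilt_op 0 = 0"
  unfolding tilt_op_def by simp

lemma tilt_op_smult: "tilt_op (smult c p) = smult c (tilt_op p)"
  unfolding tilt_op_def by (simp add: pderiv_smult smult_diff_right)

lemma tilt_op_sum: "tilt_op (\<Sum>i\<in>A. f i) = (\<Sum>i\<in>A. tilt_op (f i))"
  by (induction A rule: infinite_finite_induct) (simp_all add: tilt_op_add tilt_op_0)

lemma tilt_op_useq0: "(tilt_op ^^ J) (ratio_poly 0) = (if even J then monom 1 1 else - 1)"
proof (induction J)
  case 0 show ?case by simp
next
  case (Suc J)
  have a: "tilt_op (monom 1 1) = - 1" "tilt_op (- 1) = monom 1 1"
    by (simp_all add: tilt_op_def pderiv_monom monom_altdef pderiv_minus pderiv_pCons One_nat_def pCons_one [symmetric])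
  show ?case using Suc a by simp
qed

lemma coeff_ratio_poly_top: "J + 1 < n \<Longrightarrow> coeff (ratio_poly J) n = 0"
  by (cases J) (auto simp: coeff_monom)

lemma coeff_ratio_poly_parity: "even (n + J) \<Longrightarrow> coeff (ratio_poly J) n = 0"
  by (cases J) (auto simp: coeff_monom)

lemma tilt_op_top:
  assumes "\<And>n. J + 1 < n \<Longrightarrow> coeff q n = 0" "J + 2 < n"
  shows "coeff (tilt_op q) n = 0"
  using assms(2) by (cases n) (simp_all add: coeff_tilt_op assms(1))

lemma tilt_op_parity:
  assumes "\<And>n. even (n + J) \<Longrightarrow> coeff q n = 0" "even (n + Suc J)"
  shows "coeff (tilt_op q) n = 0"
  using assms(2) by (cases n) (simp_all add: coeff_tilt_op assms(1))

lemma orbit_sum_top: "J + 1 < n \<Longrightarrow> coeff (orbit_sum J) n = 0"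
proof (induction J arbitrary: n)
  case 0 then show ?case using coeff_ratio_poly_top [of 0 n] by simp
next
  case (Suc J)
  have "coeff (tilt_op (orbit_sum J)) n = 0" by (rule tilt_op_top [of J]) (use Suc in auto)
  then show ?case using coeff_ratio_poly_top [OF Suc.prems] by (simp del: ratio_poly.simps)
qed

lemma weighted_orbit_sum_top: "J + 1 < n \<Longrightarrow> coeff (weighted_orbit_sum J) n = 0"
proof (induction J arbitrary: n)
  case 0 then show ?case using coeff_ratio_poly_top [of 0 n] by simp
next
  case (Suc J)
  have "coeff (tilt_op (weighted_orbit_sum J)) n = 0" by (rule tilt_op_top [of J]) (use Suc in auto)
  then show ?case using orbit_sum_top [OF Suc.prems] by (simp del: ratio_poly.simps orbit_sum.simps)
qed

lemma orbit_sum_parity: "even (n + J) \<Longrightarrow> coeff (orbit_sum J) n = 0"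
proof (induction J arbitrary: n)
  case 0 then show ?case using coeff_ratio_poly_parity [of n 0] by simp
next
  case (Suc J)
  have "coeff (tilt_op (orbit_sum J)) n = 0" by (rule tilt_op_parity [of J]) (use Suc in auto)
  then show ?case using coeff_ratio_poly_parity [OF Suc.prems] by (simp del: ratio_poly.simps)
qed

lemma weighted_orbit_sum_parity: "even (n + J) \<Longrightarrow> coeff (weighted_orbit_sum J) n = 0"
proof (induction J arbitrary: n)
  case 0 then show ?case using coeff_ratio_poly_parity [of n 0] by simp
next
  case (Suc J)
  have "coeff (tilt_op (weighted_orbit_sum J)) n = 0" by (rule tilt_op_parity [of J]) (use Suc in auto)
  then show ?case using orbit_sum_parity [OF Suc.prems] by (simp del: ratio_poly.simps orbit_sum.simps)
qed

lemma response_poly_top: "J + 1 < n \<Longrightarrow> coeff (response_poly J) n = 0"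
  unfolding response_poly_def tilt_op_useq0 by (auto simp: weighted_orbit_sum_top coeff_monom)

lemma response_poly_parity: "even (n + J) \<Longrightarrow> coeff (response_poly J) n = 0"
  unfolding response_poly_def tilt_op_useq0 by (cases n) (auto simp: weighted_orbit_sum_parity coeff_monom)

lemma orbit_sum_lead: "coeff (orbit_sum (Suc J)) (Suc (Suc J)) = real J * coeff (orbit_sum J) (Suc J) - (-1) ^ J"
proof -
  have "coeff (tilt_op (orbit_sum J)) (Suc (Suc J)) = real J * coeff (orbit_sum J) (Suc J)"
    using orbit_sum_top [of J "Suc J + 2"] by (simp add: coeff_tilt_op)
  moreover have "coeff (ratio_poly (Suc J)) (Suc (Suc J)) = - ((-1) ^ J)" by (simp add: coeff_monom)
  ultimately show ?thesis by (simp del: ratio_poly.simps)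
qed

lemma weighted_orbit_sum_lead: "coeff (weighted_orbit_sum (Suc J)) (Suc (Suc J)) = real J * coeff (weighted_orbit_sum J) (Suc J) + coeff (orbit_sum (Suc J)) (Suc (Suc J))"
proof -
  have "coeff (tilt_op (weighted_orbit_sum J)) (Suc (Suc J)) = real J * coeff (weighted_orbit_sum J) (Suc J)"
    using weighted_orbit_sum_top [of J "Suc J + 2"] by (simp add: coeff_tilt_op)
  then show ?thesis by (simp del: ratio_poly.simps orbit_sum.simps)
qed

text \<open>The leading coefficients satisfy \<open>v_\<^bsub>J+1\<^esub> = J v_J - (-1)^J\<close> with \<open>v\<^sub>0 = 1\<close>, and so
\<open>v\<^sub>1 = -1\<close>, \<open>v\<^sub>2 = 0\<close>, \<open>v\<^sub>3 = -1\<close>; from then on multiplication by \<open>J \<ge> 3\<close> outweighs the alternating term.\<close>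

lemma orbit_sum_lead_nonpos: "coeff (orbit_sum (Suc J)) (Suc (Suc J)) \<le> 0"
proof -
  let ?v = "\<lambda>J. coeff (orbit_sum J) (Suc J)"
  have r: "?v (Suc J) = real J * ?v J - (-1) ^ J" for J by (rule orbit_sum_lead)
  have a: "?v (Suc 0) = -1" "?v (Suc (Suc 0)) = 0" "?v (Suc (Suc (Suc 0))) = -1"
    unfolding r by simp_all
  have big: "?v (Suc (Suc (Suc n))) \<le> -1" for n
  proof (induction n)
    case 0 show ?case unfolding a by simp
  next
    case (Suc n)
    have "real (Suc (Suc (Suc n))) * ?v (Suc (Suc (Suc n))) \<le> real (Suc (Suc (Suc n))) * (-1)"
      using Suc by (intro mult_left_mono) auto
    moreover have "- ((-1 :: real) ^ Suc (Suc (Suc n))) \<le> 1" by (cases "even n") auto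
    ultimately show ?case unfolding r [of "Suc (Suc (Suc n))"] by (simp del: orbit_sum.simps power_Suc)
  qed
  consider "J = 0" | "J = Suc 0" | n where "J = Suc (Suc n)" by (metis not0_implies_Suc)
  then show ?thesis
  proof cases
    case 1 then show ?thesis using a(1) by (simp del: orbit_sum.simps)
  next
    case 2 then show ?thesis using a(2) by (simp del: orbit_sum.simps)
  next
    case 3
    then show ?thesis using big [of n] by (simp del: orbit_sum.simps)
  qed
qed

lemma weighted_orbit_sum_lead_neg: "coeff (weighted_orbit_sum (Suc J)) (Suc (Suc J)) \<le> -1"
proof (induction J)
  case 0
  show ?case using weighted_orbit_sum_lead [of 0] orbit_sum_lead [of 0] by (simp del: orbit_sum.simps weighted_orbit_sum.simps)
next
  case (Suc J)
  have "real (Suc J) * coeff (weighted_orbit_sum (Suc J)) (Suc (Suc J)) \<le> real (Suc J) * (-1)"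
    using Suc by (intro mult_left_mono) auto
  then show ?case
    using weighted_orbit_sum_lead [of "Suc J"] orbit_sum_lead_nonpos [of "Suc J"] by (simp del: orbit_sum.simps weighted_orbit_sum.simps)
qed

lemma response_poly_lead: "coeff (response_poly (Suc J)) (Suc (Suc J)) \<noteq> 0"
  using weighted_orbit_sum_lead_neg [of J] unfolding response_poly_def tilt_op_useq0 by (auto simp: coeff_monom One_nat_def simp del: weighted_orbit_sum.simps)

lemma tilt_op_at_1: "poly (tilt_op q) 1 = - poly q 1" "poly (pderiv (tilt_op q)) 1 = poly (pderiv q) 1 - poly q 1"
  by (simp_all add: tilt_op_def pderiv_diff pderiv_pCons)

lemma ratio_poly_at_1: "poly (ratio_poly (Suc r)) 1 = 0" "poly (pderiv (ratio_poly (Suc r))) 1 = - 2 * (-1) ^ r"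
  by (simp_all add: poly_monom pderiv_smult pderiv_diff pderiv_monom del: One_nat_def)

lemma orbit_sum_at_1: "poly (orbit_sum J) 1 = (-1) ^ J \<and> poly (pderiv (orbit_sum J)) 1 = (if even J then 1 else - 2)"
proof (induction J)
  case 0 show ?case by (simp add: poly_monom pderiv_monom)
next
  case (Suc J)
  then show ?case by (auto simp: pderiv_add tilt_op_at_1 ratio_poly_at_1 simp del: ratio_poly.simps)
qed

lemma weighted_orbit_sum_at_1: "poly (weighted_orbit_sum J) 1 = (-1) ^ J * (real J + 1) \<and> poly (pderiv (weighted_orbit_sum J)) 1 = (if even J then 1 else - real J - 1)"
proof (induction J)
  case 0 show ?case by (simp add: poly_monom pderiv_monom)
next
  case (Suc J)
  then show ?case using orbit_sum_at_1 [of "Suc J"]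
    by (auto simp: pderiv_add tilt_op_at_1 algebra_simps simp del: ratio_poly.simps orbit_sum.simps)
qed

text \<open>At \<open>x = 1\<close> the operator \<open>tilt_op\<close> acts on the pair of value and derivative of a polynomial by a linear map,
so both can be computed along the recursions.\<close>

lemma response_poly_stationary: "even J \<Longrightarrow> poly (pderiv (response_poly J)) 1 = 0"
  using weighted_orbit_sum_at_1 [of J] unfolding response_poly_def tilt_op_useq0 by (simp add: pderiv_diff pderiv_monom poly_monom)

text \<open>For odd \<open>n\<close> the multiple of \<open>x\<close> is the one that makes the derivative at \<open>1\<close> vanish.\<close>

definition odd_corrected :: "nat \<Rightarrow> real poly" where
  "odd_corrected n = monom 1 n - (if odd n then monom (real n) 1 else 0)"

lemma response_poly_expand: "response_poly J = (\<Sum>i\<le>Suc J. smult (coeff (response_poly J) i) (odd_corrected i))"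
proof -
  let ?c = "coeff (response_poly J)"
  have deg: "degree (response_poly J) \<le> Suc J" by (intro degree_le allI impI) (simp add: response_poly_top)
  have P: "(\<Sum>i\<le>Suc J. monom (?c i) i) = response_poly J" by (rule poly_as_sum_of_monoms' [OF deg])
  have "(\<Sum>i\<le>Suc J. if odd i then ?c i * real i else 0) = 0"
  proof (cases "even J")
    case True
    have "(\<Sum>i\<le>Suc J. if odd i then ?c i * real i else 0) = (\<Sum>i\<le>Suc J. ?c i * real i)"
      using True by (intro sum.cong) (auto simp: response_poly_parity)
    also have "\<dots> = poly (pderiv (\<Sum>i\<le>Suc J. monom (?c i) i)) 1"
      using higher_pderiv_sum [of 1 "\<lambda>i. monom (?c i) i" "{..Suc J}"]
      by (simp add: poly_sum pderiv_monom poly_monom mult.commute One_nat_def del: sum.atMost_Suc)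
    finally show ?thesis unfolding P using response_poly_stationary [OF True] by simp
  next
    case False
    then show ?thesis by (intro sum.neutral) (auto simp: response_poly_parity)
  qed
  then have "0 = monom (\<Sum>i\<le>Suc J. if odd i then ?c i * real i else 0) 1" by simp
  also have "\<dots> = (\<Sum>i\<le>Suc J. monom (if odd i then ?c i * real i else 0) 1)" by (rule monom_sum)
  finally have z: "(\<Sum>i\<le>Suc J. monom (if odd i then ?c i * real i else 0) 1) = 0" ..
  have "(\<Sum>i\<le>Suc J. smult (?c i) (odd_corrected i)) = (\<Sum>i\<le>Suc J. monom (?c i) i - monom (if odd i then ?c i * real i else 0) 1)"
    by (intro sum.cong refl) (simp add: odd_corrected_def smult_diff_right smult_monom)
  also have "\<dots> = response_poly J" by (simp only: sum_subtractf P z diff_zero)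
  finally show ?thesis ..
qed

text \<open>By induction on \<open>n\<close>: solve the expansion of \<open>response_poly (n - 1)\<close> for its leading term. The vanishing derivative at \<open>1\<close> says exactly that
the multiples of \<open>x\<close> that complete the odd powers add up to zero.\<close>

lemma span_response_poly:
  assumes add: "\<And>p q. V p \<Longrightarrow> V q \<Longrightarrow> V (p + q)" and sm: "\<And>c p. V p \<Longrightarrow> V (smult c p)"
    and one: "V 1" and P: "\<And>J. V (response_poly J)"
  shows "V (odd_corrected n)"
proof (induction n rule: less_induct)
  case (less n)
  have zero: "V 0" using sm [OF one, of 0] by simp
  have sum: "V (\<Sum>i\<in>A. f i)" if "\<And>i. i \<in> A \<Longrightarrow> V (f i)" for A :: "nat set" and f
    using that by (induction A rule: infinite_finite_induct) (auto intro: add zero)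
  consider "n = 0" | "n = 1" | J where "n = Suc (Suc J)"
    by (metis One_nat_def not0_implies_Suc)
  then show ?case
  proof cases
    case 1 then show ?thesis using one by (simp add: odd_corrected_def monom_0 pCons_one)
  next
    case 2 then show ?thesis using zero by (simp add: odd_corrected_def)
  next
    case 3
    let ?c = "coeff (response_poly (Suc J))"
    have "response_poly (Suc J) = (\<Sum>i\<le>Suc (Suc J). smult (?c i) (odd_corrected i))" by (rule response_poly_expand)
    also have "\<dots> = (\<Sum>i<n. smult (?c i) (odd_corrected i)) + smult (?c n) (odd_corrected n)"
      unfolding 3 by (simp add: lessThan_Suc_atMost [symmetric])
    finally have "smult (?c n) (odd_corrected n) = response_poly (Suc J) + smult (-1) (\<Sum>i<n. smult (?c i) (odd_corrected i))" by simp
    moreover have "V (response_poly (Suc J) + smult (-1) (\<Sum>i<n. smult (?c i) (odd_corrected i)))"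
      by (intro add sm sum P less) auto
    ultimately have "V (smult (1 / ?c n) (smult (?c n) (odd_corrected n)))" using sm by simp
    then show ?thesis using response_poly_lead [of J] by (simp add: 3)
  qed
qed

lemma orbit_sum_sum: "orbit_sum J = (\<Sum>r\<le>J. (tilt_op ^^ (J - r)) (ratio_poly r))"
proof (induction J)
  case 0 show ?case by simp
next
  case (Suc J)
  have "tilt_op (\<Sum>r\<le>J. (tilt_op ^^ (J - r)) (ratio_poly r)) = (\<Sum>r\<le>J. (tilt_op ^^ (Suc J - r)) (ratio_poly r))"
    unfolding tilt_op_sum by (intro sum.cong refl) (auto simp: Suc_diff_le)
  then show ?case using Suc by (simp del: ratio_poly.simps)
qed

lemma weighted_orbit_sum_sum: "weighted_orbit_sum J = (\<Sum>r\<le>J. smult (real (J - r + 1)) ((tilt_op ^^ (J - r)) (ratio_poly r)))"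
proof (induction J)
  case 0 show ?case by simp
next
  case (Suc J)
  have "tilt_op (\<Sum>r\<le>J. smult (real (J - r + 1)) ((tilt_op ^^ (J - r)) (ratio_poly r)))
      = (\<Sum>r\<le>J. smult (real (J - r + 1)) ((tilt_op ^^ (Suc J - r)) (ratio_poly r)))"
    unfolding tilt_op_sum by (intro sum.cong refl) (auto simp: Suc_diff_le tilt_op_smult add.commute)
  also have "\<dots> = (\<Sum>r\<le>Suc J. smult (real (Suc J - r)) ((tilt_op ^^ (Suc J - r)) (ratio_poly r)))"
    by (simp add: Suc_diff_le add.commute)
  finally have a: "tilt_op (weighted_orbit_sum J) = (\<Sum>r\<le>Suc J. smult (real (Suc J - r)) ((tilt_op ^^ (Suc J - r)) (ratio_poly r)))"
    unfolding Suc .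
  have "weighted_orbit_sum (Suc J) = (\<Sum>r\<le>Suc J. smult (real (Suc J - r)) ((tilt_op ^^ (Suc J - r)) (ratio_poly r)) + (tilt_op ^^ (Suc J - r)) (ratio_poly r))"
    unfolding weighted_orbit_sum.simps a orbit_sum_sum by (simp only: sum.distrib)
  also have "\<dots> = (\<Sum>r\<le>Suc J. smult (real (Suc J - r + 1)) ((tilt_op ^^ (Suc J - r)) (ratio_poly r)))"
    by (intro sum.cong refl) (simp only: of_nat_add of_nat_1 smult_add_left smult_1_left)
  finally show ?case .
qed

section \<open>Expansion of the response\<close>

text \<open>With \<open>t = l y\<close> these are the means of \<open>exp (- a t)\<close> and \<open>a exp (- a t)\<close> over a spin \<open>a\<close> of mean \<open>m\<close>.\<close>

definition ch :: "real \<Rightarrow> real \<Rightarrow> real" where "ch m t = cosh t - m * sinh t"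
definition sh :: "real \<Rightarrow> real \<Rightarrow> real" where "sh m t = m * cosh t - sinh t"

lemma ch_two_point: "ch m t = two_point m (\<lambda>a. exp (- (a * t)))"
  and sh_two_point: "sh m t = two_point m (\<lambda>a. a * exp (- (a * t)))"
  unfolding ch_def sh_def two_point_def cosh_def sinh_def by (simp_all add: field_simps)

lemma ch_pos: "\<bar>m\<bar> \<le> 1 \<Longrightarrow> 0 < ch m t"
  unfolding ch_two_point by (rule two_point_exp_pos)

lemma sh_le_ch: "\<bar>m\<bar> \<le> 1 \<Longrightarrow> \<bar>sh m t\<bar> \<le> ch m t"
proof -
  assume m: "\<bar>m\<bar> \<le> 1"
  have a: "ch m t - sh m t = (1 - m) * exp t" "ch m t + sh m t = (1 + m) * exp (- t)"
    unfolding ch_def sh_def cosh_def sinh_def by (simp_all add: field_simps)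
  have "0 \<le> (1 - m) * exp t" "0 \<le> (1 + m) * exp (- t)" using m by (auto simp: abs_le_iff)
  then show ?thesis using a by linarith
qed

lemma ch_le: "\<bar>m\<bar> \<le> 1 \<Longrightarrow> 0 \<le> t \<Longrightarrow> ch m t \<le> exp t"
proof -
  assume m: "\<bar>m\<bar> \<le> 1" and t: "0 \<le> t"
  have "\<bar>two_point m (\<lambda>a. exp (- (a * t)))\<bar> \<le> exp t" by (rule two_point_bound [OF m]) (use t in auto)
  then show ?thesis unfolding ch_two_point by linarith
qed

definition ratio :: "real \<Rightarrow> real \<Rightarrow> real" where "ratio m t = sh m t / ch m t"

lemma ratio_bound: "\<bar>m\<bar> \<le> 1 \<Longrightarrow> \<bar>ratio m t\<bar> \<le> 1"
  unfolding ratio_def using sh_le_ch [of m t] ch_pos [of m t] by (simp add: abs_divide)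

text \<open>From \<open>ch' = - sh\<close> and \<open>sh' = - ch\<close> one gets \<open>ratio' = ratio^2 - 1\<close>; the product rule then produces \<open>tilt_op\<close>.\<close>

lemma DERIV_ch_poly:
  assumes m: "\<bar>m\<bar> \<le> 1"
  shows "((\<lambda>t. ch m t * poly q (ratio m t)) has_real_derivative ch m t * poly (tilt_op q) (ratio m t)) (at t)"
proof -
  have c: "ch m t \<noteq> 0" using ch_pos [OF m, of t] by simp
  have dc: "(ch m has_real_derivative - sh m t) (at t)"
    unfolding ch_def [abs_def] sh_def by (auto intro!: derivative_eq_intros)
  have ds: "(sh m has_real_derivative - ch m t) (at t)"
    unfolding sh_def [abs_def] ch_def by (auto intro!: derivative_eq_intros)
  have dr: "(ratio m has_real_derivative (ratio m t)\<^sup>2 - 1) (at t)"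
    unfolding ratio_def [abs_def]
    by (rule derivative_eq_intros refl dc ds c)+ (use c in \<open>simp add: field_simps power2_eq_square\<close>)
  have dp: "((\<lambda>t. poly q (ratio m t)) has_real_derivative poly (pderiv q) (ratio m t) * ((ratio m t)\<^sup>2 - 1)) (at t)"
    by (rule DERIV_chain2 [OF poly_DERIV dr])
  have s: "sh m t = ch m t * ratio m t" using c by (simp add: ratio_def)
  show ?thesis
    by (rule DERIV_cong [OF DERIV_mult [OF dc dp]]) (simp add: s tilt_op_def algebra_simps power2_eq_square)
qed

lemma poly_bounded_unit: "\<exists>B\<ge>0. \<forall>x. \<bar>x\<bar> \<le> 1 \<longrightarrow> \<bar>poly (p :: real poly) x\<bar> \<le> B"
proof -
  have "\<bar>poly p x\<bar> \<le> (\<Sum>i\<le>degree p. \<bar>coeff p i\<bar>)" if "\<bar>x\<bar> \<le> 1" for x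
  proof -
    have "\<bar>poly p x\<bar> \<le> (\<Sum>i\<le>degree p. \<bar>coeff p i * x ^ i\<bar>)" unfolding poly_altdef by (rule sum_abs)
    also have "\<dots> \<le> (\<Sum>i\<le>degree p. \<bar>coeff p i\<bar>)"
      using that by (intro sum_mono) (auto simp: abs_mult power_abs intro!: mult_left_le power_le_one)
    finally show ?thesis .
  qed
  then show ?thesis by (intro exI [of _ "\<Sum>i\<le>degree p. \<bar>coeff p i\<bar>"]) (auto intro: sum_nonneg)
qed

text \<open>All derivatives of \<open>ch * q(ratio)\<close> have the same form, so the Taylor coefficients at \<open>0\<close>, where \<open>ratio m 0 = m\<close>, are iterates of \<open>tilt_op\<close>, and the remainder
is controlled by \<open>\<bar>ratio\<bar> \<le> 1\<close>.\<close>

lemma taylor_ch_poly: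
  "\<exists>B\<ge>0. \<forall>m t. \<bar>m\<bar> \<le> 1 \<longrightarrow> 0 \<le> t \<longrightarrow>
    \<bar>ch m t * poly q (ratio m t) - (\<Sum>j<n. poly ((tilt_op ^^ j) q) m / fact j * t ^ j)\<bar> \<le> B * t ^ n * exp t"
proof -
  obtain B where B: "0 \<le> B" "\<And>x. \<bar>x\<bar> \<le> 1 \<Longrightarrow> \<bar>poly ((tilt_op ^^ n) q) x\<bar> \<le> B"
    using poly_bounded_unit [of "(tilt_op ^^ n) q"] by blast
  have "\<bar>ch m t * poly q (ratio m t) - (\<Sum>j<n. poly ((tilt_op ^^ j) q) m / fact j * t ^ j)\<bar> \<le> B * t ^ n * exp t"
    if m: "\<bar>m\<bar> \<le> 1" and t: "0 \<le> t" for m t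
  proof -
    define diff where "diff = (\<lambda>j t. ch m t * poly ((tilt_op ^^ j) q) (ratio m t))"
    have d: "\<forall>j x. (diff j has_real_derivative diff (Suc j) x) (at x)"
      unfolding diff_def using DERIV_ch_poly [OF m] by simp
    have d0: "diff j 0 = poly ((tilt_op ^^ j) q) m" for j by (simp add: diff_def ch_def sh_def ratio_def)
    obtain u where u: "\<bar>u\<bar> \<le> \<bar>t\<bar>" "diff 0 t = (\<Sum>j<n. diff j 0 / fact j * t ^ j) + diff n u / fact n * t ^ n"
      using Maclaurin_all_le [of diff "diff 0" t n] d by auto
    have "\<bar>ch m t * poly q (ratio m t) - (\<Sum>j<n. poly ((tilt_op ^^ j) q) m / fact j * t ^ j)\<bar> = \<bar>diff n u\<bar> / fact n * t ^ n"
      using u(2) t unfolding d0 by (simp add: diff_def abs_mult power_abs)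
    also have "\<dots> \<le> \<bar>diff n u\<bar> / 1 * t ^ n"
      using t by (intro mult_right_mono divide_left_mono) (auto simp: fact_ge_1)
    also have "\<dots> \<le> (exp t * B) * t ^ n"
    proof -
      have "\<bar>ch m u\<bar> \<le> exp t"
      proof -
        have "\<bar>two_point m (\<lambda>a. exp (- (a * u)))\<bar> \<le> exp t"
          by (rule two_point_bound [OF m]) (use u(1) t in \<open>auto simp: abs_le_iff\<close>)
        then show ?thesis unfolding ch_two_point .
      qed
      then have "\<bar>diff n u\<bar> \<le> exp t * B"
        unfolding diff_def abs_mult by (intro mult_mono B(2) ratio_bound m) auto
      then show ?thesis using t by (simp add: mult_right_mono)
    qed
    finally show ?thesis by (simp add: ac_simps)
  qed
  with B(1) show ?thesis by blast
qed

text \<open>The geometric series \<open>(t + l) / (1 + l t) = t + l (1 - t^2) \<Sum>_r (- l t)^r\<close>, truncated.\<close>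

lemma geometric_ratio:
  fixes t l :: real
  assumes "\<bar>t\<bar> \<le> 1" "0 < l" "l \<le> 1/2" "0 < n"
  shows "\<bar>(t + l) / (1 + l * t) - (\<Sum>r<n. l ^ r * poly (ratio_poly r) t)\<bar> \<le> 2 * l ^ n"
proof -
  have lt: "\<bar>l * t\<bar> \<le> l * 1" unfolding abs_mult using assms by (intro mult_mono) auto
  then have D: "1/2 \<le> 1 + l * t" using assms by linarith
  obtain k where n: "n = Suc k" using assms(4) gr0_implies_Suc by blast
  have key: "(t + l) / (1 + l * t) - (\<Sum>r<Suc k. l ^ r * poly (ratio_poly r) t) = l * (1 - t\<^sup>2) * (- (l * t)) ^ k / (1 + l * t)" for k
  proof (induction k)
    case 0
    show ?case using D by (simp add: poly_monom field_simps power2_eq_square)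
  next
    case (Suc k)
    have u: "l ^ Suc k * poly (ratio_poly (Suc k)) t = l * (1 - t\<^sup>2) * (- (l * t)) ^ k"
      by (simp add: poly_monom power_mult_distrib power_minus [of "l * t"] algebra_simps power2_eq_square)
    have "(t + l) / (1 + l * t) - (\<Sum>r<Suc (Suc k). l ^ r * poly (ratio_poly r) t)
        = l * (1 - t\<^sup>2) * (- (l * t)) ^ k / (1 + l * t) - l * (1 - t\<^sup>2) * (- (l * t)) ^ k"
      using Suc unfolding sum.lessThan_Suc [of _ "Suc k"] u by (simp only: diff_diff_eq [symmetric])
    also have "\<dots> = l * (1 - t\<^sup>2) * (- (l * t)) ^ Suc k / (1 + l * t)"
      using D by (simp add: field_simps)
    finally show ?case .
  qed
  have "\<bar>l * (1 - t\<^sup>2) * (- (l * t)) ^ k / (1 + l * t)\<bar> = l * (1 - t\<^sup>2) * \<bar>l * t\<bar> ^ k / (1 + l * t)"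
    using assms D by (simp add: abs_mult abs_divide power_abs abs_square_le_1)
  also have "\<dots> \<le> l * 1 * l ^ k / (1/2)"
  proof (rule frac_le)
    have "\<bar>l * t\<bar> ^ k \<le> l ^ k" using lt by (intro power_mono) auto
    then show "l * (1 - t\<^sup>2) * \<bar>l * t\<bar> ^ k \<le> l * 1 * l ^ k" using assms(1,2) by (intro mult_mono) (auto simp: abs_square_le_1)
    show "0 \<le> l * 1 * l ^ k" using assms(2) by simp
  qed (use D in auto)
  finally show ?thesis unfolding n key by simp
qed

lemma exponential_moment:
  "has_bochner_integral exponential_one (\<lambda>x. x ^ n) (fact n)"
proof -
  interpret prob_space exponential_one by (rule prob_space_exponential_density) simp
  have "distributed exponential_one lborel (\<lambda>x. x) (exponential_density 1)"
    unfolding distributed_def by (auto simp: distr_id2)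
  from has_bochner_integral_erlang_ith_moment [OF _ this, of n] show ?thesis by simp
qed

lemma exponential_scale:
  fixes f :: "real \<Rightarrow> real"
  assumes f: "integrable exponential_one f" and c: "0 < c"
  shows "integrable exponential_one (\<lambda>y. c * exp (- (c - 1) * y) * f (c * y))"
    and "(\<integral>x. f x \<partial>exponential_one) = (\<integral>y. c * exp (- (c - 1) * y) * f (c * y) \<partial>exponential_one)"
proof -
  have fm [measurable]: "f \<in> borel_measurable borel" using borel_measurable_integrable [OF f] by simp
  have nn: "AE x in lborel. 0 \<le> exponential_density 1 x" by (auto intro!: AE_I2 exponential_density_nonneg)
  have *: "exponential_density 1 y * (c * exp (- (c - 1) * y) * f (c * y)) = c * (exponential_density 1 (c * y) * f (c * y))" for y
    using c by (auto simp: exponential_density_def exp_add [symmetric] mult_less_0_iff field_simps)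
  have i: "integrable lborel (\<lambda>x. exponential_density 1 x * f x)"
    using f by (subst (asm) integrable_density) (use nn in auto)
  have i2: "integrable lborel (\<lambda>y. c * (exponential_density 1 (c * y) * f (c * y)))"
    using lborel_integrable_real_affine [OF i, of c 0] c by simp
  show "integrable exponential_one (\<lambda>y. c * exp (- (c - 1) * y) * f (c * y))"
  proof (subst integrable_density)
    show "integrable lborel (\<lambda>x. exponential_density 1 x *\<^sub>R (c * exp (- (c - 1) * x) * f (c * x)))"
      using i2 unfolding real_scaleR_def * .
  qed (use nn in auto)
  have "(\<integral>x. f x \<partial>exponential_one) = (\<integral>x. exponential_density 1 x * f x \<partial>lborel)"
    by (subst integral_density) (use nn in auto)
  also have "\<dots> = (\<integral>y. c * (exponential_density 1 (c * y) * f (c * y)) \<partial>lborel)"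
    using lborel_integral_real_affine [of c "\<lambda>x. exponential_density 1 x * f x" 0] c by simp
  also have "\<dots> = (\<integral>y. c * exp (- (c - 1) * y) * f (c * y) \<partial>exponential_one)"
    unfolding * [symmetric]
    by (subst integral_density) (use nn in \<open>auto simp del: mult_minus_left\<close>)
  finally show "(\<integral>x. f x \<partial>exponential_one) = (\<integral>y. c * exp (- (c - 1) * y) * f (c * y) \<partial>exponential_one)" .
qed

text \<open>In the variable \<open>y = x / (1 + l c)\<close> the likelihood of a spin value \<open>a\<close> becomes \<open>(1 + l a) exp (- a l y)\<close>, free of \<open>c\<close>.\<close>

lemma tilted_slope_scaled:
  assumes l: "0 < l" "l \<le> 1/2" and m: "\<bar>m\<bar> \<le> 1" and c: "\<bar>c\<bar> = 1"
  shows "tilted_slope l m c ((1 + l * c) * y)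
    = (sh m (l * y) - y / (1 + l * c) * (sh m (l * y) + l * ch m (l * y))) / (ch m (l * y) + l * sh m (l * y))"
proof -
  have lc: "0 < 1 + l * c" using l unit_cases [OF c] by auto
  have e: "exp (pt_term l a c ((1 + l * c) * y)) = (1 + l * a) * exp (- (a * (l * y)))" if a: "\<bar>a\<bar> = 1" for a
  proof -
    have la: "0 < 1 + l * a" using l unit_cases [OF a] by auto
    have "pt_term l a c ((1 + l * c) * y) = ln (1 + l * a) + - (a * (l * y))"
      unfolding pt_term_def using lc by simp
    then show ?thesis using la by (simp only: exp_add exp_ln)
  qed
  have n: "slope l a c ((1 + l * c) * y) * ((1 + l * a) * exp (- (a * (l * y))))
      = a * exp (- (a * (l * y))) - y / (1 + l * c) * (a * (1 + l * a) * exp (- (a * (l * y))))" if a: "\<bar>a\<bar> = 1" for a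
  proof -
    have la: "0 < 1 + l * a" using l unit_cases [OF a] by auto
    have "slope l a c ((1 + l * c) * y) = a / (1 + l * a) - y * a / (1 + l * c)"
      unfolding slope_def using lc by (simp add: power2_eq_square)
    then show ?thesis using la by (simp add: left_diff_distrib mult.assoc)
  qed
  have ab: "\<bar>1 :: real\<bar> = 1" "\<bar>- 1 :: real\<bar> = 1" by simp_all
  have num: "(1 + m) / 2 * (1 * p - r * (1 * (1 + l * 1) * p)) + (1 - m) / 2 * ((-1) * q - r * ((-1) * (1 + l * (-1)) * q))
      = (1 + m) / 2 * (1 * p) + (1 - m) / 2 * ((-1) * q)
        - r * ((1 + m) / 2 * (1 * p) + (1 - m) / 2 * ((-1) * q) + l * ((1 + m) / 2 * p + (1 - m) / 2 * q))" for p q r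
    by (simp add: field_simps)
  have den: "(1 + m) / 2 * ((1 + l * 1) * p) + (1 - m) / 2 * ((1 + l * (-1)) * q)
      = (1 + m) / 2 * p + (1 - m) / 2 * q + l * ((1 + m) / 2 * (1 * p) + (1 - m) / 2 * ((-1) * q))" for p q
    by algebra
  show ?thesis
    unfolding tilted_slope_def two_point_def ch_two_point sh_two_point
    unfolding e [OF ab(1)] e [OF ab(2)] n [OF ab(1)] n [OF ab(2)]
    by (rule arg_cong2 [where f = "(/)"]) (rule num, rule den)
qed

text \<open>Substituting \<open>x = (1 + l c) y\<close> in the two terms \<open>c = 1\<close> and \<open>c = -1\<close> separately, the densities add up to the
denominator \<open>ch + l sh\<close> of the slope, which cancels in the first part of the integrand.\<close>

lemma response_closed_form:
  assumes l: "0 < l" "l \<le> 1/2" and m: "\<bar>m\<bar> \<le> 1"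
  shows "response l m = (\<integral>y. sh m (l * y) - y * (ch m (l * y) * ((ratio m (l * y) + l) / (1 + l * ratio m (l * y)))) \<partial>exponential_one)"
proof -
  have xi: "integrable exponential_one (tilted_slope l m c)" if c: "\<bar>c\<bar> = 1" for c
  proof (rule Bochner_Integration.integrable_bound)
    show "integrable exponential_one (\<lambda>x. 4 * (1 + x))"
      by (rule integrable_mult_right [OF integrable_exponential_linear])
    show "tilted_slope l m c \<in> borel_measurable exponential_one"
      using tilted_slope_meas [of "\<lambda>_. m" exponential_one "\<lambda>x. x" "\<lambda>_. c" l] by simp
    show "AE x in exponential_one. norm (tilted_slope l m c x) \<le> norm (4 * (1 + x))"
      using AE_exponential_nonneg
    proof eventually_elim
      case (elim x)
      from tilted_slope_bound [OF l m c elim] elim show ?case by simp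
    qed
  qed
  have lp: "0 < 1 + l" and lm: "0 < 1 - l" using l by auto
  let ?w = "\<lambda>c y. (1 + l * c) * exp (- (l * c) * y) * tilted_slope l m c ((1 + l * c) * y)"
  have s1: "integrable exponential_one (?w 1)" "(\<integral>x. tilted_slope l m 1 x \<partial>exponential_one) = (\<integral>y. ?w 1 y \<partial>exponential_one)"
    using exponential_scale [OF xi lp, of 1] by simp_all
  have s2: "integrable exponential_one (?w (-1))" "(\<integral>x. tilted_slope l m (-1) x \<partial>exponential_one) = (\<integral>y. ?w (-1) y \<partial>exponential_one)"
    using exponential_scale [OF xi lm, of "-1"] by simp_all
  have "response l m = (1 + m) / 2 * (\<integral>x. tilted_slope l m 1 x \<partial>exponential_one) + (1 - m) / 2 * (\<integral>x. tilted_slope l m (-1) x \<partial>exponential_one)"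
    unfolding response_def two_point_def
    by (subst Bochner_Integration.integral_add) (auto intro!: integrable_mult_right xi)
  also have "\<dots> = (\<integral>y. (1 + m) / 2 * ?w 1 y + (1 - m) / 2 * ?w (-1) y \<partial>exponential_one)"
    unfolding s1(2) s2(2)
    by (subst Bochner_Integration.integral_add) ((rule integrable_mult_right s1(1) s2(1))+, simp only: integral_mult_right_zero)
  also have "\<dots> = (\<integral>y. sh m (l * y) - y * (ch m (l * y) * ((ratio m (l * y) + l) / (1 + l * ratio m (l * y)))) \<partial>exponential_one)"
  proof (rule Bochner_Integration.integral_cong [OF refl])
    fix y
    have ab: "\<bar>- 1 :: real\<bar> = 1" by simp
    define S C where "S = sh m (l * y)" and "C = ch m (l * y)"
    have C: "0 < C" unfolding C_def by (rule ch_pos [OF m])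
    have SC: "\<bar>S\<bar> \<le> C" unfolding S_def C_def by (rule sh_le_ch [OF m])
    have "\<bar>l * S\<bar> \<le> 1/2 * C" unfolding abs_mult using l SC by (intro mult_mono) auto
    then have D: "0 < C + l * S" using C by linarith
    define e1 e2 where "e1 = exp (- (l * y))" and "e2 = exp (l * y)"
    have Ce: "C = (1 + m) / 2 * e1 + (1 - m) / 2 * e2" "S = (1 + m) / 2 * e1 - (1 - m) / 2 * e2"
      unfolding C_def S_def ch_two_point sh_two_point two_point_def e1_def e2_def by simp_all
    have w1: "?w 1 y = e1 * ((1 + l) * S - y * (S + l * C)) / (C + l * S)"
      unfolding tilted_slope_scaled [OF l m abs_one] S_def [symmetric] C_def [symmetric] e1_def times_divide_eq_right
      by (rule arg_cong2 [where f = "(/)"]) (use lp in \<open>simp_all add: right_diff_distrib\<close>)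
    have w2: "?w (-1) y = e2 * ((1 - l) * S - y * (S + l * C)) / (C + l * S)"
      unfolding tilted_slope_scaled [OF l m ab] S_def [symmetric] C_def [symmetric] e2_def times_divide_eq_right
      by (rule arg_cong2 [where f = "(/)"]) (use lm in \<open>simp_all add: right_diff_distrib\<close>)
    have "(1 + m) / 2 * ?w 1 y + (1 - m) / 2 * ?w (-1) y
        = ((1 + m) / 2 * (e1 * ((1 + l) * S - y * (S + l * C))) + (1 - m) / 2 * (e2 * ((1 - l) * S - y * (S + l * C)))) / (C + l * S)"
      unfolding w1 w2 by (simp add: add_divide_distrib)
    also have "(1 + m) / 2 * (e1 * ((1 + l) * S - y * (S + l * C))) + (1 - m) / 2 * (e2 * ((1 - l) * S - y * (S + l * C)))
        = S * (((1 + m) / 2 * e1 + (1 - m) / 2 * e2) + l * ((1 + m) / 2 * e1 - (1 - m) / 2 * e2))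
          - y * (S + l * C) * ((1 + m) / 2 * e1 + (1 - m) / 2 * e2)" by algebra
    also have "\<dots> = S * (C + l * S) - y * (S + l * C) * C" unfolding Ce [symmetric] ..
    also have "\<dots> / (C + l * S) = S - y * (C * ((S / C + l) / (1 + l * (S / C))))"
    proof -
      have "(S / C + l) / (1 + l * (S / C)) = (S + l * C) / (C + l * S)"
      proof -
        have "S / C + l = (S + l * C) / C" "1 + l * (S / C) = (C + l * S) / C" using C by (simp_all add: field_simps)
        then show ?thesis using C by simp
      qed
      then show ?thesis using D by (simp add: diff_divide_distrib)
    qed
    finally show "(1 + m) / 2 * ?w 1 y + (1 - m) / 2 * ?w (-1) y
      = sh m (l * y) - y * (ch m (l * y) * ((ratio m (l * y) + l) / (1 + l * ratio m (l * y))))"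
      unfolding S_def C_def ratio_def .
  qed
  finally show ?thesis .
qed

lemma one_plus_power_le_exp:
  fixes y :: real
  assumes "0 \<le> y"
  shows "(1 + y) ^ k \<le> (2 * real k + 1) ^ k * exp (y / 2)"
proof (cases "k = 0")
  case False
  define a where "a = 2 * real k + 1"
  have a: "1 \<le> a" "real k / a \<le> 1/2" using False by (auto simp: a_def field_simps)
  have "1 + y \<le> a * exp (y / a)"
  proof -
    have "a * (1 + y / a) \<le> a * exp (y / a)" using a by (intro mult_left_mono exp_ge_add_one_self) auto
    moreover have "a * (1 + y / a) = a + y" using a by (simp add: field_simps)
    ultimately show ?thesis using a by linarith
  qed
  then have "(1 + y) ^ k \<le> (a * exp (y / a)) ^ k" using assms by (intro power_mono) auto
  also have "\<dots> = a ^ k * exp (real k * (y / a))" by (simp only: power_mult_distrib exp_of_nat_mult)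
  also have "\<dots> \<le> a ^ k * exp (y / 2)"
  proof -
    have "real k * (y / a) = real k / a * y" by simp
    also have "\<dots> \<le> 1/2 * y" using a(2) assms by (rule mult_right_mono)
    finally show ?thesis using a by (intro mult_left_mono) auto
  qed
  finally show ?thesis by (simp add: a_def)
qed (use assms in simp)

lemma integrable_exponential_weight:
  "integrable exponential_one (\<lambda>y. (1 + y) ^ k * exp (1/8 * y))"
proof (rule Bochner_Integration.integrable_bound)
  show "integrable exponential_one (\<lambda>y. (2 * real k + 1) ^ k * exp (5/8 * y))"
    by (intro integrable_mult_right integrable_exponential_exp) simp
  show "AE y in exponential_one. norm ((1 + y) ^ k * exp (1/8 * y)) \<le> norm ((2 * real k + 1) ^ k * exp (5/8 * y))"
    using AE_exponential_nonneg
  proof eventually_elim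
    case (elim y)
    have "(1 + y) ^ k * exp (1/8 * y) \<le> (2 * real k + 1) ^ k * exp (y / 2) * exp (1/8 * y)"
      by (intro mult_right_mono one_plus_power_le_exp elim) auto
    also have "\<dots> = (2 * real k + 1) ^ k * exp (5/8 * y)" by (simp add: mult.assoc exp_add [symmetric])
    finally show ?case using elim by simp
  qed
qed simp

lemma poly_response_poly:
  "poly (response_poly J) x = poly ((tilt_op ^^ J) (ratio_poly 0)) x - (\<Sum>r\<le>J. real (J - r + 1) * poly ((tilt_op ^^ (J - r)) (ratio_poly r)) x)"
  unfolding response_poly_def weighted_orbit_sum_sum by (simp add: poly_sum del: ratio_poly.simps)

text \<open>The geometric series and the Taylor expansion at \<open>t = l y\<close> are inserted into the closed form. The moments
\<open>\<integral> y^j e^-y dy = j!\<close> cancel the Taylor denominators, except that the factor \<open>y\<close> in the second part leaves \<open>(j + 1)! / j! = j + 1\<close>. This explains the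
weights in \<open>weighted_orbit_sum\<close>. The remainders are bounded by \<open>l^n\<close> times an integrable weight.\<close>

lemma response_expansion:
  assumes n: "0 < n"
  shows "\<exists>K\<ge>0. \<forall>l m. 0 < l \<longrightarrow> l \<le> 1/8 \<longrightarrow> \<bar>m\<bar> \<le> 1 \<longrightarrow>
    \<bar>response l m - (\<Sum>J<n. l ^ J * poly (response_poly J) m)\<bar> \<le> K * l ^ n"
proof -
  have "\<forall>r. \<exists>B\<ge>0. \<forall>m t. \<bar>m\<bar> \<le> 1 \<longrightarrow> 0 \<le> t \<longrightarrow>
    \<bar>ch m t * poly (ratio_poly r) (ratio m t) - (\<Sum>j<n - r. poly ((tilt_op ^^ j) (ratio_poly r)) m / fact j * t ^ j)\<bar> \<le> B * t ^ (n - r) * exp t"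
    by (intro allI taylor_ch_poly)
  from choice [OF this] obtain B where B0: "\<And>r. 0 \<le> B r" and B: "\<And>r m t. \<bar>m\<bar> \<le> 1 \<Longrightarrow> 0 \<le> t \<Longrightarrow>
    \<bar>ch m t * poly (ratio_poly r) (ratio m t) - (\<Sum>j<n - r. poly ((tilt_op ^^ j) (ratio_poly r)) m / fact j * t ^ j)\<bar> \<le> B r * t ^ (n - r) * exp t"
    by blast
  define Bt where "Bt = B 0 + (\<Sum>r<n. B r) + 2"
  define w where "w = (\<lambda>y :: real. (1 + y) ^ (n + 1) * exp (1/8 * y))"
  have wi: "integrable exponential_one w" unfolding w_def by (rule integrable_exponential_weight)
  define K where "K = Bt * (\<integral>y. w y \<partial>exponential_one)"
  have w0: "AE y in exponential_one. 0 \<le> w y"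
    using AE_exponential_nonneg by eventually_elim (simp add: w_def)
  have K0: "0 \<le> K"
    unfolding K_def Bt_def using B0 by (intro mult_nonneg_nonneg add_nonneg_nonneg sum_nonneg integral_nonneg_AE w0) auto
  have "\<bar>response l m - (\<Sum>J<n. l ^ J * poly (response_poly J) m)\<bar> \<le> K * l ^ n" if l: "0 < l" "l \<le> 1/8" and m: "\<bar>m\<bar> \<le> 1" for l m
  proof -
    define c where "c = (\<lambda>r j. poly ((tilt_op ^^ j) (ratio_poly r)) m)"
    define I where "I = (\<lambda>y. sh m (l * y) - y * (ch m (l * y) * ((ratio m (l * y) + l) / (1 + l * ratio m (l * y)))))"
    \<comment> \<open>the integrand with the geometric series and all Taylor expansions truncated at total order \<open>n\<close> in \<open>l\<close>\<close>
    define Q where "Q = (\<lambda>y. (\<Sum>j<n. c 0 j / fact j * (l * y) ^ j) - y * (\<Sum>r<n. l ^ r * (\<Sum>j<n - r. c r j / fact j * (l * y) ^ j)))"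
    have IQ: "\<bar>I y - Q y\<bar> \<le> Bt * l ^ n * w y" if y: "0 \<le> y" for y
    proof -
      let ?t = "l * y"
      have t: "0 \<le> ?t" using l y by simp
      have et: "exp ?t \<le> exp (1/8 * y)" unfolding exp_le_cancel_iff using l(2) y by (rule mult_right_mono)
      have yp: "y ^ i \<le> (1 + y) ^ (n + 1)" if "i \<le> n + 1" for i
      proof -
        have "y ^ i \<le> (1 + y) ^ i" using y by (intro power_mono) auto
        also have "\<dots> \<le> (1 + y) ^ (n + 1)" using y that by (intro power_increasing) auto
        finally show ?thesis .
      qed
      have main: "b * y ^ i * exp ?t \<le> b * w y" if "0 \<le> b" "i \<le> n + 1" for b i
        unfolding w_def mult.assoc using y by (intro mult_left_mono mult_mono et yp that) auto
      define a0 where "a0 = ch m ?t * poly (ratio_poly 0) (ratio m ?t) - (\<Sum>j<n. c 0 j / fact j * ?t ^ j)"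
      define a where "a = (\<lambda>r. ch m ?t * poly (ratio_poly r) (ratio m ?t) - (\<Sum>j<n - r. c r j / fact j * ?t ^ j))"
      define g where "g = (ratio m ?t + l) / (1 + l * ratio m ?t) - (\<Sum>r<n. l ^ r * poly (ratio_poly r) (ratio m ?t))"
      have sh: "sh m ?t = ch m ?t * poly (ratio_poly 0) (ratio m ?t)"
        using ch_pos [OF m, of ?t] by (simp add: ratio_def poly_monom)
      have e: "I y - Q y = a0 - (\<Sum>r<n. y * l ^ r * a r) - y * ch m ?t * g"
        unfolding I_def Q_def sh a0_def a_def g_def
        by (simp add: algebra_simps sum_distrib_left sum_subtractf del: ratio_poly.simps)
      have b0: "\<bar>a0\<bar> \<le> B 0 * l ^ n * w y"
      proof -
        have "\<bar>a0\<bar> \<le> B 0 * ?t ^ n * exp ?t" using B [OF m t, of 0] by (simp add: a0_def c_def del: ratio_poly.simps)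
        also have "\<dots> = B 0 * l ^ n * y ^ n * exp ?t" by (simp add: power_mult_distrib)
        also have "\<dots> \<le> B 0 * l ^ n * w y" using B0 l by (intro main) auto
        finally show ?thesis .
      qed
      have br: "\<bar>y * l ^ r * a r\<bar> \<le> B r * l ^ n * w y" if r: "r < n" for r
      proof -
        have "\<bar>y * l ^ r * a r\<bar> = y * l ^ r * \<bar>a r\<bar>" using y l by (simp add: abs_mult)
        also have "\<dots> \<le> y * l ^ r * (B r * ?t ^ (n - r) * exp ?t)"
          using B [OF m t, of r] y l by (intro mult_left_mono) (auto simp: a_def c_def)
        also have "\<dots> = B r * (l ^ r * l ^ (n - r)) * (y * y ^ (n - r)) * exp ?t" by (simp add: power_mult_distrib)
        also have "\<dots> = B r * l ^ n * y ^ (Suc (n - r)) * exp ?t" using r by (simp add: power_add [symmetric])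
        also have "\<dots> \<le> B r * l ^ n * w y" using B0 l by (intro main) auto
        finally show ?thesis .
      qed
      have bg: "\<bar>y * ch m ?t * g\<bar> \<le> 2 * l ^ n * w y"
      proof -
        have "\<bar>g\<bar> \<le> 2 * l ^ n" unfolding g_def using l by (intro geometric_ratio ratio_bound m n) auto
        then have "\<bar>y * ch m ?t * g\<bar> \<le> (y * exp ?t) * (2 * l ^ n)"
          unfolding abs_mult using ch_pos [OF m, of ?t] ch_le [OF m t] y by (intro mult_mono) auto
        also have "\<dots> = 2 * l ^ n * y ^ 1 * exp ?t" by simp
        also have "\<dots> \<le> 2 * l ^ n * w y" using l by (intro main) auto
        finally show ?thesis .
      qed
      have bs: "\<bar>\<Sum>r<n. y * l ^ r * a r\<bar> \<le> (\<Sum>r<n. B r) * l ^ n * w y"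
      proof -
        have "\<bar>\<Sum>r<n. y * l ^ r * a r\<bar> \<le> (\<Sum>r<n. \<bar>y * l ^ r * a r\<bar>)" by (rule sum_abs)
        also have "\<dots> \<le> (\<Sum>r<n. B r * l ^ n * w y)" by (intro sum_mono br) auto
        finally show ?thesis by (simp only: sum_distrib_right)
      qed
      have "\<bar>I y - Q y\<bar> \<le> \<bar>a0\<bar> + \<bar>\<Sum>r<n. y * l ^ r * a r\<bar> + \<bar>y * ch m ?t * g\<bar>" unfolding e by linarith
      also have "\<dots> \<le> B 0 * l ^ n * w y + (\<Sum>r<n. B r) * l ^ n * w y + 2 * l ^ n * w y"
        by (intro add_mono b0 bs bg)
      also have "\<dots> = Bt * l ^ n * w y" unfolding Bt_def by (simp only: distrib_right)
      finally show ?thesis .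
    qed
    have mom: "integrable exponential_one (\<lambda>y. y ^ i)" "(\<integral>y. y ^ i \<partial>exponential_one) = fact i" for i
      using exponential_moment [of i] by (auto simp: has_bochner_integral_iff)
    \<comment> \<open>as a polynomial in \<open>y\<close>, so that it can be integrated by moments\<close>
    have Qe: "Q y = (\<Sum>j<n. (c 0 j / fact j * l ^ j) * y ^ j) - (\<Sum>r<n. \<Sum>j<n - r. (c r j / fact j * l ^ (r + j)) * y ^ Suc j)" for y
      unfolding Q_def by (simp add: sum_distrib_left power_mult_distrib power_add algebra_simps)
    have Qi: "integrable exponential_one Q"
      unfolding Qe [abs_def]
      by (intro Bochner_Integration.integrable_diff Bochner_Integration.integrable_sum integrable_mult_right mom(1))
    have "(\<integral>y. Q y \<partial>exponential_one) = (\<Sum>j<n. (c 0 j / fact j * l ^ j) * fact j) - (\<Sum>r<n. \<Sum>j<n - r. (c r j / fact j * l ^ (r + j)) * fact (Suc j))"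
      unfolding Qe
      by (subst Bochner_Integration.integral_diff, intro Bochner_Integration.integrable_sum integrable_mult_right mom(1),
        intro Bochner_Integration.integrable_sum integrable_mult_right mom(1))
        (simp only: Bochner_Integration.integral_sum Bochner_Integration.integrable_sum integrable_mult_right mom integral_mult_right_zero)
    also have "(\<Sum>j<n. (c 0 j / fact j * l ^ j) * fact j) = (\<Sum>j<n. l ^ j * c 0 j)" by (intro sum.cong) auto
    also have "(\<Sum>r<n. \<Sum>j<n - r. (c r j / fact j * l ^ (r + j)) * fact (Suc j)) = (\<Sum>r<n. \<Sum>j<n - r. l ^ (r + j) * (real (j + 1) * c r j))"
      by (intro sum.cong refl) simp
    \<comment> \<open>collect the terms by total order \<open>J = r + j\<close>\<close>
    also have "\<dots> = (\<Sum>J<n. \<Sum>r\<le>J. l ^ (r + (J - r)) * (real (J - r + 1) * c r (J - r)))"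
    proof -
      have "(SIGMA r:{..<n}. {..<n - r}) = {(r, j). r + j < n}" by auto
      then show ?thesis
        using sum.triangle_reindex [of "\<lambda>r j. l ^ (r + j) * (real (j + 1) * c r j)" n] by (simp add: sum.Sigma)
    qed
    also have "\<dots> = (\<Sum>J<n. l ^ J * (\<Sum>r\<le>J. real (J - r + 1) * c r (J - r)))"
      unfolding sum_distrib_left by (intro sum.cong refl) simp
    finally have Qv: "(\<integral>y. Q y \<partial>exponential_one) = (\<Sum>J<n. l ^ J * poly (response_poly J) m)"
      unfolding poly_response_poly c_def by (simp only: right_diff_distrib sum_subtractf)
    have Im: "I \<in> borel_measurable exponential_one" unfolding I_def ch_def sh_def ratio_def cosh_def sinh_def by measurable
    have IQm: "(\<lambda>y. I y - Q y) \<in> borel_measurable exponential_one" by (rule borel_measurable_diff [OF Im borel_measurable_integrable [OF Qi]])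
    have IQae: "AE y in exponential_one. \<bar>I y - Q y\<bar> \<le> Bt * l ^ n * w y"
      using AE_exponential_nonneg
    proof eventually_elim
      case (elim y)
      then show ?case by (rule IQ)
    qed
    have wi': "integrable exponential_one (\<lambda>y. Bt * l ^ n * w y)" by (rule integrable_mult_right [OF wi])
    have IQi: "integrable exponential_one (\<lambda>y. I y - Q y)"
    proof (rule Bochner_Integration.integrable_bound [OF wi' IQm])
      show "AE y in exponential_one. norm (I y - Q y) \<le> norm (Bt * l ^ n * w y)"
        using IQae
      proof eventually_elim
        case (elim y)
        then show ?case unfolding real_norm_def by (rule order_trans [OF _ abs_ge_self])
      qed
    qed
    have Ii: "integrable exponential_one I" using Bochner_Integration.integrable_add [OF IQi Qi] by simp
    have "response l m = (\<integral>y. I y \<partial>exponential_one)" unfolding I_def using l by (intro response_closed_form m) auto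
    then have "response l m - (\<Sum>J<n. l ^ J * poly (response_poly J) m) = (\<integral>y. I y - Q y \<partial>exponential_one)"
      unfolding Qv [symmetric] Bochner_Integration.integral_diff [OF Ii Qi] by simp
    also have "\<bar>\<dots>\<bar> \<le> (\<integral>y. \<bar>I y - Q y\<bar> \<partial>exponential_one)" by (rule integral_abs_bound)
    also have "\<dots> \<le> (\<integral>y. Bt * l ^ n * w y \<partial>exponential_one)"
      by (rule integral_mono_AE [OF integrable_abs [OF IQi] wi' IQae])
    also have "\<dots> = K * l ^ n" unfolding K_def integral_mult_right_zero by simp
    finally show ?thesis .
  qed
  with K0 show ?thesis by blast
qed

section \<open>Self-averaging of empirical polynomial averages\<close>

lemma poly_lipschitz_unit:
  "\<exists>L\<ge>0. \<forall>x y. \<bar>x\<bar> \<le> 1 \<longrightarrow> \<bar>y\<bar> \<le> 1 \<longrightarrow> \<bar>poly p x - poly p y\<bar> \<le> L * \<bar>x - y :: real\<bar>"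
proof (induction p)
  case 0 show ?case by (intro exI [of _ 0]) simp
next
  case (pCons a q)
  obtain L where L: "0 \<le> L" "\<And>x y. \<bar>x\<bar> \<le> 1 \<Longrightarrow> \<bar>y\<bar> \<le> 1 \<Longrightarrow> \<bar>poly q x - poly q y\<bar> \<le> L * \<bar>x - y\<bar>"
    using pCons.IH by blast
  obtain B where B: "0 \<le> B" "\<And>x. \<bar>x\<bar> \<le> 1 \<Longrightarrow> \<bar>poly q x\<bar> \<le> B"
    using poly_bounded_unit [of q] by blast
  have "\<bar>poly (pCons a q) x - poly (pCons a q) y\<bar> \<le> (L + B) * \<bar>x - y\<bar>" if "\<bar>x\<bar> \<le> 1" "\<bar>y\<bar> \<le> 1" for x y
  proof -
    have eq: "poly (pCons a q) x - poly (pCons a q) y = x * (poly q x - poly q y) + (x - y) * poly q y"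
      by (simp add: algebra_simps)
    have "\<bar>poly (pCons a q) x - poly (pCons a q) y\<bar> \<le> \<bar>x\<bar> * \<bar>poly q x - poly q y\<bar> + \<bar>x - y\<bar> * \<bar>poly q y\<bar>"
      unfolding eq abs_mult [symmetric] by (rule abs_triangle_ineq)
    also have "\<dots> \<le> 1 * (L * \<bar>x - y\<bar>) + \<bar>x - y\<bar> * B"
      by (rule add_mono [OF mult_mono [OF that(1) L(2) [OF that]] mult_left_mono [OF B(2) [OF that(2)]]]) simp_all
    finally show ?thesis by (simp add: algebra_simps)
  qed
  with L(1) B(1) show ?case by (intro exI [of _ "L + B"]) auto
qed

lemma tendsto_zero_by_bounds:
  fixes x :: "nat \<Rightarrow> real"
  assumes nonneg: "\<And>N. 1 \<le> N \<Longrightarrow> 0 \<le> x N"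
    and bound: "\<And>e. 0 < e \<Longrightarrow> \<exists>z. z \<longlonglongrightarrow> 0 \<and> (\<forall>N\<ge>1. x N \<le> e + z N)"
  shows "x \<longlonglongrightarrow> 0"
proof (rule LIMSEQ_I)
  fix r :: real assume r: "0 < r"
  obtain z where z: "z \<longlonglongrightarrow> 0" "\<And>N. 1 \<le> N \<Longrightarrow> x N \<le> r / 2 + z N"
    using bound [of "r / 2"] r by auto
  have "eventually (\<lambda>N. z N < r / 2) sequentially" using z(1) r by (intro order_tendstoD(2)) auto
  then obtain M where M: "\<And>N. M \<le> N \<Longrightarrow> z N < r / 2" by (auto simp: eventually_sequentially)
  have "norm (x N - 0) < r" if "max M 1 \<le> N" for N
    using nonneg [of N] z(2) [of N] M [of N] that by simp
  then show "\<exists>n0. \<forall>N\<ge>n0. norm (x N - 0) < r" by blast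
qed

text \<open>The inequality between arithmetic and geometric means with a free parameter, used to pass from second moments to first moments.\<close>

lemma abs_le_square_weighted:
  fixes x \<eta> :: real
  assumes "0 < \<eta>"
  shows "\<bar>x\<bar> \<le> \<eta> / 2 + x\<^sup>2 / (2 * \<eta>)"
proof -
  have "(\<bar>x\<bar> - \<eta>)\<^sup>2 = x\<^sup>2 - 2 * \<eta> * \<bar>x\<bar> + \<eta>\<^sup>2" by (simp add: power2_diff)
  moreover have "0 \<le> (\<bar>x\<bar> - \<eta>)\<^sup>2" by simp
  ultimately have "2 * \<eta> * \<bar>x\<bar> \<le> \<eta>\<^sup>2 + x\<^sup>2" by linarith
  then show ?thesis using assms by (simp add: field_simps power2_eq_square)
qed

text \<open>The deterministic part of the argument. The polynomials whose fluctuation tends to zero form a linear space; \<open>key\<close> puts all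
\<open>response_poly J\<close> into it, by induction on \<open>J\<close> with \<open>k\<close> chosen large after the tolerance; and the powers are recovered from them.\<close>

lemma fluctuations_vanish:
  fixes mean_dev var :: "nat \<Rightarrow> real poly \<Rightarrow> real" and D :: "nat \<Rightarrow> real" and En :: "nat \<Rightarrow> nat \<Rightarrow> real"
  assumes nonneg: "\<And>N p. 1 \<le> N \<Longrightarrow> 0 \<le> mean_dev N p"
    and add: "\<And>N p q. 1 \<le> N \<Longrightarrow> mean_dev N (p + q) \<le> mean_dev N p + mean_dev N q"
    and smult: "\<And>N c p. 1 \<le> N \<Longrightarrow> mean_dev N (smult c p) \<le> \<bar>c\<bar> * mean_dev N p"
    and one: "\<And>N. 1 \<le> N \<Longrightarrow> mean_dev N 1 = 0"
    and power: "\<And>N n. 1 \<le> N \<Longrightarrow> mean_dev N (monom 1 n) \<le> 2"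
    and var: "\<And>N p \<eta>. 1 \<le> N \<Longrightarrow> 0 < \<eta> \<Longrightarrow> mean_dev N p \<le> \<eta> / 2 + var N p / (2 * \<eta>)"
    and key: "\<And>J. \<exists>c K. 0 \<le> K \<and> (\<forall>N\<ge>1. \<forall>k\<ge>3. var N (response_poly J) \<le> c * 2 ^ ((k + 1) * J) * (En k N + D N + (\<Sum>i<J. mean_dev N (response_poly i))) + K * (1/2) ^ k)"
    and En: "\<And>k. 3 \<le> k \<Longrightarrow> En k \<longlonglongrightarrow> 0" and D: "D \<longlonglongrightarrow> 0"
  shows "(\<lambda>N. mean_dev N (monom 1 n)) \<longlonglongrightarrow> 0"
proof -
  define V where "V p \<longleftrightarrow> (\<lambda>N. mean_dev N p) \<longlonglongrightarrow> 0" for p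
  have V_le: "V p" if z: "z \<longlonglongrightarrow> 0" and le: "\<And>N. 1 \<le> N \<Longrightarrow> mean_dev N p \<le> z N" for p z
    unfolding V_def
  proof (rule tendsto_zero_by_bounds [OF nonneg])
    fix e :: real assume "0 < e"
    then have "mean_dev N p \<le> e + z N" if "1 \<le> N" for N using le [OF that] by linarith
    with z show "\<exists>z. z \<longlonglongrightarrow> 0 \<and> (\<forall>N\<ge>1. mean_dev N p \<le> e + z N)" by blast
  qed
  have V_add: "V (p + q)" if "V p" "V q" for p q
    by (rule V_le [OF _ add]) (use tendsto_add [of "\<lambda>N. mean_dev N p" 0 _ "\<lambda>N. mean_dev N q" 0] that in \<open>auto simp: V_def\<close>)
  have V_smult: "V (smult c p)" if "V p" for c p
    by (rule V_le [OF _ smult]) (use tendsto_mult_right_zero [of "\<lambda>N. mean_dev N p" _ "\<bar>c\<bar>"] that in \<open>auto simp: V_def\<close>)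
  have V_one: "V 1" by (rule V_le [of "\<lambda>_. 0"]) (auto simp: one)
  have V_response_poly: "V (response_poly J)" for J
  proof (induction J rule: less_induct)
    case (less J)
    obtain c K where K: "0 \<le> K" and le: "\<And>N k. 1 \<le> N \<Longrightarrow> 3 \<le> k \<Longrightarrow>
        var N (response_poly J) \<le> c * 2 ^ ((k + 1) * J) * (En k N + D N + (\<Sum>i<J. mean_dev N (response_poly i))) + K * (1/2) ^ k"
      using key [of J] by blast
    show ?case
      unfolding V_def
    proof (rule tendsto_zero_by_bounds [OF nonneg])
      fix \<eta> :: real assume \<eta>: "0 < \<eta>"
      have "(\<lambda>k. K * (1/2 :: real) ^ k) \<longlonglongrightarrow> 0"
        by (intro tendsto_mult_right_zero LIMSEQ_realpow_zero) auto
      then have "eventually (\<lambda>k. K * (1/2) ^ k < \<eta>\<^sup>2) sequentially" using \<eta> by (intro order_tendstoD(2)) auto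
      then obtain M where M: "\<And>k. M \<le> k \<Longrightarrow> K * (1/2) ^ k < \<eta>\<^sup>2" by (auto simp: eventually_sequentially)
      \<comment> \<open>the tolerance decides how small \<open>\<lambda>_k\<close> has to be\<close>
      define k where "k = max M 3"
      have k: "3 \<le> k" "K * (1/2) ^ k \<le> \<eta>\<^sup>2" using M [of k] by (auto simp: k_def)
      define z where "z = (\<lambda>N. c * 2 ^ ((k + 1) * J) * (En k N + D N + (\<Sum>i<J. mean_dev N (response_poly i))) / (2 * \<eta>))"
      have "(\<lambda>N. \<Sum>i<J. mean_dev N (response_poly i)) \<longlonglongrightarrow> (\<Sum>i<J. 0)"
        by (intro tendsto_sum) (use less in \<open>auto simp: V_def\<close>)
      then have "(\<lambda>N. En k N + D N + (\<Sum>i<J. mean_dev N (response_poly i))) \<longlonglongrightarrow> 0 + 0 + 0"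
        by (intro tendsto_add En [OF k(1)] D) simp
      then have "z \<longlonglongrightarrow> c * 2 ^ ((k + 1) * J) * (0 + 0 + 0) / (2 * \<eta>)"
        unfolding z_def using \<eta> by (intro tendsto_divide tendsto_mult tendsto_const) auto
      then have z0: "z \<longlonglongrightarrow> 0" by simp
      have "mean_dev N (response_poly J) \<le> \<eta> + z N" if N: "1 \<le> N" for N
      proof -
        have "mean_dev N (response_poly J) \<le> \<eta> / 2 + var N (response_poly J) / (2 * \<eta>)" by (rule var [OF N \<eta>])
        also have "var N (response_poly J) / (2 * \<eta>) \<le> (c * 2 ^ ((k + 1) * J) * (En k N + D N + (\<Sum>i<J. mean_dev N (response_poly i))) + \<eta>\<^sup>2) / (2 * \<eta>)"
          using le [OF N k(1)] k(2) \<eta> by (intro divide_right_mono) auto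
        also have "\<dots> = z N + \<eta> / 2" using \<eta> by (simp add: z_def add_divide_distrib power2_eq_square)
        finally show ?thesis by simp
      qed
      then show "\<exists>z. z \<longlonglongrightarrow> 0 \<and> (\<forall>N\<ge>1. mean_dev N (response_poly J) \<le> \<eta> + z N)" using z0 by blast
    qed
  qed
  have V_e: "V (odd_corrected n)" for n by (rule span_response_poly [of V, OF V_add V_smult V_one V_response_poly])
  \<comment> \<open>\<open>n x = x^n - (x^n - n x)\<close> with \<open>\<bar>x^n\<bar> \<le> 1\<close>, so the fluctuation of \<open>x\<close> is at most \<open>2/n\<close> in the limit\<close>
  have V_x: "V (monom 1 1)"
    unfolding V_def
  proof (rule tendsto_zero_by_bounds [OF nonneg])
    fix \<eta> :: real assume \<eta>: "0 < \<eta>"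
    obtain n0 :: nat where n0: "2 / \<eta> < real n0" using reals_Archimedean2 by blast
    define n where "n = 2 * n0 + 1"
    have n: "odd n" "0 < real n" "2 / real n \<le> \<eta>"
    proof -
      have "2 / \<eta> \<le> real n" using n0 by (simp add: n_def)
      then show "2 / real n \<le> \<eta>" using \<eta> by (simp add: n_def field_simps)
    qed (auto simp: n_def)
    have e: "monom 1 1 = smult (1 / real n) (monom 1 n + smult (-1) (odd_corrected n))"
    proof -
      have "monom 1 n + smult (-1) (odd_corrected n) = monom (real n) 1" using n(1) by (simp add: odd_corrected_def)
      then show ?thesis using n(2) by (simp add: smult_monom)
    qed
    have "mean_dev N (monom 1 1) \<le> \<eta> + 1 / real n * mean_dev N (odd_corrected n)" if N: "1 \<le> N" for N
    proof -
      have "mean_dev N (monom 1 1) \<le> 1 / real n * mean_dev N (monom 1 n + smult (-1) (odd_corrected n))"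
        using smult [OF N, of "1 / real n" "monom 1 n + smult (-1) (odd_corrected n)"] n(2) unfolding e [symmetric] by simp
      also have "\<dots> \<le> 1 / real n * (2 + mean_dev N (odd_corrected n))"
        using add [OF N, of "monom 1 n" "smult (-1) (odd_corrected n)"] power [OF N, of n] smult [OF N, of "-1" "odd_corrected n"]
        by (intro mult_left_mono) auto
      also have "\<dots> = 2 / real n + 1 / real n * mean_dev N (odd_corrected n)" by (simp add: distrib_left)
      finally show ?thesis using n(3) by linarith
    qed
    moreover have "(\<lambda>N. 1 / real n * mean_dev N (odd_corrected n)) \<longlonglongrightarrow> 0"
      using V_e [of n] unfolding V_def by (rule tendsto_mult_right_zero)
    ultimately show "\<exists>z. z \<longlonglongrightarrow> 0 \<and> (\<forall>N\<ge>1. mean_dev N (monom 1 1) \<le> \<eta> + z N)" by blast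
  qed
  have "V (monom 1 n)"
  proof (cases "odd n")
    case True
    have "monom 1 n = odd_corrected n + smult (real n) (monom 1 1)" using True by (simp add: odd_corrected_def smult_monom)
    then show ?thesis using V_add [OF V_e V_smult [OF V_x]] by simp
  next
    case False
    then have "monom 1 n = odd_corrected n" by (simp add: odd_corrected_def)
    then show ?thesis using V_e [of n] by simp
  qed
  then show ?thesis unfolding V_def .
qed

context perturbed_model
begin

definition mean :: "(real \<Rightarrow> real) \<Rightarrow> (nat \<Rightarrow> real) \<Rightarrow> real" where
  "mean h lam = (\<integral>\<omega>. emp h lam \<omega> \<partial>lawM)"

definition dev :: "(real \<Rightarrow> real) \<Rightarrow> (nat \<Rightarrow> real) \<Rightarrow> real" where
  "dev h lam = (\<integral>\<omega>. \<bar>emp h lam \<omega> - mean h lam\<bar> \<partial>lawM)"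

definition cov :: "(real \<Rightarrow> real) \<Rightarrow> (real \<Rightarrow> real) \<Rightarrow> (nat \<Rightarrow> real) \<Rightarrow> real" where
  "cov f g lam = (\<integral>\<omega>. emp f lam \<omega> * emp g lam \<omega> \<partial>lawM) - mean f lam * mean g lam"

definition mean_dev :: "real poly \<Rightarrow> real" where
  "mean_dev p = (\<integral>lam. dev (poly p) lam \<partial>param_law)"

definition mean_var :: "real poly \<Rightarrow> real" where
  "mean_var p = (\<integral>lam. cov (poly p) (poly p) lam \<partial>param_law)"

definition mean_decorr :: real where
  "mean_decorr = (\<integral>lam. expected_decorr lam \<partial>param_law)"

lemma poly_meas: "poly (p :: real poly) \<in> borel_measurable borel"
  by (rule borel_measurable_continuous_onI) (intro continuous_intros)

lemma integrable_emp_mult: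
  assumes "f \<in> borel_measurable borel" "\<And>x. \<bar>x\<bar> \<le> 1 \<Longrightarrow> \<bar>f x\<bar> \<le> c" "g \<in> borel_measurable borel" "\<And>x. \<bar>x\<bar> \<le> 1 \<Longrightarrow> \<bar>g x\<bar> \<le> d"
  shows "integrable lawM (\<lambda>\<omega>. emp f lam \<omega> * emp g lam \<omega>)"
proof (rule law_bounded_integrable)
  show "(\<lambda>\<omega>. emp f lam \<omega> * emp g lam \<omega>) \<in> borel_measurable lawM"
    by (intro borel_measurable_times joint_section [OF meas_emp] assms)
  have c: "0 \<le> c" using assms(2) [of 0] by simp
  show "\<bar>emp f lam \<omega> * emp g lam \<omega>\<bar> \<le> c * d" for \<omega>
    unfolding abs_mult by (intro mult_mono emp_bound assms c) auto
qed

lemma mean_bound: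
  assumes "h \<in> borel_measurable borel" "\<And>x. \<bar>x\<bar> \<le> 1 \<Longrightarrow> \<bar>h x\<bar> \<le> c"
  shows "\<bar>mean h lam\<bar> \<le> c"
proof -
  have "\<bar>mean h lam\<bar> \<le> (\<integral>\<omega>. \<bar>emp h lam \<omega>\<bar> \<partial>lawM)" unfolding mean_def by (rule integral_abs_bound)
  also have "\<dots> \<le> (\<integral>\<omega>. c \<partial>lawM)"
    by (rule integral_mono) (use integrable_emp [OF assms] emp_bound [OF assms(2)] in auto)
  finally show ?thesis by (simp add: law.prob_space)
qed

lemma dev_nonneg: "0 \<le> dev h lam"
  unfolding dev_def by (intro integral_nonneg_AE) simp

lemma dev_bound:
  assumes "h \<in> borel_measurable borel" "\<And>x. \<bar>x\<bar> \<le> 1 \<Longrightarrow> \<bar>h x\<bar> \<le> c"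
  shows "dev h lam \<le> 2 * c"
proof -
  have "dev h lam \<le> (\<integral>\<omega>. 2 * c \<partial>lawM)"
    unfolding dev_def
  proof (rule integral_mono)
    show "\<bar>emp h lam \<omega> - mean h lam\<bar> \<le> 2 * c" for \<omega>
      using emp_bound [of h c lam \<omega>, OF assms(2)] mean_bound [OF assms, of lam] by linarith
  qed (use integrable_emp [OF assms] in auto)
  then show ?thesis by (simp add: law.prob_space)
qed

lemma cov_bound:
  assumes f: "f \<in> borel_measurable borel" "\<And>x. \<bar>x\<bar> \<le> 1 \<Longrightarrow> \<bar>f x\<bar> \<le> c"
    and g: "g \<in> borel_measurable borel" "\<And>x. \<bar>x\<bar> \<le> 1 \<Longrightarrow> \<bar>g x\<bar> \<le> d"
  shows "\<bar>cov f g lam\<bar> \<le> c * dev g lam"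
proof -
  note i = integrable_emp_mult [OF f g, of lam] integrable_emp [OF f, of lam] integrable_emp [OF g, of lam]
  have eq: "cov f g lam = (\<integral>\<omega>. emp f lam \<omega> * (emp g lam \<omega> - mean g lam) \<partial>lawM)"
    unfolding cov_def using i by (simp add: right_diff_distrib mean_def)
  have "\<bar>cov f g lam\<bar> \<le> (\<integral>\<omega>. \<bar>emp f lam \<omega> * (emp g lam \<omega> - mean g lam)\<bar> \<partial>lawM)"
    unfolding eq by (rule integral_abs_bound)
  also have "\<dots> \<le> (\<integral>\<omega>. c * \<bar>emp g lam \<omega> - mean g lam\<bar> \<partial>lawM)"
  proof (rule integral_mono)
    show "\<bar>emp f lam \<omega> * (emp g lam \<omega> - mean g lam)\<bar> \<le> c * \<bar>emp g lam \<omega> - mean g lam\<bar>" for \<omega>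
      unfolding abs_mult by (intro mult_right_mono emp_bound f) auto
  qed (use i in \<open>auto simp: right_diff_distrib\<close>)
  also have "\<dots> = c * dev g lam" by (simp add: dev_def)
  finally show ?thesis .
qed

lemma meas_mean:
  assumes "h \<in> borel_measurable borel"
  shows "mean h \<in> borel_measurable param_law"
  unfolding mean_def [abs_def]
  by (rule law.borel_measurable_lebesgue_integral) (use meas_emp [OF assms] in \<open>simp add: split_beta'\<close>)

lemma meas_dev:
  assumes "h \<in> borel_measurable borel"
  shows "dev h \<in> borel_measurable param_law"
  unfolding dev_def [abs_def]
proof (rule law.borel_measurable_lebesgue_integral)
  have "(\<lambda>x. mean h (fst x)) \<in> borel_measurable jointM" by (rule measurable_compose [OF measurable_fst meas_mean [OF assms]])
  then show "(\<lambda>(lam, \<omega>). \<bar>emp h lam \<omega> - mean h lam\<bar>) \<in> borel_measurable jointM"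
    unfolding split_beta' by (intro borel_measurable_abs borel_measurable_diff meas_emp assms)
qed

lemma meas_cov:
  assumes "f \<in> borel_measurable borel" "g \<in> borel_measurable borel"
  shows "cov f g \<in> borel_measurable param_law"
  unfolding cov_def [abs_def]
proof (intro borel_measurable_diff borel_measurable_times meas_mean assms law.borel_measurable_lebesgue_integral)
  show "(\<lambda>(lam, \<omega>). emp f lam \<omega> * emp g lam \<omega>) \<in> borel_measurable jointM"
    unfolding split_beta' by (intro borel_measurable_times meas_emp assms)
qed

lemma meas_mean_decorr: "(\<lambda>lam. expected_decorr lam) \<in> borel_measurable param_law"
  by (rule law.borel_measurable_lebesgue_integral) (use meas_decorr in \<open>simp add: split_beta'\<close>)

lemma integrable_decorr: "integrable lawM (decorr lam)"
  by (rule law_bounded_integrable [OF joint_section [OF meas_decorr]]) (use decorr_bound in auto)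

lemma mean_decorr_bound: "\<bar>expected_decorr lam\<bar> \<le> 2"
proof -
  have "\<bar>expected_decorr lam\<bar> \<le> (\<integral>\<omega>. \<bar>decorr lam \<omega>\<bar> \<partial>lawM)" by (rule integral_abs_bound)
  also have "\<dots> \<le> (\<integral>\<omega>. 2 \<partial>lawM)"
    by (rule integral_mono) (use integrable_decorr decorr_bound in auto)
  finally show ?thesis by (simp add: law.prob_space)
qed

lemma param_bounded_integrable:
  assumes "f \<in> borel_measurable param_law" "\<And>lam. \<bar>f lam\<bar> \<le> c"
  shows "integrable param_law (f :: _ \<Rightarrow> real)"
  by (rule param.integrable_const_bound [where B = c]) (use assms in auto)

lemma integrable_mean_decorr: "integrable param_law (\<lambda>lam. expected_decorr lam)"
  by (rule param_bounded_integrable [OF meas_mean_decorr mean_decorr_bound])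

lemma integrable_dev: "integrable param_law (dev (poly p))"
proof -
  obtain B where B: "\<And>x. \<bar>x\<bar> \<le> 1 \<Longrightarrow> \<bar>poly p x\<bar> \<le> B" using poly_bounded_unit [of p] by blast
  show ?thesis
    by (rule param_bounded_integrable [OF meas_dev [OF poly_meas], of _ "2 * B"])
      (use dev_nonneg dev_bound [OF poly_meas B] in \<open>simp add: abs_of_nonneg\<close>)
qed

lemma integrable_cov: "integrable param_law (cov (poly p) (poly q))"
proof -
  obtain B where B: "0 \<le> B" "\<And>x. \<bar>x\<bar> \<le> 1 \<Longrightarrow> \<bar>poly p x\<bar> \<le> B" using poly_bounded_unit [of p] by blast
  obtain C where C: "\<And>x. \<bar>x\<bar> \<le> 1 \<Longrightarrow> \<bar>poly q x\<bar> \<le> C" using poly_bounded_unit [of q] by blast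
  show ?thesis
  proof (rule param_bounded_integrable)
    show "cov (poly p) (poly q) \<in> borel_measurable param_law" by (rule meas_cov [OF poly_meas poly_meas])
    fix lam
    have "\<bar>cov (poly p) (poly q) lam\<bar> \<le> B * dev (poly q) lam"
      by (rule cov_bound [OF poly_meas B(2) poly_meas C])
    also have "\<dots> \<le> B * (2 * C)" by (rule mult_left_mono [OF dev_bound [OF poly_meas C] B(1)])
    finally show "\<bar>cov (poly p) (poly q) lam\<bar> \<le> B * (2 * C)" .
  qed
qed

lemma integrable_emp_poly: "integrable lawM (emp (poly p) lam)"
proof -
  obtain B where B: "\<And>x. \<bar>x\<bar> \<le> 1 \<Longrightarrow> \<bar>poly p x\<bar> \<le> B" using poly_bounded_unit [of p] by blast
  show ?thesis by (rule integrable_emp [OF poly_meas B])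
qed

lemma mean_dev_nonneg: "0 \<le> mean_dev p"
  unfolding mean_dev_def by (intro integral_nonneg_AE AE_I2 dev_nonneg)

lemma emp_poly_add: "emp (poly (p + q)) lam \<omega> = emp (poly p) lam \<omega> + emp (poly q) lam \<omega>"
  by (simp add: emp_def sum.distrib add_divide_distrib)

lemma emp_poly_smult: "emp (poly (smult c p)) lam \<omega> = c * emp (poly p) lam \<omega>"
  by (simp add: emp_def sum_distrib_left)

lemma mean_dev_add: "mean_dev (p + q) \<le> mean_dev p + mean_dev q"
proof -
  have "dev (poly (p + q)) lam \<le> dev (poly p) lam + dev (poly q) lam" for lam
  proof -
    have me: "mean (poly (p + q)) lam = mean (poly p) lam + mean (poly q) lam"
      unfolding mean_def emp_poly_add by (rule Bochner_Integration.integral_add [OF integrable_emp_poly integrable_emp_poly])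
    have "dev (poly (p + q)) lam \<le> (\<integral>\<omega>. \<bar>emp (poly p) lam \<omega> - mean (poly p) lam\<bar> + \<bar>emp (poly q) lam \<omega> - mean (poly q) lam\<bar> \<partial>lawM)"
      unfolding dev_def me emp_poly_add by (rule integral_mono) (auto simp: integrable_emp_poly)
    also have "\<dots> = dev (poly p) lam + dev (poly q) lam"
      unfolding dev_def by (rule Bochner_Integration.integral_add) (auto simp: integrable_emp_poly)
    finally show ?thesis .
  qed
  then have "mean_dev (p + q) \<le> (\<integral>lam. dev (poly p) lam + dev (poly q) lam \<partial>param_law)"
    unfolding mean_dev_def by (intro integral_mono Bochner_Integration.integrable_add integrable_dev)
  then show ?thesis unfolding mean_dev_def by (simp add: integrable_dev)
qed

lemma mean_dev_smult: "mean_dev (smult c p) \<le> \<bar>c\<bar> * mean_dev p"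
proof -
  have "dev (poly (smult c p)) = (\<lambda>lam. \<bar>c\<bar> * dev (poly p) lam)"
    unfolding dev_def mean_def emp_poly_smult by (simp add: right_diff_distrib [symmetric] abs_mult)
  then show ?thesis unfolding mean_dev_def by simp
qed

lemma mean_dev_one: "mean_dev 1 = 0"
proof -
  have "emp (poly 1) = (\<lambda>lam \<omega>. 1)" using N by (simp add: emp_def [abs_def])
  then show ?thesis unfolding mean_dev_def dev_def mean_def by (simp add: law.prob_space)
qed

lemma mean_dev_power: "mean_dev (monom 1 n) \<le> 2"
proof -
  have "dev (poly (monom 1 n)) lam \<le> 2 * 1" for lam
    by (rule dev_bound [OF poly_meas]) (simp add: poly_monom power_abs power_le_one)
  then have "mean_dev (monom 1 n) \<le> (\<integral>lam. 2 \<partial>param_law)" unfolding mean_dev_def by (intro integral_mono integrable_dev) auto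
  then show ?thesis by (simp add: param.prob_space)
qed

lemma mean_dev_le_mean_var:
  assumes \<eta>: "0 < \<eta>"
  shows "mean_dev p \<le> \<eta> / 2 + mean_var p / (2 * \<eta>)"
proof -
  have "dev (poly p) lam \<le> \<eta> / 2 + cov (poly p) (poly p) lam / (2 * \<eta>)" for lam
  proof -
    obtain B where B: "\<And>x. \<bar>x\<bar> \<le> 1 \<Longrightarrow> \<bar>poly p x\<bar> \<le> B" using poly_bounded_unit [of p] by blast
    have i2: "integrable lawM (\<lambda>\<omega>. emp (poly p) lam \<omega> * emp (poly p) lam \<omega>)"
      by (rule integrable_emp_mult [OF poly_meas B poly_meas B])
    have sq: "(emp (poly p) lam \<omega> - mean (poly p) lam)\<^sup>2 = emp (poly p) lam \<omega> * emp (poly p) lam \<omega>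
        - 2 * mean (poly p) lam * emp (poly p) lam \<omega> + mean (poly p) lam * mean (poly p) lam" for \<omega>
      by (simp add: power2_eq_square algebra_simps)
    have iq: "integrable lawM (\<lambda>\<omega>. (emp (poly p) lam \<omega> - mean (poly p) lam)\<^sup>2)"
      unfolding sq by (intro Bochner_Integration.integrable_add Bochner_Integration.integrable_diff i2 integrable_mult_right integrable_emp_poly) simp
    have "(\<integral>\<omega>. (emp (poly p) lam \<omega> - mean (poly p) lam)\<^sup>2 \<partial>lawM) = cov (poly p) (poly p) lam"
      unfolding sq cov_def using i2 integrable_emp_poly [of p lam] by (simp add: law.prob_space mean_def)
    moreover have "dev (poly p) lam \<le> (\<integral>\<omega>. \<eta> / 2 + (emp (poly p) lam \<omega> - mean (poly p) lam)\<^sup>2 / (2 * \<eta>) \<partial>lawM)"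
      unfolding dev_def by (rule integral_mono) (use iq integrable_emp_poly abs_le_square_weighted [OF \<eta>] in auto)
    moreover have "(\<integral>\<omega>. \<eta> / 2 + (emp (poly p) lam \<omega> - mean (poly p) lam)\<^sup>2 / (2 * \<eta>) \<partial>lawM)
        = \<eta> / 2 + (\<integral>\<omega>. (emp (poly p) lam \<omega> - mean (poly p) lam)\<^sup>2 \<partial>lawM) / (2 * \<eta>)"
      using iq by (simp add: law.prob_space)
    ultimately show ?thesis by simp
  qed
  then have "mean_dev p \<le> (\<integral>lam. \<eta> / 2 + cov (poly p) (poly p) lam / (2 * \<eta>) \<partial>param_law)"
    unfolding mean_dev_def by (intro integral_mono integrable_dev) (auto simp: integrable_cov)
  then show ?thesis unfolding mean_var_def by (simp add: integrable_cov param.prob_space)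
qed

lemma mean_decorr_nonneg: "0 \<le> mean_decorr"
  unfolding mean_decorr_def by (intro integral_nonneg_AE AE_I2 decorr_bound(1))

lemma mean_corr_moment_meas: "(\<lambda>lam. \<integral>\<omega>. corr_moment n lam \<omega> \<partial>lawM) \<in> borel_measurable param_law"
  by (rule law.borel_measurable_lebesgue_integral) (use meas_corr_moment in \<open>simp add: split_beta'\<close>)

lemma overlap_integrable:
  "integrable param_law (\<lambda>lam. (\<integral>\<omega>. corr_moment n lam \<omega> \<partial>lawM) - (mean (\<lambda>x. x ^ n) lam)\<^sup>2)"
proof (rule param_bounded_integrable [of _ 2])
  have mb: "\<bar>mean (\<lambda>x. x ^ n) lam\<bar> \<le> 1" for lam
    by (rule mean_bound) (auto simp: power_abs power_le_one)
  show "(\<lambda>lam. (\<integral>\<omega>. corr_moment n lam \<omega> \<partial>lawM) - (mean (\<lambda>x. x ^ n) lam)\<^sup>2) \<in> borel_measurable param_law"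
    by (intro borel_measurable_diff borel_measurable_power meas_mean mean_corr_moment_meas) simp
  fix lam
  have "\<bar>\<integral>\<omega>. corr_moment n lam \<omega> \<partial>lawM\<bar> \<le> (\<integral>\<omega>. \<bar>corr_moment n lam \<omega>\<bar> \<partial>lawM)" by (rule integral_abs_bound)
  also have "\<dots> \<le> (\<integral>\<omega>. 1 \<partial>lawM)"
    by (rule integral_mono) (use integrable_corr_moment corr_moment_bound in auto)
  finally have "\<bar>\<integral>\<omega>. corr_moment n lam \<omega> \<partial>lawM\<bar> \<le> 1" by (simp add: law.prob_space)
  moreover have "(mean (\<lambda>x. x ^ n) lam)\<^sup>2 \<le> 1" using mb [of lam] by (simp add: abs_square_le_1)
  moreover have "0 \<le> (mean (\<lambda>x. x ^ n) lam)\<^sup>2" by simp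
  ultimately show "\<bar>(\<integral>\<omega>. corr_moment n lam \<omega> \<partial>lawM) - (mean (\<lambda>x. x ^ n) lam)\<^sup>2\<bar> \<le> 2" by linarith
qed

text \<open>Integrating \<open>decorr_square_le\<close>; the variance of the empirical second moment, which distinguishes its right side from the overlap
fluctuation, has the favourable sign.\<close>

lemma mean_decorr_le_overlap:
  assumes \<eta>: "0 < \<eta>"
  shows "mean_decorr \<le> \<eta> / 2 + overlap_fluctuation N m e s [1..<Suc 2] / (2 * \<eta>)"
proof -
  let ?o = "\<lambda>lam. (\<integral>\<omega>. corr_moment 2 lam \<omega> \<partial>lawM) - (mean (\<lambda>x. x ^ 2) lam)\<^sup>2"
  have "expected_decorr lam \<le> \<eta> / 2 + ?o lam / (2 * \<eta>)" for lam
  proof -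
    have sm: "(\<lambda>x :: real. x\<^sup>2) \<in> borel_measurable borel" by measurable
    have sb: "\<bar>x\<^sup>2\<bar> \<le> 1" if "\<bar>x\<bar> \<le> 1" for x :: real using that by (simp add: abs_square_le_1)
    have i1: "integrable lawM (\<lambda>\<omega>. (emp (\<lambda>x. x\<^sup>2) lam \<omega>)\<^sup>2)"
      unfolding power2_eq_square [of "emp _ _ _"] by (rule integrable_emp_mult [OF sm sb sm sb])
    note i2 = integrable_corr_moment [of 2 lam] and i3 = integrable_emp [OF sm sb, of lam]
    have "expected_decorr lam \<le> (\<integral>\<omega>. \<eta> / 2 + (corr_moment 2 lam \<omega> - (emp (\<lambda>x. x\<^sup>2) lam \<omega>)\<^sup>2) / (2 * \<eta>) \<partial>lawM)"
    proof (rule integral_mono_AE [OF integrable_decorr])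
      show "AE \<omega> in lawM. decorr lam \<omega> \<le> \<eta> / 2 + (corr_moment 2 lam \<omega> - (emp (\<lambda>x. x\<^sup>2) lam \<omega>)\<^sup>2) / (2 * \<eta>)"
        using AE_Z_pos [of lam]
      proof eventually_elim
        case (elim \<omega>)
        have "decorr lam \<omega> \<le> \<eta> / 2 + (decorr lam \<omega>)\<^sup>2 / (2 * \<eta>)"
          using abs_le_square_weighted [OF \<eta>, of "decorr lam \<omega>"] by linarith
        also have "(decorr lam \<omega>)\<^sup>2 / (2 * \<eta>) \<le> (corr_moment 2 lam \<omega> - (emp (\<lambda>x. x\<^sup>2) lam \<omega>)\<^sup>2) / (2 * \<eta>)"
          using decorr_square_le [OF elim] \<eta> by (intro divide_right_mono) auto
        finally show ?case by simp
      qed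
    qed (use i1 i2 in auto)
    also have "\<dots> = \<eta> / 2 + ((\<integral>\<omega>. corr_moment 2 lam \<omega> \<partial>lawM) - (\<integral>\<omega>. (emp (\<lambda>x. x\<^sup>2) lam \<omega>)\<^sup>2 \<partial>lawM)) / (2 * \<eta>)"
      using i1 i2 by (simp add: law.prob_space)
    also have "\<dots> \<le> \<eta> / 2 + ?o lam / (2 * \<eta>)"
    proof -
      let ?c = "mean (\<lambda>x. x\<^sup>2) lam"
      have "0 \<le> (\<integral>\<omega>. (emp (\<lambda>x. x\<^sup>2) lam \<omega> - ?c)\<^sup>2 \<partial>lawM)" by simp
      also have "\<dots> = (\<integral>\<omega>. (emp (\<lambda>x. x\<^sup>2) lam \<omega>)\<^sup>2 - 2 * ?c * emp (\<lambda>x. x\<^sup>2) lam \<omega> + ?c\<^sup>2 \<partial>lawM)"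
        by (intro Bochner_Integration.integral_cong refl) (simp add: power2_eq_square algebra_simps)
      also have "\<dots> = (\<integral>\<omega>. (emp (\<lambda>x. x\<^sup>2) lam \<omega>)\<^sup>2 \<partial>lawM) - ?c\<^sup>2"
        using i1 i3 by (simp add: law.prob_space mean_def power2_eq_square)
      finally show ?thesis using \<eta> by (intro add_left_mono divide_right_mono) auto
    qed
    finally show ?thesis .
  qed
  then have "mean_decorr \<le> (\<integral>lam. \<eta> / 2 + ?o lam / (2 * \<eta>) \<partial>param_law)"
    unfolding mean_decorr_def
    by (intro integral_mono integrable_mean_decorr Bochner_Integration.integrable_add integrable_divide_zero overlap_integrable) auto
  also have "\<dots> = \<eta> / 2 + (\<integral>lam. ?o lam \<partial>param_law) / (2 * \<eta>)"
    using overlap_integrable [of 2] by (simp add: param.prob_space)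
  also have "(\<integral>lam. ?o lam \<partial>param_law) = overlap_fluctuation N m e s [1..<Suc 2]"
    unfolding overlap_fluctuation_eq mean_def ..
  finally show ?thesis .
qed

text \<open>The fluctuation splits into the mean of \<open>corr_moment n - (emp (\<lambda>x. x^n))^2\<close>, which the decorrelation controls, and
the variance of the empirical moment.\<close>

lemma overlap_fluctuation_le:
  "\<bar>overlap_fluctuation N m e s [1..<Suc n]\<bar> \<le> real n * mean_decorr + mean_dev (monom 1 n)"
proof -
  let ?h = "\<lambda>x :: real. x ^ n"
  have hp: "poly (monom 1 n) = ?h" by (rule ext) (simp add: poly_monom)
  have hb: "\<bar>?h x\<bar> \<le> 1" if "\<bar>x\<bar> \<le> 1" for x using that by (simp add: power_abs power_le_one)
  have hm: "?h \<in> borel_measurable borel" by measurable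
  let ?o = "\<lambda>lam. (\<integral>\<omega>. corr_moment n lam \<omega> \<partial>lawM) - (mean ?h lam)\<^sup>2"
  have o: "\<bar>?o lam\<bar> \<le> real n * expected_decorr lam + dev ?h lam" for lam
  proof -
    have i1: "integrable lawM (\<lambda>\<omega>. emp ?h lam \<omega> * emp ?h lam \<omega>)" by (rule integrable_emp_mult [OF hm hb hm hb])
    note i2 = integrable_corr_moment [of n lam]
    have "?o lam = (\<integral>\<omega>. corr_moment n lam \<omega> - (emp ?h lam \<omega>)\<^sup>2 \<partial>lawM) + cov ?h ?h lam"
      unfolding cov_def using i1 i2 by (simp add: power2_eq_square)
    moreover have "\<bar>\<integral>\<omega>. corr_moment n lam \<omega> - (emp ?h lam \<omega>)\<^sup>2 \<partial>lawM\<bar> \<le> real n * expected_decorr lam"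
    proof -
      have "\<bar>\<integral>\<omega>. corr_moment n lam \<omega> - (emp ?h lam \<omega>)\<^sup>2 \<partial>lawM\<bar> \<le> (\<integral>\<omega>. \<bar>corr_moment n lam \<omega> - (emp ?h lam \<omega>)\<^sup>2\<bar> \<partial>lawM)"
        by (rule integral_abs_bound)
      also have "\<dots> \<le> (\<integral>\<omega>. real n * decorr lam \<omega> \<partial>lawM)"
        by (rule integral_mono) (use i1 i2 integrable_decorr corr_moment_near in \<open>auto simp: power2_eq_square\<close>)
      finally show ?thesis by simp
    qed
    moreover have "\<bar>cov ?h ?h lam\<bar> \<le> 1 * dev ?h lam" by (rule cov_bound [OF hm hb hm hb])
    ultimately show ?thesis by linarith
  qed
  have "\<bar>overlap_fluctuation N m e s [1..<Suc n]\<bar> = \<bar>\<integral>lam. ?o lam \<partial>param_law\<bar>"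
    unfolding overlap_fluctuation_eq mean_def ..
  also have "\<dots> \<le> (\<integral>lam. \<bar>?o lam\<bar> \<partial>param_law)" by (rule integral_abs_bound)
  also have "\<dots> \<le> (\<integral>lam. real n * expected_decorr lam + dev ?h lam \<partial>param_law)"
    by (rule integral_mono [OF _ _ o])
      (use overlap_integrable integrable_mean_decorr integrable_dev [of "monom 1 n"] in \<open>auto simp: hp\<close>)
  also have "\<dots> = real n * mean_decorr + mean_dev (monom 1 n)"
    unfolding mean_decorr_def mean_dev_def hp
    using integrable_mean_decorr integrable_dev [of "monom 1 n"] by (simp add: hp)
  finally show ?thesis .
qed

lemma integrable_energy_dev: "1 \<le> k \<Longrightarrow> integrable param_law (energy_dev k)"
proof -
  assume k: "1 \<le> k"
  show "integrable param_law (energy_dev k)"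
  proof (rule param.integrable_const_bound [where B = "8 * s * mark_mass"])
    show "AE lam in param_law. norm (energy_dev k lam) \<le> 8 * s * mark_mass"
      using AE_param_box
    proof eventually_elim
      case (elim lam)
      show ?case using integrable_energy(3) [OF elim k] energy_dev_nonneg [of k lam] by (simp add: energy_dev_def)
    qed
  qed (rule meas_energy_dev [OF k])
qed

definition mean_energy_dev :: "nat \<Rightarrow> real" where
  "mean_energy_dev k = (\<integral>lam. energy_dev k lam \<partial>param_law) / s"

lemma mean_energy_dev_nonneg: "0 \<le> mean_energy_dev k"
  unfolding mean_energy_dev_def using s by (intro divide_nonneg_pos integral_nonneg_AE AE_I2 energy_dev_nonneg) auto

text \<open>In the expansion of \<open>emp (response l)\<close> the term of order \<open>J\<close> contributes \<open>l^J\<close> times the variance in question to the covariance with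
\<open>emp (response_poly J)\<close>. The lower terms are covariances with averages of smaller index, and the remainder, divided by \<open>l^J\<close>, is of order \<open>l \<le> 2^-k\<close>.\<close>

lemma variance_bound:
  assumes k: "3 \<le> k"
    and C: "0 \<le> C" "\<And>x. \<bar>x\<bar> \<le> 1 \<Longrightarrow> \<bar>poly (response_poly J) x\<bar> \<le> C"
    and L: "0 \<le> L" "\<And>x y. \<bar>x\<bar> \<le> 1 \<Longrightarrow> \<bar>y\<bar> \<le> 1 \<Longrightarrow> \<bar>poly (response_poly J) x - poly (response_poly J) y\<bar> \<le> L * \<bar>x - y\<bar>"
    and K: "0 \<le> K" "\<And>l x. 0 < l \<Longrightarrow> l \<le> 1/8 \<Longrightarrow> \<bar>x\<bar> \<le> 1 \<Longrightarrow>
      \<bar>response l x - (\<Sum>i<Suc J. l ^ i * poly (response_poly i) x)\<bar> \<le> K * l ^ Suc J"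
  shows "mean_var (response_poly J) \<le> 2 ^ ((k + 1) * J) * (C * mean_energy_dev k + 8 * L * exp_moment * mean_decorr + C * (\<Sum>i<J. mean_dev (response_poly i)))
    + 2 * C * K * (1/2) ^ k"
proof -
  let ?P = "\<lambda>i. poly (response_poly i)"
  let ?R = "\<lambda>lam. 2 ^ ((k + 1) * J) * (C * (energy_dev k lam / s) + 8 * L * exp_moment * expected_decorr lam + C * (\<Sum>i<J. dev (?P i) lam))
    + 2 * C * K * (1/2) ^ k"
  have k1: "1 \<le> k" using k by simp
  have pointwise: "cov (?P J) (?P J) lam \<le> ?R lam" if lam: "lam \<in> param_box" for lam
  proof -
    define l where "l = lam k"
    have l: "0 < l" "l \<le> 1/8" "l \<le> 1/2" "(1/2) ^ (k + 1) \<le> l" "l \<le> (1/2) ^ k" "l \<le> 1"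
      using param_box_bounds(1) [OF lam, of k] param_box_eighth [OF lam k] lam by (auto simp: l_def param_box_def)
    define r where "r = (\<lambda>x. response l x - (\<Sum>i<Suc J. l ^ i * ?P i x))"
    have rm: "r \<in> borel_measurable borel"
      unfolding r_def using poly_meas by (intro borel_measurable_diff borel_measurable_sum borel_measurable_times response_meas) auto
    have rb: "\<bar>r x\<bar> \<le> K * l ^ Suc J" if "\<bar>x\<bar> \<le> 1" for x unfolding r_def by (rule K(2) [OF l(1,2) that])
    have ge: "emp (response l) lam \<omega> = (\<Sum>i<Suc J. l ^ i * emp (?P i) lam \<omega>) + emp r lam \<omega>" for \<omega>
    proof -
      have "emp (response l) lam \<omega> = (\<Sum>j=1..N. (\<Sum>i<Suc J. l ^ i * ?P i (mag lam \<omega> j)) + r (mag lam \<omega> j)) / real N"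
        by (simp add: emp_def r_def)
      also have "\<dots> = (\<Sum>j=1..N. \<Sum>i<Suc J. l ^ i * ?P i (mag lam \<omega> j)) / real N + emp r lam \<omega>"
        by (simp only: sum.distrib add_divide_distrib emp_def)
      also have "(\<Sum>j=1..N. \<Sum>i<Suc J. l ^ i * ?P i (mag lam \<omega> j)) / real N = (\<Sum>i<Suc J. l ^ i * emp (?P i) lam \<omega>)"
        by (subst sum.swap) (simp only: emp_def sum_divide_distrib sum_distrib_left times_divide_eq_right)
      finally show ?thesis .
    qed
    have ii: "integrable lawM (\<lambda>\<omega>. emp (?P J) lam \<omega> * emp (?P i) lam \<omega>)" for i
    proof -
      obtain B where B: "\<And>x. \<bar>x\<bar> \<le> 1 \<Longrightarrow> \<bar>?P i x\<bar> \<le> B" using poly_bounded_unit [of "response_poly i"] by blast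
      show ?thesis by (rule integrable_emp_mult [OF poly_meas C(2) poly_meas B])
    qed
    have ir: "integrable lawM (\<lambda>\<omega>. emp (?P J) lam \<omega> * emp r lam \<omega>)" by (rule integrable_emp_mult [OF poly_meas C(2) rm rb])
    have ir1: "integrable lawM (emp r lam)" by (rule integrable_emp [OF rm rb])
    have mg: "mean (response l) lam = (\<Sum>i<Suc J. l ^ i * mean (?P i) lam) + mean r lam"
    proof -
      have "mean (response l) lam = (\<integral>\<omega>. (\<Sum>i<Suc J. l ^ i * emp (?P i) lam \<omega>) \<partial>lawM) + (\<integral>\<omega>. emp r lam \<omega> \<partial>lawM)"
        unfolding mean_def ge
        by (intro Bochner_Integration.integral_add Bochner_Integration.integrable_sum integrable_mult_right integrable_emp_poly ir1)
      also have "(\<integral>\<omega>. (\<Sum>i<Suc J. l ^ i * emp (?P i) lam \<omega>) \<partial>lawM) = (\<Sum>i<Suc J. \<integral>\<omega>. l ^ i * emp (?P i) lam \<omega> \<partial>lawM)"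
        by (intro Bochner_Integration.integral_sum integrable_mult_right integrable_emp_poly)
      finally show ?thesis unfolding mean_def integral_mult_right_zero .
    qed
    have pg: "(\<integral>\<omega>. emp (?P J) lam \<omega> * emp (response l) lam \<omega> \<partial>lawM)
        = (\<Sum>i<Suc J. l ^ i * (\<integral>\<omega>. emp (?P J) lam \<omega> * emp (?P i) lam \<omega> \<partial>lawM)) + (\<integral>\<omega>. emp (?P J) lam \<omega> * emp r lam \<omega> \<partial>lawM)"
    proof -
      have "(\<integral>\<omega>. emp (?P J) lam \<omega> * emp (response l) lam \<omega> \<partial>lawM)
          = (\<integral>\<omega>. (\<Sum>i<Suc J. l ^ i * (emp (?P J) lam \<omega> * emp (?P i) lam \<omega>)) + emp (?P J) lam \<omega> * emp r lam \<omega> \<partial>lawM)"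
        unfolding ge by (simp only: distrib_left sum_distrib_left mult.left_commute)
      also have "\<dots> = (\<integral>\<omega>. (\<Sum>i<Suc J. l ^ i * (emp (?P J) lam \<omega> * emp (?P i) lam \<omega>)) \<partial>lawM) + (\<integral>\<omega>. emp (?P J) lam \<omega> * emp r lam \<omega> \<partial>lawM)"
        by (intro Bochner_Integration.integral_add Bochner_Integration.integrable_sum integrable_mult_right ii ir)
      also have "(\<integral>\<omega>. (\<Sum>i<Suc J. l ^ i * (emp (?P J) lam \<omega> * emp (?P i) lam \<omega>)) \<partial>lawM) = (\<Sum>i<Suc J. \<integral>\<omega>. l ^ i * (emp (?P J) lam \<omega> * emp (?P i) lam \<omega>) \<partial>lawM)"
        by (intro Bochner_Integration.integral_sum integrable_mult_right ii)
      finally show ?thesis unfolding integral_mult_right_zero .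
    qed
    have cg: "cov (?P J) (response l) lam = (\<Sum>i<Suc J. l ^ i * cov (?P J) (?P i) lam) + cov (?P J) r lam"
      unfolding cov_def pg mg
      by (simp add: right_diff_distrib sum_subtractf distrib_left sum_distrib_left mult.left_commute del: sum.lessThan_Suc)
    \<comment> \<open>the term of order \<open>J\<close> is the variance; the others are moved to the right\<close>
    then have main: "l ^ J * cov (?P J) (?P J) lam = cov (?P J) (response l) lam - (\<Sum>i<J. l ^ i * cov (?P J) (?P i) lam) - cov (?P J) r lam"
      by simp
    have b1: "\<bar>cov (?P J) (response l) lam\<bar> \<le> C * (energy_dev k lam / s) + 8 * L * exp_moment * expected_decorr lam"
      using covariance_bound [OF lam k, of "?P J" C L] C L
      unfolding cov_def mean_def l_def by (simp add: continuous_intros)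
    have b2: "\<bar>\<Sum>i<J. l ^ i * cov (?P J) (?P i) lam\<bar> \<le> C * (\<Sum>i<J. dev (?P i) lam)"
    proof -
      have "\<bar>\<Sum>i<J. l ^ i * cov (?P J) (?P i) lam\<bar> \<le> (\<Sum>i<J. \<bar>l ^ i * cov (?P J) (?P i) lam\<bar>)" by (rule sum_abs)
      also have "\<dots> \<le> (\<Sum>i<J. C * dev (?P i) lam)"
      proof (rule sum_mono)
        fix i
        obtain B where B: "\<And>x. \<bar>x\<bar> \<le> 1 \<Longrightarrow> \<bar>?P i x\<bar> \<le> B" using poly_bounded_unit [of "response_poly i"] by blast
        have "\<bar>l ^ i * cov (?P J) (?P i) lam\<bar> = l ^ i * \<bar>cov (?P J) (?P i) lam\<bar>" using l by (simp add: abs_mult)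
        also have "\<dots> \<le> 1 * (C * dev (?P i) lam)"
          using l cov_bound [OF poly_meas C(2) poly_meas B] by (intro mult_mono power_le_one) auto
        finally show "\<bar>l ^ i * cov (?P J) (?P i) lam\<bar> \<le> C * dev (?P i) lam" by simp
      qed
      finally show ?thesis by (simp only: sum_distrib_left)
    qed
    have b3: "\<bar>cov (?P J) r lam\<bar> \<le> C * (2 * (K * l ^ Suc J))"
    proof -
      have "\<bar>cov (?P J) r lam\<bar> \<le> C * dev r lam" by (rule cov_bound [OF poly_meas C(2) rm rb])
      also have "\<dots> \<le> C * (2 * (K * l ^ Suc J))" by (rule mult_left_mono [OF dev_bound [OF rm rb] C(1)])
      finally show ?thesis .
    qed
    let ?X = "C * (energy_dev k lam / s) + 8 * L * exp_moment * expected_decorr lam + C * (\<Sum>i<J. dev (?P i) lam)"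
    have lJ: "0 < l ^ J" using l by simp
    have X0: "0 \<le> ?X" using b1 b2 by linarith
    have "l ^ J * cov (?P J) (?P J) lam \<le> ?X + C * (2 * (K * l ^ Suc J))"
      using main b1 b2 b3 by linarith
    then have "cov (?P J) (?P J) lam \<le> (?X + C * (2 * (K * l ^ Suc J))) / l ^ J"
      using lJ by (simp add: pos_le_divide_eq mult.commute)
    also have "\<dots> = 1 / l ^ J * ?X + 2 * C * K * l" using lJ by (simp add: add_divide_distrib)
    also have "\<dots> \<le> 2 ^ ((k + 1) * J) * ?X + 2 * C * K * (1/2) ^ k"
    proof (intro add_mono mult_left_mono mult_right_mono X0)
      have "((1/2) ^ (k + 1)) ^ J \<le> l ^ J" using l by (intro power_mono) auto
      then have "1 / l ^ J \<le> 1 / ((1/2 :: real) ^ (k + 1)) ^ J" by (intro divide_left_mono mult_pos_pos lJ) auto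
      also have "\<dots> = 2 ^ ((k + 1) * J)" by (simp only: power_mult [symmetric] power_one_over) simp
      finally show "1 / l ^ J \<le> 2 ^ ((k + 1) * J)" .
    qed (use l C(1) K(1) in auto)
    finally show ?thesis .
  qed
  have "mean_var (response_poly J) \<le> (\<integral>lam. ?R lam \<partial>param_law)"
    unfolding mean_var_def
  proof (rule integral_mono_AE [OF integrable_cov])
    show "AE lam in param_law. cov (?P J) (?P J) lam \<le> ?R lam"
      using AE_param_box
    proof eventually_elim
      case (elim lam)
      then show ?case by (rule pointwise)
    qed
    show "integrable param_law ?R"
      by (intro Bochner_Integration.integrable_add integrable_mult_right Bochner_Integration.integrable_sum
          integrable_divide_zero integrable_energy_dev [OF k1] integrable_mean_decorr integrable_dev) simp
  qed
  also have "\<dots> = 2 ^ ((k + 1) * J) * (C * mean_energy_dev k + 8 * L * exp_moment * mean_decorr + C * (\<Sum>i<J. mean_dev (response_poly i)))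
    + 2 * C * K * (1/2) ^ k"
    unfolding mean_energy_dev_def mean_decorr_def mean_dev_def
    using integrable_energy_dev [OF k1] integrable_mean_decorr integrable_dev
    by (simp add: param.prob_space del: power_mult)
  finally show ?thesis .
qed

end

text \<open>The constants depend on \<open>J\<close> only, neither on the model nor on its size.\<close>

lemma variance_key:
  "\<exists>c K. 0 \<le> K \<and> (\<forall>N m e s k. perturbed_model N m e s \<longrightarrow> 3 \<le> k \<longrightarrow>
    perturbed_model.mean_var N m e s (response_poly J) \<le> c * 2 ^ ((k + 1) * J) *
      (perturbed_model.mean_energy_dev N m e s k + perturbed_model.mean_decorr N m e s
        + (\<Sum>i<J. perturbed_model.mean_dev N m e s (response_poly i))) + K * (1/2) ^ k)"
proof -
  obtain C where C: "0 \<le> C" "\<And>x. \<bar>x\<bar> \<le> 1 \<Longrightarrow> \<bar>poly (response_poly J) x\<bar> \<le> C" using poly_bounded_unit [of "response_poly J"] by blast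
  obtain L where L: "0 \<le> L" "\<And>x y. \<bar>x\<bar> \<le> 1 \<Longrightarrow> \<bar>y\<bar> \<le> 1 \<Longrightarrow> \<bar>poly (response_poly J) x - poly (response_poly J) y\<bar> \<le> L * \<bar>x - y\<bar>"
    using poly_lipschitz_unit [of "response_poly J"] by blast
  obtain K where K: "0 \<le> K" "\<And>l x. 0 < l \<Longrightarrow> l \<le> 1/8 \<Longrightarrow> \<bar>x\<bar> \<le> 1 \<Longrightarrow>
      \<bar>response l x - (\<Sum>i<Suc J. l ^ i * poly (response_poly i) x)\<bar> \<le> K * l ^ Suc J"
    using response_expansion [of "Suc J"] by blast
  let ?c = "max C (8 * L * exp_moment)"
  have "perturbed_model.mean_var N m e s (response_poly J) \<le> ?c * 2 ^ ((k + 1) * J) *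
      (perturbed_model.mean_energy_dev N m e s k + perturbed_model.mean_decorr N m e s
        + (\<Sum>i<J. perturbed_model.mean_dev N m e s (response_poly i))) + 2 * C * K * (1/2) ^ k"
    if M: "perturbed_model N m e s" and k: "3 \<le> k" for N and m :: "('a, 'b) base_model" and e s k
  proof -
    interpret perturbed_model N m e s by (rule M)
    have "C * mean_energy_dev k + 8 * L * exp_moment * mean_decorr + C * (\<Sum>i<J. mean_dev (response_poly i))
        \<le> ?c * mean_energy_dev k + ?c * mean_decorr + ?c * (\<Sum>i<J. mean_dev (response_poly i))"
      by (intro add_mono mult_right_mono mean_energy_dev_nonneg mean_decorr_nonneg sum_nonneg mean_dev_nonneg) auto
    then have "2 ^ ((k + 1) * J) * (C * mean_energy_dev k + 8 * L * exp_moment * mean_decorr + C * (\<Sum>i<J. mean_dev (response_poly i)))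
        \<le> 2 ^ ((k + 1) * J) * (?c * mean_energy_dev k + ?c * mean_decorr + ?c * (\<Sum>i<J. mean_dev (response_poly i)))"
      by (rule mult_left_mono) simp
    also have "\<dots> = ?c * 2 ^ ((k + 1) * J) * (mean_energy_dev k + mean_decorr + (\<Sum>i<J. mean_dev (response_poly i)))"
      by (simp only: distrib_left mult.assoc mult.left_commute)
    finally show ?thesis using variance_bound [OF k C L K] by linarith
  qed
  moreover have "0 \<le> 2 * C * K" using C K by simp
  ultimately show ?thesis by (intro exI [of _ ?c] exI [of _ "2 * C * K"]) blast
qed

theorem theorem2p2:
  fixes m :: "nat \<Rightarrow> ('o, 'y) base_model"
    and \<epsilon> s :: "nat \<Rightarrow> real"
    and v :: real
  assumes model: "\<And>N. N \<ge> 1 \<Longrightarrow> valid_model N (m N)"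
    and symmetry: "\<And>N. N \<ge> 1 \<Longrightarrow> spin_symmetric N (m N) (\<epsilon> N) (s N)"
    and eps_pos: "\<And>N. N \<ge> 1 \<Longrightarrow> 0 < \<epsilon> N"
    and eps_le_1: "\<And>N. N \<ge> 1 \<Longrightarrow> \<epsilon> N \<le> 1"
    and eps_lim: "\<epsilon> \<longlonglongrightarrow> 0"
    and N_eps_lim: "filterlim (\<lambda>N. real N * \<epsilon> N) at_top sequentially"
    and s_pos: "\<And>N. N \<ge> 1 \<Longrightarrow> 0 < s N"
    and s_over_N_lim: "(\<lambda>N. s N / real N) \<longlonglongrightarrow> 0"
    and s_over_sqrt_N_lim: "filterlim (\<lambda>N. s N / sqrt (real N)) at_top sequentially"
    and free_energy_concentration:
      "\<And>N. N \<ge> 1 \<Longrightarrow> free_energy_fluctuation N (m N) (\<epsilon> N) (s N) \<le> ennreal v"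
    and overlap_concentration:
      "(\<lambda>N. overlap_fluctuation N (m N) (\<epsilon> N) (s N) [1, 2]) \<longlonglongrightarrow> 0"
  shows "\<forall>n\<ge>1. (\<lambda>N. overlap_fluctuation N (m N) (\<epsilon> N) (s N) [1..<Suc n]) \<longlonglongrightarrow> 0"
proof (intro allI impI)
  fix n :: nat
  have PM: "perturbed_model N (m N) (\<epsilon> N) (s N)" if "1 \<le> N" for N
    using that by (unfold_locales) (auto intro: model eps_pos s_pos)
  define FL where "FL = (\<lambda>N. perturbed_model.mean_dev N (m N) (\<epsilon> N) (s N))"
  define VR where "VR = (\<lambda>N. perturbed_model.mean_var N (m N) (\<epsilon> N) (s N))"
  define D where "D = (\<lambda>N. perturbed_model.mean_decorr N (m N) (\<epsilon> N) (s N))"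
  define En where "En = (\<lambda>k N. perturbed_model.mean_energy_dev N (m N) (\<epsilon> N) (s N) k)"
  have D_lim: "D \<longlonglongrightarrow> 0"
  proof (rule tendsto_zero_by_bounds)
    show "0 \<le> D N" if "1 \<le> N" for N unfolding D_def by (rule perturbed_model.mean_decorr_nonneg [OF PM [OF that]])
    fix \<eta> :: real assume \<eta>: "0 < \<eta>"
    define z where "z = (\<lambda>N. overlap_fluctuation N (m N) (\<epsilon> N) (s N) [1, 2] / (2 * \<eta>))"
    have two: "[1..<Suc 2] = [1, 2]" by (simp add: upt_rec)
    have "z \<longlonglongrightarrow> 0 / (2 * \<eta>)" unfolding z_def using \<eta> by (intro tendsto_divide overlap_concentration tendsto_const) auto
    moreover have "D N \<le> \<eta> + z N" if "1 \<le> N" for N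
      using perturbed_model.mean_decorr_le_overlap [OF PM [OF that] \<eta>] \<eta> unfolding D_def z_def two by simp
    ultimately show "\<exists>z. z \<longlonglongrightarrow> 0 \<and> (\<forall>N\<ge>1. D N \<le> \<eta> + z N)" by auto
  qed
  have En_lim: "En k \<longlonglongrightarrow> 0" if k: "3 \<le> k" for k
  proof (rule tendsto_zero_by_bounds)
    show "0 \<le> En k N" if "1 \<le> N" for N unfolding En_def by (rule perturbed_model.mean_energy_dev_nonneg [OF PM [OF that]])
    fix \<eta> :: real assume \<eta>: "0 < \<eta>"
    define c where "c = 2 ^ (k + 1) * (64 * mark_mass) + 1"
    have c: "0 < c" unfolding c_def using perturbed_model.mark_mass_pos [OF PM [of 1]] by (intro add_nonneg_pos mult_nonneg_nonneg) auto
    \<comment> \<open>the first bound keeps the part of \<open>energy_concentration\<close> that is linear in \<open>\<delta>\<close> below the tolerance\<close>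
    define \<delta> where "\<delta> = min (\<eta> / c) ((1/2) ^ (k + 1) / 4)"
    have "\<delta> \<le> (1/2) ^ (k + 1) / 4" "\<delta> \<le> \<eta> / c" unfolding \<delta>_def by (rule min.cobounded2, rule min.cobounded1)
    moreover have "0 < \<delta>" unfolding \<delta>_def using \<eta> c by (simp add: min_less_iff_conj)
    ultimately have \<delta>: "0 < \<delta>" "4 * \<delta> \<le> (1/2) ^ (k + 1)" "\<delta> \<le> \<eta> / c" by linarith+
    have cd: "c * \<delta> \<le> \<eta>" using \<delta>(3) c by (simp add: pos_le_divide_eq mult.commute)
    \<comment> \<open>a negative \<open>v\<close> means that the fluctuation is zero, as for \<open>v = 0\<close>\<close>
    define w where "w = max v 0"
    define z where "z = (\<lambda>N. 2 ^ (k + 1) * (4 * sqrt w / \<delta>) * inverse (s N / sqrt (real N)))"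
    have "(\<lambda>N. inverse (s N / sqrt (real N))) \<longlonglongrightarrow> 0"
      by (rule tendsto_inverse_0_at_top [OF s_over_sqrt_N_lim])
    then have z: "z \<longlonglongrightarrow> 0" unfolding z_def by (rule tendsto_mult_right_zero)
    have "En k N \<le> \<eta> + z N" if N: "1 \<le> N" for N
    proof -
      have sN: "0 < s N" by (rule s_pos [OF N])
      have fe: "free_energy_fluctuation N (m N) (\<epsilon> N) (s N) \<le> ennreal w"
        using free_energy_concentration [OF N] by (rule order_trans) (simp add: w_def ennreal_leI)
      have "En k N \<le> 2 ^ (k + 1) * (4 * sqrt (w * real N) / \<delta> + 64 * mark_mass * \<delta> * s N) / s N"
        unfolding En_def perturbed_model.mean_energy_dev_def [OF PM [OF N]]
        by (intro divide_right_mono perturbed_model.energy_concentration [OF PM [OF N] fe]) (use \<delta> k sN in \<open>auto simp: w_def\<close>)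
      also have "\<dots> = z N + 2 ^ (k + 1) * (64 * mark_mass) * \<delta>"
      proof -
        have "a * (4 * (x * y) / \<delta> + 64 * mark_mass * \<delta> * t) / t = a * (4 * x / \<delta>) * inverse (t / y) + a * (64 * mark_mass) * \<delta>"
          if "0 < t" for a x y t :: real
          using that \<delta>(1) by (simp add: field_simps)
        from this [OF sN] show ?thesis unfolding z_def real_sqrt_mult .
      qed
      also have "2 ^ (k + 1) * (64 * mark_mass) * \<delta> \<le> c * \<delta>" unfolding c_def using \<delta> by (intro mult_right_mono) auto
      finally show ?thesis using cd by linarith
    qed
    then show "\<exists>z. z \<longlonglongrightarrow> 0 \<and> (\<forall>N\<ge>1. En k N \<le> \<eta> + z N)" using z by blast
  qed
  have FL_lim: "(\<lambda>N. FL N (monom 1 n)) \<longlonglongrightarrow> 0"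
  proof (rule fluctuations_vanish [where var = VR and D = D and En = En])
    fix J
    obtain c K where K: "0 \<le> K" and key: "\<And>N m e s k. perturbed_model N (m :: ('o, 'y) base_model) e s \<Longrightarrow> 3 \<le> k \<Longrightarrow>
      perturbed_model.mean_var N m e s (response_poly J) \<le> c * 2 ^ ((k + 1) * J) *
      (perturbed_model.mean_energy_dev N m e s k + perturbed_model.mean_decorr N m e s
        + (\<Sum>i<J. perturbed_model.mean_dev N m e s (response_poly i))) + K * (1/2) ^ k"
      using variance_key [of J] by blast
    show "\<exists>c K. 0 \<le> K \<and> (\<forall>N\<ge>1. \<forall>k\<ge>3. VR N (response_poly J) \<le> c * 2 ^ ((k + 1) * J) * (En k N + D N + (\<Sum>i<J. FL N (response_poly i))) + K * (1/2) ^ k)"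
      unfolding VR_def En_def D_def FL_def using K key [OF PM] by blast
  qed (auto simp: FL_def VR_def intro: D_lim En_lim perturbed_model.mean_dev_nonneg [OF PM] perturbed_model.mean_dev_add [OF PM]
      perturbed_model.mean_dev_smult [OF PM] perturbed_model.mean_dev_one [OF PM] perturbed_model.mean_dev_power [OF PM] perturbed_model.mean_dev_le_mean_var [OF PM])
  have "(\<lambda>N. real n * D N + FL N (monom 1 n)) \<longlonglongrightarrow> real n * 0 + 0"
    by (intro tendsto_add tendsto_mult tendsto_const D_lim FL_lim)
  then have lim: "(\<lambda>N. real n * D N + FL N (monom 1 n)) \<longlonglongrightarrow> 0" by simp
  show "(\<lambda>N. overlap_fluctuation N (m N) (\<epsilon> N) (s N) [1..<Suc n]) \<longlonglongrightarrow> 0"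
  proof (rule Lim_null_comparison [OF _ lim])
    show "eventually (\<lambda>N. norm (overlap_fluctuation N (m N) (\<epsilon> N) (s N) [1..<Suc n]) \<le> real n * D N + FL N (monom 1 n)) sequentially"
      using eventually_ge_at_top [of 1]
    proof eventually_elim
      case (elim N)
      show ?case
        using perturbed_model.overlap_fluctuation_le [OF PM [OF elim], of n] unfolding D_def FL_def real_norm_def .
    qed
  qed
qed

end
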